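(* Let $\alpha>0$ and $\rho>0$. Let $\mathsf Q$ be a probability measure on $\mathbb{R}_+$ such that $\mathsf E[\varrho^d]<\infty$, where $\varrho$ is a random variable with distribution $\mathsf Q$. Let $\mathcal C\subset\mathbb{R}^d$ be one of the following random closed sets (defined in the context): (i) the Poisson-Boolean model with intensity $\alpha$ and radius distribution $\mathsf Q$, in dimension $d\geq 2$; (ii) the Poisson cylinders at level $\alpha$ with radius $\rho$, in dimension $d\geq 2$; (iii) the Brownian interlacements at level $\alpha$ with radius $\rho$, in dimension $d\geq 3$. (The measure $\mathsf Q$ and the condition on it are relevant only in case (i), and $\rho$ only in cases (ii) and (iii).) For $r>0$ let $$M_r=\sup\big\{\|x-y\|\,:\,x,y\in B(r),\ [x,y]\cap\mathcal C=\emptyset\big\}.$$ Let $q_r=\log r\,\log\log r$ in case (iii) with $d=3$, and $q_r=\log r$ in all other cases. Let $\varkappa$ be equal to $\kappa_{d-1}\,\mathsf E[\varrho^{d-1}]$ in case (i), to $\kappa_{d-2}\,\rho^{d-2}\,\mathrm{Beta}(\frac12,\frac d2)/\mathrm{Beta}(\frac12,\frac{d-1}{2})$ in case (ii), and in case (iii) to $\pi$ if $d=3$ and to $2\pi^{\frac{d-1}{2}}\rho^{d-3}/\Gamma(\frac{d-3}{2})$ if $d\geq 4$. Then: (a) for any $\gamma>\frac{d}{\alpha\varkappa}$ there exists $\epsilon>0$, depending only on $d$, the law of $\mathcal C$ and $\gamma$, such that $$\mathsf P[M_r>\gamma q_r]=O(r^{-\epsilon})\quad\text{as } r\to\infty;$$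 (b) for any $\gamma<\frac{d}{\alpha\varkappa}$ there exists $\epsilon>0$, depending only on $d$, the law of $\mathcal C$ and $\gamma$, such that, as $r\to\infty$, $$\mathsf P[M_r<\gamma q_r]=O(r^{-\epsilon})+O\big(\mathsf E\big[\varrho^d\min(\varrho/r,1)^d\big]\big),$$ where the second term is non-zero only for the Poisson-Boolean models, that is, in case (i); in cases (ii) and (iii), $\mathsf P[M_r<\gamma q_r]=O(r^{-\epsilon})$. Moreover, if $\mathsf E[\varrho^{d+s}]<\infty$ for some $s\in(0,d]$, then $$\mathsf E\big[\varrho^d\min(\varrho/r,1)^d\big]\leq\mathsf E\big[\varrho^d\min(\varrho^s/r^s,1)\big]\leq\mathsf E[\varrho^{d+s}]/r^s=O(r^{-s}),$$ thus the second term in (b) decays subpolynomially only if $\mathsf E[\varrho^{d+s}]=\infty$ for all $s>0$.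
   Context: Notation. $\|\cdot\|$ is the Euclidean norm on $\mathbb{R}^d$; $B(x,s)$ is the closed Euclidean ball with center $x$ and radius $s$; $B(s)=B(0,s)$; for $K\subset\mathbb{R}^d$, $B(K,s)=\bigcup_{x\in K}B(x,s)$. $[x,y]$ is the closed line segment from $x$ to $y$. $\lambda_k$ is $k$-dimensional Lebesgue measure. For $n\geq0$, $\kappa_n=\pi^{n/2}/\Gamma(\frac n2+1)$. $\mathrm{Beta}(a,b)=\Gamma(a)\Gamma(b)/\Gamma(a+b)$. A point $x$ is said to be visible from $y$ if $[x,y]\cap\mathcal C=\emptyset$, so $M_r$ is the maximal distance between mutually visible points of $B(r)$. Poisson-Boolean model with intensity $\alpha$ and radius distribution $\mathsf Q$: let $\{(x_i,r_i)\}_i$ be the points of a Poisson point process on $\mathbb{R}^d\times\mathbb{R}_+$ with intensity measure $\alpha\lambda_d\otimes\mathsf Q$; then $\mathcal C=\bigcup_i B(x_i,r_i)$. Equivalently, for all compact $K$, $\mathsf P[\mathcal C\cap K=\emptyset]=\exp(-\alpha\,\mathsf E[\lambda_d(B(K,\varrho))])$. The condition $\mathsf E[\varrho^d]<\infty$ is necessary and sufficient for the Poisson-Boolean model not covering the whole $\mathbb{R}^d$ almost surely. Poisson cylinders at level $\alpha$ with radius $\rho$: on the space of (affine) lines in $\mathbb{R}^d$ consider the isometry-invariant measure $\mu(A)=\int_{SO(d)}\int_{H}\mathbf 1\{\varphi(\mathbb{R}e_1+z)\in A\}\,\lambda_{d-1}(dz)\,d\varphi$, where $H=\{z\in\mathbb{R}^d: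 z(1)=0\}$ ($z(1)$ the first coordinate, $e_1$ the first canonical basis vector) and $d\varphi$ is the Haar probability measure on $SO(d)$. Let $\{L_i\}_i$ be a Poisson point process of lines with intensity measure $\alpha\mu$; then $\mathcal C=\bigcup_i B(L_i,\rho)$. Equivalently, for all compact $K$, $\mathsf P[\mathcal C\cap K=\emptyset]=\exp(-\alpha\,\mu(\{L: L\cap B(K,\rho)\neq\emptyset\}))$. Brownian interlacements at level $\alpha$ with radius $\rho$ ($d\geq3$): the union of the closed $\rho$-neighborhoods of the ranges of the trajectories in a Poisson point process with intensity measure $\alpha\nu$, where $\nu$ is Sznitman's $\sigma$-finite measure on the space of doubly-infinite continuous trajectories $w:\mathbb{R}\to\mathbb{R}^d$ with $\|w(t)\|\to\infty$ as $|t|\to\infty$, modulo time shift. For each closed ball $K$, $\nu$ restricted to the trajectories hitting $K$ is the image (under the quotient by time shift) of the measure under which the position at the first hitting time of $K$ (taken to be time $0$) is distributed as the equilibrium measure $e_K$ of $K$, and, given this position $y$, the forward path is a standard Brownian motion started at $y$ and the backward path is independent of it and is a standard Brownian motion started at $y$ conditioned never to hit $K$ at positive times. The law of $\mathcal C$ as a random closed set is characterized by $\mathsf P[\mathcal C\cap K=\emptyset]=\exp(-\alpha\,\mathrm{cap}(B(K,\rho)))$ for all compact $K$, where $\mathrm{cap}$ is the Newtonian capacity associated with standard Brownian motion: $\mathrm{cap}(K)=e_K(K)=\big(\inf_{m}\iint g(x-y)\,m(dx)\,m(dy)\big)^{-1}$, the infimum over probability measures $m$ on $K$, with $g(x)=\frac{\Gamma(\frac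 d2-1)}{2\pi^{d/2}}\|x\|^{2-d}$. *)

theory Defs
  imports "HOL-Probability.Probability" "HOL-Library.Landau_Symbols"
begin

section \<open>Random closed sets and Poisson point processes\<close>

definition nbhd :: "'a::metric_space set \<Rightarrow> real \<Rightarrow> 'a set" where
  "nbhd K s = (\<Union>x\<in>K. cball x s)"

definition random_closed_set :: "'w measure \<Rightarrow> ('w \<Rightarrow> 'a::topological_space set) \<Rightarrow> bool" where
  "random_closed_set M C \<longleftrightarrow> prob_space M \<and> (\<forall>\<omega>\<in>space M. closed (C \<omega>)) \<and>
     (\<forall>K. compact K \<longrightarrow> {\<omega> \<in> space M. C \<omega> \<inter> K = {}} \<in> sets M)"

definition num_points :: "'s set \<Rightarrow> 's set \<Rightarrow> ennreal" where
  "num_points X A = emeasure (count_space UNIV) (X \<inter> A)"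

text \<open>Poisson point process with intensity \<open>\<Lambda>\<close>, as a random countable set of points. All
  intensities used below are \<open>\<sigma>\<close>-finite and diffuse, so the process has almost surely no
  multiple points and no multiplicities have to be recorded.\<close>

definition poisson_process :: "'w measure \<Rightarrow> 's measure \<Rightarrow> ('w \<Rightarrow> 's set) \<Rightarrow> bool" where
  "poisson_process M \<Lambda> X \<longleftrightarrow> prob_space M \<and>
     (\<forall>\<omega>\<in>space M. countable (X \<omega>) \<and> X \<omega> \<subseteq> space \<Lambda>) \<and>
     (\<forall>A\<in>sets \<Lambda>. (\<lambda>\<omega>. num_points (X \<omega>) A) \<in> borel_measurable M) \<and>
     (\<forall>A\<in>sets \<Lambda>. emeasure \<Lambda> A < \<infinity> \<longrightarrow>
        (\<forall>k::nat. measure M {\<omega> \<in> space M. num_points (X \<omega>) A = of_nat k} =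
           exp (- measure \<Lambda> A) * measure \<Lambda> A ^ k / fact k)) \<and>
     (\<forall>A\<in>sets \<Lambda>. emeasure \<Lambda> A = \<infinity> \<longrightarrow> (AE \<omega> in M. num_points (X \<omega>) A = \<infinity>)) \<and>
     (\<forall>(n::nat) A. A ` {..<n} \<subseteq> sets \<Lambda> \<and> disjoint_family_on A {..<n} \<longrightarrow>
        prob_space.indep_vars M (\<lambda>_. borel) (\<lambda>i \<omega>. num_points (X \<omega>) (A i)) {..<n})"


section \<open>The Poisson-Boolean model\<close>

definition boolean_model ::
  "real \<Rightarrow> real measure \<Rightarrow> 'w measure \<Rightarrow> ('w \<Rightarrow> (real^'n) set) \<Rightarrow> bool" where
  "boolean_model \<alpha> Q M C \<longleftrightarrow> random_closed_set M C \<and>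
     (\<exists>X. poisson_process M (scale_measure (ennreal \<alpha>) (lborel \<Otimes>\<^sub>M Q)) X \<and>
          (AE \<omega> in M. C \<omega> = (\<Union>(x, s)\<in>X \<omega>. cball x s)))"


section \<open>Poisson cylinders\<close>

definition first_axis :: "real^('n::{finite,linorder})" where
  "first_axis = axis (Min UNIV) 1"

text \<open>The \<open>(d - 1)\<close>-dimensional Lebesgue measure on the hyperplane of points with vanishing first
  coordinate, as a measure on the whole space.\<close>

definition hyperplane_measure :: "(real^('n::{finite,linorder})) measure" where
  "hyperplane_measure = distr (\<Pi>\<^sub>M i\<in>UNIV - {Min UNIV}. (lborel :: real measure)) borel
     (\<lambda>f. \<chi> i. if i = Min UNIV then 0 else f i)"

definition haar_SO :: "(real^'n^'n) measure \<Rightarrow> bool" where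
  "haar_SO \<theta> \<longleftrightarrow> prob_space \<theta> \<and> sets \<theta> = sets (restrict_space borel {A. rotation_matrix A}) \<and>
     (\<forall>R. rotation_matrix R \<longrightarrow> distr \<theta> \<theta> (\<lambda>A. R ** A) = \<theta>)"

definition affine_lines :: "'a::real_vector set set" where
  "affine_lines = {range (\<lambda>s::real. p + s *\<^sub>R u) | p u. u \<noteq> 0}"

definition line_space :: "'a::real_normed_vector set measure" where
  "line_space = sigma affine_lines {{L \<in> affine_lines. L \<inter> K \<noteq> {}} | K. compact K}"

definition line_measure ::
  "(real^('n::{finite,linorder})^('n::{finite,linorder})) measure \<Rightarrow> (real^('n::{finite,linorder})) set measure" where
  "line_measure \<theta> = distr (\<theta> \<Otimes>\<^sub>M hyperplane_measure) line_space
     (\<lambda>(A, z). (\<lambda>x. A *v x) ` range (\<lambda>s::real. s *\<^sub>R first_axis + z))"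

definition poisson_cylinders ::
  "real \<Rightarrow> real \<Rightarrow> 'w measure \<Rightarrow> ('w \<Rightarrow> (real^('n::{finite,linorder})) set) \<Rightarrow> bool" where
  "poisson_cylinders \<alpha> \<rho> M C \<longleftrightarrow> random_closed_set M C \<and>
     (\<exists>\<theta> X. haar_SO \<theta> \<and>
          poisson_process M (scale_measure (ennreal \<alpha>) (line_measure \<theta>)) X \<and>
          (AE \<omega> in M. C \<omega> = (\<Union>L\<in>X \<omega>. nbhd L \<rho>)))"


section \<open>Brownian motion\<close>

text \<open>Continuous paths indexed by \<open>[0, \<infinity>)\<close>, represented as extensional functions.\<close>

definition path_space :: "(real \<Rightarrow> real^'n) measure" where
  "path_space = restrict_space (\<Pi>\<^sub>M t\<in>{0..}. borel) {w. continuous_on {0..} w}"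

definition brownian_law :: "real^'n \<Rightarrow> (real \<Rightarrow> real^'n) measure \<Rightarrow> bool" where
  "brownian_law y P \<longleftrightarrow> prob_space P \<and> sets P = sets path_space \<and>
     (AE w in P. w 0 = y) \<and>
     (\<forall>s t. 0 \<le> s \<and> s < t \<longrightarrow>
        distributed P lborel (\<lambda>w. w t - w s)
          (\<lambda>x. ennreal (\<Prod>i\<in>UNIV. normal_density 0 (sqrt (t - s)) (x $ i)))) \<and>
     (\<forall>(n::nat) \<tau>. 0 \<le> \<tau> 0 \<and> (\<forall>i<n. \<tau> i < \<tau> (Suc i)) \<longrightarrow>
        prob_space.indep_vars P (\<lambda>_. borel) (\<lambda>i w. w (\<tau> (Suc i)) - w (\<tau> i)) {..<n})"

text \<open>\<open>P'\<close> is the law of a process with law \<open>P\<close> conditioned never to hit \<open>K\<close> at positive times.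
  When \<open>P\<close> is the law of Brownian motion started on the boundary of a ball \<open>K\<close>, the conditioning
  event has probability zero; the conditioned law is then the weak limit of the laws conditioned
  to avoid \<open>K\<close> during \<open>[\<delta>, \<infinity>)\<close>, as \<open>\<delta>\<close> decreases to \<open>0\<close>. Testing against products of bounded
  continuous functions of finitely many coordinates amounts to weak convergence of the
  finite-dimensional distributions, which determines \<open>P'\<close>.\<close>

definition conditioned_law ::
  "(real \<Rightarrow> real^'n) measure \<Rightarrow> (real^'n) set \<Rightarrow> (real \<Rightarrow> real^'n) measure \<Rightarrow> bool" where
  "conditioned_law P K P' \<longleftrightarrow> prob_space P' \<and> sets P' = sets path_space \<and>
     (\<forall>J (g :: real \<Rightarrow> real^'n \<Rightarrow> real). finite J \<and> J \<subseteq> {0..} \<and>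
        (\<forall>t\<in>J. continuous_on UNIV (g t) \<and> bounded (range (g t))) \<longrightarrow>
        ((\<lambda>\<delta>. \<integral>w. (\<Prod>t\<in>J. g t (w t))
                \<partial>uniform_measure P {w \<in> space P. \<forall>t\<ge>\<delta>. w t \<notin> K})
         \<longlongrightarrow> (\<integral>w. (\<Prod>t\<in>J. g t (w t)) \<partial>P')) (at_right 0))"


section \<open>Brownian interlacements\<close>

definition green :: "real^'n \<Rightarrow> ennreal" where
  "green x = (if x = 0 then \<infinity> else
     ennreal (Gamma (real CARD('n) / 2 - 1) / (2 * pi powr (real CARD('n) / 2))
              * norm x powr (2 - real CARD('n))))"

text \<open>The equilibrium measure of \<open>K\<close> is the measure carried by \<open>K\<close> whose Green potential is the
  probability that Brownian motion hits \<open>K\<close>; its total mass is the Newtonian capacity of \<open>K\<close>.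
  \<open>P\<close> is the family of Brownian laws, indexed by the starting point.\<close>

definition equilibrium_measure ::
  "(real^'n \<Rightarrow> (real \<Rightarrow> real^'n) measure) \<Rightarrow> (real^'n) set \<Rightarrow> (real^'n) measure \<Rightarrow> bool" where
  "equilibrium_measure P K e \<longleftrightarrow> finite_measure e \<and> sets e = sets borel \<and> emeasure e (- K) = 0 \<and>
     (\<forall>x. (\<integral>\<^sup>+y. green (x - y) \<partial>e) =
          emeasure (P x) {w \<in> space (P x). \<exists>t\<ge>0. w t \<in> K})"

definition trajectories :: "(real \<Rightarrow> real^'n) set" where
  "trajectories = {w. continuous_on UNIV w \<and>
     filterlim (\<lambda>t. norm (w t)) at_top at_top \<and> filterlim (\<lambda>t. norm (w t)) at_top at_bot}"

definition trajectory_space :: "(real \<Rightarrow> real^'n) measure" where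
  "trajectory_space = restrict_space (\<Pi>\<^sub>M t\<in>UNIV. borel) trajectories"

definition time_shift :: "((real \<Rightarrow> real^'n) \<times> (real \<Rightarrow> real^'n)) set" where
  "time_shift = {(w, w'). w \<in> trajectories \<and> w' \<in> trajectories \<and> (\<exists>s. \<forall>t. w' t = w (t + s))}"

text \<open>Trajectories modulo time shift, with the finest \<open>\<sigma>\<close>-algebra that makes the quotient map
  measurable.\<close>

definition trajectory_quotient :: "(real \<Rightarrow> real^'n) set measure" where
  "trajectory_quotient = sigma (trajectories // time_shift)
     {A. A \<subseteq> trajectories // time_shift \<and>
         {w \<in> trajectories. time_shift `` {w} \<in> A} \<in> sets trajectory_space}"

definition hitting_classes :: "(real^'n) set \<Rightarrow> (real \<Rightarrow> real^'n) set set" where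
  "hitting_classes K = {c \<in> trajectories // time_shift. \<exists>w\<in>c. \<exists>t. w t \<in> K}"

text \<open>The measure on trajectories first hitting the ball \<open>K\<close> at time \<open>0\<close>: the position at time \<open>0\<close> is
  distributed as the equilibrium measure \<open>e\<close> and, given that it is \<open>y\<close>, the forward path has law
  \<open>P y\<close>, and the backward path is independent of it and has law \<open>P' y\<close>. The conditioned laws
  \<open>P' y\<close> matter only for \<open>y\<close> on the boundary of \<open>K\<close>, which carries \<open>e\<close>.\<close>

definition hitting_trajectory_measure ::
  "(real^'n \<Rightarrow> (real \<Rightarrow> real^'n) measure) \<Rightarrow> (real^'n) set \<Rightarrow> (real \<Rightarrow> real^'n) measure \<Rightarrow> bool" where
  "hitting_trajectory_measure P K q \<longleftrightarrow> sets q = sets trajectory_space \<and>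
     (\<exists>e P'. equilibrium_measure P K e \<and> (\<forall>y\<in>frontier K. conditioned_law (P y) K (P' y)) \<and>
        (\<forall>D\<in>sets borel. \<forall>A\<in>sets path_space. \<forall>B\<in>sets path_space.
           emeasure q {w \<in> space q. w 0 \<in> D \<and> restrict w {0..} \<in> A \<and>
                                    restrict (\<lambda>t. w (- t)) {0..} \<in> B} =
           (\<integral>\<^sup>+y. indicator D y * emeasure (P y) A * emeasure (P' y) B \<partial>e)))"

definition sznitman_measure :: "(real \<Rightarrow> real^'n) set measure \<Rightarrow> bool" where
  "sznitman_measure \<nu> \<longleftrightarrow> sets \<nu> = sets trajectory_quotient \<and>
     (\<exists>P. (\<forall>y. brownian_law y (P y)) \<and>
        (\<forall>c R. R > 0 \<longrightarrow> (\<exists>q. hitting_trajectory_measure P (cball c R) q \<and>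
           density \<nu> (indicator (hitting_classes (cball c R))) =
           distr q trajectory_quotient (\<lambda>w. time_shift `` {w}))))"

definition brownian_interlacements ::
  "real \<Rightarrow> real \<Rightarrow> 'w measure \<Rightarrow> ('w \<Rightarrow> (real^'n) set) \<Rightarrow> bool" where
  "brownian_interlacements \<alpha> \<rho> M C \<longleftrightarrow> random_closed_set M C \<and>
     (\<exists>\<nu> X. sznitman_measure \<nu> \<and> poisson_process M (scale_measure (ennreal \<alpha>) \<nu>) X \<and>
          (AE \<omega> in M. C \<omega> = (\<Union>c\<in>X \<omega>. \<Union>w\<in>c. nbhd (range w) \<rho>)))"


section \<open>Maximal visibility\<close>

datatype model_kind = Boolean | Cylinders | Interlacements

fun is_model :: "model_kind \<Rightarrow> real \<Rightarrow> real \<Rightarrow> real measure \<Rightarrow> 'w measure \<Rightarrow>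
    ('w \<Rightarrow> (real^('n::{finite,linorder})) set) \<Rightarrow> bool" where
  "is_model Boolean \<alpha> \<rho> Q M C = boolean_model \<alpha> Q M C"
| "is_model Cylinders \<alpha> \<rho> Q M C = poisson_cylinders \<alpha> \<rho> M C"
| "is_model Interlacements \<alpha> \<rho> Q M C = brownian_interlacements \<alpha> \<rho> M C"

fun min_dim :: "model_kind \<Rightarrow> nat" where
  "min_dim Boolean = 2"
| "min_dim Cylinders = 2"
| "min_dim Interlacements = 3"

text \<open>The supremum is taken in the extended reals, so it is \<open>-\<infinity>\<close> when \<open>C\<close> covers the ball. For a
  random closed set it is measurable, since by closedness the endpoints \<open>x\<close> and \<open>y\<close> may be restricted
  to a countable dense set.\<close>

definition max_visibility :: "'a::real_normed_vector set \<Rightarrow> real \<Rightarrow> ereal" where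
  "max_visibility C r = Sup {ereal (norm (x - y)) | x y.
     x \<in> cball 0 r \<and> y \<in> cball 0 r \<and> closed_segment x y \<inter> C = {}}"

definition visibility_scale :: "model_kind \<Rightarrow> nat \<Rightarrow> real \<Rightarrow> real" where
  "visibility_scale m d r = (if m = Interlacements \<and> d = 3 then ln r * ln (ln r) else ln r)"

fun visibility_const :: "model_kind \<Rightarrow> nat \<Rightarrow> real \<Rightarrow> real measure \<Rightarrow> real" where
  "visibility_const Boolean d \<rho> Q = unit_ball_vol (real (d - 1)) * (\<integral>x. x ^ (d - 1) \<partial>Q)"
| "visibility_const Cylinders d \<rho> Q = unit_ball_vol (real (d - 2)) * \<rho> ^ (d - 2)
     * Beta (1 / 2) (real d / 2) / Beta (1 / 2) (real (d - 1) / 2)"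
| "visibility_const Interlacements d \<rho> Q = (if d = 3 then pi else
     2 * pi powr (real (d - 1) / 2) * \<rho> ^ (d - 3) / Gamma (real (d - 3) / 2))"

text \<open>Division in the extended reals: the critical value is \<open>\<infinity>\<close> when the constant vanishes, which
  happens only for the Boolean model whose radii are almost surely \<open>0\<close>.\<close>

definition critical_value :: "model_kind \<Rightarrow> nat \<Rightarrow> real \<Rightarrow> real \<Rightarrow> real measure \<Rightarrow> ereal" where
  "critical_value m d \<alpha> \<rho> Q = ereal (real d) / ereal (\<alpha> * visibility_const m d \<rho> Q)"

definition radius_error :: "nat \<Rightarrow> real measure \<Rightarrow> real \<Rightarrow> real" where
  "radius_error d Q r = (\<integral>x. x ^ d * min (x / r) 1 ^ d \<partial>Q)"

end

theory Submission
  imports Defs "HOL-Real_Asymp.Real_Asymp"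
begin

text \<open>In each model the obstacles meeting a segment are counted by a Poisson variable, so a segment is
 visible with probability \<open>exp (- \<alpha> \<mu>)\<close>, where \<open>\<mu>\<close> is the intensity of the grains that meet it. For a
 segment of length \<open>l\<close> this intensity is \<open>\<kappa> l\<close> up to lower order: the mean volume of a tube for the Boolean
 model, the mean length of a projection under the Haar measure for the cylinders, and the capacity of a
 tube for the interlacements, of order \<open>l / ln l\<close> when \<open>d = 3\<close>, which is where the extra factor in the scale
 comes from. The capacity is bracketed by Green potentials of uniform measures on segments; these are
 compared with Brownian hitting probabilities by running super- and submartingales along dyadic random
 walks. The upper tail is a union bound over a net of segments. For the lower tail a second moment
 argument is applied to parallel segments based at a lattice of mesh \<open>r\<close> to a small power; what limits it
 is the intensity of the grains meeting two of them, which in the Boolean model sums to the radius error.\<close>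

section \<open>Lebesgue measure and tubes\<close>

text \<open>For the interlacements, \<open>sznitman_measure\<close> describes the trajectories
  hitting a ball through equilibrium measures and finite-dimensional Brownian laws; neither the
  capacity formula for general sets nor the strong Markov property is at hand. Stopping at a hitting
  time is replaced by a finite automaton that reads the dyadic skeleton of a path; functions
  attached to its states bound the probability of visiting sets in a given order. A comparison
  measure near a tube is integrated against the equilibrium measure of a large ball; by symmetry of
  the Green function this recovers its mass, which brackets the capacity.

  Two countings fix the threshold \<open>d\<close>. In the upper tail a segment is coded by a base
  point and a short displacement, so the family has \<open>r\<close> to the power \<open>d\<close>
  members up to logarithms, not twice that power. In the lower tail a segment is visible with
  probability at least \<open>r powr (- \<tau>)\<close> with \<open>\<tau> < d\<close>, and the mesh
  leaves about \<open>r\<close> to the power \<open>(d + \<tau>) / 2\<close> segments, an exponent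
  midway between the two.\<close>

lemma measurable_vec_lambda_PiM [measurable]:
 "(vec_lambda :: ('n::finite \<Rightarrow> real) \<Rightarrow> real^'n) \<in> (\<Pi>\<^sub>M i\<in>UNIV. lborel) \<rightarrow>\<^sub>M borel"
proof (rule borel_measurable_euclidean_space[THEN iffD2], rule ballI)
 fix b :: "real^'n" assume "b \<in> Basis"
 then obtain i where b: "b = axis i 1" by (auto simp: Basis_vec_def)
 have "(\<lambda>f. vec_lambda f \<bullet> b) = (\<lambda>f. f i)" by (auto simp: b inner_axis)
 then show "(\<lambda>f. vec_lambda f \<bullet> b) \<in> borel_measurable (\<Pi>\<^sub>M i\<in>UNIV. lborel)" by simp
qed

lemma borel_measurable_vec_nth [measurable]:
 "(\<lambda>x::real^'n. x $ i) \<in> borel_measurable borel"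
 by (intro borel_measurable_continuous_onI continuous_intros)

lemma lborel_vec_eq_distr_PiM:
 "(lborel :: (real^'n) measure) = distr (\<Pi>\<^sub>M i\<in>UNIV. lborel) borel vec_lambda"
proof (rule lborel_eqI)
 fix l u :: "real^'n" assume lu: "\<And>b. b \<in> Basis \<Longrightarrow> l \<bullet> b \<le> u \<bullet> b"
 interpret product_sigma_finite "\<lambda>_::'n. lborel :: real measure" by standard
 have le: "l $ i \<le> u $ i" for i using lu[of "axis i 1"] by (simp add: inner_axis axis_in_Basis_iff)
 have *: "vec_lambda -` box l u \<inter> space (\<Pi>\<^sub>M i\<in>(UNIV::'n set). (lborel::real measure)) = (\<Pi>\<^sub>E i\<in>UNIV. {l$i<..<u$i})"
  by (auto simp: mem_box_cart space_PiM PiE_iff)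
 have "emeasure (distr (\<Pi>\<^sub>M i\<in>UNIV. lborel) borel vec_lambda) (box l u) =
   emeasure (\<Pi>\<^sub>M i\<in>(UNIV::'n set). (lborel::real measure)) (\<Pi>\<^sub>E i\<in>UNIV. {l$i<..<u$i})"
  by (subst emeasure_distr) (auto simp: * )
 also have "... = (\<Prod>i\<in>UNIV. ennreal (u$i - l$i))"
  by (subst emeasure_PiM) (auto simp: le)
 also have "... = ennreal (\<Prod>i\<in>UNIV. (u - l)$i)"
  by (subst prod_ennreal) (auto simp: le)
 also have "(\<Prod>i\<in>UNIV. (u - l)$i) = (\<Prod>b\<in>Basis. (u - l) \<bullet> b)"
  unfolding Basis_vec_def
  by (subst prod.reindex_cong[of "\<lambda>i. axis i (1::real)" UNIV])
    (auto simp: inner_axis axis_eq_axis inj_on_def)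
 finally show "emeasure (distr (\<Pi>\<^sub>M i\<in>UNIV. lborel) borel vec_lambda) (box l u) =
   (\<Prod>b\<in>Basis. (u - l) \<bullet> b)" by simp
qed simp

lemma nn_integral_lborel_vec:
 assumes [measurable]: "f \<in> borel_measurable borel"
 shows "(\<integral>\<^sup>+x. f x \<partial>(lborel :: (real^'n) measure)) = (\<integral>\<^sup>+x. f (vec_lambda x) \<partial>(\<Pi>\<^sub>M i\<in>UNIV. lborel))"
 by (subst lborel_vec_eq_distr_PiM, subst nn_integral_distr) auto

lemma nn_integral_vec_prod:
 fixes g :: "'n::finite \<Rightarrow> real \<Rightarrow> ennreal"
 assumes [measurable]: "\<And>i. g i \<in> borel_measurable borel"
 shows "(\<integral>\<^sup>+x. (\<Prod>i\<in>UNIV. g i (x $ i)) \<partial>(lborel :: (real^'n) measure)) = (\<Prod>i\<in>UNIV. \<integral>\<^sup>+t. g i t \<partial>lborel)"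
proof -
 interpret product_sigma_finite "\<lambda>_::'n. lborel :: real measure" by standard
 show ?thesis
  by (subst nn_integral_lborel_vec) (auto simp: product_nn_integral_prod)
qed

lemma nn_integral_translation:
 fixes a :: "'a::euclidean_space"
 assumes [measurable]: "f \<in> borel_measurable borel"
 shows "(\<integral>\<^sup>+x. f (a + x) \<partial>lborel) = (\<integral>\<^sup>+x. f x \<partial>lborel)"
proof -
 have "(lborel :: 'a measure) = distr lborel borel ((+) a)"
  using lborel_affine[of 1 a] by (simp add: density_1)
 then have "(\<integral>\<^sup>+x. f x \<partial>lborel) = (\<integral>\<^sup>+x. f x \<partial>distr lborel borel ((+) a))" by simp
 also have "... = (\<integral>\<^sup>+x. f (a + x) \<partial>lborel)"
  by (simp add: nn_integral_distr)
 finally show ?thesis ..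
qed

lemma measurable_orthogonal_transformation:
 fixes T :: "'a::euclidean_space \<Rightarrow> 'a"
 assumes T: "orthogonal_transformation T"
 shows "T \<in> borel \<rightarrow>\<^sub>M borel"
 using T by (intro borel_measurable_continuous_onI)
   (simp add: linear_continuous_on linear_linear orthogonal_transformation_linear)

text \<open>The image of Lebesgue measure is translation invariant, so by a Fubini argument it is a
 multiple of Lebesgue measure; the multiple is \<open>1\<close> because balls are preserved.\<close>

lemma distr_lborel_orthogonal:
 fixes T :: "'a::euclidean_space \<Rightarrow> 'a"
 assumes T: "orthogonal_transformation T"
 shows "distr lborel borel T = lborel"
proof -
 define N where "N = distr lborel borel T"
 have sN [measurable_cong, simp]: "sets N = sets borel" and spN [simp]: "space N = UNIV"
  by (auto simp: N_def)
 define h :: "'a \<Rightarrow> ennreal" where "h = indicator (ball 0 1)"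
 have [measurable]: "h \<in> borel_measurable borel"
  unfolding h_def by (intro borel_measurable_indicator borel_open open_ball)
 note [measurable] = measurable_orthogonal_transformation[OF T]
 have lin: "linear T" and norm: "norm (T x) = norm x" for x
  using T by (auto simp: orthogonal_transformation_linear orthogonal_transformation_norm)
 have surj: "surj T" using T by (rule orthogonal_transformation_surj)
 have h_eq: "h x = h y" if "norm x = norm y" for x y using that by (auto simp: h_def indicator_def)
 have int_N: "(\<integral>\<^sup>+x. f x \<partial>N) = (\<integral>\<^sup>+x. f (T x) \<partial>lborel)"
  if [measurable]: "f \<in> borel_measurable borel" for f :: "'a \<Rightarrow> ennreal"
  by (simp add: N_def nn_integral_distr)
 have hN: "(\<integral>\<^sup>+x. h x \<partial>N) = (\<integral>\<^sup>+x. h x \<partial>lborel)"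
  by (subst int_N) (auto intro!: nn_integral_cong h_eq simp: norm)
 have trans: "(\<integral>\<^sup>+x. f (a + x) \<partial>N) = (\<integral>\<^sup>+x. f x \<partial>N)"
  if [measurable]: "f \<in> borel_measurable borel" for f :: "'a \<Rightarrow> ennreal" and a
 proof -
  obtain b where b: "a = T b" using surj by blast
  have "(\<integral>\<^sup>+x. f (a + x) \<partial>N) = (\<integral>\<^sup>+x. f (T (b + x)) \<partial>lborel)"
   by (simp add: int_N b linear_add[OF lin])
  also have "... = (\<integral>\<^sup>+x. f (T x) \<partial>lborel)"
   by (rule nn_integral_translation[where f="\<lambda>x. f (T x)"]) measurable
  finally show ?thesis by (simp add: int_N)
 qed
 interpret N: sigma_finite_measure N
 proof
  have "emeasure N (ball 0 (real n)) = emeasure lborel (ball 0 (real n) :: 'a set)" for n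
  proof -
   have "T -` ball 0 (real n) = ball 0 (real n)" using norm by (auto simp: dist_norm)
   then show ?thesis unfolding N_def by (subst emeasure_distr) auto
  qed
  moreover have "emeasure lborel (ball 0 (real n) :: 'a set) \<noteq> \<infinity>" for n
   by (metis bounded_ball emeasure_bounded_finite infinity_ennreal_def less_irrefl)
  moreover have "(\<Union>n. ball 0 (real n)) = (UNIV :: 'a set)"
   by (auto simp: dist_norm intro: reals_Archimedean2)
  ultimately show "\<exists>A. countable A \<and> A \<subseteq> sets N \<and> \<Union>A = space N \<and> (\<forall>a\<in>A. emeasure N a \<noteq> \<infinity>)"
   by (intro exI[of _ "range (\<lambda>n. ball 0 (real n))"]) auto
 qed
 interpret pair_sigma_finite N "lborel :: 'a measure"
  by (intro pair_sigma_finite.intro N.sigma_finite_measure_axioms sigma_finite_lborel)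
 have "N = lborel"
 proof (rule measure_eqI)
  fix A assume "A \<in> sets N"
  then have [measurable]: "A \<in> sets borel" by simp
  \<comment> \<open>The radial function \<open>h\<close> is even, which turns the reflected argument
    into a translate, and \<open>N\<close> is translation invariant.\<close>
  have sym: "(\<integral>\<^sup>+x. h (-x + y) \<partial>N) = (\<integral>\<^sup>+x. h x \<partial>N)" for y
  proof -
   have "(\<integral>\<^sup>+x. h (-x + y) \<partial>N) = (\<integral>\<^sup>+x. h (-y + x) \<partial>N)"
    by (intro nn_integral_cong h_eq) (metis add.commute minus_diff_eq norm_minus_cancel uminus_add_conv_diff)
   also have "... = (\<integral>\<^sup>+x. h x \<partial>N)" by (rule trans) measurable
   finally show ?thesis .
  qed
  have "emeasure N A * (\<integral>\<^sup>+y. h y \<partial>lborel) = (\<integral>\<^sup>+y. h y * emeasure N A \<partial>lborel)"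
   by (subst nn_integral_multc) (auto simp: mult_ac)
  also have "... = (\<integral>\<^sup>+y. \<integral>\<^sup>+x. h y * indicator A x \<partial>N \<partial>lborel)"
   by (intro nn_integral_cong, subst nn_integral_cmult) auto
  also have "... = (\<integral>\<^sup>+y. \<integral>\<^sup>+x. h y * indicator A (y + x) \<partial>N \<partial>lborel)"
  proof (rule nn_integral_cong)
   fix y show "(\<integral>\<^sup>+x. h y * indicator A x \<partial>N) = (\<integral>\<^sup>+x. h y * indicator A (y + x) \<partial>N)"
    by (rule trans[symmetric]) measurable
  qed
  also have "... = (\<integral>\<^sup>+x. \<integral>\<^sup>+y. h y * indicator A (y + x) \<partial>lborel \<partial>N)"
   by (rule Fubini'[where f="\<lambda>x y. h y * indicator A (y + x)"]) measurable
  also have "... = (\<integral>\<^sup>+x. \<integral>\<^sup>+y. h (-x + (x + y)) * indicator A (x + y) \<partial>lborel \<partial>N)"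
   by (simp add: add.commute)
  also have "... = (\<integral>\<^sup>+x. \<integral>\<^sup>+y. h (-x + y) * indicator A y \<partial>lborel \<partial>N)"
  proof (rule nn_integral_cong)
   fix x show "(\<integral>\<^sup>+y. h (-x + (x + y)) * indicator A (x + y) \<partial>lborel) = (\<integral>\<^sup>+y. h (-x + y) * indicator A y \<partial>lborel)"
    by (rule nn_integral_translation[where f="\<lambda>y. h (-x + y) * indicator A y"]) measurable
  qed
  also have "... = (\<integral>\<^sup>+y. \<integral>\<^sup>+x. h (-x + y) * indicator A y \<partial>N \<partial>lborel)"
   by (rule Fubini'[where f="\<lambda>x y. h (-x + y) * indicator A y", symmetric]) measurable
  also have "... = (\<integral>\<^sup>+y. (\<integral>\<^sup>+x. h x \<partial>N) * indicator A y \<partial>lborel)"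
   by (rule nn_integral_cong, subst nn_integral_multc) (auto simp: sym[simplified])
  also have "... = (\<integral>\<^sup>+x. h x \<partial>lborel) * emeasure lborel A"
   by (subst nn_integral_cmult) (auto simp: hN)
  finally have "emeasure N A * (\<integral>\<^sup>+y. h y \<partial>lborel) = (\<integral>\<^sup>+x. h x \<partial>lborel) * emeasure lborel A" .
  then have *: "emeasure N A * (\<integral>\<^sup>+y. h y \<partial>lborel) = emeasure lborel A * (\<integral>\<^sup>+y. h y \<partial>lborel)"
   by (simp add: mult_ac)
  have "(\<integral>\<^sup>+y. h y \<partial>lborel) = ennreal (unit_ball_vol DIM('a))"
   by (simp add: h_def emeasure_ball)
  moreover have "unit_ball_vol DIM('a) \<noteq> 0" using unit_ball_vol_pos[of "real DIM('a)"] by linarith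
  ultimately have "(\<integral>\<^sup>+y. h y \<partial>lborel) \<noteq> 0" "(\<integral>\<^sup>+y. h y \<partial>lborel) \<noteq> \<infinity>" by simp_all
  with * show "emeasure N A = emeasure lborel A"
   by (metis ennreal_mult_divide_eq infinity_ennreal_def)
 qed simp
 then show ?thesis by (simp add: N_def)
qed

lemma nn_integral_orthogonal:
 fixes T :: "'a::euclidean_space \<Rightarrow> 'a"
 assumes T: "orthogonal_transformation T" and [measurable]: "f \<in> borel_measurable borel"
 shows "(\<integral>\<^sup>+x. f (T x) \<partial>lborel) = (\<integral>\<^sup>+x. f x \<partial>lborel)"
proof -
 note [measurable] = measurable_orthogonal_transformation[OF T]
 have "(\<integral>\<^sup>+x. f x \<partial>lborel) = (\<integral>\<^sup>+x. f x \<partial>distr lborel borel T)"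
  by (simp add: distr_lborel_orthogonal[OF T])
 also have "... = (\<integral>\<^sup>+x. f (T x) \<partial>lborel)"
  by (subst nn_integral_distr) auto
 finally show ?thesis ..
qed

lemma nn_integral_uminus:
 fixes f :: "real^'n \<Rightarrow> ennreal"
 assumes [measurable]: "f \<in> borel_measurable borel"
 shows "(\<integral>\<^sup>+x. f (- x) \<partial>lborel) = (\<integral>\<^sup>+x. f x \<partial>lborel)"
 by (rule nn_integral_orthogonal)
   (auto simp: orthogonal_transformation_def linear_iff)

text \<open>Peeling off one bounded coordinate at a time by Fubini reduces the product of a box in
  the coordinates \<open>J\<close> and a ball in the coordinates \<open>K\<close> to the ball
  alone.\<close>

lemma emeasure_PiM_cylinder:
 assumes "finite J" "finite K" "J \<inter> K = {}" "s > 0" "\<And>i. i \<in> J \<Longrightarrow> l i \<ge> 0"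
 shows "emeasure (\<Pi>\<^sub>M i\<in>J \<union> K. (lborel :: real measure))
   {f \<in> space (\<Pi>\<^sub>M i\<in>J \<union> K. (lborel :: real measure)). (\<forall>i\<in>J. 0 \<le> f i \<and> f i \<le> l i) \<and> sqrt (\<Sum>i\<in>K. (f i)\<^sup>2) \<le> s}
   = ennreal ((\<Prod>i\<in>J. l i) * (unit_ball_vol (real (card K)) * s ^ card K))"
 using assms(1,3,5)
proof (induction J)
 case empty
 have "{f \<in> space (\<Pi>\<^sub>M i\<in>K. (lborel :: real measure)). sqrt (\<Sum>i\<in>K. (f i)\<^sup>2) \<le> s} =
  {f. sqrt (\<Sum>i\<in>K. (f i)\<^sup>2) \<le> s} \<inter> space (Pi\<^sub>M K (\<lambda>_. lborel))" by auto
 then show ?case using emeasure_cball_aux[OF assms(2,4)] by simp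
next
 case (insert j J)
 interpret product_sigma_finite "\<lambda>_. lborel :: real measure" by standard
 let ?M = "\<lambda>I. (\<Pi>\<^sub>M i\<in>I. (lborel :: real measure))"
 let ?S = "\<lambda>J. {f \<in> space (?M (J \<union> K)). (\<forall>i\<in>J. 0 \<le> f i \<and> f i \<le> l i) \<and> sqrt (\<Sum>i\<in>K. (f i)\<^sup>2) \<le> s}"
 have jK: "j \<notin> J \<union> K" "finite (J \<union> K)" using insert assms by auto
 have [measurable]: "?S J \<in> sets (?M (J \<union> K))"
  using insert.hyps assms(2) by measurable
 have fin: "finite (insert j J)" using insert.hyps by simp
 have "?S (insert j J) = {f \<in> space (?M (insert j (J \<union> K))). (\<forall>i\<in>insert j J. 0 \<le> f i \<and> f i \<le> l i) \<and> sqrt (\<Sum>i\<in>K. (f i)\<^sup>2) \<le> s}"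
  by simp
 also have "... \<in> sets (?M (insert j (J \<union> K)))"
 proof -
  have [measurable]: "(\<lambda>f. f i) \<in> borel_measurable (?M (insert j (J \<union> K)))" if "i \<in> insert j J" for i
   using that measurable_component_singleton[of i "insert j (J \<union> K)" "\<lambda>_. lborel :: real measure"] by auto
  have [measurable]: "(\<lambda>f. f i) \<in> borel_measurable (?M (insert j (J \<union> K)))" if "i \<in> K" for i
   using that measurable_component_singleton[of i "insert j (J \<union> K)" "\<lambda>_. lborel :: real measure"] by auto
  show ?thesis
   using fin assms(2) by measurable
 qed
 finally have m: "?S (insert j J) \<in> sets (?M (insert j (J \<union> K)))" .
 have "emeasure (?M (insert j J \<union> K)) (?S (insert j J)) = (\<integral>\<^sup>+f. indicator (?S (insert j J)) f \<partial>?M (insert j (J \<union> K)))"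
  using m by (subst nn_integral_indicator) auto
 also have "... = (\<integral>\<^sup>+y. \<integral>\<^sup>+f. indicator (?S (insert j J)) (f(j := y)) \<partial>?M (J \<union> K) \<partial>lborel)"
  using m jK by (subst product_nn_integral_insert_rev) auto
 also have "... = (\<integral>\<^sup>+y. \<integral>\<^sup>+f. indicator {0..l j} y * indicator (?S J) f \<partial>?M (J \<union> K) \<partial>lborel)"
 proof (intro nn_integral_cong, goal_cases)
  case (1 y f)
  have "(\<Sum>i\<in>K. ((f(j:=y)) i)\<^sup>2) = (\<Sum>i\<in>K. (f i)\<^sup>2)" using jK by (intro sum.cong) auto
  moreover have "(\<forall>i\<in>J. 0 \<le> (f(j:=y)) i \<and> (f(j:=y)) i \<le> l i) \<longleftrightarrow> (\<forall>i\<in>J. 0 \<le> f i \<and> f i \<le> l i)"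
   using jK by (intro ball_cong) auto
  moreover have "f(j:=y) \<in> space (?M (insert j J \<union> K))" using 1 by (auto simp: space_PiM PiE_def extensional_def)
  ultimately show ?case using 1 by (auto simp: indicator_def simp del: fun_upd_apply) auto
 qed
 also have "... = (\<integral>\<^sup>+y. indicator {0..l j} y * emeasure (?M (J \<union> K)) (?S J) \<partial>lborel)"
  by (subst nn_integral_cmult) auto
 also have "... = ennreal (l j) * emeasure (?M (J \<union> K)) (?S J)"
  using insert.prems by (subst nn_integral_multc) auto
 also have "... = ennreal (l j) * ennreal ((\<Prod>i\<in>J. l i) * (unit_ball_vol (real (card K)) * s ^ card K))"
  using insert by auto
 also have "... = ennreal ((\<Prod>i\<in>insert j J. l i) * (unit_ball_vol (real (card K)) * s ^ card K))"
  using insert assms by (subst ennreal_mult[symmetric]) (auto intro!: mult_nonneg_nonneg prod_nonneg simp: mult_ac)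
 finally show ?case .
qed

lemma emeasure_coordinate_cylinder:
 fixes J :: "'n::finite set" and l :: "'n \<Rightarrow> real"
 assumes "s > 0" "\<And>i. i \<in> J \<Longrightarrow> l i \<ge> 0"
 shows "emeasure lborel {x::real^'n. (\<forall>i\<in>J. 0 \<le> x $ i \<and> x $ i \<le> l i) \<and> sqrt (\<Sum>i\<in>-J. (x $ i)\<^sup>2) \<le> s}
   = ennreal ((\<Prod>i\<in>J. l i) * (unit_ball_vol (real (card (-J))) * s ^ card (-J)))"
proof -
 have "{x::real^'n. (\<forall>i\<in>J. 0 \<le> x $ i \<and> x $ i \<le> l i) \<and> sqrt (\<Sum>i\<in>-J. (x $ i)\<^sup>2) \<le> s} \<in> sets borel"
  by measurable
 then show ?thesis
  using emeasure_PiM_cylinder[of J "-J" s l] assms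
  by (subst lborel_vec_eq_distr_PiM, subst emeasure_distr) (auto simp: vimage_def Int_def conj_commute)
qed

text \<open>The reflection in the hyperplane orthogonal to \<open>a - b\<close> does it; vectors
  orthogonal to both \<open>a\<close> and \<open>b\<close> lie in the mirror. That last clause later
  keeps a block of coordinates fixed while a segment is turned onto an axis.\<close>

lemma householder_reflection:
 fixes a b :: "'a::euclidean_space"
 assumes "norm a = norm b"
 obtains T where "orthogonal_transformation T" "T a = b" "\<And>x. x \<bullet> a = 0 \<Longrightarrow> x \<bullet> b = 0 \<Longrightarrow> T x = x"
proof (cases "a = b")
 case True
 then show ?thesis using that[of "\<lambda>x. x"] by (auto simp: orthogonal_transformation_id[unfolded id_def])
next
 case False
 define v where "v = a - b"
 define T where "T = (\<lambda>x. x - (2 * (x \<bullet> v) / (v \<bullet> v)) *\<^sub>R v)"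
 have v: "v \<bullet> v \<noteq> 0" using False by (simp add: v_def)
 have "linear T" unfolding T_def
  by (rule linearI) (auto simp: algebra_simps inner_add_left add_divide_distrib)
 moreover have "T x \<bullet> T y = x \<bullet> y" for x y
 proof -
  have "v \<bullet> y = y \<bullet> v" by (rule inner_commute)
  then show ?thesis using v unfolding T_def
   by (simp add: inner_diff_left inner_diff_right field_simps)
 qed
 ultimately have T: "orthogonal_transformation T"
  by (simp add: orthogonal_transformation_def)
 have "a \<bullet> a = b \<bullet> b" using assms by (simp add: dot_square_norm)
 then have vv: "v \<bullet> v = 2 * (a \<bullet> v)" unfolding v_def
  by (simp add: inner_diff_left inner_diff_right inner_commute)
 then have "T a = a - v" using v unfolding T_def by simp
 then have "T a = b" by (simp add: v_def)
 moreover have "T x = x" if "x \<bullet> a = 0" "x \<bullet> b = 0" for x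
  using that by (simp add: T_def v_def inner_diff_right)
 ultimately show ?thesis using that T by blast
qed

section \<open>Neighbourhoods of segments and their volumes\<close>

lemma mem_nbhd_segment:
 "p \<in> nbhd (closed_segment a b) s \<longleftrightarrow> (\<exists>t\<in>{0..1}. norm (p - (a + t *\<^sub>R (b - a))) \<le> s)"
proof -
 have "p \<in> nbhd (closed_segment a b) s \<longleftrightarrow> (\<exists>q\<in>closed_segment a b. norm (p - q) \<le> s)"
  by (auto simp: nbhd_def dist_norm norm_minus_commute)
 moreover have "closed_segment a b = (\<lambda>t. a + t *\<^sub>R (b - a)) ` {0..1}"
  by (auto simp: closed_segment_def image_def algebra_simps)
 ultimately show ?thesis by simp
qed

lemma compact_nbhd:
 fixes K :: "'a::euclidean_space set"
 assumes "compact K" shows "compact (nbhd K s)"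
proof -
 have "nbhd K s = {x + y |x y. x \<in> K \<and> y \<in> cball 0 s}"
 proof (safe, goal_cases)
  case (1 p)
  then obtain x where "x \<in> K" "p \<in> cball x s" by (auto simp: nbhd_def)
  then show ?case by (intro exI[of _ x] exI[of _ "p - x"]) (auto simp: dist_norm norm_minus_commute)
 next
  case (2 p x y)
  then show ?case by (auto simp: nbhd_def dist_norm intro!: bexI[of _ x])
 qed
 then show ?thesis using compact_sums[OF assms compact_cball[of 0 s]] by metis
qed

text \<open>One statement for two uses: \<open>F = {}\<close> gives the volume of a neighbourhood of
  a segment in the whole space, and a singleton \<open>F\<close> gives the same inside a coordinate
  hyperplane, thickened by a unit interval in the missing direction. The bounds come from the
  straight cylinder around the segment and from the cylinder prolonged by \<open>s\<close> at both
  ends.\<close>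

lemma emeasure_thick_tube:
 fixes F :: "'n::finite set" and a b :: "real^'n" and s :: real
 assumes s: "s > 0" and jF: "j \<notin> F" and ab: "\<And>i. i \<in> F \<Longrightarrow> a $ i = 0 \<and> b $ i = 0"
 defines "S \<equiv> {w. (\<forall>i\<in>F. 0 \<le> w $ i \<and> w $ i \<le> 1) \<and>
   (\<chi> i. if i \<in> F then 0 else w $ i) \<in> nbhd (closed_segment a b) s}"
 defines "c \<equiv> unit_ball_vol (real (card (-F) - 1)) * s ^ (card (-F) - 1)"
 shows "S \<in> sets borel" "ennreal (norm (a - b) * c) \<le> emeasure lborel S"
  "emeasure lborel S \<le> ennreal ((norm (a - b) + 2 * s) * c)"
proof -
 define P where "P = (\<lambda>w::real^'n. (\<chi> i. if i \<in> F then 0 else w $ i))"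
 define len where "len = norm (b - a)"
 have linP: "linear P" by (rule linearI) (auto simp: P_def vec_eq_iff)
 have "{w::real^'n. (\<forall>i\<in>F. 0 \<le> w $ i \<and> w $ i \<le> 1)} = (\<Inter>i\<in>F. {w. 0 \<le> w $ i} \<inter> {w. w $ i \<le> 1})"
  by auto
 moreover have "closed (\<Inter>i\<in>F. {w. 0 \<le> w $ i} \<inter> {w::real^'n. w $ i \<le> 1})"
  by (intro closed_INT ballI closed_Int closed_Collect_le continuous_intros)
 ultimately have "closed {w::real^'n. (\<forall>i\<in>F. 0 \<le> w $ i \<and> w $ i \<le> 1)}" by simp
 moreover have "closed (P -` nbhd (closed_segment a b) s)"
  by (intro closed_vimage linear_continuous_on compact_imp_closed compact_nbhd compact_segment)
    (simp add: linear_linear linP)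
 moreover have S_eq: "S = {w::real^'n. (\<forall>i\<in>F. 0 \<le> w $ i \<and> w $ i \<le> 1)} \<inter> P -` nbhd (closed_segment a b) s"
  by (auto simp: S_def P_def)
 ultimately have "closed S" by auto
 \<comment> \<open>From here on the segment is turned onto the axis \<open>j\<close> by a
   reflection, which fixes the axes in \<open>F\<close> because \<open>a\<close>, \<open>b\<close>
   and \<open>axis j 1\<close> have no component there.\<close>
 then show [measurable]: "S \<in> sets borel" by (rule borel_closed)
 have nax: "norm (len *\<^sub>R axis j (1::real)) = norm (b - a)" by (simp add: len_def)
 obtain T where T: "orthogonal_transformation T" "T (len *\<^sub>R axis j 1) = b - a"
  and Tfix: "\<And>x. x \<bullet> (len *\<^sub>R axis j 1) = 0 \<Longrightarrow> x \<bullet> (b - a) = 0 \<Longrightarrow> T x = x"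
  by (rule householder_reflection[OF nax]) blast
 have linT: "linear T" using T by (simp add: orthogonal_transformation_linear)
 have normT: "norm (T x) = norm x" for x using T by (simp add: orthogonal_transformation_norm)
 have Tax: "T (axis i 1) = axis i 1" if "i \<in> F" for i
 proof (rule Tfix)
  have "axis j (1::real) $ i = 0" using that jF by (auto simp: axis_def)
  then show "axis i 1 \<bullet> (len *\<^sub>R axis j (1::real)) = 0" by (simp add: inner_axis')
  show "axis i 1 \<bullet> (b - a) = 0" using ab[OF that] by (simp add: inner_axis')
 qed
 have Tnth: "T w $ i = w $ i" if "i \<in> F" for w i
 proof -
  have "T w \<bullet> T (axis i 1) = w \<bullet> axis i 1" using T by (simp add: orthogonal_transformation_def)
  then show ?thesis using Tax[OF that] by (simp add: inner_axis)
 qed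
 have Pdef2: "P w = w - (\<Sum>i\<in>F. (w $ i) *\<^sub>R axis i 1)" for w
  by (auto simp: P_def vec_eq_iff axis_def if_distrib[of "\<lambda>x. _ * x"] cong: if_cong)
 have PT: "P (T w) = T (P w)" for w
  unfolding Pdef2 by (simp add: linear_diff[OF linT] linear_sum[OF linT] linear_scale[OF linT] Tnth Tax)
 have Pa: "P (a + w) = a + P w" for w using ab by (auto simp: P_def vec_eq_iff)
 note [measurable] = measurable_orthogonal_transformation[OF T(1)]
 define V where "V = {v. (\<forall>i\<in>F. 0 \<le> v $ i \<and> v $ i \<le> 1) \<and> (\<exists>t\<in>{0..1}. norm (P v - (t * len) *\<^sub>R axis j 1) \<le> s)}"
 have mem: "a + T v \<in> S \<longleftrightarrow> v \<in> V" for v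
 proof -
  have "norm (P (a + T v) - (a + t *\<^sub>R (b - a))) = norm (P v - (t * len) *\<^sub>R axis j 1)" for t
  proof -
   have "P (a + T v) - (a + t *\<^sub>R (b - a)) = T (P v - (t * len) *\<^sub>R axis j 1)"
   proof -
    have "P (a + T v) - (a + t *\<^sub>R (b - a)) = T (P v) - t *\<^sub>R T (len *\<^sub>R axis j 1)"
     unfolding T(2) Pa PT by simp
    also have "... = T (P v - t *\<^sub>R (len *\<^sub>R axis j 1))"
     by (simp only: linear_diff[OF linT] linear_scale[OF linT])
    finally show ?thesis by simp
   qed
   then show ?thesis by (simp add: normT)
  qed
  moreover have "(\<forall>i\<in>F. 0 \<le> (a + T v) $ i \<and> (a + T v) $ i \<le> 1) \<longleftrightarrow> (\<forall>i\<in>F. 0 \<le> v $ i \<and> v $ i \<le> 1)"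
   by (intro ball_cong) (simp_all add: Tnth ab)
  ultimately show ?thesis unfolding S_eq V_def Int_iff vimage_eq mem_Collect_eq mem_nbhd_segment by simp
 qed
 have Vm: "V \<in> sets borel"
 proof -
  have "V = (\<lambda>v. a + T v) -` S" by (auto simp: mem)
  moreover have "(\<lambda>v. a + T v) \<in> borel \<rightarrow>\<^sub>M borel" by measurable
  ultimately show ?thesis using measurable_sets[of "\<lambda>v. a + T v" borel borel S] by simp
 qed
 have "emeasure lborel S = (\<integral>\<^sup>+v. indicator S v \<partial>lborel)" by simp
 also have "... = (\<integral>\<^sup>+v. indicator S (a + v) \<partial>lborel)"
  by (rule nn_integral_translation[symmetric]) measurable
 also have "... = (\<integral>\<^sup>+v. indicator S (a + T v) \<partial>lborel)"
  by (rule nn_integral_orthogonal[OF T(1), symmetric]) measurable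
 also have "... = (\<integral>\<^sup>+v. indicator V v \<partial>lborel)"
  by (intro nn_integral_cong) (auto simp: indicator_def mem)
 also have "... = emeasure lborel V" using Vm by simp
 finally have S_V: "emeasure lborel S = emeasure lborel V" .
 define J where "J = insert j F"
 have card: "card (-J) = card (-F) - 1"
  using jF by (auto simp: J_def Compl_insert card_Diff_singleton_if)
 have perp: "norm (P v - \<tau> *\<^sub>R axis j 1) = sqrt ((v $ j - \<tau>)\<^sup>2 + (\<Sum>i\<in>-J. (v $ i)\<^sup>2))" for v \<tau>
 proof -
  have "(\<Sum>i\<in>UNIV. ((P v - \<tau> *\<^sub>R axis j 1) $ i)\<^sup>2) =
    (\<Sum>i\<in>insert j (-J). ((P v - \<tau> *\<^sub>R axis j 1) $ i)\<^sup>2)"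
   by (rule sum.mono_neutral_right) (auto simp: P_def J_def axis_def)
  also have "... = (v $ j - \<tau>)\<^sup>2 + (\<Sum>i\<in>-J. ((P v - \<tau> *\<^sub>R axis j 1) $ i)\<^sup>2)"
   using jF by (subst sum.insert) (auto simp: J_def P_def)
  also have "(\<Sum>i\<in>-J. ((P v - \<tau> *\<^sub>R axis j 1) $ i)\<^sup>2) = (\<Sum>i\<in>-J. (v $ i)\<^sup>2)"
   by (intro sum.cong) (auto simp: J_def P_def axis_def)
  finally show ?thesis by (simp add: norm_vec_def L2_set_def)
 qed
 have l0: "len \<ge> 0" by (simp add: len_def)
 define W where "W = {x::real^'n. (\<forall>i\<in>J. 0 \<le> x $ i \<and> x $ i \<le> (if i = j then len else 1)) \<and> sqrt (\<Sum>i\<in>-J. (x $ i)\<^sup>2) \<le> s}"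
 have prod_l: "(\<Prod>i\<in>J. if i = j then x else 1) = x" for x :: real
  by (subst prod.delta) (auto simp: J_def)
 have W: "emeasure lborel W = ennreal (len * c)"
  unfolding W_def using s l0 by (subst emeasure_coordinate_cylinder) (auto simp: prod_l card c_def)
 show "ennreal (norm (a - b) * c) \<le> emeasure lborel S"
 proof (cases "len = 0")
  case False
  have "W \<subseteq> V"
  proof
   fix v assume v: "v \<in> W"
   have "norm (P v - (v $ j / len * len) *\<^sub>R axis j 1) \<le> s"
    using v False by (simp add: perp W_def)
   moreover have "v $ j / len \<in> {0..1}" using v l0 False by (auto simp: W_def J_def divide_simps)
   moreover have "0 \<le> v $ i \<and> v $ i \<le> 1" if "i \<in> F" for i
    using v that jF by (auto simp: W_def J_def split: if_splits)
   ultimately show "v \<in> V" unfolding V_def by blast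
  qed
  then have "emeasure lborel W \<le> emeasure lborel V" using Vm by (intro emeasure_mono) auto
  then show ?thesis unfolding W S_V by (simp add: len_def norm_minus_commute)
 qed (simp add: len_def norm_minus_commute)
 \<comment> \<open>Along the axis the tube extends from \<open>-s\<close> to \<open>len + s\<close>;
   a shift by \<open>s\<close> brings this to the form \<open>0 \<le> x $ j\<close> of
   \<open>emeasure_coordinate_cylinder\<close>.\<close>
 define W' where "W' = {x::real^'n. (\<forall>i\<in>J. 0 \<le> x $ i \<and> x $ i \<le> (if i = j then len + 2 * s else 1)) \<and> sqrt (\<Sum>i\<in>-J. (x $ i)\<^sup>2) \<le> s}"
 have W'm [measurable]: "W' \<in> sets borel" unfolding W'_def by measurable
 have "emeasure lborel V = (\<integral>\<^sup>+v. indicator V v \<partial>lborel)" using Vm by simp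
 also have "... \<le> (\<integral>\<^sup>+v. indicator W' (s *\<^sub>R axis j 1 + v) \<partial>lborel)"
 proof (rule nn_integral_mono)
  fix v
  have "s *\<^sub>R axis j 1 + v \<in> W'" if v: "v \<in> V"
  proof -
   obtain t where t: "t \<in> {0..1}" "norm (P v - (t * len) *\<^sub>R axis j 1) \<le> s" using v by (auto simp: V_def)
   have le: "sqrt ((v $ j - t * len)\<^sup>2 + (\<Sum>i\<in>-J. (v $ i)\<^sup>2)) \<le> s" using t by (simp add: perp)
   have "sqrt ((v $ j - t * len)\<^sup>2) \<le> s" by (rule order_trans[OF _ le]) (simp add: sum_nonneg del: real_sqrt_abs)
   then have 1: "\<bar>v $ j - t * len\<bar> \<le> s" by simp
   have 2: "sqrt (\<Sum>i\<in>-J. (v $ i)\<^sup>2) \<le> s" by (rule order_trans[OF _ le]) simp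
   have "0 \<le> t * len" "t * len \<le> len" using t l0 by (auto intro: mult_left_le_one_le)
   then have 3: "0 \<le> s + v $ j" "s + v $ j \<le> len + 2 * s" using 1 by linarith+
   have nth: "(s *\<^sub>R axis j 1 + v) $ i = (if i = j then s + v $ j else v $ i)" for i by (simp add: axis_def)
   have "(\<Sum>i\<in>-J. (if i = j then s + v $ j else v $ i)\<^sup>2) = (\<Sum>i\<in>-J. (v $ i)\<^sup>2)"
    by (rule sum.cong) (auto simp: J_def)
   then show ?thesis unfolding W'_def mem_Collect_eq nth using v 2 3 by (auto simp: V_def J_def)
  qed
  then show "indicator V v \<le> (indicator W' (s *\<^sub>R axis j 1 + v) :: ennreal)"
   by (auto simp: indicator_def)
 qed
 also have "... = (\<integral>\<^sup>+v. indicator W' v \<partial>lborel)" by (rule nn_integral_translation) measurable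
 also have "... = emeasure lborel W'" by simp
 also have "... = ennreal ((len + 2 * s) * c)"
  unfolding W'_def using s l0 by (subst emeasure_coordinate_cylinder) (auto simp: prod_l card c_def)
 finally show "emeasure lborel S \<le> ennreal ((norm (a - b) + 2 * s) * c)"
  unfolding S_V by (simp add: len_def norm_minus_commute)
qed

section \<open>The heat kernel and Green potentials\<close>

text \<open>The Gaussian transition density in the product form in which \<open>brownian_law\<close>
  gives the law of the increments; \<open>heat_eq\<close> is its rotation invariant form.\<close>

definition heat :: "real \<Rightarrow> real^'n \<Rightarrow> real" where
 "heat t x = (\<Prod>i\<in>UNIV. normal_density 0 (sqrt t) (x $ i))"

lemma heat_nonneg [simp]: "heat t x \<ge> 0"
 by (simp add: heat_def prod_nonneg)

lemma measurable_heat [measurable]: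
 assumes [measurable]: "f \<in> borel_measurable M" "g \<in> borel_measurable M"
 shows "(\<lambda>w. heat (f w) (g w)) \<in> borel_measurable M"
 unfolding heat_def normal_density_def by measurable

lemma heat_minus [simp]: "heat t (- x) = heat t x"
 by (simp add: heat_def normal_density_def)

lemma heat_eq:
 assumes "t > 0"
 shows "heat t (x::real^'n) = (2 * pi * t) powr (- (real CARD('n) / 2)) * exp (- (norm x)\<^sup>2 / (2 * t))"
proof -
 have "heat t x = (\<Prod>i\<in>(UNIV::'n set). (1 / sqrt (2 * pi * t)) * exp (- (x $ i)\<^sup>2 / (2 * t)))"
  using assms by (simp add: heat_def normal_density_def)
 also have "... = (1 / sqrt (2 * pi * t)) ^ CARD('n) * exp (\<Sum>i\<in>UNIV. - (x $ i)\<^sup>2 / (2 * t))"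
  by (simp only: prod.distrib prod_constant exp_sum[OF finite])
 also have "(\<Sum>i\<in>UNIV. - (x $ i)\<^sup>2 / (2 * t)) = - (norm x)\<^sup>2 / (2 * t)"
  by (simp add: norm_vec_def L2_set_def sum_nonneg sum_negf flip: sum_divide_distrib)
 also have "1 / sqrt (2 * pi * t) = (2 * pi * t) powr (- (1/2))"
  using assms by (simp add: powr_minus powr_half_sqrt divide_simps)
 also have "((2 * pi * t) powr (- (1/2))) ^ CARD('n) = (2 * pi * t) powr (- (real CARD('n) / 2))"
  using assms by (simp add: powr_realpow[symmetric] powr_powr)
 finally show ?thesis .
qed

lemma nn_integral_heat:
 assumes "t > 0"
 shows "(\<integral>\<^sup>+x. ennreal (heat t (x::real^'n)) \<partial>lborel) = 1"
proof -
 have "(\<integral>\<^sup>+x. ennreal (heat t (x::real^'n)) \<partial>lborel) =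
   (\<integral>\<^sup>+x. (\<Prod>i\<in>UNIV. ennreal (normal_density 0 (sqrt t) ((x::real^'n) $ i))) \<partial>lborel)"
  by (simp add: heat_def prod_ennreal)
 also have "... = (\<Prod>i\<in>(UNIV::'n set). \<integral>\<^sup>+s. ennreal (normal_density 0 (sqrt t) s) \<partial>lborel)"
  by (rule nn_integral_vec_prod) measurable
 also have "(\<integral>\<^sup>+s. ennreal (normal_density 0 (sqrt t) s) \<partial>lborel) = 1"
  using assms by (subst nn_integral_eq_integral) auto
 finally show ?thesis by simp
qed

text \<open>The convolution factorises over the coordinates into the semigroup property of centred
  normal densities; the sign of \<open>z\<close> is immaterial because the kernel is even.\<close>

lemma heat_conv:
 assumes "s > 0" "t > 0"
 shows "(\<integral>\<^sup>+z. ennreal (heat s (x + z)) * ennreal (heat t (z::real^'n)) \<partial>lborel) = ennreal (heat (s + t) x)"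
proof -
 have conv: "(\<integral>\<^sup>+z. ennreal (normal_density 0 (sqrt s) (a - z) * normal_density 0 (sqrt t) z) \<partial>lborel)
   = ennreal (normal_density 0 (sqrt (s + t)) a)" for a
  using fun_cong[OF conv_normal_density_zero_mean[of "sqrt s" "sqrt t"], of a] assms by simp
 have "(\<integral>\<^sup>+z. ennreal (heat s (x + z)) * ennreal (heat t z) \<partial>(lborel :: (real^'n) measure))
  = (\<integral>\<^sup>+z. (\<lambda>z. ennreal (heat s (x - z)) * ennreal (heat t z)) (- z) \<partial>lborel)"
  by simp
 also have "... = (\<integral>\<^sup>+z. ennreal (heat s (x - z)) * ennreal (heat t z) \<partial>lborel)"
  by (rule nn_integral_uminus) measurable
 also have "... = (\<integral>\<^sup>+z. (\<Prod>i\<in>UNIV. ennreal (normal_density 0 (sqrt s) (x $ i - z $ i) * normal_density 0 (sqrt t) (z $ i))) \<partial>lborel)"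
  by (simp add: heat_def prod_ennreal ennreal_mult[symmetric] prod_nonneg flip: prod.distrib)
 also have "... = (\<Prod>i\<in>UNIV. \<integral>\<^sup>+z. ennreal (normal_density 0 (sqrt s) (x $ i - z) * normal_density 0 (sqrt t) z) \<partial>lborel)"
  by (rule nn_integral_vec_prod) measurable
 also have "... = ennreal (heat (s + t) x)"
  by (simp add: conv heat_def prod_ennreal)
 finally show ?thesis .
qed

text \<open>The substitution \<open>u = A / t\<close> turns the integral into Euler's integral for
  the Gamma function at \<open>b - 1\<close>; large times are integrable because
  \<open>b > 1\<close>.\<close>

lemma nn_integral_inverse_gamma:
 assumes A: "A > 0" and b: "b > 1"
 shows "(\<integral>\<^sup>+t. indicator {0<..} t * ennreal ((2 * pi * t) powr (- b) * exp (- A / t)) \<partial>lborel)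
   = ennreal ((2 * pi) powr (- b) * Gamma (b - 1) * A powr (1 - b))"
proof -
 define f where "f = (\<lambda>u::real. u powr (b - 2) / exp u)"
 define g where "g = (\<lambda>t. A / t)"
 have "(f has_integral Gamma (b - 1)) {0..}"
  using Gamma_integral_real[of "b - 1"] b by (simp add: f_def diff_diff_eq)
 then have "((\<lambda>t. if t \<in> {0<..} then f t else 0) has_integral Gamma (b - 1)) {0..}"
  by (rule has_integral_spike[of "{0}", rotated 2]) auto
 then have hi: "(f has_integral Gamma (b - 1)) {0<..}"
  by (subst (asm) has_integral_restrict) auto
 have f_abs: "f absolutely_integrable_on {0<..}"
  by (rule nonnegative_absolutely_integrable_1) (use hi in \<open>auto simp: f_def has_integral_integrable_integral\<close>)
 have img: "g ` {0<..} = {0<..}"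
 proof safe
  fix x :: real assume "x > 0"
  then show "x \<in> g ` {0<..}" using A by (intro image_eqI[of _ _ "A / x"]) (auto simp: g_def)
 qed (use A in \<open>auto simp: g_def\<close>)
 have "(\<lambda>t. \<bar>- A / t\<^sup>2\<bar> * f (g t)) absolutely_integrable_on {0<..} \<and>
   integral {0<..} (\<lambda>t. \<bar>- A / t\<^sup>2\<bar> * f (g t)) = Gamma (b - 1)"
 proof (rule has_absolute_integral_change_of_variables_1'[where f=f and g=g, THEN iffD2])
  show "(g has_field_derivative - A / x\<^sup>2) (at x within {0<..})" if "x \<in> {0<..}" for x
   using that unfolding g_def by (auto intro!: derivative_eq_intros simp: power2_eq_square)
  show "inj_on g {0<..}" using A by (auto simp: inj_on_def g_def)
  show "f absolutely_integrable_on g ` {0<..} \<and> integral (g ` {0<..}) f = Gamma (b - 1)"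
   unfolding img using f_abs hi by (auto simp: has_integral_integrable_integral)
 qed auto
 then have "((\<lambda>t. \<bar>- A / t\<^sup>2\<bar> * f (g t)) has_integral Gamma (b - 1)) {0<..}"
  by (auto simp: has_integral_integrable_integral absolutely_integrable_on_def)
 moreover have "\<bar>- A / t\<^sup>2\<bar> * f (g t) = A powr (b - 1) * (t powr (- b) * exp (- A / t))" if "t > 0" for t
 proof -
  have "A / t\<^sup>2 * (A / t) powr (b - 2) = A powr (b - 1) * t powr (- b)"
   using that A by (simp add: powr_divide powr_diff powr_minus power2_eq_square field_simps powr_add)
  then show ?thesis using that A by (simp add: f_def g_def exp_minus field_simps)
 qed
 ultimately have "((\<lambda>t. A powr (b - 1) * (t powr (- b) * exp (- A / t))) has_integral Gamma (b - 1)) {0<..}"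
  using has_integral_eq[of "{0<..}" "\<lambda>t. \<bar>- A / t\<^sup>2\<bar> * f (g t)" "\<lambda>t. A powr (b - 1) * (t powr (- b) * exp (- A / t))"] by auto
 from has_integral_mult_right[OF this, of "(2 * pi) powr (- b) * A powr (1 - b)"]
 have "((\<lambda>t. (2 * pi * t) powr (- b) * exp (- A / t)) has_integral
   (2 * pi) powr (- b) * Gamma (b - 1) * A powr (1 - b)) {0<..}"
 proof (rule has_integral_eq_rhs[OF has_integral_eq, rotated])
  fix t :: real assume "t \<in> {0<..}"
  then have "A powr (1 - b) * A powr (b - 1) = 1" using A by (simp flip: powr_add)
  then show "(2 * pi) powr (- b) * A powr (1 - b) * (A powr (b - 1) * (t powr (- b) * exp (- A / t))) =
   (2 * pi * t) powr (- b) * exp (- A / t)"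
   using \<open>t \<in> {0<..}\<close> by (simp add: powr_mult mult_ac)
 qed (simp add: mult_ac)
 from nn_integral_has_integral_lebesgue[OF _ this]
 show ?thesis by (simp add: ennreal_mult' ennreal_indicator[symmetric] mult_ac)
qed

lemma power2_powr: "(x::real) > 0 \<Longrightarrow> x\<^sup>2 powr a = x powr (2 * a)"
 using powr_powr[of x 2 a] by (simp add: powr_numeral)

text \<open>The constants are arranged as in \<open>green\<close>. The exponent
  \<open>b = d / 2\<close> yields the Green function of dimension \<open>d\<close>, and
  \<open>b = (d - 1) / 2\<close> will yield the potential of a full line.\<close>

lemma nn_integral_gaussian_time:
 assumes "a > 0" "b > 1"
 shows "(\<integral>\<^sup>+t. indicator {0<..} t * ennreal ((2 * pi * t) powr (- b) * exp (- (a / 2) / t)) \<partial>lborel)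
   = ennreal (Gamma (b - 1) / (2 * pi powr b) * a powr (1 - b))"
proof -
 have "(a / 2) powr (1 - b) = a powr (1 - b) * (2 powr b / 2)" using assms by (simp add: powr_divide powr_diff)
 then have "(2 * pi) powr (- b) * Gamma (b - 1) * (a / 2) powr (1 - b) = Gamma (b - 1) / (2 * pi powr b) * a powr (1 - b)"
  by (simp add: powr_mult powr_minus field_simps)
 then show ?thesis using nn_integral_inverse_gamma[of "a / 2" b] assms by simp
qed

lemma green_eq_nn_integral_heat:
 assumes "CARD('n) \<ge> 3" and x: "(x::real^'n) \<noteq> 0"
 shows "green x = (\<integral>\<^sup>+t. indicator {0<..} t * ennreal (heat t x) \<partial>lborel)"
proof -
 define b where "b = real CARD('n) / 2"
 have b: "b > 1" using assms by (simp add: b_def)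
 have "(\<integral>\<^sup>+t. indicator {0<..} t * ennreal (heat t x) \<partial>lborel) =
   (\<integral>\<^sup>+t. indicator {0<..} t * ennreal ((2 * pi * t) powr (- b) * exp (- ((norm x)\<^sup>2 / 2) / t)) \<partial>lborel)"
  by (intro nn_integral_cong) (auto simp: indicator_def heat_eq b_def)
 also have "... = ennreal (Gamma (b - 1) / (2 * pi powr b) * (norm x)\<^sup>2 powr (1 - b))"
  using x b by (intro nn_integral_gaussian_time) auto
 also have "... = green x"
  using x by (simp add: green_def b_def power2_powr algebra_simps)
 finally show ?thesis ..
qed

lemma measurable_green [measurable]:
 assumes [measurable]: "f \<in> borel_measurable M"
 shows "(\<lambda>w. green (f w :: real^'n)) \<in> borel_measurable M"
 unfolding green_def by measurable

lemma green_minus [simp]: "green (- x) = green x" by (simp add: green_def)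

lemma green_minus_commute: "green (x - y) = green (y - x)"
 by (metis green_minus minus_diff_eq)

section \<open>Heat semigroup and Green potentials\<close>

abbreviation (input) heat_mean :: "real \<Rightarrow> (real^'n \<Rightarrow> ennreal) \<Rightarrow> real^'n \<Rightarrow> ennreal" where
 "heat_mean h f x \<equiv> (\<integral>\<^sup>+z. f (x + z) * ennreal (heat h z) \<partial>lborel)"

text \<open>The time integral defining the Green function is cut at \<open>h\<close>. The head is
  what a potential loses during a step of length \<open>h\<close>, and the tail is what the heat
  semigroup leaves of it.\<close>

abbreviation (input) heat_head :: "real \<Rightarrow> real^'n \<Rightarrow> ennreal" where
 "heat_head h x \<equiv> (\<integral>\<^sup>+t. indicator {0<..h} t * ennreal (heat t x) \<partial>lborel)"

definition heat_tail :: "real \<Rightarrow> real^'n \<Rightarrow> ennreal" where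
 "heat_tail h x = (\<integral>\<^sup>+t. indicator {h<..} t * ennreal (heat t x) \<partial>lborel)"

lemma measurable_heat_tail [measurable]:
 assumes [measurable]: "f \<in> borel_measurable M"
 shows "(\<lambda>w. heat_tail h (f w)) \<in> borel_measurable M"
 unfolding heat_tail_def by measurable

lemma AE_lborel_neq: "AE z in (lborel :: 'a::euclidean_space measure). z \<noteq> c"
 by (rule AE_lborel_singleton)

text \<open>By the semigroup property, averaging at time \<open>h\<close> advances every time in the
  integral by \<open>h\<close>, so exactly the part after \<open>h\<close> remains.\<close>

lemma heat_conv_green:
 fixes x :: "real^'n"
 assumes d: "CARD('n) \<ge> 3" and h: "h > 0"
 shows "heat_mean h green x = heat_tail h x"
proof -
 have "heat_mean h green x =
   (\<integral>\<^sup>+z. \<integral>\<^sup>+t. indicator {0<..} t * ennreal (heat t (x + z)) * ennreal (heat h z) \<partial>lborel \<partial>lborel)"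
 proof (rule nn_integral_cong_AE)
  show "AE z in lborel. green (x + z) * ennreal (heat h z) =
    (\<integral>\<^sup>+t. indicator {0<..} t * ennreal (heat t (x + z)) * ennreal (heat h z) \<partial>lborel)"
   using AE_lborel_neq[of "-x"]
  proof eventually_elim
   case (elim z)
   then have "x + z \<noteq> 0" by (metis add_eq_0_iff)
   then show ?case by (subst green_eq_nn_integral_heat[OF d]) (auto simp: nn_integral_multc)
  qed
 qed
 also have "... = (\<integral>\<^sup>+t. \<integral>\<^sup>+z. indicator {0<..} t * (ennreal (heat t (x + z)) * ennreal (heat h z)) \<partial>lborel \<partial>lborel)"
  by (subst lborel_pair.Fubini') (auto simp: mult_ac)
 also have "... = (\<integral>\<^sup>+t. indicator {0<..} t * ennreal (heat (t + h) x) \<partial>lborel)"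
 proof (rule nn_integral_cong)
  fix t :: real
  show "(\<integral>\<^sup>+z. indicator {0<..} t * (ennreal (heat t (x + z)) * ennreal (heat h z)) \<partial>lborel)
    = indicator {0<..} t * ennreal (heat (t + h) x)"
   by (subst nn_integral_cmult) (auto simp: heat_conv h indicator_def)
 qed
 also have "... = (\<integral>\<^sup>+t. indicator {h<..} (h + t) * ennreal (heat (h + t) x) \<partial>lborel)"
  by (intro nn_integral_cong) (auto simp: indicator_def add.commute)
 also have "... = heat_tail h x"
  unfolding heat_tail_def by (rule nn_integral_translation[where f="\<lambda>t. indicator {h<..} t * ennreal (heat t x)"]) measurable
 finally show ?thesis .
qed

lemma green_split:
 fixes x :: "real^'n"
 assumes d: "CARD('n) \<ge> 3" and h: "h > 0" and x: "x \<noteq> 0"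
 shows "green x = heat_head h x + heat_tail h x"
proof -
 have "green x = (\<integral>\<^sup>+t. indicator {0<..h} t * ennreal (heat t x) + indicator {h<..} t * ennreal (heat t x) \<partial>lborel)"
  unfolding green_eq_nn_integral_heat[OF d x] using h by (intro nn_integral_cong) (auto simp: indicator_def)
 then show ?thesis unfolding heat_tail_def by (simp add: nn_integral_add)
qed

lemma heat_tail_le_green:
 fixes x :: "real^'n"
 assumes d: "CARD('n) \<ge> 3" and h: "h > 0"
 shows "heat_tail h x \<le> green x"
 by (cases "x = 0") (auto simp: green_split[OF d h] green_def[of "0::real^'n"])

definition potential :: "(real^'n) measure \<Rightarrow> real^'n \<Rightarrow> ennreal" where
 "potential m x = (\<integral>\<^sup>+y. green (x - y) \<partial>m)"

lemma measurable_potential [measurable]: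
 assumes "sigma_finite_measure m" and [measurable_cong]: "sets m = sets borel"
  and [measurable]: "f \<in> borel_measurable M"
 shows "(\<lambda>w. potential m (f w)) \<in> borel_measurable M"
proof -
 interpret sigma_finite_measure m by fact
 show ?thesis unfolding potential_def by measurable
qed

lemma heat_conv_potential:
 fixes x :: "real^'n"
 assumes d: "CARD('n) \<ge> 3" and h: "h > 0"
  and m: "sigma_finite_measure m" and [measurable_cong]: "sets m = sets borel"
 shows "heat_mean h (potential m) x = (\<integral>\<^sup>+y. heat_tail h (x - y) \<partial>m)"
proof -
 interpret m: sigma_finite_measure m by fact
 interpret pair_sigma_finite m "lborel :: (real^'n) measure" ..
 have "heat_mean h (potential m) x =
   (\<integral>\<^sup>+z. \<integral>\<^sup>+y. green (x + z - y) * ennreal (heat h z) \<partial>m \<partial>lborel)"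
  unfolding potential_def by (intro nn_integral_cong nn_integral_multc[symmetric]) measurable
 also have "... = (\<integral>\<^sup>+y. \<integral>\<^sup>+z. green (x + z - y) * ennreal (heat h z) \<partial>lborel \<partial>m)"
  by (rule Fubini'[where f="\<lambda>y z. green (x + z - y) * ennreal (heat h z)"]) measurable
 also have "... = (\<integral>\<^sup>+y. heat_tail h (x - y) \<partial>m)"
  by (intro nn_integral_cong, subst heat_conv_green[OF d h, symmetric]) (simp add: algebra_simps)
 finally show ?thesis .
qed

lemma potential_superharmonic:
 fixes x :: "real^'n"
 assumes d: "CARD('n) \<ge> 3" and h: "h > 0"
  and m: "sigma_finite_measure m" and s: "sets m = sets borel"
 shows "heat_mean h (potential m) x \<le> potential m x"
 unfolding heat_conv_potential[OF d h m s] unfolding potential_def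
 by (intro nn_integral_mono heat_tail_le_green d h)

text \<open>Away from the support of \<open>m\<close> the head is tiny, so this identity is what
  makes a potential nearly harmonic there. Points of \<open>m\<close> must differ from
  \<open>x\<close> because the Green function is split at non-zero arguments.\<close>

lemma potential_split:
 fixes x :: "real^'n"
 assumes d: "CARD('n) \<ge> 3" and h: "h > 0"
  and m: "sigma_finite_measure m" and s[measurable_cong]: "sets m = sets borel"
  and x: "AE y in m. y \<noteq> x"
 shows "potential m x = (\<integral>\<^sup>+y. heat_head h (x - y) \<partial>m)
   + heat_mean h (potential m) x"
proof -
 have "potential m x = (\<integral>\<^sup>+y. heat_head h (x - y) + heat_tail h (x - y) \<partial>m)"
  unfolding potential_def
 proof (rule nn_integral_cong_AE)
  show "AE y in m. green (x - y) = heat_head h (x - y) + heat_tail h (x - y)"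
   using x by eventually_elim (intro green_split d h, auto)
 qed
 then show ?thesis
  unfolding heat_conv_potential[OF d h m s] by (simp add: nn_integral_add)
qed

section \<open>Short-time decay of the heat kernel\<close>

lemma power_divide_fact_le_exp:
 assumes "(y::real) \<ge> 0" shows "y ^ k / fact k \<le> exp y"
proof -
 have "(\<Sum>n\<in>{k}. y ^ n /\<^sub>R fact n) \<le> (\<Sum>n. y ^ n /\<^sub>R fact n)"
  using assms by (intro sum_le_suminf summable_exp_generic) auto
 then show ?thesis by (simp add: exp_def divide_inverse mult.commute)
qed

text \<open>One term of the exponential series is at most its sum, so a Gaussian factor beats any
  power of \<open>t\<close>; \<open>k\<close> is left free, to be spent against the singular
  prefactor of the heat kernel.\<close>

lemma exp_minus_square_le:
 fixes \<delta> t a y :: real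
 assumes "\<delta> > 0" "t > 0" "a > 0" "\<delta> \<le> y"
 shows "exp (- (y\<^sup>2 / (a * t))) \<le> fact k * (a / \<delta>\<^sup>2) ^ k * t ^ k"
proof -
 define y0 where "y0 = \<delta>\<^sup>2 / (a * t)"
 have y0: "y0 > 0" using assms by (simp add: y0_def)
 have "y0 ^ k / fact k \<le> exp y0" using y0 by (intro power_divide_fact_le_exp) auto
 then have "exp (- y0) \<le> fact k / y0 ^ k" using y0 by (simp add: exp_minus field_simps)
 moreover have "exp (- (y\<^sup>2 / (a * t))) \<le> exp (- y0)"
  using assms by (auto simp: y0_def intro!: divide_right_mono power_mono)
 moreover have "fact k / y0 ^ k = fact k * (a / \<delta>\<^sup>2) ^ k * t ^ k"
  using assms by (simp add: y0_def power_divide power_mult_distrib field_simps)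
 ultimately show ?thesis by linarith
qed

text \<open>The quadratic rate is the point: an error of order \<open>h\<^sup>2\<close> in each of
  about \<open>T / h\<close> steps sums to order \<open>h\<close> and vanishes with the
  mesh.\<close>

lemma heat_small_time:
 assumes \<delta>: "\<delta> > 0"
 obtains C where "C \<ge> 0" "\<And>(t::real) x. 0 < t \<Longrightarrow> t \<le> 1 \<Longrightarrow> norm (x::real^'n) \<ge> \<delta> \<Longrightarrow> heat t x \<le> C * t\<^sup>2"
proof
 define d where "d = CARD('n)"
 \<comment> \<open>For \<open>t \<le> 1\<close> the prefactor is at most \<open>1 / t ^ d\<close>;
   the two further powers leave the square.\<close>
 define k where "k = d + 2"
 define C where "C = fact k * (2 / \<delta>\<^sup>2) ^ k"
 show "C \<ge> 0" by (simp add: C_def)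
 fix t :: real and x :: "real^'n" assume t: "0 < t" "t \<le> 1" and x: "norm x \<ge> \<delta>"
 have "(2 * pi * t) powr (- (real d / 2)) \<le> t powr (- (real d / 2))"
  using t pi_gt3 by (intro powr_mono2') auto
 also have "... \<le> t powr (- real d)" using t by (intro powr_mono') auto
 also have "... = 1 / t ^ d" using t by (simp add: powr_minus powr_realpow divide_inverse)
 finally have 1: "(2 * pi * t) powr (- (real d / 2)) \<le> 1 / t ^ d" .
 have 2: "exp (- ((norm x)\<^sup>2 / (2 * t))) \<le> C * t ^ k"
  using exp_minus_square_le[OF \<delta> t(1) _ x, of 2 k] by (simp add: C_def)
 have "heat t x \<le> 1 / t ^ d * (C * t ^ k)"
  using 1 2 t unfolding heat_eq[OF t(1)] by (intro mult_mono) (auto simp: d_def)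
 also have "... = C * t\<^sup>2" using t by (simp add: k_def power_add power2_eq_square)
 finally show "heat t x \<le> C * t\<^sup>2" .
qed

section \<open>Random walks and Brownian hitting probabilities\<close>

definition gauss :: "real \<Rightarrow> (real^'n) measure" where
 "gauss h = density lborel (\<lambda>x. ennreal (heat h x))"

lemma sets_gauss [measurable_cong, simp]: "sets (gauss h) = sets borel"
 and space_gauss [simp]: "space (gauss h) = UNIV"
 by (simp_all add: gauss_def)

lemma prob_space_gauss: "h > 0 \<Longrightarrow> prob_space (gauss h :: (real^'n) measure)"
 by (intro prob_spaceI) (simp add: gauss_def emeasure_density nn_integral_heat)

lemma nn_integral_gauss:
 assumes [measurable]: "f \<in> borel_measurable borel"
 shows "(\<integral>\<^sup>+z. f z \<partial>gauss h) = (\<integral>\<^sup>+z. f z * ennreal (heat h (z::real^'n)) \<partial>lborel)"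
 unfolding gauss_def by (subst nn_integral_density) (auto simp: mult.commute)

definition walk :: "real^'n \<Rightarrow> (nat \<Rightarrow> real^'n) \<Rightarrow> nat \<Rightarrow> real^'n" where
 "walk y \<xi> k = y + (\<Sum>j<k. \<xi> j)"

text \<open>The state of an automaton after it has read the positions \<open>x 0, ..., x n\<close>.
  The starting position is read as well, so a walk that starts inside a set counts as having hit
  it.\<close>

primrec run :: "('q \<Rightarrow> 'a \<Rightarrow> 'q) \<Rightarrow> 'q \<Rightarrow> (nat \<Rightarrow> 'a) \<Rightarrow> nat \<Rightarrow> 'q" where
 "run \<Delta> q x 0 = \<Delta> q (x 0)"
| "run \<Delta> q x (Suc n) = \<Delta> (run \<Delta> q x n) (x (Suc n))"

lemma run_cong: "(\<And>k. k \<le> n \<Longrightarrow> x k = x' k) \<Longrightarrow> run \<Delta> q x n = run \<Delta> q x' n"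
 by (induction n) auto

lemma run_last: "\<exists>q'. run \<Delta> q x n = \<Delta> q' (x n)"
 by (cases n) auto

lemma measurable_run:
 fixes \<Delta> :: "'q::countable \<Rightarrow> 'a \<Rightarrow> 'q"
 assumes \<Delta>: "\<And>q. \<Delta> q \<in> N \<rightarrow>\<^sub>M count_space UNIV"
  and x: "\<And>k. k \<le> n \<Longrightarrow> (\<lambda>w. x w k) \<in> M \<rightarrow>\<^sub>M N"
 shows "(\<lambda>w. run \<Delta> q (x w) n) \<in> M \<rightarrow>\<^sub>M count_space UNIV"
 using x
proof (induction n)
 case 0
 show ?case using measurable_compose[OF 0[of 0] \<Delta>[of q]] by simp
next
 case (Suc n)
 have "(\<lambda>w. run \<Delta> q (x w) n) \<in> M \<rightarrow>\<^sub>M count_space UNIV" using Suc by auto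
 moreover have "(\<lambda>w. \<Delta> q' (x w (Suc n))) \<in> M \<rightarrow>\<^sub>M count_space UNIV" for q'
  using measurable_compose[OF Suc.prems[of "Suc n"] \<Delta>] by simp
 ultimately show ?case by (auto intro: measurable_compose_countable)
qed

lemma measurable_run_value:
 fixes \<Delta> :: "'q::countable \<Rightarrow> 'a \<Rightarrow> 'q" and V :: "'q \<Rightarrow> 'a \<Rightarrow> ennreal"
 assumes \<Delta>: "\<And>q. \<Delta> q \<in> N \<rightarrow>\<^sub>M count_space UNIV" and V: "\<And>q. V q \<in> borel_measurable N"
  and x: "\<And>k. k \<le> n \<Longrightarrow> (\<lambda>w. x w k) \<in> M \<rightarrow>\<^sub>M N"
 shows "(\<lambda>w. V (run \<Delta> q (x w) n) (x w n)) \<in> borel_measurable M"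
proof (rule measurable_compose_countable[where f="\<lambda>q' w. V q' (x w n)" and g="\<lambda>w. run \<Delta> q (x w) n"])
 show "(\<lambda>w. V q' (x w n)) \<in> borel_measurable M" for q'
  using x[of n] V[of q'] by (rule measurable_compose) simp
 show "(\<lambda>w. run \<Delta> q (x w) n) \<in> M \<rightarrow>\<^sub>M count_space UNIV"
  by (rule measurable_run[OF \<Delta> x])
qed

definition increments :: "real \<Rightarrow> nat \<Rightarrow> (nat \<Rightarrow> real^'n) measure" where
 "increments h n = (\<Pi>\<^sub>M k\<in>{..<n}. gauss h)"

lemma measurable_walk [measurable]:
 assumes "k \<le> n"
 shows "(\<lambda>\<xi>. walk y \<xi> k) \<in> increments h n \<rightarrow>\<^sub>M borel"
proof -
 have "(\<lambda>\<xi>. \<xi> j) \<in> increments h n \<rightarrow>\<^sub>M borel" if "j \<in> {..<k}" for j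
  using assms that measurable_component_singleton[of j "{..<n}" "\<lambda>_. gauss h"]
  unfolding increments_def by (simp cong: measurable_cong_sets)
 then show ?thesis unfolding walk_def by (intro borel_measurable_add borel_measurable_sum) auto
qed

lemma prob_space_increments: "h > 0 \<Longrightarrow> prob_space (increments h n)"
 unfolding increments_def by (intro prob_space_PiM prob_space_gauss)

lemma nn_integral_increments_Suc:
 fixes f :: "(nat \<Rightarrow> real^'n) \<Rightarrow> ennreal"
 assumes h: "h > 0" and f: "f \<in> borel_measurable (increments h (Suc n))"
 shows "(\<integral>\<^sup>+\<xi>. f \<xi> \<partial>increments h (Suc n)) = (\<integral>\<^sup>+\<xi>. \<integral>\<^sup>+z. f (\<xi>(n := z)) \<partial>gauss h \<partial>increments h n)"
proof -
 interpret G: prob_space "gauss h :: (real^'n) measure" using h by (rule prob_space_gauss)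
 interpret product_sigma_finite "\<lambda>_::nat. gauss h :: (real^'n) measure" by standard
 show ?thesis using f unfolding increments_def lessThan_Suc
  by (subst product_nn_integral_insert) auto
qed

lemma walk_Suc_upd:
 "walk y (\<xi>(n := z)) (Suc n) = walk y \<xi> n + z" "k \<le> n \<Longrightarrow> walk y (\<xi>(n := z)) k = walk y \<xi> k"
 by (auto simp: walk_def intro!: sum.cong)

lemma run_walk_upd: "run \<Delta> q (walk y (\<xi>(n := z))) (Suc n) = \<Delta> (run \<Delta> q (walk y \<xi>) n) (walk y \<xi> n + z)"
proof -
 have "run \<Delta> q (walk y (\<xi>(n := z))) n = run \<Delta> q (walk y \<xi>) n"
  by (intro run_cong walk_Suc_upd(2))
 then show ?thesis unfolding run.simps walk_Suc_upd(1) by simp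
qed

text \<open>One step of the Markov property: the last increment is integrated out against the heat
  kernel, given the state and the position reached before it.\<close>

lemma nn_integral_run_Suc:
 fixes \<Delta> :: "'q::countable \<Rightarrow> real^'n \<Rightarrow> 'q" and V :: "'q \<Rightarrow> real^'n \<Rightarrow> ennreal"
 assumes h: "h > 0" and \<Delta>: "\<And>q. \<Delta> q \<in> borel \<rightarrow>\<^sub>M count_space UNIV" and V: "\<And>q. V q \<in> borel_measurable borel"
 shows "(\<integral>\<^sup>+\<xi>. V (run \<Delta> q (walk y \<xi>) (Suc n)) (walk y \<xi> (Suc n)) \<partial>increments h (Suc n)) =
  (\<integral>\<^sup>+\<xi>. \<integral>\<^sup>+z. V (\<Delta> (run \<Delta> q (walk y \<xi>) n) (walk y \<xi> n + z)) (walk y \<xi> n + z) * ennreal (heat h z) \<partial>lborel \<partial>increments h n)"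
proof -
 have "(\<integral>\<^sup>+\<xi>. V (run \<Delta> q (walk y \<xi>) (Suc n)) (walk y \<xi> (Suc n)) \<partial>increments h (Suc n)) =
  (\<integral>\<^sup>+\<xi>. \<integral>\<^sup>+z. V (\<Delta> (run \<Delta> q (walk y \<xi>) n) (walk y \<xi> n + z)) (walk y \<xi> n + z) \<partial>gauss h \<partial>increments h n)"
 proof -
  have m: "(\<lambda>\<xi>. V (run \<Delta> q (walk y \<xi>) (Suc n)) (walk y \<xi> (Suc n))) \<in> borel_measurable (increments h (Suc n))"
  proof (rule measurable_run_value[where N=borel and V=V and \<Delta>=\<Delta> and x="walk y" and n="Suc n" and q=q and M="increments h (Suc n)"])
   show "\<Delta> q \<in> borel \<rightarrow>\<^sub>M count_space UNIV" for q by (rule \<Delta>)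
   show "V q \<in> borel_measurable borel" for q by (rule V)
   show "(\<lambda>\<xi>. walk y \<xi> k) \<in> increments h (Suc n) \<rightarrow>\<^sub>M borel" if "k \<le> Suc n" for k
    using that by (rule measurable_walk)
  qed
  show ?thesis unfolding nn_integral_increments_Suc[OF h m] run_walk_upd walk_Suc_upd(1) ..
 qed
 also have "... = (\<integral>\<^sup>+\<xi>. \<integral>\<^sup>+z. V (\<Delta> (run \<Delta> q (walk y \<xi>) n) (walk y \<xi> n + z)) (walk y \<xi> n + z) * ennreal (heat h z) \<partial>lborel \<partial>increments h n)"
 proof (intro nn_integral_cong nn_integral_gauss)
  fix \<xi>
  have "(\<lambda>z. V (\<Delta> q' (c + z)) (c + z)) \<in> borel_measurable borel" for q' c
  proof -
   have "(\<lambda>x. V (\<Delta> q' x) x) \<in> borel_measurable borel"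
    by (rule measurable_compose_countable[where f=V and g="\<Delta> q'", OF V \<Delta>])
   moreover have "(+) c \<in> borel \<rightarrow>\<^sub>M borel" by measurable
   ultimately show ?thesis by (rule measurable_compose[rotated])
  qed
  then show "(\<lambda>z. V (\<Delta> (run \<Delta> q (walk y \<xi>) n) (walk y \<xi> n + z)) (walk y \<xi> n + z)) \<in> borel_measurable borel" .
 qed
 finally show ?thesis .
qed

lemma nn_integral_increments_0:
 assumes "h > 0"
 shows "(\<integral>\<^sup>+\<xi>. f (walk y \<xi> 0) \<partial>increments h 0) = (f y :: ennreal)"
proof -
 interpret prob_space "increments h 0 :: (nat \<Rightarrow> real^'n) measure" using assms by (rule prob_space_increments)
 show ?thesis by (simp add: walk_def emeasure_space_1)
qed

text \<open>The value \<open>V q x\<close> of an automaton state \<open>q\<close> at position \<open>x\<close>, when superharmonic in \<open>x\<close> and not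
 increased by the transitions, is a supermartingale along the walk.\<close>

lemma run_supermartingale:
 fixes \<Delta> :: "'q::countable \<Rightarrow> real^'n \<Rightarrow> 'q" and V :: "'q \<Rightarrow> real^'n \<Rightarrow> ennreal"
 assumes h: "h > 0" and \<Delta>: "\<And>q. \<Delta> q \<in> borel \<rightarrow>\<^sub>M count_space UNIV" and V: "\<And>q. V q \<in> borel_measurable borel"
  and step: "\<And>q x. V (\<Delta> q x) x \<le> V q x"
  and super: "\<And>q x. heat_mean h (V q) x \<le> V q x"
 shows "(\<integral>\<^sup>+\<xi>. V (run \<Delta> q (walk y \<xi>) n) (walk y \<xi> n) \<partial>increments h n) \<le> V q y"
proof -
 define I where "I n = (\<integral>\<^sup>+\<xi>. V (run \<Delta> q (walk y \<xi>) n) (walk y \<xi> n) \<partial>increments h n)" for n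
 have step_le: "I (Suc n) \<le> I n" for n
 proof -
  have "I (Suc n) = (\<integral>\<^sup>+\<xi>. \<integral>\<^sup>+z. V (\<Delta> (run \<Delta> q (walk y \<xi>) n) (walk y \<xi> n + z)) (walk y \<xi> n + z) * ennreal (heat h z) \<partial>lborel \<partial>increments h n)"
   unfolding I_def using h \<Delta> V by (rule nn_integral_run_Suc[where \<Delta>=\<Delta> and V=V])
  also have "... \<le> (\<integral>\<^sup>+\<xi>. heat_mean h (V (run \<Delta> q (walk y \<xi>) n)) (walk y \<xi> n) \<partial>increments h n)"
   by (rule nn_integral_mono, rule nn_integral_mono, rule mult_right_mono, rule step, rule zero_le)
  also have "... \<le> I n"
   unfolding I_def by (rule nn_integral_mono) (rule super)
  finally show ?thesis .
 qed
 have "I 0 = V (\<Delta> q y) y" unfolding I_def run.simps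
  using h by (rule nn_integral_increments_0[where f="\<lambda>x. V (\<Delta> q x) x"])
 then have "I 0 \<le> V q y" using step[of q y] by simp
 then have "I n \<le> V q y"
  using step_le by (induction n) (auto intro: order_trans)
 then show ?thesis by (simp only: I_def)
qed

text \<open>Here a transition can only increase the value, and each step loses at most
  \<open>err\<close>. The hypothesis \<open>sub\<close> concerns the state just after
  \<open>x\<close> has been read: if it is still unsuccessful, then \<open>x\<close> is known to lie
  outside the target.\<close>

lemma run_submartingale:
 fixes \<Delta> :: "'q::countable \<Rightarrow> real^'n \<Rightarrow> 'q" and V :: "'q \<Rightarrow> real^'n \<Rightarrow> ennreal"
 assumes h: "h > 0" and \<Delta>: "\<And>q. \<Delta> q \<in> borel \<rightarrow>\<^sub>M count_space UNIV" and V: "\<And>q. V q \<in> borel_measurable borel"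
  and step: "\<And>q x. V q x \<le> V (\<Delta> q x) x"
  and sub: "\<And>q x. V (\<Delta> q x) x \<le> heat_mean h (V (\<Delta> q x)) x + err"
 shows "V q y \<le> (\<integral>\<^sup>+\<xi>. V (run \<Delta> q (walk y \<xi>) n) (walk y \<xi> n) \<partial>increments h n) + of_nat n * err"
proof -
 define I where "I n = (\<integral>\<^sup>+\<xi>. V (run \<Delta> q (walk y \<xi>) n) (walk y \<xi> n) \<partial>increments h n)" for n
 define J where "J n \<xi> = heat_mean h (V (run \<Delta> q (walk y \<xi>) n)) (walk y \<xi> n)" for n \<xi>
 have step_le: "I n \<le> I (Suc n) + err" for n
 proof -
  have sub': "V (run \<Delta> q (walk y \<xi>) n) (walk y \<xi> n) \<le> J n \<xi> + err" for \<xi>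
  proof -
   obtain q' where q': "run \<Delta> q (walk y \<xi>) n = \<Delta> q' (walk y \<xi> n)"
    using run_last[of \<Delta> q "walk y \<xi>" n] by (rule exE)
   have "V (run \<Delta> q (walk y \<xi>) n) (walk y \<xi> n) = V (\<Delta> q' (walk y \<xi> n)) (walk y \<xi> n)" by (simp only: q')
   also have "... \<le> heat_mean h (V (\<Delta> q' (walk y \<xi> n))) (walk y \<xi> n) + err" by (rule sub)
   also have "... = J n \<xi> + err" by (simp only: J_def q')
   finally show ?thesis .
  qed
  have m: "J n \<in> borel_measurable (increments h n)"
   unfolding J_def
  proof (rule measurable_compose_countable[where f="\<lambda>q' \<xi>. heat_mean h (V q') (walk y \<xi> n)" and g="\<lambda>\<xi>. run \<Delta> q (walk y \<xi>) n"])
   show "(\<lambda>\<xi>. run \<Delta> q (walk y \<xi>) n) \<in> increments h n \<rightarrow>\<^sub>M count_space UNIV"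
    by (rule measurable_run[where N=borel and x="walk y", OF \<Delta> measurable_walk])
   have [measurable]: "V q' \<in> borel_measurable borel" for q' by (rule V)
   have [measurable]: "(\<lambda>\<xi>. walk y \<xi> n) \<in> increments h n \<rightarrow>\<^sub>M borel" by (rule measurable_walk) simp
   show "(\<lambda>\<xi>. heat_mean h (V q') (walk y \<xi> n)) \<in> borel_measurable (increments h n)" for q'
    by measurable
  qed
  have JI: "(\<integral>\<^sup>+\<xi>. J n \<xi> \<partial>increments h n) \<le> I (Suc n)"
  proof -
   have "(\<integral>\<^sup>+\<xi>. J n \<xi> \<partial>increments h n) \<le> (\<integral>\<^sup>+\<xi>. \<integral>\<^sup>+z. V (\<Delta> (run \<Delta> q (walk y \<xi>) n) (walk y \<xi> n + z)) (walk y \<xi> n + z) * ennreal (heat h z) \<partial>lborel \<partial>increments h n)"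
    unfolding J_def by (rule nn_integral_mono, rule nn_integral_mono, rule mult_right_mono, rule step, rule zero_le)
   also have "... = I (Suc n)" unfolding I_def
    using h \<Delta> V by (rule nn_integral_run_Suc[where \<Delta>=\<Delta> and V=V, symmetric])
   finally show ?thesis .
  qed
  have "I n \<le> (\<integral>\<^sup>+\<xi>. J n \<xi> + err \<partial>increments h n)"
   unfolding I_def by (rule nn_integral_mono) (rule sub')
  also have "... = (\<integral>\<^sup>+\<xi>. J n \<xi> \<partial>increments h n) + err"
   using m by (simp add: nn_integral_add prob_space.emeasure_space_1[OF prob_space_increments[OF h]])
  finally show ?thesis using JI by (meson add_right_mono order_trans)
 qed
 have "V q y \<le> I n + of_nat n * err"
 proof (induction n)
  case 0
  have "I 0 = V (\<Delta> q y) y" unfolding I_def run.simps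
   using h by (rule nn_integral_increments_0[where f="\<lambda>x. V (\<Delta> q x) x"])
  then show ?case using step[of q y] by simp
 next
  case (Suc n)
  have "V q y \<le> (I (Suc n) + err) + of_nat n * err"
   using Suc step_le[of n] by (meson add_right_mono order_trans)
  also have "... = I (Suc n) + of_nat (Suc n) * err"
   by (simp add: distrib_right add.assoc)
  finally show ?case .
 qed
 then show ?thesis by (simp only: I_def)
qed

section \<open>Measurability of hitting events for continuous paths\<close>

lemma sets_Collect_hits_open:
 fixes F :: "'w \<Rightarrow> real \<Rightarrow> 'b::topological_space"
 assumes m: "\<And>t. t \<in> T \<Longrightarrow> (\<lambda>w. F w t) \<in> M \<rightarrow>\<^sub>M borel"
  and c: "\<And>w. w \<in> space M \<Longrightarrow> continuous_on T (F w)" and U: "open U"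
 shows "{w \<in> space M. \<exists>t\<in>T. F w t \<in> U} \<in> sets M"
proof -
 obtain D where D: "countable D" "D \<subseteq> T" "T \<subseteq> closure D" by (rule separable)
 \<comment> \<open>A continuous path that is in an open set at some time of \<open>T\<close> is
   there at all nearby times of \<open>T\<close>, hence at a time of the countable dense set
   \<open>D\<close>.\<close>
 have eq: "(\<exists>t\<in>T. F w t \<in> U) \<longleftrightarrow> (\<exists>t\<in>D. F w t \<in> U)" if w: "w \<in> space M" for w
 proof
  assume "\<exists>t\<in>T. F w t \<in> U"
  then obtain t where t: "t \<in> T" "F w t \<in> U" by blast
  have "\<exists>A. open A \<and> A \<inter> T = F w -` U \<inter> T"
   using c[OF w] U unfolding continuous_on_open_invariant by blast
  then obtain A where A: "open A" "A \<inter> T = F w -` U \<inter> T" by blast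
  have "A \<inter> closure D \<noteq> {}" using t A D by blast
  then have "A \<inter> D \<noteq> {}" using A(1) open_Int_closure_eq_empty by blast
  then show "\<exists>t\<in>D. F w t \<in> U" using A(2) D(2) by blast
 qed (use D in auto)
 have "{w \<in> space M. \<exists>t\<in>T. F w t \<in> U} = (\<Union>t\<in>D. {w \<in> space M. F w t \<in> U})"
  using eq by auto
 also have "... \<in> sets M"
 proof (rule sets.countable_UN''[OF D(1)])
  show "{w \<in> space M. F w t \<in> U} \<in> sets M" if "t \<in> D" for t
   using measurable_sets[OF m[of t] borel_open[OF U]] that D(2) by (auto simp: vimage_def Int_def conj_commute)
 qed
 finally show ?thesis .
qed

text \<open>On a compact time set the distance to \<open>K\<close> attains its infimum, so the path
  hits \<open>K\<close> iff it enters each of a sequence of open neighbourhoods shrinking to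
  \<open>K\<close>. Compact pieces exhaust \<open>T\<close>.\<close>

lemma sets_Collect_hits_closed:
 fixes F :: "'w \<Rightarrow> real \<Rightarrow> 'b::metric_space"
 assumes m: "\<And>t. t \<in> T \<Longrightarrow> (\<lambda>w. F w t) \<in> M \<rightarrow>\<^sub>M borel"
  and c: "\<And>w. w \<in> space M \<Longrightarrow> continuous_on T (F w)" and K: "closed K"
  and T: "T = (\<Union>n::nat. S n)" "\<And>n. compact (S n)"
 shows "{w \<in> space M. \<exists>t\<in>T. F w t \<in> K} \<in> sets M"
proof (cases "K = {}")
 case False
 define U where "U k = {x. infdist x K < 1 / real (Suc k)}" for k
 have U: "open (U k)" for k unfolding U_def
  by (intro open_Collect_less continuous_intros)
 have eq: "(\<exists>t\<in>S n. F w t \<in> K) \<longleftrightarrow> (\<forall>k. \<exists>t\<in>S n. F w t \<in> U k)" if w: "w \<in> space M" for w n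
 proof
  assume *: "\<forall>k. \<exists>t\<in>S n. F w t \<in> U k"
  then have ne: "S n \<noteq> {}" by auto
  have "continuous_on (S n) (F w)" using c[OF w] T(1) by (auto intro: continuous_on_subset)
  then have "continuous_on (S n) (\<lambda>t. infdist (F w t) K)" by (intro continuous_intros)
  from continuous_attains_inf[OF T(2) ne this] obtain t where
   t: "t \<in> S n" "\<And>s. s \<in> S n \<Longrightarrow> infdist (F w t) K \<le> infdist (F w s) K" by blast
  have "infdist (F w t) K \<le> 1 / real (Suc k)" for k
  proof -
   obtain s where "s \<in> S n" "infdist (F w s) K < 1 / real (Suc k)" using * by (auto simp: U_def)
   then show ?thesis using t(2)[of s] by linarith
  qed
  then have "infdist (F w t) K \<le> 0"
   by (metis (no_types) inverse_eq_divide not_le reals_Archimedean)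
  then have "infdist (F w t) K = 0" using infdist_nonneg[of "F w t" K] by linarith
  then have "F w t \<in> K" using in_closed_iff_infdist_zero[OF K False] by blast
  then show "\<exists>t\<in>S n. F w t \<in> K" using t(1) by blast
 next
  assume "\<exists>t\<in>S n. F w t \<in> K"
  then show "\<forall>k. \<exists>t\<in>S n. F w t \<in> U k" by (auto simp: U_def intro!: bexI)
 qed
 have "{w \<in> space M. \<exists>t\<in>T. F w t \<in> K} = (\<Union>n. {w \<in> space M. \<exists>t\<in>S n. F w t \<in> K})"
  unfolding T(1) by blast
 also have "... = (\<Union>n. (\<Inter>k. {w \<in> space M. \<exists>t\<in>S n. F w t \<in> U k}))"
 proof (rule arg_cong[where f=Union], rule image_cong[OF refl])
  show "{w \<in> space M. \<exists>t\<in>S n. F w t \<in> K} = (\<Inter>k. {w \<in> space M. \<exists>t\<in>S n. F w t \<in> U k})" for n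
  proof (rule set_eqI)
   show "w \<in> {w \<in> space M. \<exists>t\<in>S n. F w t \<in> K} \<longleftrightarrow> w \<in> (\<Inter>k. {w \<in> space M. \<exists>t\<in>S n. F w t \<in> U k})" for w
    by (cases "w \<in> space M") (simp_all add: eq)
  qed
 qed
 also have "... \<in> sets M"
 proof (intro sets.countable_UN sets.countable_INT image_subsetI)
  show "{w \<in> space M. \<exists>t\<in>S n. F w t \<in> U k} \<in> sets M" for n k
   by (rule sets_Collect_hits_open) (use m c U T in \<open>auto intro: continuous_on_subset\<close>)
 qed auto
 finally show ?thesis .
qed auto

section \<open>Brownian laws on path space\<close>

lemma space_path_space: "space path_space = {w. continuous_on {0..} w} \<inter> extensional {0..}"
 by (auto simp: path_space_def space_restrict_space space_PiM PiE_def)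

lemma measurable_path_component:
 assumes "sets P = sets path_space" "t \<ge> 0"
 shows "(\<lambda>w. w t) \<in> P \<rightarrow>\<^sub>M borel"
proof -
 have "(\<lambda>w. w t) \<in> path_space \<rightarrow>\<^sub>M borel"
  unfolding path_space_def
  by (rule measurable_restrict_space1) (use assms in \<open>auto intro!: measurable_component_singleton\<close>)
 then show ?thesis using measurable_cong_sets[OF assms(1) refl] by blast
qed

lemma continuous_on_path:
 assumes "sets P = sets path_space" "w \<in> space P" "T \<subseteq> {0..}"
 shows "continuous_on T w"
 using assms sets_eq_imp_space_eq[OF assms(1)] by (auto simp: space_path_space intro: continuous_on_subset)

lemma sets_path_hits_open:
 assumes P: "sets P = sets path_space" and T: "T \<subseteq> {0..}" and U: "open U"
 shows "{w \<in> space P. \<exists>t\<in>T. w t \<in> U} \<in> sets P"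
 by (rule sets_Collect_hits_open[where F="\<lambda>w. w", OF measurable_path_component[OF P] continuous_on_path[OF P _ T] U])
   (use T in auto)

lemma atLeast_eq_UN: "{a..} = (\<Union>n. {a..a + real n})"
proof safe
 fix x assume x: "a \<le> x"
 obtain n where "x - a \<le> real n" using real_arch_simple by blast
 then show "x \<in> (\<Union>n. {a..a + real n})" using x by (intro UN_I[of n]) auto
qed auto

lemma sets_path_hits_closed:
 assumes P: "sets P = sets path_space" and a: "a \<ge> 0" and K: "closed K"
 shows "{w \<in> space P. \<exists>t\<ge>a. w t \<in> K} \<in> sets P"
proof -
 have T: "{a..} \<subseteq> {0..}" using a by auto
 have "{w \<in> space P. \<exists>t\<in>{a..}. w t \<in> K} \<in> sets P"
  by (rule sets_Collect_hits_closed[where F="\<lambda>w. w" and S="\<lambda>n. {a..a + real n}", OF measurable_path_component[OF P] continuous_on_path[OF P _ T] K atLeast_eq_UN])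
    (use T in auto)
 then show ?thesis by (simp add: Bex_def conj_commute)
qed

lemma brownian_lawD:
 assumes "brownian_law y P"
 shows "prob_space P" "sets P = sets path_space" "AE w in P. w 0 = y"
 using assms unfolding brownian_law_def by blast+

lemma brownian_law_distr_increment:
 fixes P :: "(real \<Rightarrow> real^'n) measure"
 assumes "brownian_law y P" "0 \<le> s" "s < t"
 shows "distr P borel (\<lambda>w. w t - w s) = gauss (t - s)"
proof -
 have "distributed P lborel (\<lambda>w. w t - w s) (\<lambda>x. ennreal (heat (t - s) x))"
  using assms unfolding brownian_law_def heat_def by blast
 then have "distr P lborel (\<lambda>w. w t - w s) = gauss (t - s)"
  unfolding gauss_def by (rule distributed_distr_eq_density)
 moreover have "distr P lborel (\<lambda>w. w t - w s) = distr P borel (\<lambda>w. w t - w s)"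
  by (rule distr_cong) auto
 ultimately show ?thesis by simp
qed

text \<open>Sampled at the multiples of \<open>h\<close>, the path is a walk with independent
  Gaussian increments. The functional may look at the first \<open>n + 1\<close> positions only, and
  the start at \<open>y\<close> holds almost surely.\<close>

lemma brownian_law_grid:
 fixes P :: "(real \<Rightarrow> real^'n) measure" and \<Phi> :: "(nat \<Rightarrow> real^'n) \<Rightarrow> ennreal"
 assumes B: "brownian_law y P" and h: "h > 0" and n: "n > 0"
  and cong: "\<And>x x'. (\<And>k. k \<le> n \<Longrightarrow> x k = x' k) \<Longrightarrow> \<Phi> x = \<Phi> x'"
  and m: "(\<lambda>\<xi>. \<Phi> (walk y \<xi>)) \<in> borel_measurable (increments h n)"
 shows "(\<integral>\<^sup>+w. \<Phi> (\<lambda>k. w (real k * h)) \<partial>P) = (\<integral>\<^sup>+\<xi>. \<Phi> (walk y \<xi>) \<partial>increments h n)"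
proof -
 interpret prob_space P using brownian_lawD[OF B] by simp
 note sP = brownian_lawD(2)[OF B]
 define \<tau> where "\<tau> i = real i * h" for i
 define X where "X i w = w (\<tau> (Suc i)) - w (\<tau> i)" for i and w :: "real \<Rightarrow> real^'n"
 have \<tau>: "0 \<le> \<tau> i" "\<tau> i < \<tau> (Suc i)" "\<tau> (Suc i) - \<tau> i = h" for i
  using h by (auto simp: \<tau>_def algebra_simps)
 have rv: "random_variable borel (X i)" for i
  unfolding X_def by (intro borel_measurable_diff measurable_path_component[OF sP] \<tau>)
 have "\<forall>(n::nat) \<tau>. 0 \<le> \<tau> 0 \<and> (\<forall>i<n. \<tau> i < \<tau> (Suc i)) \<longrightarrow>
    indep_vars (\<lambda>_. borel) (\<lambda>i w. w (\<tau> (Suc i)) - w (\<tau> i)) {..<n}"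
  using B unfolding brownian_law_def by blast
 then have "indep_vars (\<lambda>_. borel) X {..<n}" unfolding X_def using \<tau> by blast
 then have d: "distr P (\<Pi>\<^sub>M i\<in>{..<n}. borel) (\<lambda>w. \<lambda>i\<in>{..<n}. X i w) = (\<Pi>\<^sub>M i\<in>{..<n}. distr P borel (X i))"
  using n by (subst (asm) indep_vars_iff_distr_eq_PiM) (auto intro: rv)
 have "distr P borel (X i) = gauss h" for i
  unfolding X_def using brownian_law_distr_increment[OF B \<tau>(1,2)] \<tau>(3) by metis
 then have d: "distr P (\<Pi>\<^sub>M i\<in>{..<n}. borel) (\<lambda>w. \<lambda>i\<in>{..<n}. X i w) = increments h n"
  using d unfolding increments_def by simp
 have walk_X: "walk (w 0) (\<lambda>i\<in>{..<n}. X i w) k = w (real k * h)" if "k \<le> n" for w k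
  using that
 proof (induction k)
  case 0 then show ?case by (simp add: walk_def)
 next
  case (Suc k)
  have "walk (w 0) (\<lambda>i\<in>{..<n}. X i w) (Suc k) = walk (w 0) (\<lambda>i\<in>{..<n}. X i w) k + X k w"
   using Suc.prems by (simp add: walk_def)
  also have "... = w (real (Suc k) * h)" using Suc by (simp only: X_def \<tau>_def) simp
  finally show ?case .
 qed
 have meas: "(\<lambda>w. \<lambda>i\<in>{..<n}. X i w) \<in> P \<rightarrow>\<^sub>M (\<Pi>\<^sub>M i\<in>{..<n}. borel)"
  by (intro measurable_restrict rv)
 have "(\<integral>\<^sup>+\<xi>. \<Phi> (walk y \<xi>) \<partial>increments h n) = (\<integral>\<^sup>+w. \<Phi> (walk y (\<lambda>i\<in>{..<n}. X i w)) \<partial>P)"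
  using m unfolding d[symmetric] by (subst nn_integral_distr[OF meas]) auto
 also have "... = (\<integral>\<^sup>+w. \<Phi> (\<lambda>k. w (real k * h)) \<partial>P)"
 proof (rule nn_integral_cong_AE)
  show "AE w in P. \<Phi> (walk y (\<lambda>i\<in>{..<n}. X i w)) = \<Phi> (\<lambda>k. w (real k * h))"
   using brownian_lawD(3)[OF B]
  proof eventually_elim
   case (elim w)
   show ?case by (rule cong) (use walk_X[of _ w] elim in auto)
  qed
 qed
 finally show ?thesis ..
qed

lemma brownian_law_at:
 fixes P :: "(real \<Rightarrow> real^'n) measure"
 assumes B: "brownian_law y P" and t: "t > 0" and [measurable]: "f \<in> borel_measurable borel"
 shows "(\<integral>\<^sup>+w. f (w t) \<partial>P) = heat_mean t f y"
proof -
 note sP = brownian_lawD(2)[OF B]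
 have [measurable]: "(\<lambda>w. w t - w 0) \<in> P \<rightarrow>\<^sub>M borel"
  using t by (intro borel_measurable_diff measurable_path_component[OF sP]) auto
 have "(\<integral>\<^sup>+w. f (w t) \<partial>P) = (\<integral>\<^sup>+w. f (y + (w t - w 0)) \<partial>P)"
  using brownian_lawD(3)[OF B] by (intro nn_integral_cong_AE) auto
 also have "... = (\<integral>\<^sup>+z. f (y + z) \<partial>distr P borel (\<lambda>w. w t - w 0))"
  by (subst nn_integral_distr) auto
 also have "... = heat_mean t f y"
  using brownian_law_distr_increment[OF B order_refl t] by (simp add: nn_integral_gauss)
 finally show ?thesis .
qed

section \<open>Hitting estimates along dyadic skeletons\<close>

definition hit_flag :: "'a set \<Rightarrow> bool \<Rightarrow> 'a \<Rightarrow> bool" where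
 "hit_flag U q x \<longleftrightarrow> q \<or> x \<in> U"

lemma run_hit_flag: "run (hit_flag U) False x n \<longleftrightarrow> (\<exists>k\<le>n. x k \<in> U)"
 by (induction n) (auto simp: hit_flag_def le_Suc_eq)

lemma measurable_hit_flag:
 assumes [measurable]: "U \<in> sets borel"
 shows "hit_flag U q \<in> borel \<rightarrow>\<^sub>M count_space UNIV"
 unfolding hit_flag_def by measurable

text \<open>The second flag can be raised only when the first one is up, possibly through the same
  position; both flags up means a visit to \<open>U1\<close> followed or accompanied by a visit to
  \<open>U2\<close>.\<close>

definition hit_both_flag :: "'a set \<Rightarrow> 'a set \<Rightarrow> bool \<times> bool \<Rightarrow> 'a \<Rightarrow> bool \<times> bool" where
 "hit_both_flag U1 U2 q x = (fst q \<or> x \<in> U1, snd q \<or> (fst q \<or> x \<in> U1) \<and> x \<in> U2)"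

lemma run_hit_both_flag:
 "run (hit_both_flag U1 U2) (False, False) x n = (\<exists>j\<le>n. x j \<in> U1, \<exists>k\<le>n. (\<exists>j\<le>k. x j \<in> U1) \<and> x k \<in> U2)"
proof -
 have "(\<exists>k\<le>Suc n. P k) \<longleftrightarrow> (\<exists>k\<le>n. P k) \<or> P (Suc n)" for n P by (auto simp: le_Suc_eq)
 then show ?thesis by (induction n) (simp_all add: hit_both_flag_def)
qed

lemma measurable_hit_both_flag:
 assumes [measurable]: "U1 \<in> sets borel" "U2 \<in> sets borel"
 shows "hit_both_flag U1 U2 q \<in> borel \<rightarrow>\<^sub>M count_space UNIV"
proof -
 have "hit_both_flag U1 U2 q -` {a} = {x. (fst q \<or> x \<in> U1) = fst a \<and> (snd q \<or> (fst q \<or> x \<in> U1) \<and> x \<in> U2) = snd a}" for a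
  by (cases a) (auto simp: hit_both_flag_def)
 then show ?thesis by (simp add: measurable_count_space_eq2)
qed

text \<open>These are the supermedian functions of the heat semigroup: no continuity is asked for
  and infinite values are allowed, so that Green potentials qualify.\<close>

definition superharmonic :: "(real^'n \<Rightarrow> ennreal) \<Rightarrow> bool" where
 "superharmonic f \<longleftrightarrow> f \<in> borel_measurable borel \<and>
   (\<forall>h x. h > 0 \<longrightarrow> heat_mean h f x \<le> f x)"

lemma superharmonic_potential:
 assumes "CARD('n) \<ge> 3" "sigma_finite_measure (m :: (real^'n) measure)" "sets m = sets borel"
 shows "superharmonic (potential m)"
 unfolding superharmonic_def using potential_superharmonic[OF assms(1) _ assms(2,3)]
  measurable_potential[OF assms(2,3) measurable_ident] by (auto simp: id_def)

lemma superharmonic_cmult: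
 assumes "superharmonic f" shows "superharmonic (\<lambda>x. c * f x)"
proof -
 have [measurable]: "f \<in> borel_measurable borel" using assms by (simp add: superharmonic_def)
 have "(\<integral>\<^sup>+z. c * f (x + z) * ennreal (heat h z) \<partial>lborel) \<le> c * f x" if "h > 0" for h x
 proof -
  have "(\<integral>\<^sup>+z. c * f (x + z) * ennreal (heat h z) \<partial>lborel) = c * heat_mean h f x"
   by (subst nn_integral_cmult[symmetric]) (auto simp: mult.assoc)
  also have "... \<le> c * f x" using assms that by (intro mult_left_mono) (auto simp: superharmonic_def)
  finally show ?thesis .
 qed
 then show ?thesis by (auto simp: superharmonic_def)
qed

lemma nn_integral_heat_const:
 assumes "h > 0" shows "(\<integral>\<^sup>+z. c * ennreal (heat h (z::real^'n)) \<partial>lborel) = c"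
 using assms by (simp add: nn_integral_cmult nn_integral_heat)

lemma dyadic_floor_tendsto:
 assumes "t \<ge> 0"
 shows "(\<lambda>N. real (nat \<lfloor>t * 2 ^ N\<rfloor>) * (1 / 2) ^ N) \<longlonglongrightarrow> t"
proof -
 have "(\<lambda>N. real_of_int \<lfloor>t * 2 ^ N\<rfloor> / 2 ^ N) \<longlonglongrightarrow> t"
 proof (cases "t = 0")
  case False
  then have "t > 0" using assms by simp
  then show ?thesis by real_asymp
 qed simp
 then show ?thesis using assms by (simp add: power_one_over)
qed

definition dyadic_path :: "nat \<Rightarrow> (real \<Rightarrow> 'a) \<Rightarrow> nat \<Rightarrow> 'a" where
 "dyadic_path N w k = w (real k * (1 / 2) ^ N)"

lemma dyadic_path_Suc: "dyadic_path (Suc N) w (2 * k) = dyadic_path N w k"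
 by (simp add: dyadic_path_def)

text \<open>The skeleton of level \<open>N\<close> has mesh \<open>(1 / 2) ^ N\<close> and runs up
  to time \<open>N + 1\<close>: refining it also lengthens the horizon, so every fixed time is
  eventually covered.\<close>

lemma eventually_dyadic_path:
 fixes w :: "real \<Rightarrow> 'a::topological_space"
 assumes w: "continuous_on {0..} w" and t: "t \<ge> 0" "w t \<in> U" and U: "open U"
 shows "eventually (\<lambda>N. dyadic_path N w (nat \<lfloor>t * 2 ^ N\<rfloor>) \<in> U \<and> nat \<lfloor>t * 2 ^ N\<rfloor> \<le> Suc N * 2 ^ N) sequentially"
proof (rule eventually_conj)
 have "((w \<circ> (\<lambda>N. real (nat \<lfloor>t * 2 ^ N\<rfloor>) * (1 / 2) ^ N)) \<longlongrightarrow> w t) sequentially"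
  unfolding o_def
  by (rule continuous_on_tendsto_compose[OF w dyadic_floor_tendsto[OF t(1)]]) (use t in auto)
 then show "eventually (\<lambda>N. dyadic_path N w (nat \<lfloor>t * 2 ^ N\<rfloor>) \<in> U) sequentially"
  using topological_tendstoD[OF _ U t(2)] by (fastforce simp: dyadic_path_def)
 show "eventually (\<lambda>N. nat \<lfloor>t * 2 ^ N\<rfloor> \<le> Suc N * 2 ^ N) sequentially"
 proof -
  obtain N0 where N0: "t \<le> real N0" using real_arch_simple by blast
  show ?thesis
  proof (rule eventually_sequentiallyI[of N0])
   fix N assume "N0 \<le> N"
   then have "t * 2 ^ N \<le> real (Suc N) * 2 ^ N" using N0 by (intro mult_right_mono) auto
   then have "t * 2 ^ N \<le> real_of_int (int (Suc N * 2 ^ N))" by (simp only: of_int_mult of_int_power of_int_numeral of_int_of_nat_eq of_nat_mult of_nat_power of_nat_numeral)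
   then have "\<lfloor>t * 2 ^ N\<rfloor> \<le> int (Suc N * 2 ^ N)" by linarith
   then show "nat \<lfloor>t * 2 ^ N\<rfloor> \<le> Suc N * 2 ^ N" by linarith
  qed
 qed
qed

lemma emeasure_le_dyadic:
 assumes m: "\<And>N. E N \<in> sets P" and inc: "incseq E" and S: "S \<subseteq> (\<Union>N. E N)" "\<And>N. emeasure P (E N) \<le> c"
 shows "emeasure P S \<le> (c::ennreal)"
proof -
 have "emeasure P S \<le> emeasure P (\<Union>N. E N)" using m S(1) by (intro emeasure_mono) auto
 also have "... = (SUP N. emeasure P (E N))" using m inc by (intro SUP_emeasure_incseq[symmetric]) auto
 also have "... \<le> c" using S(2) by (rule SUP_least)
 finally show ?thesis .
qed

lemma measurable_dyadic_path:
 assumes "sets P = sets path_space"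
 shows "(\<lambda>w. dyadic_path N w k) \<in> P \<rightarrow>\<^sub>M borel"
 unfolding dyadic_path_def by (rule measurable_path_component[OF assms]) simp

text \<open>The value function dominates the indicator of the state \<open>q1\<close>, so the
  supermartingale bound controls the probability of ending there, uniformly in the mesh and the
  number of steps.\<close>

lemma brownian_run_le:
 fixes P :: "(real \<Rightarrow> real^'n) measure" and \<Delta> :: "'q::countable \<Rightarrow> real^'n \<Rightarrow> 'q"
 assumes B: "brownian_law y P"
  and \<Delta>: "\<And>q. \<Delta> q \<in> borel \<rightarrow>\<^sub>M count_space UNIV" and V: "\<And>q. superharmonic (V q)"
  and step: "\<And>q x. V (\<Delta> q x) x \<le> V q x"
  and one: "\<And>x. V q1 x = 1" and n: "n > 0"
 shows "emeasure P {w \<in> space P. run \<Delta> q (dyadic_path N w) n = q1} \<le> V q y"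
proof -
 note sP = brownian_lawD(2)[OF B]
 have Vm: "V q \<in> borel_measurable borel" for q using V[of q] by (simp add: superharmonic_def)
 define h where "h = (1 / 2 :: real) ^ N"
 have h: "h > 0" by (simp add: h_def)
 have dp: "dyadic_path N w = (\<lambda>k. w (real k * h))" for w :: "real \<Rightarrow> real^'n"
  by (simp add: dyadic_path_def h_def fun_eq_iff)
 have r: "(\<lambda>w. run \<Delta> q (dyadic_path N w) n) \<in> P \<rightarrow>\<^sub>M count_space UNIV"
  by (rule measurable_run[where N=borel]) (rule \<Delta>, rule measurable_dyadic_path[OF sP])
 have E: "{w \<in> space P. run \<Delta> q (dyadic_path N w) n = q1} \<in> sets P"
  using measurable_sets[OF r, of "{q1}"] by (simp add: vimage_def Int_def conj_commute)
 have "emeasure P {w \<in> space P. run \<Delta> q (dyadic_path N w) n = q1} =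
   (\<integral>\<^sup>+w. indicator {w \<in> space P. run \<Delta> q (dyadic_path N w) n = q1} w \<partial>P)" using E by simp
 also have "... \<le> (\<integral>\<^sup>+w. V (run \<Delta> q (dyadic_path N w) n) (dyadic_path N w n) \<partial>P)"
  by (intro nn_integral_mono) (auto simp: indicator_def one)
 also have "... = (\<integral>\<^sup>+\<xi>. V (run \<Delta> q (walk y \<xi>) n) (walk y \<xi> n) \<partial>increments h n)"
  unfolding dp
 proof (rule brownian_law_grid[OF B h n, where \<Phi>="\<lambda>x. V (run \<Delta> q x n) (x n)"])
  show "V (run \<Delta> q x n) (x n) = V (run \<Delta> q x' n) (x' n)" if "\<And>k. k \<le> n \<Longrightarrow> x k = x' k" for x x' :: "nat \<Rightarrow> real^'n"
   using run_cong[of n x x' \<Delta> q] that by simp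
  show "(\<lambda>\<xi>. V (run \<Delta> q (walk y \<xi>) n) (walk y \<xi> n)) \<in> borel_measurable (increments h n)"
   by (rule measurable_run_value[where N=borel]) (rule \<Delta>, rule Vm, rule measurable_walk)
 qed
 also have "... \<le> V q y"
 proof (rule run_supermartingale[where V=V and \<Delta>=\<Delta> and h=h and q=q and y=y and n=n])
  show "h > 0" by (rule h)
  show "\<Delta> q \<in> borel \<rightarrow>\<^sub>M count_space UNIV" for q by (rule \<Delta>)
  show "V q \<in> borel_measurable borel" for q by (rule Vm)
  show "V (\<Delta> q x) x \<le> V q x" for q x by (rule step)
  show "heat_mean h (V q) x \<le> V q x" for q x
   using V[of q] h by (simp add: superharmonic_def)
 qed
 finally show ?thesis .
qed

lemma superharmonic_const: "superharmonic (\<lambda>_. c)"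
 by (auto simp: superharmonic_def nn_integral_heat_const)

text \<open>The maximum principle without stopping times: the skeleton events increase and cover the
  hitting event of an open set, and on each skeleton the value \<open>f\<close> before the hit and 1
  after it form a supermartingale.\<close>

lemma brownian_hit_le:
 fixes P :: "(real \<Rightarrow> real^'n) measure"
 assumes B: "brownian_law y P" and U: "open U" and f: "superharmonic f" "\<And>x. x \<in> U \<Longrightarrow> f x \<ge> 1"
 shows "emeasure P {w \<in> space P. \<exists>t\<ge>0. w t \<in> U} \<le> f y"
proof (rule emeasure_le_dyadic)
 note sP = brownian_lawD(2)[OF B]
 define E where "E N = {w \<in> space P. \<exists>k\<le>Suc N * 2 ^ N. dyadic_path N w k \<in> U}" for N
 show "E N \<in> sets P" for N
 proof -
  have "E N = (\<Union>k\<in>{..Suc N * 2 ^ N}. {w \<in> space P. dyadic_path N w k \<in> U})" by (auto simp: E_def)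
  also have "... \<in> sets P"
   using measurable_sets[OF measurable_dyadic_path[OF sP] borel_open[OF U]]
   by (intro sets.finite_UN) (auto simp: vimage_def Int_def conj_commute)
  finally show ?thesis .
 qed
 show "incseq E"
 proof (rule incseq_SucI, rule subsetI)
  fix N w assume "w \<in> E N"
  then obtain k where "w \<in> space P" "k \<le> Suc N * 2 ^ N" "dyadic_path N w k \<in> U" by (auto simp: E_def)
  then show "w \<in> E (Suc N)" unfolding E_def
   by (intro CollectI conjI exI[of _ "2 * k"]) (auto simp: dyadic_path_Suc)
 qed
 show "{w \<in> space P. \<exists>t\<ge>0. w t \<in> U} \<subseteq> (\<Union>N. E N)"
 proof safe
  fix w and t :: real assume w: "w \<in> space P" "0 \<le> t" "w t \<in> U"
  have "eventually (\<lambda>N. w \<in> E N) sequentially"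
   using eventually_dyadic_path[OF continuous_on_path[OF sP w(1) order_refl] w(2,3) U]
   by eventually_elim (use w in \<open>auto simp: E_def\<close>)
  then show "w \<in> (\<Union>N. E N)" by (auto simp: eventually_sequentially)
 qed
 show "emeasure P (E N) \<le> f y" for N
 proof -
  define V where "V q x = (if q then 1 else f x)" for q x
  have "E N = {w \<in> space P. run (hit_flag U) False (dyadic_path N w) (Suc N * 2 ^ N) = True}"
   by (auto simp: E_def run_hit_flag)
  also have "emeasure P \<dots> \<le> V False y"
  proof (rule brownian_run_le[OF B])
   show "superharmonic (V q)" for q
    using f(1) superharmonic_const[of 1] by (cases q) (auto simp: V_def[abs_def])
   show "V (hit_flag U q x) x \<le> V q x" for q x using f(2) by (auto simp: V_def hit_flag_def)
   show "hit_flag U q \<in> borel \<rightarrow>\<^sub>M count_space UNIV" for q using U by (intro measurable_hit_flag) auto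
  qed (auto simp: V_def)
  finally show ?thesis by (simp add: V_def)
 qed
qed

text \<open>The value is \<open>c * f1\<close> before the visit to \<open>U1\<close>, then
  \<open>f2\<close>, then 1. Transitions lower it because \<open>f2 \<le> c \<le> c * f1\<close> on
  \<open>U1\<close> and \<open>1 \<le> f2\<close> on \<open>U2\<close>. This does the work of the
  strong Markov property at the first visit to \<open>U1\<close>.\<close>

lemma brownian_hit_both_le:
 fixes P :: "(real \<Rightarrow> real^'n) measure"
 assumes B: "brownian_law y P" and U: "open U1" "open U2"
  and f1: "superharmonic f1" "\<And>x. x \<in> U1 \<Longrightarrow> f1 x \<ge> 1"
  and f2: "superharmonic f2" "\<And>x. x \<in> U2 \<Longrightarrow> f2 x \<ge> 1" "\<And>x. x \<in> U1 \<Longrightarrow> f2 x \<le> c"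
 shows "{w \<in> space P. \<exists>t\<ge>0. \<exists>s\<in>{0..t}. w s \<in> U1 \<and> w t \<in> U2} \<in> sets P" (is "?J \<in> _")
  and "emeasure P {w \<in> space P. \<exists>t\<ge>0. \<exists>s\<in>{0..t}. w s \<in> U1 \<and> w t \<in> U2} \<le> c * f1 y"
proof -
 note sP = brownian_lawD(2)[OF B]
 define E where "E N = {w \<in> space P. \<exists>k\<le>Suc N * 2 ^ N. \<exists>j\<le>k. dyadic_path N w j \<in> U1 \<and> dyadic_path N w k \<in> U2}" for N
 have dm: "{w \<in> space P. dyadic_path N w k \<in> U} \<in> sets P" if "open U" for N k U
  using measurable_sets[OF measurable_dyadic_path[OF sP] borel_open[OF that]]
  by (simp add: vimage_def Int_def conj_commute)
 have Em: "E N \<in> sets P" for N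
 proof -
  have "E N = (\<Union>k\<in>{..Suc N * 2 ^ N}. \<Union>j\<in>{..k}. {w \<in> space P. dyadic_path N w j \<in> U1} \<inter> {w \<in> space P. dyadic_path N w k \<in> U2})"
   by (auto simp: E_def)
  also have "... \<in> sets P" using dm U by (intro sets.finite_UN sets.Int) auto
  finally show ?thesis .
 qed
 have inc: "incseq E"
 proof (rule incseq_SucI, rule subsetI)
  fix N w assume "w \<in> E N"
  then obtain k j where "w \<in> space P" "k \<le> Suc N * 2 ^ N" "j \<le> k" "dyadic_path N w j \<in> U1" "dyadic_path N w k \<in> U2"
   by (auto simp: E_def)
  then show "w \<in> E (Suc N)" unfolding E_def
   by (intro CollectI conjI exI[of _ "2 * k"] exI[of _ "2 * j"]) (auto simp: dyadic_path_Suc)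
 qed
 have sub: "?J \<subseteq> (\<Union>N. E N)"
 proof safe
  fix w and t s :: real assume w: "w \<in> space P" "0 \<le> t" "w t \<in> U2" "s \<in> {0..t}" "w s \<in> U1"
  have cont: "continuous_on {0..} w" by (rule continuous_on_path[OF sP w(1) order_refl])
  have le: "nat \<lfloor>s * 2 ^ N\<rfloor> \<le> nat \<lfloor>t * 2 ^ N\<rfloor>" for N
   using w(4) by (intro nat_mono floor_mono mult_right_mono) auto
  have "eventually (\<lambda>N. w \<in> E N) sequentially"
   using eventually_dyadic_path[OF cont w(2,3) U(2)] eventually_dyadic_path[OF cont _ w(5) U(1)] w(4)
  proof (elim eventually_elim2)
   fix N
   assume "dyadic_path N w (nat \<lfloor>t * 2 ^ N\<rfloor>) \<in> U2 \<and> nat \<lfloor>t * 2 ^ N\<rfloor> \<le> Suc N * 2 ^ N"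
    "dyadic_path N w (nat \<lfloor>s * 2 ^ N\<rfloor>) \<in> U1 \<and> nat \<lfloor>s * 2 ^ N\<rfloor> \<le> Suc N * 2 ^ N"
   then show "w \<in> E N" using w(1) le[of N] unfolding E_def by blast
  qed auto
  then show "w \<in> (\<Union>N. E N)" by (auto simp: eventually_sequentially)
 qed
 have "(\<Union>N. E N) \<subseteq> ?J"
 proof safe
  fix w N assume "w \<in> E N"
  then obtain k j where kj: "w \<in> space P" "j \<le> k" "dyadic_path N w j \<in> U1" "dyadic_path N w k \<in> U2"
   by (auto simp: E_def)
  then show "w \<in> space P" "\<exists>t\<ge>0. \<exists>s\<in>{0..t}. w s \<in> U1 \<and> w t \<in> U2"
   by (auto simp: dyadic_path_def intro!: exI[of _ "real k * (1 / 2) ^ N"] bexI[of _ "real j * (1 / 2) ^ N"] mult_right_mono)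
 qed
 with sub have "?J = (\<Union>N. E N)" by blast
 then show "?J \<in> sets P" using Em by auto
 have le: "emeasure P (E N) \<le> c * f1 y" for N
 proof -
  define V where "V q x = (if snd q then 1 else if fst q then f2 x else c * f1 x)" for q x
  have c_le: "f2 x \<le> c * f1 x" if "x \<in> U1" for x
  proof -
   have "c * 1 \<le> c * f1 x" using f1(2)[OF that] by (intro mult_left_mono) auto
   then show ?thesis using f2(3)[OF that] by simp
  qed
  have "E N = {w \<in> space P. run (hit_both_flag U1 U2) (False, False) (dyadic_path N w) (Suc N * 2 ^ N) = (True, True)}"
   by (auto simp: E_def run_hit_both_flag) (meson order_trans)
  also have "emeasure P \<dots> \<le> V (False, False) y"
  proof (rule brownian_run_le[OF B])
   show "superharmonic (V q)" for q
    using superharmonic_cmult[OF f1(1), of c] f2(1) superharmonic_const[of 1]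
    by (cases "snd q"; cases "fst q") (simp_all add: V_def[abs_def])
   show "V (hit_both_flag U1 U2 q x) x \<le> V q x" for q x
    using f2(2)[of x] c_le[of x] by (auto simp: V_def hit_both_flag_def)
   show "hit_both_flag U1 U2 q \<in> borel \<rightarrow>\<^sub>M count_space UNIV" for q
    using U by (intro measurable_hit_both_flag) auto
  qed (auto simp: V_def)
  finally show ?thesis by (simp add: V_def)
 qed
 show "emeasure P ?J \<le> c * f1 y" by (rule emeasure_le_dyadic[OF Em inc sub le])
qed

text \<open>The walk started at \<open>y\<close> either hits \<open>U\<close> or carries at most the
  value of \<open>f\<close> at its end, whose mean is small at a late time \<open>T\<close>; the
  losses of the \<open>n\<close> steps add up to \<open>C * T\<^sup>2 / n\<close>.\<close>

lemma brownian_hit_ge: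
 fixes P :: "(real \<Rightarrow> real^'n) measure" and f :: "real^'n \<Rightarrow> ennreal"
 assumes B: "brownian_law y P" and U: "open U" and fm [measurable]: "f \<in> borel_measurable borel"
  and sub: "\<And>h x. 0 < h \<Longrightarrow> h \<le> 1 \<Longrightarrow> x \<notin> U \<Longrightarrow>
    min (f x) 1 \<le> heat_mean h (\<lambda>x. min (f x) 1) x + ennreal (C * h\<^sup>2)"
  and C: "C \<ge> 0"
  and tail: "\<And>\<epsilon>. \<epsilon> > 0 \<Longrightarrow> \<exists>T>0. heat_mean T f y \<le> ennreal \<epsilon>"
 shows "min (f y) 1 \<le> emeasure P {w \<in> space P. \<exists>t\<ge>0. w t \<in> U}"
proof (rule ennreal_le_epsilon)
 note sP = brownian_lawD(2)[OF B]
 let ?H = "{w \<in> space P. \<exists>t\<ge>0. w t \<in> U}"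
 have Hm: "?H \<in> sets P" using sets_path_hits_open[OF sP order_refl U] by (simp add: Bex_def conj_commute)
 fix e :: real assume e: "e > 0"
 obtain T where T: "T > 0" "heat_mean T f y \<le> ennreal (e / 2)"
  using tail[of "e / 2"] e by auto
 \<comment> \<open>\<open>T \<le> real n\<close> makes the step \<open>h = T / real n\<close> at
   most 1, and the last bound makes the total loss at most \<open>e / 2\<close>.\<close>
 obtain n where n: "n > 0" "T \<le> real n" "C * T\<^sup>2 / (e / 2) \<le> real n"
 proof -
  obtain n where "max 1 (max T (C * T\<^sup>2 / (e / 2))) \<le> real n" using real_arch_simple by blast
  then show ?thesis using that[of n] by (cases n) auto
 qed
 define h where "h = T / real n"
 have h: "h > 0" "h \<le> 1" using T n by (auto simp: h_def)
 define V where "V q x = (if q then 1 else min (f x) 1)" for q x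
 have Vm: "V q \<in> borel_measurable borel" for q by (cases q) (simp_all add: V_def[abs_def])
 have Um: "hit_flag U q \<in> borel \<rightarrow>\<^sub>M count_space UNIV" for q using U by (intro measurable_hit_flag) auto
 have rm: "(\<lambda>\<xi>. run (hit_flag U) False (walk y \<xi>) n) \<in> increments h n \<rightarrow>\<^sub>M count_space UNIV"
  by (rule measurable_run[where N=borel]) (rule Um, rule measurable_walk)
 have "min (f y) 1 = V False y" by (simp add: V_def)
 also have "... \<le> (\<integral>\<^sup>+\<xi>. V (run (hit_flag U) False (walk y \<xi>) n) (walk y \<xi> n) \<partial>increments h n) + of_nat n * ennreal (C * h\<^sup>2)"
 proof (rule run_submartingale[where V=V and \<Delta>="hit_flag U" and h=h and q=False and y=y and n=n])
  show "h > 0" by (rule h)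
  show "hit_flag U q \<in> borel \<rightarrow>\<^sub>M count_space UNIV" for q by (rule Um)
  show "V q \<in> borel_measurable borel" for q by (rule Vm)
  show "V q x \<le> V (hit_flag U q x) x" for q x by (auto simp: V_def hit_flag_def)
  show "V (hit_flag U q x) x \<le> heat_mean h (V (hit_flag U q x)) x + ennreal (C * h\<^sup>2)" for q x
  proof (cases "hit_flag U q x")
   case True
   then show ?thesis using nn_integral_heat[OF h(1), where 'n='n] by (simp add: V_def)
  next
   case False
   then have "x \<notin> U" by (auto simp: hit_flag_def)
   then show ?thesis using sub[OF h] False by (simp add: V_def)
  qed
 qed
 also have "of_nat n * ennreal (C * h\<^sup>2) \<le> ennreal (e / 2)"
 proof -
  have "real n * (C * h\<^sup>2) = C * T\<^sup>2 / real n" using n by (simp add: h_def power2_eq_square)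
  also have "... \<le> e / 2" using n e by (simp add: divide_simps mult.commute split: if_splits)
  finally show ?thesis using C by (simp add: ennreal_of_nat_eq_real_of_nat ennreal_mult[symmetric] ennreal_leI)
 qed
 also have "(\<integral>\<^sup>+\<xi>. V (run (hit_flag U) False (walk y \<xi>) n) (walk y \<xi> n) \<partial>increments h n)
   \<le> (\<integral>\<^sup>+\<xi>. indicator {True} (run (hit_flag U) False (walk y \<xi>) n) + f (walk y \<xi> n) \<partial>increments h n)"
  by (intro nn_integral_mono) (auto simp: V_def indicator_def)
 also have "... = (\<integral>\<^sup>+\<xi>. indicator {True} (run (hit_flag U) False (walk y \<xi>) n) \<partial>increments h n) + (\<integral>\<^sup>+\<xi>. f (walk y \<xi> n) \<partial>increments h n)"
  by (rule nn_integral_add) (rule measurable_compose[OF rm], simp, rule measurable_compose[OF measurable_walk[OF order_refl] fm])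
 also have "(\<integral>\<^sup>+\<xi>. f (walk y \<xi> n) \<partial>increments h n) \<le> ennreal (e / 2)"
 proof -
  have "(\<integral>\<^sup>+\<xi>. f (walk y \<xi> n) \<partial>increments h n) = (\<integral>\<^sup>+w. f (w (real n * h)) \<partial>P)"
   by (rule brownian_law_grid[OF B h(1) n(1), where \<Phi>="\<lambda>x. f (x n)", symmetric])
     (auto intro!: measurable_compose[OF measurable_walk[OF order_refl] fm])
  also have "real n * h = T" using n by (simp add: h_def)
  also have "(\<integral>\<^sup>+w. f (w T) \<partial>P) \<le> ennreal (e / 2)"
   using T by (subst brownian_law_at[OF B T(1) fm])
  finally show ?thesis .
 qed
 also have "(\<integral>\<^sup>+\<xi>. indicator {True} (run (hit_flag U) False (walk y \<xi>) n) \<partial>increments h n) \<le> emeasure P ?H"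
 proof -
  have "(\<integral>\<^sup>+\<xi>. indicator {True} (run (hit_flag U) False (walk y \<xi>) n) \<partial>increments h n) =
    (\<integral>\<^sup>+w. indicator {True} (run (hit_flag U) False (\<lambda>k. w (real k * h)) n) \<partial>P)"
  proof (rule brownian_law_grid[OF B h(1) n(1), where \<Phi>="\<lambda>x. indicator {True} (run (hit_flag U) False x n)", symmetric])
   show "indicator {True} (run (hit_flag U) False x n) = (indicator {True} (run (hit_flag U) False x' n) :: ennreal)"
    if "\<And>k. k \<le> n \<Longrightarrow> x k = x' k" for x x' :: "nat \<Rightarrow> real^'n"
    using run_cong[of n x x' "hit_flag U" False] that by simp
   show "(\<lambda>\<xi>. indicator {True} (run (hit_flag U) False (walk y \<xi>) n) :: ennreal) \<in> borel_measurable (increments h n)"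
    by (rule measurable_compose[OF rm]) simp
  qed
  also have "... \<le> (\<integral>\<^sup>+w. indicator ?H w \<partial>P)"
  proof (rule nn_integral_mono)
   fix w assume "w \<in> space P"
   moreover have "\<exists>t\<ge>0. w t \<in> U" if "w (real k * h) \<in> U" for k
    using that h by (intro exI[of _ "real k * h"]) auto
   ultimately show "indicator {True} (run (hit_flag U) False (\<lambda>k. w (real k * h)) n) \<le> (indicator ?H w :: ennreal)"
    by (auto simp: run_hit_flag indicator_def)
  qed
  also have "... = emeasure P ?H" using Hm by simp
  finally show ?thesis .
 qed
 finally have "min (f y) 1 \<le> emeasure P ?H + ennreal (e / 2) + ennreal (e / 2)" by (simp add: add_mono)
 also have "... = emeasure P ?H + ennreal e" using e by (simp add: add.assoc ennreal_plus[symmetric] del: ennreal_plus)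
 finally show "min (f y) 1 \<le> emeasure P ?H + ennreal e" .
qed

section \<open>Potentials and equilibrium measures\<close>

text \<open>This is transience: for \<open>t \<ge> 1\<close> and dimension at least 3 the kernel is
  at most \<open>t powr (- (3/2))\<close>, uniformly in \<open>x\<close>, and this is integrable at
  infinity.\<close>

lemma heat_tail_le:
 fixes x :: "real^'n"
 assumes d: "CARD('n) \<ge> 3" and T: "T \<ge> 1"
 shows "heat_tail T x \<le> ennreal (2 / sqrt T)"
proof -
 have "heat_tail T x \<le> (\<integral>\<^sup>+t. ennreal (t powr (- (3/2))) * indicator {T..} t \<partial>lborel)"
  unfolding heat_tail_def
 proof (rule nn_integral_mono)
  fix t :: real
  have "heat t x \<le> t powr (- (3/2))" if "t > T"
  proof -
   have "t > 0" using that T by linarith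
   then have "heat t x \<le> (2 * pi * t) powr (- (real CARD('n) / 2))"
    by (simp add: heat_eq mult_left_le)
   also have "(2 * pi * t) powr (- (real CARD('n) / 2)) \<le> t powr (- (real CARD('n) / 2))"
    using that T pi_gt3 by (intro powr_mono2') auto
   also have "... \<le> t powr (- (3/2))" using that T d by (intro powr_mono) auto
   finally show ?thesis by simp
  qed
  then show "indicator {T<..} t * ennreal (heat t x) \<le> ennreal (t powr (- (3/2))) * indicator {T..} t"
   by (auto simp: indicator_def intro!: ennreal_leI)
 qed
 also have "... = ennreal (0 - (- 2 * T powr (- (1/2))))"
 proof (rule nn_integral_FTC_atLeast)
  show "((\<lambda>t. - 2 * t powr (- (1/2))) has_real_derivative t powr (- (3/2))) (at t)" if "T \<le> t" for t
   using that T by (auto intro!: derivative_eq_intros)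
  show "((\<lambda>t. - 2 * t powr (- (1/2)) :: real) \<longlongrightarrow> 0) at_top"
   by (intro tendsto_mult_right_zero tendsto_neg_powr filterlim_ident) auto
 qed auto
 also have "T powr (- (1/2)) = inverse (sqrt T)"
  using T by (simp add: powr_minus powr_half_sqrt)
 also have "0 - (- 2 * inverse (sqrt T)) = 2 / sqrt T" by (simp only: divide_inverse)
 finally show ?thesis .
qed

text \<open>Half of the Gaussian exponent is spent on the factor \<open>t\<^sup>2\<close>; the other
  half remains as a heat kernel at time \<open>2 * t\<close>, whose mass is 1.\<close>

lemma nn_integral_heat_outside_ball:
 assumes \<delta>: "\<delta> > 0"
 obtains C where "C \<ge> 0" "\<And>t. 0 < t \<Longrightarrow>
  (\<integral>\<^sup>+z. indicator {z. norm z \<ge> \<delta>} z * ennreal (heat t (z::real^'n)) \<partial>lborel) \<le> ennreal (C * t\<^sup>2)"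
proof
 define b where "b = real CARD('n) / 2"
 define C where "C = 2 powr b * (2 * (4 / \<delta>\<^sup>2) ^ 2)"
 show "C \<ge> 0" by (simp add: C_def)
 fix t :: real assume t: "0 < t"
 have pt: "heat t z \<le> C * t\<^sup>2 * heat (2 * t) z" if z: "norm z \<ge> \<delta>" for z :: "real^'n"
 proof -
  define y where "y = (norm z)\<^sup>2 / (4 * t)"
  have e: "exp (- y) \<le> 2 * (4 / \<delta>\<^sup>2) ^ 2 * t\<^sup>2"
   using exp_minus_square_le[OF \<delta> t _ z, of 4 2] by (simp add: y_def)
  have "exp (- (norm z)\<^sup>2 / (2 * t)) = exp (- y) * exp (- y)"
   using t by (simp add: y_def flip: exp_add)
  moreover have "(2 * pi * t) powr (- b) = 2 powr b * (2 * pi * (2 * t)) powr (- b)"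
  proof -
   have "(2 * pi * (2 * t)) powr (- b) = (2 * (2 * pi * t)) powr (- b)" by (simp add: mult_ac)
   also have "... = 2 powr (- b) * (2 * pi * t) powr (- b)" by (rule powr_mult)
   finally show ?thesis by (simp add: powr_minus)
  qed
  ultimately have "heat t z = 2 powr b * exp (- y) * ((2 * pi * (2 * t)) powr (- b) * exp (- y))"
   using t by (simp add: heat_eq b_def)
  also have "... = 2 powr b * exp (- y) * heat (2 * t) z"
   using t by (simp add: heat_eq b_def y_def)
  also have "... \<le> 2 powr b * (2 * (4 / \<delta>\<^sup>2) ^ 2 * t\<^sup>2) * heat (2 * t) z"
   using e by (intro mult_right_mono mult_left_mono) auto
  finally show ?thesis by (simp add: C_def mult_ac)
 qed
 have "(\<integral>\<^sup>+z. indicator {z. norm z \<ge> \<delta>} z * ennreal (heat t (z::real^'n)) \<partial>lborel)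
   \<le> (\<integral>\<^sup>+z. ennreal (C * t\<^sup>2) * ennreal (heat (2 * t) (z::real^'n)) \<partial>lborel)"
  using pt \<open>C \<ge> 0\<close>
  by (intro nn_integral_mono) (auto simp: indicator_def ennreal_mult[symmetric] intro!: ennreal_leI)
 also have "... = ennreal (C * t\<^sup>2)"
  using t by (simp add: nn_integral_cmult nn_integral_heat)
 finally show "(\<integral>\<^sup>+z. indicator {z. norm z \<ge> \<delta>} z * ennreal (heat t (z::real^'n)) \<partial>lborel) \<le> ennreal (C * t\<^sup>2)" .
qed

text \<open>The part of the Green function before time 1 has integral 1 over the whole space, and
  the part after time 1 is at most 2 pointwise; the bound is uniform in the pole
  \<open>y\<close>.\<close>

lemma nn_integral_green_bounded:
 assumes d: "CARD('n) \<ge> 3" and V: "V \<in> sets borel" "emeasure lborel (V :: (real^'n) set) < \<infinity>"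
 shows "(\<integral>\<^sup>+v. indicator V v * green (v - y) \<partial>lborel) \<le> 1 + emeasure lborel V * 2"
proof -
 note [measurable] = V(1)
 have "(\<integral>\<^sup>+v. indicator V v * green (v - y) \<partial>lborel) =
  (\<integral>\<^sup>+v. indicator V v * heat_head 1 (v - y) + indicator V v * heat_tail 1 (v - y) \<partial>lborel)"
 proof (rule nn_integral_cong_AE)
  show "AE v in lborel. indicator V v * green (v - y) = indicator V v * heat_head 1 (v - y) + indicator V v * heat_tail 1 (v - y)"
   using AE_lborel_neq[of y]
  proof eventually_elim
   case (elim v)
   then show ?case by (subst green_split[OF d zero_less_one]) (auto simp: distrib_left)
  qed
 qed
 also have "... = (\<integral>\<^sup>+v. indicator V v * heat_head 1 (v - y) \<partial>lborel) + (\<integral>\<^sup>+v. indicator V v * heat_tail 1 (v - y) \<partial>lborel)"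
  by (rule nn_integral_add) measurable
 also have "(\<integral>\<^sup>+v. indicator V v * heat_head 1 (v - y) \<partial>lborel) \<le>
   (\<integral>\<^sup>+v. heat_head 1 (v - y) \<partial>lborel)"
  by (intro nn_integral_mono) (auto simp: indicator_def)
 also have "... = (\<integral>\<^sup>+t. \<integral>\<^sup>+v. indicator {0<..1} t * ennreal (heat t (v - y)) \<partial>lborel \<partial>lborel)"
  by (rule lborel_pair.Fubini'[symmetric]) measurable
 also have "... = (\<integral>\<^sup>+t. indicator {0<..1::real} t \<partial>lborel)"
 proof (rule nn_integral_cong)
  fix t :: real
  have "(\<integral>\<^sup>+v. ennreal (heat t (v - y)) \<partial>lborel) = (\<integral>\<^sup>+v. ennreal (heat t (v :: real^'n)) \<partial>lborel)"
   using nn_integral_translation[of "\<lambda>v. ennreal (heat t v)" "-y"] by simp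
  then show "(\<integral>\<^sup>+v. indicator {0<..1} t * ennreal (heat t (v - y)) \<partial>lborel) = indicator {0<..1} t"
   by (subst nn_integral_cmult) (auto simp: indicator_def nn_integral_heat)
 qed
 also have "... = 1" by simp
 also have "(\<integral>\<^sup>+v. indicator V v * heat_tail 1 (v - y) \<partial>lborel) \<le> (\<integral>\<^sup>+v. indicator V v * 2 \<partial>lborel)"
  using heat_tail_le[OF d order_refl, of "_ - y"] by (intro nn_integral_mono mult_left_mono) auto
 also have "... = emeasure lborel V * 2" by (subst nn_integral_multc) auto
 finally show ?thesis by (simp add: add_mono)
qed

lemma emeasure_space_ge_AE:
 assumes "sets m = sets borel" "emeasure m (- S) = 0" "closed S"
 shows "AE y in m. y \<in> S"
 using assms by (intro AE_I[where N="-S"]) auto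

text \<open>Off an open neighbourhood \<open>U\<close> of the set where the potential exceeds \<open>1\<close>, the truncated
 potential is harmonic up to an error \<open>O(h\<^sup>2)\<close> for the walk with step \<open>h\<close>, so it is dominated by the
 hitting probability of \<open>U\<close>.\<close>

lemma potential_le_hitting_probability:
 fixes P :: "(real \<Rightarrow> real^'n) measure"
 assumes d: "CARD('n) \<ge> 3" and B: "brownian_law y P" and U: "open U"
  and m: "finite_measure m" and s[measurable_cong]: "sets m = sets borel"
  and S: "closed S" "emeasure m (- S) = 0" "S \<subseteq> V"
  and V: "V \<in> sets borel" "emeasure lborel V < \<infinity>" "V \<subseteq> U"
  and \<delta>: "\<delta> > 0" "\<And>x v. x \<notin> U \<Longrightarrow> v \<in> V \<Longrightarrow> norm (x - v) \<ge> \<delta>"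
  and le1: "\<And>x. x \<notin> V \<Longrightarrow> potential m x \<le> 1" and y: "y \<notin> U"
 shows "potential m y \<le> emeasure P {w \<in> space P. \<exists>t\<ge>0. w t \<in> U}"
proof -
 interpret m: finite_measure m by fact
 have sf: "sigma_finite_measure m" by unfold_locales
 interpret pair_sigma_finite m "lborel :: (real^'n) measure" ..
 note [measurable] = V(1)
 have fm [measurable]: "potential m \<in> borel_measurable borel"
  using measurable_potential[OF sf s measurable_ident] by (simp add: id_def)
 have AES: "AE y in m. y \<in> S" by (rule emeasure_space_ge_AE[OF s S(2,1)])
 obtain C0 where C0: "C0 \<ge> 0" "\<And>t x. 0 < t \<Longrightarrow> t \<le> 1 \<Longrightarrow> norm (x::real^'n) \<ge> \<delta> \<Longrightarrow> heat t x \<le> C0 * t\<^sup>2"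
  using heat_small_time[OF \<delta>(1)] by blast
 define M where "M = measure m UNIV"
 have M: "emeasure m (space m) = ennreal M"
  using m.emeasure_eq_measure sets_eq_imp_space_eq[OF s] by (simp add: M_def)
 \<comment> \<open>The potential may be infinite inside \<open>V\<close>, but its integral over
   \<open>V\<close> is finite; this controls what the truncation at 1 discards.\<close>
 have fV: "(\<integral>\<^sup>+v. indicator V v * potential m v \<partial>lborel) \<le> ennreal M * (1 + emeasure lborel V * 2)"
 proof -
  have "(\<integral>\<^sup>+v. indicator V v * potential m v \<partial>lborel) = (\<integral>\<^sup>+v. \<integral>\<^sup>+y. indicator V v * green (v - y) \<partial>m \<partial>lborel)"
   unfolding potential_def by (intro nn_integral_cong nn_integral_cmult[symmetric]) measurable
  also have "... = (\<integral>\<^sup>+y. \<integral>\<^sup>+v. indicator V v * green (v - y) \<partial>lborel \<partial>m)"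
   by (rule Fubini'[where f="\<lambda>y v. indicator V v * green (v - y)"]) measurable
  also have "... \<le> (\<integral>\<^sup>+y. 1 + emeasure lborel V * 2 \<partial>m)"
   by (intro nn_integral_mono nn_integral_green_bounded[OF d V(1,2)])
  also have "... = ennreal M * (1 + emeasure lborel V * 2)" by (simp add: M mult.commute)
  finally show ?thesis .
 qed
 define G where "G = enn2real (ennreal M * (1 + emeasure lborel V * 2))"
 have G: "ennreal M * (1 + emeasure lborel V * 2) = ennreal G"
  unfolding G_def using V(2) by (intro ennreal_enn2real[symmetric]) (auto simp: ennreal_mult_less_top less_top)
 have G0: "G \<ge> 0" by (simp add: G_def)
 have M0: "M \<ge> 0" by (simp add: M_def)
 \<comment> \<open>One term for the head of the potential, one for the part cut off inside
   \<open>V\<close>.\<close>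
 define C where "C = M * C0 + C0 * G"
 have "min (potential m y) 1 \<le> emeasure P {w \<in> space P. \<exists>t\<ge>0. w t \<in> U}"
 proof (rule brownian_hit_ge[OF B U fm])
  show "C \<ge> 0" using C0 M0 G0 by (simp add: C_def)
  show "\<exists>T>0. heat_mean T (potential m) y \<le> ennreal \<epsilon>" if \<epsilon>: "\<epsilon> > 0" for \<epsilon>
  proof -
   \<comment> \<open>Then \<open>2 * M / \<epsilon> \<le> sqrt T\<close>, so by
     \<open>heat_tail_le\<close> the potential averaged at time \<open>T\<close> is at most
     \<open>\<epsilon>\<close>.\<close>
   define T where "T = max 1 ((2 * M / \<epsilon>)\<^sup>2)"
   have T: "T \<ge> 1" by (simp add: T_def)
   have "sqrt ((2 * M / \<epsilon>)\<^sup>2) \<le> sqrt T" unfolding T_def by (intro real_sqrt_le_mono) simp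
   then have "2 * M / \<epsilon> \<le> sqrt T" using M0 \<epsilon> by simp
   then have T2: "M * (2 / sqrt T) \<le> \<epsilon>" using \<epsilon> T by (simp add: field_simps)
   have "heat_mean T (potential m) y = (\<integral>\<^sup>+x. heat_tail T (y - x) \<partial>m)"
    using T by (intro heat_conv_potential[OF d _ sf s]) auto
   also have "... \<le> (\<integral>\<^sup>+x. ennreal (2 / sqrt T) \<partial>m)" by (intro nn_integral_mono heat_tail_le[OF d T])
   also have "... = ennreal (2 / sqrt T) * ennreal M" by (simp add: M)
   also have "... = ennreal (M * (2 / sqrt T))"
    using M0 T by (subst ennreal_mult[symmetric]) (auto simp: mult.commute)
   also have "... \<le> ennreal \<epsilon>" by (intro ennreal_leI T2)
   finally show ?thesis using T by (intro exI[of _ T]) auto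
  qed
  show "min (potential m x) 1 \<le> heat_mean h (\<lambda>x. min (potential m x) 1) x + ennreal (C * h\<^sup>2)"
   if h: "0 < h" "h \<le> 1" and x: "x \<notin> U" for h x
  proof -
   have far: "heat t (x - v) \<le> C0 * h\<^sup>2" if "v \<in> V" "0 < t" "t \<le> h" for v t
   proof -
    have "heat t (x - v) \<le> C0 * t\<^sup>2" using that h \<delta>(2)[OF x] by (intro C0) auto
    also have "... \<le> C0 * h\<^sup>2" using that C0 by (intro mult_left_mono power_mono) auto
    finally show ?thesis .
   qed
   have ne: "AE v in m. v \<noteq> x" using AES S(3) V(3) x by (auto elim: AE_mp)
   have "min (potential m x) 1 \<le> potential m x" by simp
   also have "... = (\<integral>\<^sup>+v. heat_head h (x - v) \<partial>m)
     + heat_mean h (potential m) x"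
    by (rule potential_split[OF d h(1) sf s ne])
   also have "... \<le> ennreal (M * C0 * h\<^sup>2) + (heat_mean h (\<lambda>x. min (potential m x) 1) x + ennreal (C0 * G * h\<^sup>2))"
   proof (rule add_mono)
    have "(\<integral>\<^sup>+v. heat_head h (x - v) \<partial>m) \<le> (\<integral>\<^sup>+v. ennreal (C0 * h\<^sup>2) \<partial>m)"
    proof (rule nn_integral_mono_AE)
     show "AE v in m. heat_head h (x - v) \<le> ennreal (C0 * h\<^sup>2)"
      using AES
     proof eventually_elim
      case (elim v)
      then have v: "v \<in> V" using S(3) by auto
      have "heat_head h (x - v) \<le> (\<integral>\<^sup>+t. indicator {0<..h} t * ennreal (C0 * h\<^sup>2) \<partial>lborel)"
       using far[OF v] by (intro nn_integral_mono) (auto simp: indicator_def intro!: ennreal_leI)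
      also have "... = ennreal h * ennreal (C0 * h\<^sup>2)" using h by (subst nn_integral_multc) auto
      also have "... \<le> 1 * ennreal (C0 * h\<^sup>2)" using h by (intro mult_right_mono) auto
      finally show ?case by simp
     qed
    qed
    also have "... = ennreal (C0 * h\<^sup>2) * ennreal M" by (simp add: M)
    also have "... = ennreal (M * C0 * h\<^sup>2)"
     using C0 M0 by (subst ennreal_mult[symmetric]) (auto simp: mult_ac)
    finally show "(\<integral>\<^sup>+v. heat_head h (x - v) \<partial>m) \<le> ennreal (M * C0 * h\<^sup>2)" .
    \<comment> \<open>Off \<open>V\<close> the truncation changes nothing; inside \<open>V\<close>
      the heat kernel from \<open>x \<notin> U\<close> is itself at most
      \<open>C0 * h\<^sup>2\<close>.\<close>
    have "heat_mean h (potential m) x \<le>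
     (\<integral>\<^sup>+z. min (potential m (x + z)) 1 * ennreal (heat h z) + indicator V (x + z) * potential m (x + z) * ennreal (C0 * h\<^sup>2) \<partial>lborel)"
    proof (rule nn_integral_mono)
     fix z
     show "potential m (x + z) * ennreal (heat h z) \<le> min (potential m (x + z)) 1 * ennreal (heat h z) + indicator V (x + z) * potential m (x + z) * ennreal (C0 * h\<^sup>2)"
     proof (cases "x + z \<in> V")
      case True
      then have "heat h (x - (x + z)) \<le> C0 * h\<^sup>2" using h by (intro far) auto
      then have "potential m (x + z) * ennreal (heat h z) \<le> potential m (x + z) * ennreal (C0 * h\<^sup>2)"
       by (intro mult_left_mono ennreal_leI) auto
      then show ?thesis using True by (simp add: add_increasing)
     next
      case False
      then show ?thesis using le1[of "x + z"] by (simp add: min_absorb1)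
     qed
    qed
    also have "... = heat_mean h (\<lambda>x. min (potential m x) 1) x +
      (\<integral>\<^sup>+z. indicator V (x + z) * potential m (x + z) * ennreal (C0 * h\<^sup>2) \<partial>lborel)"
     by (rule nn_integral_add) measurable
    also have "(\<integral>\<^sup>+z. indicator V (x + z) * potential m (x + z) * ennreal (C0 * h\<^sup>2) \<partial>lborel) =
      (\<integral>\<^sup>+z. indicator V z * potential m z * ennreal (C0 * h\<^sup>2) \<partial>lborel)"
     by (rule nn_integral_translation[where f="\<lambda>z. indicator V z * potential m z * ennreal (C0 * h\<^sup>2)"]) measurable
    also have "... = (\<integral>\<^sup>+z. indicator V z * potential m z \<partial>lborel) * ennreal (C0 * h\<^sup>2)"
     by (rule nn_integral_multc) measurable
    also have "... \<le> ennreal G * ennreal (C0 * h\<^sup>2)" using fV G by (intro mult_right_mono) auto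
    also have "... = ennreal (C0 * G * h\<^sup>2)" using C0 G0 by (simp add: ennreal_mult[symmetric] mult_ac)
    finally show "heat_mean h (potential m) x \<le>
     heat_mean h (\<lambda>x. min (potential m x) 1) x + ennreal (C0 * G * h\<^sup>2)" by (simp add: add_left_mono)
   qed
   also have "... = heat_mean h (\<lambda>x. min (potential m x) 1) x + (ennreal (M * C0 * h\<^sup>2) + ennreal (C0 * G * h\<^sup>2))"
    by (simp add: add_ac)
   also have "ennreal (M * C0 * h\<^sup>2) + ennreal (C0 * G * h\<^sup>2) = ennreal (C * h\<^sup>2)"
    using M0 C0 G0 by (simp add: C_def distrib_right flip: ennreal_plus)
   finally show ?thesis .
  qed
 qed
 then show ?thesis using le1[of y] y V(3) by (auto simp: min_def split: if_splits)
qed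

text \<open>Fubini and the symmetry of the Green function exchange the two measures. When
  \<open>K\<close> is a ball containing the support of \<open>m\<close>, the right-hand side is the
  mass of \<open>m\<close>.\<close>

lemma nn_integral_potential_equilibrium:
 fixes P :: "real^'n \<Rightarrow> (real \<Rightarrow> real^'n) measure"
 assumes e: "equilibrium_measure P K e" and m: "finite_measure m" and s[measurable_cong]: "sets m = sets borel"
 shows "(\<integral>\<^sup>+y. potential m y \<partial>e) = (\<integral>\<^sup>+z. emeasure (P z) {w \<in> space (P z). \<exists>t\<ge>0. w t \<in> K} \<partial>m)"
proof -
 have fe: "finite_measure e" and se[measurable_cong]: "sets e = sets borel"
  and pot: "\<And>x. (\<integral>\<^sup>+y. green (x - y) \<partial>e) = emeasure (P x) {w \<in> space (P x). \<exists>t\<ge>0. w t \<in> K}"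
  using e by (auto simp: equilibrium_measure_def)
 interpret e: finite_measure e by fact
 interpret m: finite_measure m by fact
 interpret pair_sigma_finite e m ..
 have "(\<integral>\<^sup>+y. potential m y \<partial>e) = (\<integral>\<^sup>+z. \<integral>\<^sup>+y. green (y - z) \<partial>e \<partial>m)"
  unfolding potential_def by (rule Fubini'[where f="\<lambda>y z. green (y - z)", symmetric]) measurable
 also have "... = (\<integral>\<^sup>+z. \<integral>\<^sup>+y. green (z - y) \<partial>e \<partial>m)"
  by (simp only: green_minus_commute)
 finally show ?thesis by (simp only: pot)
qed

lemma brownian_hits_from_inside:
 assumes B: "brownian_law y P" and K: "closed K" "y \<in> K"
 shows "emeasure P {w \<in> space P. \<exists>t\<ge>0. w t \<in> K} = 1"
proof -
 interpret prob_space P using brownian_lawD[OF B] by simp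
 have "AE w in P. w \<in> {w \<in> space P. \<exists>t\<ge>0. w t \<in> K}"
  using brownian_lawD(3)[OF B] AE_space by eventually_elim (use K in auto)
 then show ?thesis
  using sets_path_hits_closed[OF brownian_lawD(2)[OF B] order_refl K(1)] by (simp add: emeasure_eq_1_AE)
qed

lemma one_le_nn_integral_heat:
 fixes f :: "real^'n \<Rightarrow> ennreal"
 assumes h: "h > 0" and [measurable]: "f \<in> borel_measurable borel" and f: "\<And>z. norm z < \<delta> \<Longrightarrow> f z = 1"
  and out: "(\<integral>\<^sup>+z. indicator {z. norm z \<ge> \<delta>} z * ennreal (heat h (z::real^'n)) \<partial>lborel) \<le> e"
 shows "1 \<le> (\<integral>\<^sup>+z. f z * ennreal (heat h z) \<partial>lborel) + e"
proof -
 have "1 = (\<integral>\<^sup>+z. ennreal (heat h (z::real^'n)) \<partial>lborel)" by (simp add: nn_integral_heat[OF h])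
 also have "... \<le> (\<integral>\<^sup>+z. f z * ennreal (heat h z) + indicator {z. norm z \<ge> \<delta>} z * ennreal (heat h z) \<partial>lborel)"
 proof (rule nn_integral_mono)
  fix z :: "real^'n"
  show "ennreal (heat h z) \<le> f z * ennreal (heat h z) + indicator {z. norm z \<ge> \<delta>} z * ennreal (heat h z)"
   using f[of z] by (cases "norm z < \<delta>") auto
 qed
 also have "... = (\<integral>\<^sup>+z. f z * ennreal (heat h z) \<partial>lborel) + (\<integral>\<^sup>+z. indicator {z. norm z \<ge> \<delta>} z * ennreal (heat h (z::real^'n)) \<partial>lborel)"
  by (rule nn_integral_add) measurable
 also have "... \<le> (\<integral>\<^sup>+z. f z * ennreal (heat h z) \<partial>lborel) + e" using out by (rule add_left_mono)
 finally show ?thesis .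
qed

text \<open>The equilibrium potential is \<open>1\<close> on the ball, so it is harmonic inside up to the probability
 \<open>O(h\<^sup>2)\<close> of leaving the ball within time \<open>h\<close>, while a mass inside would contribute order \<open>h\<close>.\<close>

lemma equilibrium_measure_interior:
 fixes P :: "real^'n \<Rightarrow> (real \<Rightarrow> real^'n) measure"
 assumes d: "CARD('n) \<ge> 3" and B: "\<And>y. brownian_law y (P y)"
  and e: "equilibrium_measure P (cball c R) e"
 shows "emeasure e (ball c R) = 0"
proof -
 have fe: "finite_measure e" and se[measurable_cong]: "sets e = sets borel"
  and pot: "\<And>x. potential e x = emeasure (P x) {w \<in> space (P x). \<exists>t\<ge>0. w t \<in> cball c R}"
  using e by (auto simp: equilibrium_measure_def potential_def)
 interpret e: finite_measure e by fact
 have sf: "sigma_finite_measure e" by unfold_locales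
 interpret pair_sigma_finite e "lborel :: (real^'n) measure" ..
 have fm [measurable]: "potential e \<in> borel_measurable borel"
  using measurable_potential[OF sf se measurable_ident] by (simp add: id_def)
 have pot1: "potential e x = 1" if "x \<in> cball c R" for x
  unfolding pot using that by (intro brownian_hits_from_inside[OF B]) auto
 \<comment> \<open>An atom at \<open>x\<close> would make the potential there infinite, whereas it
   is 1.\<close>
 have ne: "AE v in e. v \<noteq> x" if "x \<in> cball c R" for x
 proof -
  have "(\<integral>\<^sup>+y. green (x - y) \<partial>e) \<noteq> \<infinity>" using pot1[OF that] by (simp add: potential_def)
  then have "AE y in e. green (x - y) \<noteq> \<infinity>"
   by (intro nn_integral_PInf_AE) auto
  then show ?thesis by eventually_elim (auto simp: green_def)
 qed
 \<comment> \<open>Two margins of width \<open>\<delta>\<close>: during a time \<open>h\<close> a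
   path from the small ball stays in \<open>D\<close>, and one from \<open>D\<close> stays in the
   large ball, up to a probability of order \<open>h\<^sup>2\<close>.\<close>
 have inner: "emeasure e (ball c (R - 2 * \<delta>)) = 0" if \<delta>: "\<delta> > 0" for \<delta>
 proof -
  obtain C where C: "C \<ge> 0" "\<And>t. 0 < t \<Longrightarrow>
   (\<integral>\<^sup>+z. indicator {z. norm z \<ge> \<delta>} z * ennreal (heat t (z::real^'n)) \<partial>lborel) \<le> ennreal (C * t\<^sup>2)"
   using nn_integral_heat_outside_ball[OF \<delta>] by blast
  define D where "D = ball c (R - \<delta>)"
  have Dm [measurable]: "D \<in> sets borel" by (simp add: D_def)
  define S where "S h x = (\<integral>\<^sup>+v. heat_head h (x - v) \<partial>e)" for h :: real and x
  have S_le: "S h x \<le> ennreal (C * h\<^sup>2)" if h: "h > 0" and x: "x \<in> D" for h x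
  proof -
   have xK: "x \<in> cball c R" using x \<delta> by (auto simp: D_def)
   let ?I = "heat_mean h (potential e) x"
   have eq: "1 = S h x + ?I"
    using potential_split[OF d h sf se ne[OF xK]] pot1[OF xK] by (simp add: S_def)
   have "1 \<le> ?I + ennreal (C * h\<^sup>2)"
   proof (rule one_le_nn_integral_heat[OF h _ _ C(2)[OF h]])
    fix z :: "real^'n" assume "norm z < \<delta>"
    moreover have "dist c (x + z) \<le> dist c x + norm z"
     using dist_triangle[of c "x + z" x] by (simp add: dist_norm)
    ultimately show "potential e (x + z) = 1" using x by (intro pot1) (auto simp: D_def)
   qed measurable
   then have le: "?I + S h x \<le> ?I + ennreal (C * h\<^sup>2)" using eq by (simp add: add.commute)
   have "?I \<noteq> \<top>"
   proof
    assume "?I = \<top>"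
    then show False using eq by simp
   qed
   then show ?thesis using le by (simp add: ennreal_add_left_cancel_le)
  qed
  define a where "a = measure e (ball c (R - 2 * \<delta>))"
  have a: "emeasure e (ball c (R - 2 * \<delta>)) = ennreal a" by (simp add: a_def e.emeasure_eq_measure)
  define L where "L = measure lborel D"
  have L: "emeasure lborel D = ennreal L"
   unfolding L_def D_def using emeasure_bounded_finite[OF bounded_ball, of c "R - \<delta>"]
   by (intro emeasure_eq_ennreal_measure) auto
  have [measurable]: "ball c (R - 2 * \<delta>) \<in> sets e" by (simp add: se)
  \<comment> \<open>The head \<open>S h\<close> integrated over \<open>D\<close> is at least nearly
    \<open>a * h\<close>, while \<open>S_le\<close> makes it of order \<open>h\<^sup>2\<close>;
    dividing by \<open>h\<close> and letting it decrease to 0 forces \<open>a = 0\<close>.\<close>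
  have low: "ennreal (a * (h * (1 - C * h\<^sup>2))) \<le> (\<integral>\<^sup>+x. indicator D x * S h x \<partial>lborel)" if h: "0 < h" "C * h\<^sup>2 \<le> 1" for h
  proof -
   have "(\<integral>\<^sup>+x. indicator D x * S h x \<partial>lborel) =
     (\<integral>\<^sup>+x. \<integral>\<^sup>+v. indicator D x * heat_head h (x - v) \<partial>e \<partial>lborel)"
    unfolding S_def by (intro nn_integral_cong nn_integral_cmult[symmetric]) measurable
   also have "... = (\<integral>\<^sup>+v. \<integral>\<^sup>+x. indicator D x * heat_head h (x - v) \<partial>lborel \<partial>e)"
    by (rule Fubini'[where f="\<lambda>v x. indicator D x * heat_head h (x - v)"]) measurable
   also have "... \<ge> (\<integral>\<^sup>+v. indicator (ball c (R - 2 * \<delta>)) v * ennreal (h * (1 - C * h\<^sup>2)) \<partial>e)"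
   proof (rule nn_integral_mono)
    fix v
    show "indicator (ball c (R - 2 * \<delta>)) v * ennreal (h * (1 - C * h\<^sup>2)) \<le>
     (\<integral>\<^sup>+x. indicator D x * heat_head h (x - v) \<partial>lborel)"
    proof (cases "v \<in> ball c (R - 2 * \<delta>)")
     case True
     have inD: "ennreal (1 - C * h\<^sup>2) \<le> (\<integral>\<^sup>+x. indicator D x * ennreal (heat t (x - v)) \<partial>lborel)" if t: "0 < t" "t \<le> h" for t
     proof -
      have "1 \<le> (\<integral>\<^sup>+z. indicator D (v + z) * ennreal (heat t z) \<partial>lborel) + ennreal (C * h\<^sup>2)"
      proof (rule one_le_nn_integral_heat[OF t(1)])
       show "indicator D (v + z) = (1::ennreal)" if "norm z < \<delta>" for z
       proof -
        have "dist c (v + z) \<le> dist c v + norm z"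
         using dist_triangle[of c "v + z" v] by (simp add: dist_norm)
        then show ?thesis using True that by (simp add: D_def)
       qed
       show "(\<integral>\<^sup>+z. indicator {z. norm z \<ge> \<delta>} z * ennreal (heat t (z::real^'n)) \<partial>lborel) \<le> ennreal (C * h\<^sup>2)"
        using C(2)[OF t(1)] by (rule order_trans) (use t C in \<open>auto intro!: ennreal_leI mult_left_mono power_mono\<close>)
      qed measurable
      also have "(\<integral>\<^sup>+z. indicator D (v + z) * ennreal (heat t z) \<partial>lborel) = (\<integral>\<^sup>+x. indicator D x * ennreal (heat t (x - v)) \<partial>lborel)"
       using nn_integral_translation[of "\<lambda>x. indicator D x * ennreal (heat t (x - v))" v] by simp
      finally have "1 - ennreal (C * h\<^sup>2) \<le> (\<integral>\<^sup>+x. indicator D x * ennreal (heat t (x - v)) \<partial>lborel)"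
       by (simp add: ennreal_minus_le_iff add.commute)
      then show ?thesis using C by (simp add: ennreal_minus flip: ennreal_1)
     qed
     have "ennreal (h * (1 - C * h\<^sup>2)) = (\<integral>\<^sup>+t. indicator {0<..h} t * ennreal (1 - C * h\<^sup>2) \<partial>lborel)"
      using h by (subst nn_integral_multc) (auto simp: ennreal_mult)
     also have "... \<le> (\<integral>\<^sup>+t. indicator {0<..h} t * (\<integral>\<^sup>+x. indicator D x * ennreal (heat t (x - v)) \<partial>lborel) \<partial>lborel)"
      using inD by (intro nn_integral_mono) (auto simp: indicator_def)
     also have "... = (\<integral>\<^sup>+t. \<integral>\<^sup>+x. indicator D x * (indicator {0<..h} t * ennreal (heat t (x - v))) \<partial>lborel \<partial>lborel)"
      by (intro nn_integral_cong, subst nn_integral_cmult[symmetric]) (auto simp: mult_ac)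
     also have "... = (\<integral>\<^sup>+x. \<integral>\<^sup>+t. indicator D x * (indicator {0<..h} t * ennreal (heat t (x - v))) \<partial>lborel \<partial>lborel)"
      by (rule lborel_pair.Fubini') measurable
     also have "... = (\<integral>\<^sup>+x. indicator D x * heat_head h (x - v) \<partial>lborel)"
      by (intro nn_integral_cong nn_integral_cmult) measurable
     finally show ?thesis using True by simp
    qed simp
   qed
   also have "(\<integral>\<^sup>+v. indicator (ball c (R - 2 * \<delta>)) v * ennreal (h * (1 - C * h\<^sup>2)) \<partial>e) = ennreal (a * (h * (1 - C * h\<^sup>2)))"
    using h by (subst nn_integral_multc) (auto simp: a a_def ennreal_mult'')
   finally show ?thesis .
  qed
  have up: "(\<integral>\<^sup>+x. indicator D x * S h x \<partial>lborel) \<le> ennreal (L * (C * h\<^sup>2))" if h: "h > 0" for h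
  proof -
   have "(\<integral>\<^sup>+x. indicator D x * S h x \<partial>lborel) \<le> (\<integral>\<^sup>+x. indicator D x * ennreal (C * h\<^sup>2) \<partial>lborel)"
    using S_le[OF h] by (intro nn_integral_mono) (auto simp: indicator_def)
   also have "... = ennreal (L * (C * h\<^sup>2))"
    using C by (subst nn_integral_multc) (auto simp: L L_def ennreal_mult'')
   finally show ?thesis .
  qed
  have "a * (1 - C * h\<^sup>2) \<le> L * C * h" if h: "0 < h" "C * h\<^sup>2 \<le> 1" for h
  proof -
   have "ennreal (a * (h * (1 - C * h\<^sup>2))) \<le> ennreal (L * (C * h\<^sup>2))" using low[OF h] up[OF h(1)] by (rule order_trans)
   then have "a * (h * (1 - C * h\<^sup>2)) \<le> L * (C * h\<^sup>2)" using C by (subst (asm) ennreal_le_iff) (auto simp: L_def)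
   then have "h * (a * (1 - C * h\<^sup>2)) \<le> h * (L * C * h)" by (simp add: power2_eq_square mult_ac)
   then show ?thesis using h by simp
  qed
  then have ev: "eventually (\<lambda>h. a * (1 - C * h\<^sup>2) \<le> L * C * h) (at_right 0)"
  proof -
   have "eventually (\<lambda>h::real. 0 < h) (at_right 0)" by (simp add: eventually_at_right_less)
   moreover have "eventually (\<lambda>h::real. C * h\<^sup>2 < 1) (at_right 0)"
   proof (rule order_tendstoD(2))
    show "((\<lambda>h::real. C * h\<^sup>2) \<longlongrightarrow> 0) (at_right 0)" by real_asymp
   qed simp
   ultimately show ?thesis
    by eventually_elim (use \<open>\<And>h. 0 < h \<Longrightarrow> C * h\<^sup>2 \<le> 1 \<Longrightarrow> a * (1 - C * h\<^sup>2) \<le> L * C * h\<close> in auto)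
  qed
  have "a \<le> 0"
  proof (rule tendsto_le[OF _ _ _ ev])
   show "((\<lambda>h::real. L * C * h) \<longlongrightarrow> 0) (at_right 0)" by real_asymp
   show "((\<lambda>h::real. a * (1 - C * h\<^sup>2)) \<longlongrightarrow> a) (at_right 0)" by (auto intro!: tendsto_eq_intros)
  qed simp
  then show ?thesis by (simp add: a ennreal_neg)
 qed
 have "ball c R = (\<Union>n. ball c (R - 2 * (1 / real (Suc n))))"
 proof safe
  fix x assume "x \<in> ball c R"
  then have "0 < (R - dist c x) / 2" by simp
  then obtain n where "1 / real (Suc n) < (R - dist c x) / 2" by (metis reals_Archimedean inverse_eq_divide)
  then show "x \<in> (\<Union>n. ball c (R - 2 * (1 / real (Suc n))))" by (intro UN_I[of n]) auto
 next
  fix x n assume "x \<in> ball c (R - 2 * (1 / real (Suc n)))"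
  moreover have "2 * (1 / real (Suc n)) > 0" by simp
  ultimately show "x \<in> ball c R" unfolding mem_ball by linarith
 qed
 moreover have "emeasure e (\<Union>n. ball c (R - 2 * (1 / real (Suc n)))) = 0"
 proof (rule emeasure_UN_eq_0)
  show "emeasure e (ball c (R - 2 * (1 / real (Suc n)))) = 0" for n by (rule inner) simp
 qed (auto simp: se)
 ultimately show ?thesis by simp
qed

text \<open>The conditioned law is known through limits of continuous test functions, so the open
  ball is probed by a function positive exactly inside it. Positive rational times suffice, since a
  continuous path meeting an open set, even at time 0, also meets it at such a time.\<close>

lemma conditioned_law_avoids:
 fixes c :: "real^'n"
 assumes P: "sets P = sets path_space" and C: "conditioned_law P (cball c R) P'"
 shows "emeasure P' {w \<in> space P'. \<exists>t\<ge>0. w t \<in> ball c R} = 0"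
proof -
 have P': "prob_space P'" "sets P' = sets path_space" using C by (auto simp: conditioned_law_def)
 interpret P': prob_space P' by fact
 define g where "g x = min 1 (max 0 (R - dist c x))" for x :: "real^'n"
 have g: "continuous_on UNIV g" unfolding g_def by (intro continuous_intros)
 have gb: "0 \<le> g x" "g x \<le> 1" for x by (auto simp: g_def)
 have g0: "g x = 0 \<longleftrightarrow> x \<notin> ball c R" for x by (auto simp: g_def min_def max_def)
 have g0': "g x = 0" if "x \<notin> cball c R" for x using that by (simp add: g0)
 have gm [measurable]: "g \<in> borel_measurable borel" using g by (rule borel_measurable_continuous_onI)
 have at: "AE w in P'. w t \<notin> ball c R" if t: "t > 0" for t
 proof -
  have cm: "(\<lambda>w. w t) \<in> P' \<rightarrow>\<^sub>M borel" using t by (intro measurable_path_component[OF P'(2)]) auto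
  have "bounded (range g)" using gb by (intro boundedI[of _ 1]) (auto simp: abs_le_iff intro: order_trans[of _ 0])
  then have "((\<lambda>\<delta>. \<integral>w. (\<Prod>t\<in>{t}. g (w t)) \<partial>uniform_measure P {w \<in> space P. \<forall>t\<ge>\<delta>. w t \<notin> cball c R})
     \<longlongrightarrow> (\<integral>w. (\<Prod>t\<in>{t}. g (w t)) \<partial>P')) (at_right 0)"
   using C t g unfolding conditioned_law_def by (elim conjE) (drule spec[of _ "{t}"], drule spec[of _ "\<lambda>_. g"], auto)
  then have lim: "((\<lambda>\<delta>. \<integral>w. g (w t) \<partial>uniform_measure P {w \<in> space P. \<forall>t\<ge>\<delta>. w t \<notin> cball c R})
     \<longlongrightarrow> (\<integral>w. g (w t) \<partial>P')) (at_right 0)" by simp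
  have "eventually (\<lambda>\<delta>. (\<integral>w. g (w t) \<partial>uniform_measure P {w \<in> space P. \<forall>t\<ge>\<delta>. w t \<notin> cball c R}) = 0) (at_right 0)"
   unfolding eventually_at_right_field
  proof (intro exI[of _ t] conjI allI impI t)
   fix \<delta> :: real assume \<delta>: "0 < \<delta>" "\<delta> < t"
   let ?A = "{w \<in> space P. \<forall>t\<ge>\<delta>. w t \<notin> cball c R}"
   have "?A = space P - {w \<in> space P. \<exists>t\<ge>\<delta>. w t \<in> cball c R}" by auto
   then have Am: "?A \<in> sets P" using sets_path_hits_closed[OF P, of \<delta> "cball c R"] \<delta> by auto
   have "AE w in uniform_measure P ?A. g (w t) = 0"
    by (rule AE_uniform_measureI[OF Am]) (use \<delta> g0' in auto)
   then show "(\<integral>w. g (w t) \<partial>uniform_measure P ?A) = 0"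
    by (rule integral_eq_zero_AE)
  qed
  then have "((\<lambda>\<delta>. \<integral>w. g (w t) \<partial>uniform_measure P {w \<in> space P. \<forall>t\<ge>\<delta>. w t \<notin> cball c R})
     \<longlongrightarrow> 0) (at_right 0)" by (rule tendsto_eventually)
  from tendsto_unique[OF _ lim this] have z: "(\<integral>w. g (w t) \<partial>P') = 0" by simp
  have "(\<lambda>w. g (w t)) \<in> borel_measurable P'" using measurable_compose[OF cm gm] .
  then have "integrable P' (\<lambda>w. g (w t))"
   using gb by (intro P'.integrable_const_bound[where B=1]) auto
  then have "AE w in P'. g (w t) = 0"
   using integral_nonneg_eq_0_iff_AE[of P' "\<lambda>w. g (w t)"] gb z by auto
  then show ?thesis by (simp add: g0)
 qed
 have "AE w in P'. \<forall>t\<in>\<rat> \<inter> {0<..}. w t \<notin> ball c R"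
  using at by (intro AE_ball_countable[THEN iffD2]) (auto intro: countable_rat countable_subset[OF _ countable_rat])
 then have "AE w in P'. \<not> (\<exists>t\<ge>0. w t \<in> ball c R)"
 proof (rule AE_mp, intro AE_I2 impI notI)
  fix w assume w: "w \<in> space P'" "\<forall>t\<in>\<rat> \<inter> {0<..}. w t \<notin> ball c R" "\<exists>t\<ge>0. w t \<in> ball c R"
  then obtain t where t: "t \<ge> 0" "w t \<in> ball c R" by blast
  have cont: "continuous_on {0..} w" by (rule continuous_on_path[OF P'(2) w(1) order_refl])
  obtain s where s: "s > 0" "\<And>t'. t' \<in> {0..} \<Longrightarrow> dist t' t < s \<Longrightarrow> w t' \<in> ball c R"
   using cont t open_ball[of c R] unfolding continuous_on_topological
   by (metis atLeast_iff open_dist)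
  obtain q where q: "q \<in> \<rat>" "t < q" "q < t + s" using Rats_dense_in_real[of t "t + s"] s by auto
  then have "w q \<in> ball c R" using t s(2)[of q] by (auto simp: dist_real_def)
  then show False using w(2) q t by auto
 qed
 then show ?thesis
  using sets_path_hits_open[OF P'(2) order_refl open_ball, of c R]
  by (subst AE_iff_measurable[symmetric, of _ P' "\<lambda>w. \<not> (\<exists>t\<ge>0. w t \<in> ball c R)"]) (auto simp: Bex_def conj_commute)
qed

section \<open>Intensities of interlacement trajectories\<close>

lemma mem_time_shift_class: "w \<in> trajectories \<Longrightarrow> w \<in> time_shift `` {w}"
 by (auto simp: time_shift_def intro!: exI[of _ 0])

lemma class_in_hitting_classes:
 assumes "w \<in> trajectories"
 shows "time_shift `` {w} \<in> hitting_classes U \<longleftrightarrow> (\<exists>t. w t \<in> U)"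
proof
 assume "time_shift `` {w} \<in> hitting_classes U"
 then show "\<exists>t. w t \<in> U" by (auto simp: hitting_classes_def time_shift_def)
next
 assume "\<exists>t. w t \<in> U"
 then show "time_shift `` {w} \<in> hitting_classes U"
  using mem_time_shift_class[OF assms] assms by (auto simp: hitting_classes_def intro!: quotientI)
qed

lemma space_trajectory_space: "space trajectory_space = trajectories"
 by (auto simp: trajectory_space_def space_restrict_space space_PiM)

lemma measurable_trajectory_component:
 "(\<lambda>w. w t) \<in> trajectory_space \<rightarrow>\<^sub>M borel"
 unfolding trajectory_space_def
 by (rule measurable_restrict_space1) (auto intro!: measurable_component_singleton)

lemma continuous_on_trajectory: "w \<in> trajectories \<Longrightarrow> continuous_on T w"
 by (auto simp: trajectories_def intro: continuous_on_subset)

lemma sets_trajectory_hits_open: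
 assumes "open U" shows "{w \<in> trajectories. \<exists>t. w t \<in> U} \<in> sets trajectory_space"
proof -
 have "{w \<in> space trajectory_space. \<exists>t\<in>UNIV. w t \<in> U} \<in> sets trajectory_space"
  by (rule sets_Collect_hits_open[where F="\<lambda>w. w", OF measurable_trajectory_component _ assms])
    (simp add: space_trajectory_space continuous_on_trajectory)
 then show ?thesis by (simp add: space_trajectory_space)
qed

lemma UNIV_eq_UN_Icc: "UNIV = (\<Union>n. {- real n..real n})"
proof -
 have "\<exists>n. x \<in> {- real n..real n}" for x :: real
  using real_arch_simple[of "\<bar>x\<bar>"] by (auto simp: abs_le_iff minus_le_iff)
 then show ?thesis by auto
qed

lemma sets_trajectory_hits_closed:
 assumes "closed K" shows "{w \<in> trajectories. \<exists>t. w t \<in> K} \<in> sets trajectory_space"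
proof -
 have "{w \<in> space trajectory_space. \<exists>t\<in>UNIV. w t \<in> K} \<in> sets trajectory_space"
  by (rule sets_Collect_hits_closed[where F="\<lambda>w. w" and S="\<lambda>n. {- real n..real n}", OF measurable_trajectory_component _ assms UNIV_eq_UN_Icc])
    (simp_all add: space_trajectory_space continuous_on_trajectory)
 then show ?thesis by (simp add: space_trajectory_space)
qed

lemma trajectory_quotient_sets:
 "sets trajectory_quotient = sigma_sets (trajectories // time_shift)
   {A. A \<subseteq> trajectories // time_shift \<and> {w \<in> trajectories. time_shift `` {w} \<in> A} \<in> sets trajectory_space}"
 and space_trajectory_quotient: "space trajectory_quotient = trajectories // time_shift"
 unfolding trajectory_quotient_def by (auto intro!: sets_measure_of space_measure_of)

lemma sets_hitting_classes:
 assumes "{w \<in> trajectories. \<exists>t. w t \<in> U} \<in> sets trajectory_space"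
 shows "hitting_classes U \<in> sets trajectory_quotient"
proof -
 have "{w \<in> trajectories. time_shift `` {w} \<in> hitting_classes U} = {w \<in> trajectories. \<exists>t. w t \<in> U}"
  using class_in_hitting_classes by blast
 moreover have "hitting_classes U \<subseteq> trajectories // time_shift" by (auto simp: hitting_classes_def)
 ultimately show ?thesis unfolding trajectory_quotient_sets using assms by (intro sigma_sets.Basic) simp
qed

lemma measurable_time_shift_class:
 assumes "sets q = sets trajectory_space"
 shows "(\<lambda>w. time_shift `` {w}) \<in> q \<rightarrow>\<^sub>M trajectory_quotient"
proof -
 have sp: "space q = trajectories" using sets_eq_imp_space_eq[OF assms] by (simp add: space_trajectory_space)
 show ?thesis
 proof (rule measurable_sigma_sets[OF trajectory_quotient_sets])
  show "(\<lambda>w. time_shift `` {w}) \<in> space q \<rightarrow> trajectories // time_shift"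
   by (auto simp: sp intro!: quotientI)
  show "(\<lambda>w. time_shift `` {w}) -` A \<inter> space q \<in> sets q"
   if "A \<in> {A. A \<subseteq> trajectories // time_shift \<and> {w \<in> trajectories. time_shift `` {w} \<in> A} \<in> sets trajectory_space}" for A
   using that by (simp add: assms sp vimage_def Int_def conj_commute)
 qed auto
qed

lemma measurable_restrict_path:
 assumes "sets q = sets trajectory_space" "continuous_on {0..} \<phi>"
 shows "(\<lambda>w. restrict (\<lambda>t. w (\<phi> t)) {0..}) \<in> q \<rightarrow>\<^sub>M path_space"
proof -
 have sp: "space q = trajectories" using sets_eq_imp_space_eq[OF assms(1)] by (simp add: space_trajectory_space)
 have c: "(\<lambda>w. w t) \<in> q \<rightarrow>\<^sub>M borel" for t
  using measurable_trajectory_component[of t] measurable_cong_sets[OF assms(1) refl] by blast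
 show ?thesis unfolding path_space_def
 proof (rule measurable_restrict_space2)
  show "(\<lambda>w. restrict (\<lambda>t. w (\<phi> t)) {0..}) \<in> space q \<rightarrow> {w. continuous_on {0..} w}"
  proof (rule Pi_I, rule CollectI)
   fix w assume "w \<in> space q"
   then have "continuous_on UNIV w" by (auto simp: sp intro: continuous_on_trajectory)
   then have "continuous_on {0..} (\<lambda>t. w (\<phi> t))" by (rule continuous_on_compose2[OF _ assms(2)]) simp
   then show "continuous_on {0..} (restrict (\<lambda>t. w (\<phi> t)) {0..})"
    by (rule continuous_on_eq) simp
  qed
  show "(\<lambda>w. restrict (\<lambda>t. w (\<phi> t)) {0..}) \<in> q \<rightarrow>\<^sub>M Pi\<^sub>M {0..} (\<lambda>t. borel)"
   by (rule measurable_restrict) (rule c)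
 qed
qed

lemma restrict_path_measurable:
 assumes "sets q = sets trajectory_space"
 shows "(\<lambda>w. restrict w {0..}) \<in> q \<rightarrow>\<^sub>M path_space" "(\<lambda>w. restrict (\<lambda>t. w (- t)) {0..}) \<in> q \<rightarrow>\<^sub>M path_space"
 using measurable_restrict_path[OF assms continuous_on_id]
  measurable_restrict_path[OF assms continuous_on_minus[OF continuous_on_id]] by simp_all

text \<open>The form in which the interlacement measure is used: trajectories hitting the ball are
  counted by their forward path alone. The upper bound may discard those in the open ball at some
  time \<open>t \<le> 0\<close>, since the backward path almost surely avoids it.\<close>

lemma sznitman_ball:
 fixes \<nu> :: "(real \<Rightarrow> real^'n) set measure"
 assumes d: "CARD('n) \<ge> 3" and \<nu>: "sznitman_measure \<nu>" and R: "R > 0"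
 obtains P e where "\<And>y. brownian_law y (P y)" "equilibrium_measure P (cball 0 R) e"
  "AE y in e. norm y = R"
  "\<And>E A. E \<in> sets trajectory_quotient \<Longrightarrow> A \<in> sets path_space \<Longrightarrow>
   (\<And>w. w \<in> trajectories \<Longrightarrow> time_shift `` {w} \<in> E \<Longrightarrow> restrict w {0..} \<in> A \<or> (\<exists>t\<le>0. w t \<in> ball 0 R)) \<Longrightarrow>
   emeasure \<nu> (E \<inter> hitting_classes (cball 0 R)) \<le> (\<integral>\<^sup>+y. emeasure (P y) A \<partial>e)"
  "\<And>E A. E \<in> sets trajectory_quotient \<Longrightarrow> A \<in> sets path_space \<Longrightarrow>
   (\<And>w. w \<in> trajectories \<Longrightarrow> restrict w {0..} \<in> A \<Longrightarrow> time_shift `` {w} \<in> E) \<Longrightarrow>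
   (\<integral>\<^sup>+y. emeasure (P y) A \<partial>e) \<le> emeasure \<nu> (E \<inter> hitting_classes (cball 0 R))"
proof -
 let ?K = "cball (0::real^'n) R"
 have s\<nu>: "sets \<nu> = sets trajectory_quotient" using \<nu> by (simp add: sznitman_measure_def)
 obtain P where P: "\<And>y. brownian_law y (P y)" and
  ex: "\<And>c R. R > 0 \<Longrightarrow> (\<exists>q. hitting_trajectory_measure P (cball c R) q \<and>
      density \<nu> (indicator (hitting_classes (cball c R))) = distr q trajectory_quotient (\<lambda>w. time_shift `` {w}))"
  using \<nu> unfolding sznitman_measure_def by blast
 obtain q where q: "hitting_trajectory_measure P ?K q" and
  dens: "density \<nu> (indicator (hitting_classes ?K)) = distr q trajectory_quotient (\<lambda>w. time_shift `` {w})"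
  using ex[OF R] by blast
 obtain e P' where sq: "sets q = sets trajectory_space" and e: "equilibrium_measure P ?K e"
  and P': "\<And>y. y \<in> frontier ?K \<Longrightarrow> conditioned_law (P y) ?K (P' y)"
  and f: "\<And>D A B. D \<in> sets borel \<Longrightarrow> A \<in> sets path_space \<Longrightarrow> B \<in> sets path_space \<Longrightarrow>
      emeasure q {w \<in> space q. w 0 \<in> D \<and> restrict w {0..} \<in> A \<and> restrict (\<lambda>t. w (- t)) {0..} \<in> B} =
      (\<integral>\<^sup>+y. indicator D y * emeasure (P y) A * emeasure (P' y) B \<partial>e)"
  using q unfolding hitting_trajectory_measure_def by blast
 have spq: "space q = trajectories" using sets_eq_imp_space_eq[OF sq] by (simp add: space_trajectory_space)
 have se: "sets e = sets borel" and eK: "emeasure e (- ?K) = 0" using e by (auto simp: equilibrium_measure_def)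
 have fr: "AE y in e. norm y = R"
 proof -
  have "emeasure e (ball 0 R) = 0" by (rule equilibrium_measure_interior[OF d P e])
  then have "AE y in e. y \<notin> ball 0 R" by (intro AE_I[where N="ball 0 R"]) (auto simp: se)
  moreover have "AE y in e. y \<in> ?K" by (rule emeasure_space_ge_AE[OF se eK]) simp
  ultimately show ?thesis by eventually_elim auto
 qed
 have fr': "AE y in e. conditioned_law (P y) ?K (P' y)"
  using fr by eventually_elim (use P' R in \<open>auto simp: frontier_cball\<close>)
 have rm: "restrict w {0..} \<in> space path_space" "restrict (\<lambda>t. w (- t)) {0..} \<in> space path_space"
  if "w \<in> trajectories" for w :: "real \<Rightarrow> real^'n"
  using that restrict_path_measurable[OF sq] by (auto simp: measurable_def spq)
 have hK: "hitting_classes ?K \<in> sets \<nu>"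
  unfolding s\<nu> by (intro sets_hitting_classes sets_trajectory_hits_closed) simp
 have 1: "emeasure \<nu> (A \<inter> hitting_classes ?K) = emeasure q {w \<in> trajectories. time_shift `` {w} \<in> A}"
  if A: "A \<in> sets trajectory_quotient" for A
 proof -
  have A\<nu>: "A \<in> sets \<nu>" using A by (simp add: s\<nu>)
  have "emeasure \<nu> (A \<inter> hitting_classes ?K) = (\<integral>\<^sup>+x. indicator (hitting_classes ?K) x * indicator A x \<partial>\<nu>)"
  proof -
   have "A \<inter> hitting_classes ?K \<in> sets \<nu>" using A\<nu> hK by auto
   then have "emeasure \<nu> (A \<inter> hitting_classes ?K) = (\<integral>\<^sup>+x. indicator (A \<inter> hitting_classes ?K) x \<partial>\<nu>)" by simp
   also have "... = (\<integral>\<^sup>+x. indicator (hitting_classes ?K) x * indicator A x \<partial>\<nu>)"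
    by (intro nn_integral_cong) (auto split: split_indicator)
   finally show ?thesis .
  qed
  also have "... = emeasure (density \<nu> (indicator (hitting_classes ?K))) A"
   using A\<nu> hK by (subst emeasure_density) auto
  also have "... = emeasure q ((\<lambda>w. time_shift `` {w}) -` A \<inter> space q)"
   unfolding dens by (rule emeasure_distr[OF measurable_time_shift_class[OF sq] A])
  finally show ?thesis by (simp add: vimage_def Int_def spq conj_commute)
 qed
 \<comment> \<open>The two-sided formula with an unrestricted backward path, whose conditioned law
   has total mass 1.\<close>
 have 2: "emeasure q {w \<in> trajectories. restrict w {0..} \<in> A} = (\<integral>\<^sup>+y. emeasure (P y) A \<partial>e)" if A: "A \<in> sets path_space" for A
 proof -
  have "emeasure q {w \<in> trajectories. restrict w {0..} \<in> A} =
   emeasure q {w \<in> space q. w 0 \<in> UNIV \<and> restrict w {0..} \<in> A \<and> restrict (\<lambda>t. w (- t)) {0..} \<in> space path_space}"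
   using rm by (intro arg_cong[where f="emeasure q"]) (auto simp: spq)
  also have "... = (\<integral>\<^sup>+y. indicator UNIV y * emeasure (P y) A * emeasure (P' y) (space path_space) \<partial>e)"
   using A by (intro f) auto
  also have "... = (\<integral>\<^sup>+y. emeasure (P y) A \<partial>e)"
  proof (rule nn_integral_cong_AE)
   show "AE y in e. indicator UNIV y * emeasure (P y) A * emeasure (P' y) (space path_space) = emeasure (P y) A"
    using fr'
   proof eventually_elim
    case (elim y)
    then have "prob_space (P' y)" "space (P' y) = space path_space"
     using sets_eq_imp_space_eq by (auto simp: conditioned_law_def)
    then show ?case using prob_space.emeasure_space_1[of "P' y"] by simp
   qed
  qed
  finally show ?thesis .
 qed
 \<comment> \<open>After time reversal this event concerns the backward path only, and
   \<open>conditioned_law_avoids\<close> makes it null.\<close>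
 have 3: "emeasure q {w \<in> trajectories. \<exists>t\<le>0. w t \<in> ball 0 R} = 0"
 proof -
  define B where "B = {w \<in> space path_space. \<exists>t\<ge>0. w t \<in> ball (0::real^'n) R}"
  have B: "B \<in> sets path_space"
   using sets_path_hits_open[OF refl order_refl open_ball, of 0 R] by (simp add: B_def Bex_def conj_commute)
  have "{w \<in> trajectories. \<exists>t\<le>0. w t \<in> ball 0 R} =
   {w \<in> space q. w 0 \<in> UNIV \<and> restrict w {0..} \<in> space path_space \<and> restrict (\<lambda>t. w (- t)) {0..} \<in> B}"
  proof (intro set_eqI iffI; clarsimp simp: spq)
   fix w :: "real \<Rightarrow> real^'n" and t assume "w \<in> trajectories" "t \<le> 0" "norm (w t) < R"
   then show "restrict w {0..} \<in> space path_space \<and> restrict (\<lambda>t. w (- t)) {0..} \<in> B"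
    using rm[of w] by (auto simp: B_def intro!: exI[of _ "- t"])
  next
   fix w :: "real \<Rightarrow> real^'n" assume "restrict (\<lambda>t. w (- t)) {0..} \<in> B"
   then obtain t where "t \<ge> 0" "w (- t) \<in> ball 0 R" by (auto simp: B_def)
   then show "\<exists>t\<le>0. norm (w t) < R" by (intro exI[of _ "- t"]) auto
  qed
  then have "emeasure q {w \<in> trajectories. \<exists>t\<le>0. w t \<in> ball 0 R} =
    (\<integral>\<^sup>+y. indicator UNIV y * emeasure (P y) (space path_space) * emeasure (P' y) B \<partial>e)"
   using B f[of UNIV "space path_space" B] by simp
  also have "... = (\<integral>\<^sup>+y. 0 \<partial>e)"
  proof (rule nn_integral_cong_AE)
   show "AE y in e. indicator UNIV y * emeasure (P y) (space path_space) * emeasure (P' y) B = 0"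
    using fr'
   proof eventually_elim
    case (elim y)
    then have "space (P' y) = space path_space" using sets_eq_imp_space_eq by (auto simp: conditioned_law_def)
    then have "emeasure (P' y) B = 0"
     using conditioned_law_avoids[OF brownian_lawD(2)[OF P[of y]] elim] by (simp add: B_def)
    then show ?case by simp
   qed
  qed
  finally show ?thesis by simp
 qed
 have Em: "{w \<in> trajectories. time_shift `` {w} \<in> E} \<in> sets q" if "E \<in> sets trajectory_quotient" for E
  using measurable_sets[OF measurable_time_shift_class[OF sq] that] by (simp add: vimage_def Int_def spq conj_commute)
 have Am: "{w \<in> trajectories. restrict w {0..} \<in> A} \<in> sets q" if "A \<in> sets path_space" for A
  using measurable_sets[OF restrict_path_measurable(1)[OF sq] that] by (simp add: vimage_def Int_def spq conj_commute)
 have Bm: "{w \<in> trajectories. \<exists>t\<le>0. w t \<in> ball 0 R} \<in> sets q"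
 proof -
  have "{w \<in> space q. \<exists>t\<in>{..0}. w t \<in> ball 0 R} \<in> sets q"
  proof (rule sets_Collect_hits_open[where F="\<lambda>w. w"])
   show "(\<lambda>w. w t) \<in> q \<rightarrow>\<^sub>M borel" for t
    using measurable_trajectory_component[of t] measurable_cong_sets[OF sq refl] by blast
  qed (auto simp: spq intro: continuous_on_trajectory)
  then show ?thesis by (simp add: spq Bex_def conj_commute)
 qed
 have 4: "emeasure \<nu> (E \<inter> hitting_classes ?K) \<le> (\<integral>\<^sup>+y. emeasure (P y) A \<partial>e)"
  if E: "E \<in> sets trajectory_quotient" and A: "A \<in> sets path_space"
   and sub: "\<And>w. w \<in> trajectories \<Longrightarrow> time_shift `` {w} \<in> E \<Longrightarrow> restrict w {0..} \<in> A \<or> (\<exists>t\<le>0. w t \<in> ball 0 R)"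
  for E A
 proof -
  have "emeasure \<nu> (E \<inter> hitting_classes ?K) = emeasure q {w \<in> trajectories. time_shift `` {w} \<in> E}" by (rule 1[OF E])
  also have "... \<le> emeasure q ({w \<in> trajectories. restrict w {0..} \<in> A} \<union> {w \<in> trajectories. \<exists>t\<le>0. w t \<in> ball 0 R})"
   using sub Am[OF A] Bm by (intro emeasure_mono) auto
  also have "... \<le> emeasure q {w \<in> trajectories. restrict w {0..} \<in> A} + emeasure q {w \<in> trajectories. \<exists>t\<le>0. w t \<in> ball 0 R}"
   by (rule emeasure_subadditive[OF Am[OF A] Bm])
  also have "... = (\<integral>\<^sup>+y. emeasure (P y) A \<partial>e)" unfolding 3 2[OF A] by simp
  finally show ?thesis .
 qed
 have 5: "(\<integral>\<^sup>+y. emeasure (P y) A \<partial>e) \<le> emeasure \<nu> (E \<inter> hitting_classes ?K)"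
  if E: "E \<in> sets trajectory_quotient" and A: "A \<in> sets path_space"
   and sub: "\<And>w. w \<in> trajectories \<Longrightarrow> restrict w {0..} \<in> A \<Longrightarrow> time_shift `` {w} \<in> E"
  for E A
  unfolding 1[OF E] 2[OF A, symmetric] using sub Em[OF E] by (intro emeasure_mono) auto
 show ?thesis by (rule that[OF P e fr 4 5])
qed

section \<open>Trajectories hitting one or two sets\<close>

lemma bounded_subset_ball0:
 assumes "bounded S" obtains R where "R > 0" "S \<subseteq> ball (0::'a::real_normed_vector) R"
 using bounded_subset_ballD[OF assms, of 0] by blast

lemma hitting_classes_mono: "U \<subseteq> V \<Longrightarrow> hitting_classes U \<subseteq> hitting_classes V"
 by (auto simp: hitting_classes_def)

lemma hitting_classes_subset_ball:
 assumes "U \<subseteq> ball 0 R"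
 shows "hitting_classes U \<inter> hitting_classes (cball 0 R) = hitting_classes U"
 using assms by (intro inf.absorb1 hitting_classes_mono) auto

lemma restrict_hits: "t \<ge> 0 \<Longrightarrow> w t \<in> U \<Longrightarrow> w \<in> trajectories \<Longrightarrow> restrict w {0..} \<in> {w \<in> space path_space. \<exists>t\<ge>0. w t \<in> U}"
 using measurable_space[OF restrict_path_measurable(1)[OF refl]] by (auto simp: space_trajectory_space)

text \<open>The probability of hitting \<open>U\<close> is at most the potential of
  \<open>m\<close>. Integrated against the equilibrium measure of a large ball, and after exchange
  of the two measures, this leaves at most the mass of \<open>m\<close>: the upper bound of a
  capacity by potentials that are at least 1 on the set.\<close>

lemma sznitman_hits_le:
 fixes \<nu> :: "(real \<Rightarrow> real^'n) set measure"
 assumes d: "CARD('n) \<ge> 3" and \<nu>: "sznitman_measure \<nu>"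
  and U: "open U" "bounded U"
  and m: "finite_measure m" and s: "sets m = sets borel"
  and ge1: "\<And>x. x \<in> U \<Longrightarrow> potential m x \<ge> 1"
 shows "emeasure \<nu> (hitting_classes U) \<le> emeasure m (space m)"
proof -
 obtain R where R: "R > 0" "U \<subseteq> ball 0 R" using bounded_subset_ball0[OF U(2)] .
 interpret m: finite_measure m by fact
 have sf: "sigma_finite_measure m" by unfold_locales
 show ?thesis
 proof (rule sznitman_ball[OF d \<nu> R(1)], goal_cases)
  case (1 P e)
  note P = 1(1) and e = 1(2) and ub = 1(4)
  define A where "A = {w \<in> space path_space. \<exists>t\<ge>0. w t \<in> U}"
  have A: "A \<in> sets path_space"
   using sets_path_hits_open[OF refl order_refl U(1)] by (simp add: A_def Bex_def conj_commute)
  have "emeasure \<nu> (hitting_classes U) = emeasure \<nu> (hitting_classes U \<inter> hitting_classes (cball 0 R))"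
   by (simp only: hitting_classes_subset_ball[OF R(2)])
  also have "... \<le> (\<integral>\<^sup>+y. emeasure (P y) A \<partial>e)"
  proof (rule ub[OF _ A])
   show "hitting_classes U \<in> sets trajectory_quotient"
    by (intro sets_hitting_classes sets_trajectory_hits_open U)
   fix w assume w: "w \<in> trajectories" "time_shift `` {w} \<in> hitting_classes U"
   then obtain t where t: "w t \<in> U" using class_in_hitting_classes[of w U] by auto
   show "restrict w {0..} \<in> A \<or> (\<exists>t\<le>0. w t \<in> ball 0 R)"
   proof (cases "t \<ge> 0")
    case True
    then show ?thesis using restrict_hits[OF True t w(1)] by (simp add: A_def)
   next
    case False
    then show ?thesis using t R(2) by (intro disjI2 exI[of _ t]) auto
   qed
  qed
  also have "... \<le> (\<integral>\<^sup>+y. potential m y \<partial>e)"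
  proof (rule nn_integral_mono)
   fix y
   have "space (P y) = space path_space" using sets_eq_imp_space_eq[OF brownian_lawD(2)[OF P]] .
   then show "emeasure (P y) A \<le> potential m y"
    using brownian_hit_le[OF P[of y] U(1) superharmonic_potential[OF d sf s] ge1] by (simp add: A_def)
  qed
  also have "... = (\<integral>\<^sup>+z. emeasure (P z) {w \<in> space (P z). \<exists>t\<ge>0. w t \<in> cball 0 R} \<partial>m)"
   by (rule nn_integral_potential_equilibrium[OF e m s])
  also have "... \<le> (\<integral>\<^sup>+z. 1 \<partial>m)"
   by (intro nn_integral_mono prob_space.emeasure_le_1 brownian_lawD(1)[OF P])
  finally show ?thesis by simp
 qed
qed

text \<open>The dual bound: a potential at most 1 off \<open>V\<close> is dominated by the hitting
  probability of \<open>U\<close>, and since \<open>m\<close> sits inside the large ball the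
  exchange of measures gives its full mass. The gap \<open>\<delta>\<close> between \<open>V\<close>
  and the complement of \<open>U\<close> is what the discretisation in time needs.\<close>

lemma sznitman_hits_ge:
 fixes \<nu> :: "(real \<Rightarrow> real^'n) set measure"
 assumes d: "CARD('n) \<ge> 3" and \<nu>: "sznitman_measure \<nu>"
  and U: "open U" "bounded U"
  and m: "finite_measure m" and s: "sets m = sets borel"
  and S: "closed S" "emeasure m (- S) = 0" "S \<subseteq> V"
  and V: "V \<in> sets borel" "V \<subseteq> U"
  and \<delta>: "\<delta> > 0" "\<And>x v. x \<notin> U \<Longrightarrow> v \<in> V \<Longrightarrow> norm (x - v) \<ge> \<delta>"
  and le1: "\<And>x. x \<notin> V \<Longrightarrow> potential m x \<le> 1"
 shows "emeasure m (space m) \<le> emeasure \<nu> (hitting_classes U)"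
proof -
 obtain R where R: "R > 0" "U \<subseteq> ball 0 R" using bounded_subset_ball0[OF U(2)] .
 interpret m: finite_measure m by fact
 have sf: "sigma_finite_measure m" by unfold_locales
 have Vfin: "emeasure lborel V < \<infinity>"
  using bounded_subset[OF U(2) V(2)] by (rule emeasure_bounded_finite)
 show ?thesis
 proof (rule sznitman_ball[OF d \<nu> R(1)], goal_cases)
  case (1 P e)
  note P = 1(1) and e = 1(2) and fr = 1(3) and lb = 1(5)
  define A where "A = {w \<in> space path_space. \<exists>t\<ge>0. w t \<in> U}"
  have A: "A \<in> sets path_space"
   using sets_path_hits_open[OF refl order_refl U(1)] by (simp add: A_def Bex_def conj_commute)
  have AES: "AE y in m. y \<in> S" by (rule emeasure_space_ge_AE[OF s S(2,1)])
  have "emeasure m (space m) = (\<integral>\<^sup>+z. 1 \<partial>m)" by simp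
  also have "... = (\<integral>\<^sup>+z. emeasure (P z) {w \<in> space (P z). \<exists>t\<ge>0. w t \<in> cball 0 R} \<partial>m)"
  proof (rule nn_integral_cong_AE)
   show "AE z in m. 1 = emeasure (P z) {w \<in> space (P z). \<exists>t\<ge>0. w t \<in> cball 0 R}"
    using AES
   proof eventually_elim
    case (elim z)
    then have "z \<in> ball 0 R" using S(3) V(2) R(2) by blast
    then show ?case by (intro brownian_hits_from_inside[OF P, symmetric]) auto
   qed
  qed
  also have "... = (\<integral>\<^sup>+y. potential m y \<partial>e)"
   by (rule nn_integral_potential_equilibrium[OF e m s, symmetric])
  also have "... \<le> (\<integral>\<^sup>+y. emeasure (P y) A \<partial>e)"
  proof (rule nn_integral_mono_AE)
   show "AE y in e. potential m y \<le> emeasure (P y) A"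
    using fr
   proof eventually_elim
    case (elim y)
    then have y: "y \<notin> U" using R(2) by auto
    have "space (P y) = space path_space" using sets_eq_imp_space_eq[OF brownian_lawD(2)[OF P]] .
    then show ?case
     using potential_le_hitting_probability[OF d P[of y] U(1) m s S V(1) Vfin V(2) \<delta> le1 y] by (simp add: A_def)
   qed
  qed
  also have "... \<le> emeasure \<nu> (hitting_classes U \<inter> hitting_classes (cball 0 R))"
  proof (rule lb[OF _ A])
   show "hitting_classes U \<in> sets trajectory_quotient"
    by (intro sets_hitting_classes sets_trajectory_hits_open U)
   fix w assume w: "w \<in> trajectories" "restrict w {0..} \<in> A"
   then obtain t where "t \<ge> 0" "w t \<in> U" by (auto simp: A_def)
   then show "time_shift `` {w} \<in> hitting_classes U" using class_in_hitting_classes[OF w(1)] by auto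
  qed
  also have "... = emeasure \<nu> (hitting_classes U)"
   by (simp only: hitting_classes_subset_ball[OF R(2)])
  finally show ?thesis .
 qed
qed

text \<open>The two sets are visited in one order or the other; in each case the second visit costs
  a factor \<open>c\<close> on top of the first.\<close>

lemma sznitman_hits_both_le:
 fixes \<nu> :: "(real \<Rightarrow> real^'n) set measure"
 assumes d: "CARD('n) \<ge> 3" and \<nu>: "sznitman_measure \<nu>"
  and U1: "open U1" "bounded U1" and U2: "open U2" "bounded U2"
  and m1: "finite_measure m1" "sets m1 = sets borel" and m2: "finite_measure m2" "sets m2 = sets borel"
  and ge1: "\<And>x. x \<in> U1 \<Longrightarrow> potential m1 x \<ge> 1" and ge2: "\<And>x. x \<in> U2 \<Longrightarrow> potential m2 x \<ge> 1"
  and le1: "\<And>x. x \<in> U2 \<Longrightarrow> potential m1 x \<le> c" and le2: "\<And>x. x \<in> U1 \<Longrightarrow> potential m2 x \<le> c"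
 shows "emeasure \<nu> (hitting_classes U1 \<inter> hitting_classes U2) \<le> c * (emeasure m1 (space m1) + emeasure m2 (space m2))"
proof -
 have "bounded (U1 \<union> U2)" using U1 U2 by simp
 then obtain R where R: "R > 0" "U1 \<union> U2 \<subseteq> ball 0 R" using bounded_subset_ball0 by metis
 interpret m1: finite_measure m1 by fact
 interpret m2: finite_measure m2 by fact
 have sf: "sigma_finite_measure m1" "sigma_finite_measure m2" by unfold_locales
 show ?thesis
 proof (rule sznitman_ball[OF d \<nu> R(1)], goal_cases)
  case (1 P e)
  note P = 1(1) and e = 1(2) and ub = 1(4)
  have se[measurable_cong]: "sets e = sets borel" using e by (simp add: equilibrium_measure_def)
  define A where "A = {w \<in> space path_space. (\<exists>t\<ge>0. w t \<in> U1) \<and> (\<exists>t\<ge>0. w t \<in> U2)}"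
  have "A = {w \<in> space path_space. \<exists>t\<in>{0..}. w t \<in> U1} \<inter> {w \<in> space path_space. \<exists>t\<in>{0..}. w t \<in> U2}"
   by (auto simp: A_def)
  then have A: "A \<in> sets path_space"
   using sets_path_hits_open[OF refl order_refl U1(1)] sets_path_hits_open[OF refl order_refl U2(1)] by simp
  have hm: "hitting_classes U1 \<in> sets trajectory_quotient" "hitting_classes U2 \<in> sets trajectory_quotient"
   by (intro sets_hitting_classes sets_trajectory_hits_open U1 U2)+
  have "U1 \<subseteq> ball 0 R" using R(2) by simp
  from hitting_classes_subset_ball[OF this]
  have "hitting_classes U1 \<inter> hitting_classes U2 = hitting_classes U1 \<inter> hitting_classes U2 \<inter> hitting_classes (cball 0 R)" by blast
  then have "emeasure \<nu> (hitting_classes U1 \<inter> hitting_classes U2) = emeasure \<nu> (hitting_classes U1 \<inter> hitting_classes U2 \<inter> hitting_classes (cball 0 R))"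
   by simp
  also have "... \<le> (\<integral>\<^sup>+y. emeasure (P y) A \<partial>e)"
  proof (rule ub[OF _ A])
   show "hitting_classes U1 \<inter> hitting_classes U2 \<in> sets trajectory_quotient" using hm by auto
   fix w assume w: "w \<in> trajectories" "time_shift `` {w} \<in> hitting_classes U1 \<inter> hitting_classes U2"
   then obtain t1 t2 where t: "w t1 \<in> U1" "w t2 \<in> U2" using class_in_hitting_classes[of w] by auto
   have "w t1 \<in> ball 0 R" "w t2 \<in> ball 0 R" using t R(2) by auto
   moreover have "restrict w {0..} \<in> A" if "t1 \<ge> 0" "t2 \<ge> 0"
    using restrict_hits[OF that(1) t(1) w(1)] restrict_hits[OF that(2) t(2) w(1)] by (simp add: A_def)
   ultimately show "restrict w {0..} \<in> A \<or> (\<exists>t\<le>0. w t \<in> ball 0 R)" by (meson linear)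
  qed
  also have "... \<le> (\<integral>\<^sup>+y. c * potential m1 y + c * potential m2 y \<partial>e)"
  proof (rule nn_integral_mono)
   fix y
   have sp: "space (P y) = space path_space" and sP: "sets (P y) = sets path_space"
    using sets_eq_imp_space_eq[OF brownian_lawD(2)[OF P]] brownian_lawD(2)[OF P] .
   define J where "J U V = {w \<in> space (P y). \<exists>t\<ge>0. \<exists>s\<in>{0..t}. w s \<in> U \<and> w t \<in> V}" for U V
   note both1 = brownian_hit_both_le[OF P[of y] U1(1) U2(1) superharmonic_potential[OF d sf(1) m1(2)] ge1 superharmonic_potential[OF d sf(2) m2(2)] ge2 le2]
   note both2 = brownian_hit_both_le[OF P[of y] U2(1) U1(1) superharmonic_potential[OF d sf(2) m2(2)] ge2 superharmonic_potential[OF d sf(1) m1(2)] ge1 le1]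
   have Jm: "J U1 U2 \<in> sets (P y)" "J U2 U1 \<in> sets (P y)"
    unfolding J_def by (rule both1(1), assumption+) (rule both2(1), assumption+)
   have le12: "emeasure (P y) (J U1 U2) \<le> c * potential m1 y" "emeasure (P y) (J U2 U1) \<le> c * potential m2 y"
    unfolding J_def by (rule both1(2), assumption+) (rule both2(2), assumption+)
   have "emeasure (P y) A \<le> emeasure (P y) (J U1 U2 \<union> J U2 U1)"
   proof (rule emeasure_mono)
    show "A \<subseteq> J U1 U2 \<union> J U2 U1"
    proof
     fix w assume "w \<in> A"
     then obtain t1 t2 where w: "w \<in> space (P y)" "t1 \<ge> 0" "t2 \<ge> 0" "w t1 \<in> U1" "w t2 \<in> U2" by (auto simp: A_def sp)
     show "w \<in> J U1 U2 \<union> J U2 U1"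
     proof (cases "t1 \<le> t2")
      case True
      then have "w \<in> J U1 U2" unfolding J_def
       by (intro CollectI conjI exI[of _ t2] bexI[of _ t1]) (use w in auto)
      then show ?thesis ..
     next
      case False
      then have "w \<in> J U2 U1" unfolding J_def
       by (intro CollectI conjI exI[of _ t1] bexI[of _ t2]) (use w in auto)
      then show ?thesis ..
     qed
    qed
   qed (use Jm in auto)
   also have "... \<le> emeasure (P y) (J U1 U2) + emeasure (P y) (J U2 U1)"
    by (rule emeasure_subadditive[OF Jm])
   also have "... \<le> c * potential m1 y + c * potential m2 y"
    by (rule add_mono[OF le12])
   finally show "emeasure (P y) A \<le> c * potential m1 y + c * potential m2 y" .
  qed
  also have "... = c * (\<integral>\<^sup>+y. potential m1 y \<partial>e) + c * (\<integral>\<^sup>+y. potential m2 y \<partial>e)"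
  proof -
   have [measurable]: "potential m1 \<in> borel_measurable e" "potential m2 \<in> borel_measurable e"
    using measurable_potential[OF sf(1) m1(2) measurable_ident] measurable_potential[OF sf(2) m2(2) measurable_ident]
     measurable_cong_sets[OF se refl] by (auto simp: id_def)
   show ?thesis by (simp add: nn_integral_add nn_integral_cmult)
  qed
  also have "... \<le> c * (\<integral>\<^sup>+z. 1 \<partial>m1) + c * (\<integral>\<^sup>+z. 1 \<partial>m2)"
   unfolding nn_integral_potential_equilibrium[OF e m1] nn_integral_potential_equilibrium[OF e m2]
   by (intro add_mono mult_left_mono nn_integral_mono prob_space.emeasure_le_1 brownian_lawD(1)[OF P]) auto
  finally show ?thesis by (simp add: distrib_left)
 qed
qed

section \<open>Capacities of tubes\<close>

definition green_const :: "nat \<Rightarrow> real" where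
 "green_const d = Gamma (real d / 2 - 1) / (2 * pi powr (real d / 2))"

lemma green_const_pos: "d \<ge> 3 \<Longrightarrow> green_const d > 0"
 unfolding green_const_def by (intro divide_pos_pos Gamma_real_pos) auto

text \<open>The Green function in terms of the squared distance, which along a line is a quadratic
  \<open>t\<^sup>2 + s\<^sup>2\<close>.\<close>

definition green_sq :: "nat \<Rightarrow> real \<Rightarrow> real" where
 "green_sq d a = green_const d * a powr (1 - real d / 2)"

lemma green_eq_green_sq:
 assumes "(x::real^'n) \<noteq> 0" shows "green x = ennreal (green_sq CARD('n) ((norm x)\<^sup>2))"
 using assms by (simp add: green_def green_sq_def green_const_def power2_powr algebra_simps)

lemma green_sq_pos: "d \<ge> 3 \<Longrightarrow> a > 0 \<Longrightarrow> green_sq d a > 0"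
 by (simp add: green_sq_def green_const_pos)

lemma green_sq_nonneg: "d \<ge> 3 \<Longrightarrow> green_sq d a \<ge> 0"
 using green_const_pos[of d] by (simp add: green_sq_def)

lemma green_sq_antimono: "d \<ge> 3 \<Longrightarrow> 0 < a \<Longrightarrow> a \<le> b \<Longrightarrow> green_sq d b \<le> green_sq d a"
 unfolding green_sq_def using green_const_pos[of d] by (intro mult_left_mono powr_mono2') auto

lemma measurable_green_sq [measurable]:
 assumes [measurable]: "f \<in> borel_measurable M" shows "(\<lambda>x. green_sq d (f x)) \<in> borel_measurable M"
 unfolding green_sq_def by measurable

text \<open>The potential of the uniform measure on a segment of half-length \<open>L\<close>, at
  distance \<open>s\<close> from its midpoint in a perpendicular direction. Its inverse is the
  density that normalises such a potential to 1.\<close>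

definition line_green :: "nat \<Rightarrow> real \<Rightarrow> real \<Rightarrow> ennreal" where
 "line_green d L s = (\<integral>\<^sup>+t. indicator {-L..L} t * ennreal (green_sq d (t\<^sup>2 + s\<^sup>2)) \<partial>lborel)"

section \<open>Potentials of uniform measures on segments\<close>

definition segment_measure :: "real^'n \<Rightarrow> real^'n \<Rightarrow> real \<Rightarrow> real \<Rightarrow> ennreal \<Rightarrow> (real^'n) measure" where
 "segment_measure a u l r c = distr (density lborel (\<lambda>t. c * indicator {l..r} t)) borel (\<lambda>t. a + t *\<^sub>R u)"

lemma sets_segment_measure [simp, measurable_cong]: "sets (segment_measure a u l r c) = sets borel"
 by (simp add: segment_measure_def)

lemma nn_integral_segment_measure:
 assumes [measurable]: "f \<in> borel_measurable borel"
 shows "(\<integral>\<^sup>+x. f x \<partial>segment_measure a u l r c) = (\<integral>\<^sup>+t. c * (indicator {l..r} t * f (a + t *\<^sub>R u)) \<partial>lborel)"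
 unfolding segment_measure_def
 by (subst nn_integral_distr) (auto simp: nn_integral_density mult.assoc)

lemma emeasure_segment_measure_space:
 "l \<le> r \<Longrightarrow> emeasure (segment_measure a u l r c) (space (segment_measure a u l r c)) = c * ennreal (r - l)"
 using nn_integral_segment_measure[of "\<lambda>_. 1" a u l r c] by (simp add: nn_integral_cmult)

lemma finite_segment_measure:
 assumes "l \<le> r" "c < \<infinity>" shows "finite_measure (segment_measure a u l r c)"
 by (rule finite_measureI) (use assms in \<open>auto simp: emeasure_segment_measure_space ennreal_mult_eq_top_iff\<close>)

lemma emeasure_segment_measure_outside:
 assumes "closed S" "\<And>t. t \<in> {l..r} \<Longrightarrow> a + t *\<^sub>R u \<in> S"
 shows "emeasure (segment_measure a u l r c) (- S) = 0"
proof -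
 have [measurable]: "- S \<in> sets borel" using assms(1) by auto
 have "emeasure (segment_measure a u l r c) (- S) = (\<integral>\<^sup>+x. indicator (- S) x \<partial>segment_measure a u l r c)" by simp
 also have "... = (\<integral>\<^sup>+t. c * (indicator {l..r} t * indicator (- S) (a + t *\<^sub>R u)) \<partial>lborel)"
  by (rule nn_integral_segment_measure) measurable
 also have "... = (\<integral>\<^sup>+t. 0 \<partial>(lborel::real measure))"
  using assms(2) by (intro nn_integral_cong) (auto simp: indicator_def)
 finally show ?thesis by simp
qed

lemma potential_segment_measure:
 "potential (segment_measure a u l r c) x = (\<integral>\<^sup>+t. c * (indicator {l..r} t * green (x - (a + t *\<^sub>R u))) \<partial>lborel)"
 unfolding potential_def by (rule nn_integral_segment_measure) measurable

lemma norm_sq_line: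
 fixes u x a :: "'a::real_inner"
 assumes "norm u = 1"
 defines "t0 \<equiv> (x - a) \<bullet> u"
 shows "(norm (x - (a + t *\<^sub>R u)))\<^sup>2 = (t - t0)\<^sup>2 + (norm (x - (a + t0 *\<^sub>R u)))\<^sup>2"
proof -
 have uu: "u \<bullet> u = 1" using assms by (simp add: dot_square_norm)
 define v where "v = x - (a + t0 *\<^sub>R u)"
 have vu: "v \<bullet> u = 0" by (simp add: v_def t0_def inner_diff_left inner_add_left uu)
 have "x - (a + t *\<^sub>R u) = v + (t0 - t) *\<^sub>R u" by (simp add: v_def algebra_simps)
 then have "(norm (x - (a + t *\<^sub>R u)))\<^sup>2 = (v + (t0 - t) *\<^sub>R u) \<bullet> (v + (t0 - t) *\<^sub>R u)"
  by (simp add: power2_norm_eq_inner)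
 also have "... = v \<bullet> v + (t - t0)\<^sup>2"
  using vu by (simp add: inner_add_left inner_add_right inner_commute[of u v] uu power2_eq_square algebra_simps)
 finally show ?thesis by (simp add: v_def power2_norm_eq_inner)
qed

lemma line_green_translate:
 "(\<integral>\<^sup>+t. indicator {t0 - L..t0 + L} t * ennreal (green_sq d ((t - t0)\<^sup>2 + s\<^sup>2)) \<partial>lborel) = line_green d L s"
proof -
 have "(\<integral>\<^sup>+t. indicator {t0 - L..t0 + L} t * ennreal (green_sq d ((t - t0)\<^sup>2 + s\<^sup>2)) \<partial>lborel) =
  (\<integral>\<^sup>+t. indicator {t0 - L..t0 + L} (t0 + t) * ennreal (green_sq d ((t0 + t - t0)\<^sup>2 + s\<^sup>2)) \<partial>lborel)"
  by (rule nn_integral_translation[symmetric]) measurable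
 also have "... = line_green d L s" unfolding line_green_def
  by (intro nn_integral_cong) (auto simp: indicator_def)
 finally show ?thesis .
qed

text \<open>The foot of \<open>x\<close> on the line has a length \<open>L\<close> of the segment on
  either side; only this window is kept, and the distance to the line is raised to
  \<open>s\<close>.\<close>

lemma potential_segment_measure_ge:
 fixes x :: "real^'n"
 assumes d: "CARD('n) \<ge> 3" and u: "norm u = 1" and s: "s > 0"
  and near: "norm (x - (a + ((x - a) \<bullet> u) *\<^sub>R u)) \<le> s"
  and l: "l \<le> (x - a) \<bullet> u - L" "(x - a) \<bullet> u + L \<le> r"
 shows "c * line_green CARD('n) L s \<le> potential (segment_measure a u l r c) x"
proof -
 define t0 where "t0 = (x - a) \<bullet> u"
 have "c * line_green CARD('n) L s = (\<integral>\<^sup>+t. c * (indicator {t0 - L..t0 + L} t * ennreal (green_sq CARD('n) ((t - t0)\<^sup>2 + s\<^sup>2))) \<partial>lborel)"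
  by (subst nn_integral_cmult) (auto simp: line_green_translate)
 also have "... \<le> (\<integral>\<^sup>+t. c * (indicator {l..r} t * green (x - (a + t *\<^sub>R u))) \<partial>lborel)"
 proof (intro nn_integral_mono mult_left_mono)
  fix t :: real
  have "ennreal (green_sq CARD('n) ((t - t0)\<^sup>2 + s\<^sup>2)) \<le> green (x - (a + t *\<^sub>R u))"
  proof (cases "x - (a + t *\<^sub>R u) = 0")
   case True then show ?thesis by (simp add: green_def)
  next
   case False
   have "(norm (x - (a + t *\<^sub>R u)))\<^sup>2 \<le> (t - t0)\<^sup>2 + s\<^sup>2"
    unfolding norm_sq_line[OF u, of x a t] t0_def using near by (intro add_left_mono power_mono) auto
   then show ?thesis unfolding green_eq_green_sq[OF False]
    using False by (intro ennreal_leI green_sq_antimono d) auto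
  qed
  then show "indicator {t0 - L..t0 + L} t * ennreal (green_sq CARD('n) ((t - t0)\<^sup>2 + s\<^sup>2)) \<le> indicator {l..r} t * green (x - (a + t *\<^sub>R u))"
   using l by (auto simp: indicator_def t0_def)
 qed auto
 finally show ?thesis by (simp add: potential_segment_measure)
qed

text \<open>Centred at the point of the segment nearest to \<open>x\<close>, a window of half-length
  \<open>r - l\<close> contains the whole segment, and lowering the distance at the centre to
  \<open>s\<close> only increases the integrand.\<close>

lemma potential_segment_measure_le:
 fixes x :: "real^'n"
 assumes d: "CARD('n) \<ge> 3" and u: "norm u = 1" and s: "s > 0" and lr: "l \<le> r"
  and far: "\<And>t. t \<in> {l..r} \<Longrightarrow> norm (x - (a + t *\<^sub>R u)) \<ge> s"
 shows "potential (segment_measure a u l r c) x \<le> c * line_green CARD('n) (r - l) s"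
proof -
 define t0 where "t0 = (x - a) \<bullet> u"
 define t1 where "t1 = max l (min r t0)"
 have t1: "t1 \<in> {l..r}" using lr by (auto simp: t1_def)
 have sq: "(t - t1)\<^sup>2 + s\<^sup>2 \<le> (norm (x - (a + t *\<^sub>R u)))\<^sup>2" if t: "t \<in> {l..r}" for t
 proof -
  have "s\<^sup>2 \<le> (norm (x - (a + t1 *\<^sub>R u)))\<^sup>2" using far[OF t1] s by (intro power_mono) auto
  then have 1: "s\<^sup>2 \<le> (t1 - t0)\<^sup>2 + (norm (x - (a + t0 *\<^sub>R u)))\<^sup>2"
   unfolding norm_sq_line[OF u, of x a t1] t0_def .
  \<comment> \<open>The obtuse angle property of the projection \<open>t1\<close> of
    \<open>t0\<close> onto the interval.\<close>
  have "(t - t1) * (t1 - t0) \<ge> 0"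
  proof (cases "t0 < l")
   case True
   then have "t1 = l" using lr by (simp add: t1_def)
   then show ?thesis using True t by (intro mult_nonneg_nonneg) auto
  next
   case False
   show ?thesis
   proof (cases "r < t0")
    case True
    then have "t1 = r" using lr by (simp add: t1_def)
    then show ?thesis using True t by (intro mult_nonpos_nonpos) auto
   next
    case False
    then have "t1 = t0" using \<open>\<not> t0 < l\<close> by (simp add: t1_def)
    then show ?thesis by simp
   qed
  qed
  moreover have "(t - t0)\<^sup>2 = (t - t1)\<^sup>2 + 2 * ((t - t1) * (t1 - t0)) + (t1 - t0)\<^sup>2"
   by (simp add: power2_eq_square algebra_simps)
  ultimately have "(t - t1)\<^sup>2 + (t1 - t0)\<^sup>2 \<le> (t - t0)\<^sup>2" by linarith
  then show ?thesis unfolding norm_sq_line[OF u, of x a t] t0_def[symmetric] using 1 by linarith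
 qed
 have "potential (segment_measure a u l r c) x = (\<integral>\<^sup>+t. c * (indicator {l..r} t * green (x - (a + t *\<^sub>R u))) \<partial>lborel)"
  by (rule potential_segment_measure)
 also have "... \<le> (\<integral>\<^sup>+t. c * (indicator {t1 - (r - l)..t1 + (r - l)} t * ennreal (green_sq CARD('n) ((t - t1)\<^sup>2 + s\<^sup>2))) \<partial>lborel)"
 proof (intro nn_integral_mono mult_left_mono)
  fix t :: real
  show "indicator {l..r} t * green (x - (a + t *\<^sub>R u)) \<le> indicator {t1 - (r - l)..t1 + (r - l)} t * ennreal (green_sq CARD('n) ((t - t1)\<^sup>2 + s\<^sup>2))"
  proof (cases "t \<in> {l..r}")
   case True
   have "x - (a + t *\<^sub>R u) \<noteq> 0" using far[OF True] s by auto
   then have "green (x - (a + t *\<^sub>R u)) \<le> ennreal (green_sq CARD('n) ((t - t1)\<^sup>2 + s\<^sup>2))"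
    using sq[OF True] s by (subst green_eq_green_sq) (auto intro!: ennreal_leI green_sq_antimono d add_nonneg_pos)
   then show ?thesis using True t1 by (auto simp: indicator_def)
  qed simp
 qed auto
 also have "... = c * line_green CARD('n) (r - l) s"
  by (subst nn_integral_cmult) (auto simp: line_green_translate)
 finally show ?thesis .
qed

section \<open>Hitting intensities of tubes\<close>

definition tube :: "real^'n \<Rightarrow> real^'n \<Rightarrow> real \<Rightarrow> (real^'n) set" where
 "tube x y s = (\<Union>p\<in>closed_segment x y. ball p s)"

lemma open_tube: "open (tube x y s)" by (auto simp: tube_def)

lemma bounded_tube: "bounded (tube x y s)"
 by (rule bounded_subset[OF compact_imp_bounded[OF compact_nbhd[OF compact_segment]], of _ x y s])
  (force simp: tube_def nbhd_def)

lemma line_green_pos_finite: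
 assumes d: "d \<ge> 3" and L: "L > 0" and s: "s > 0"
 shows "0 < line_green d L s" "line_green d L s < \<infinity>"
proof -
 have lb: "ennreal (green_sq d (L\<^sup>2 + s\<^sup>2)) * ennreal (2 * L) \<le> line_green d L s"
 proof -
  have "ennreal (green_sq d (L\<^sup>2 + s\<^sup>2)) * ennreal (2 * L) = (\<integral>\<^sup>+t. ennreal (green_sq d (L\<^sup>2 + s\<^sup>2)) * indicator {-L..L} t \<partial>lborel)"
   using L by (subst nn_integral_cmult) auto
  also have "... \<le> line_green d L s" unfolding line_green_def
  proof (rule nn_integral_mono)
   fix t :: real
   have "t\<^sup>2 \<le> L\<^sup>2" if "t \<in> {-L..L}" using that by (auto simp: abs_le_square_iff[symmetric])
   then show "ennreal (green_sq d (L\<^sup>2 + s\<^sup>2)) * indicator {-L..L} t \<le> indicator {-L..L} t * ennreal (green_sq d (t\<^sup>2 + s\<^sup>2))"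
    using s by (auto simp: indicator_def intro!: ennreal_leI green_sq_antimono d add_nonneg_pos)
  qed
  finally show ?thesis .
 qed
 have "0 < ennreal (green_sq d (L\<^sup>2 + s\<^sup>2)) * ennreal (2 * L)"
  using green_sq_pos[OF d, of "L\<^sup>2 + s\<^sup>2"] L s by (simp add: ennreal_zero_less_mult_iff add_nonneg_pos)
 then show "0 < line_green d L s" using lb by (rule order.strict_trans2)
 have "line_green d L s \<le> (\<integral>\<^sup>+t. ennreal (green_sq d (s\<^sup>2)) * indicator {-L..L} t \<partial>lborel)"
  unfolding line_green_def using s
  by (intro nn_integral_mono) (auto simp: indicator_def intro!: ennreal_leI green_sq_antimono d)
 also have "... = ennreal (green_sq d (s\<^sup>2)) * ennreal (2 * L)"
  using L by (subst nn_integral_cmult) auto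
 also have "... < \<infinity>" by (simp add: ennreal_mult_less_top)
 finally show "line_green d L s < \<infinity>" .
qed

lemma line_green_inverse:
 assumes "d \<ge> 3" "L > 0" "s > 0"
 shows "1 / line_green d L s < \<infinity>" "1 / line_green d L s * line_green d L s = 1"
 using line_green_pos_finite[OF assms]
 by (simp_all add: ennreal_divide_eq_top_iff less_top[symmetric] ennreal_divide_times ennreal_divide_self)

text \<open>The segment is prolonged by \<open>L + s\<close> at both ends: the foot of a point of
  the tube leaves the segment by less than \<open>s\<close>, so a length \<open>L\<close> remains on
  either side of it. The density is chosen so that the potential is at least 1 on the tube.\<close>

lemma sznitman_tube_le:
 fixes \<nu> :: "(real \<Rightarrow> real^'n) set measure"
 assumes d: "CARD('n) \<ge> 3" and \<nu>: "sznitman_measure \<nu>"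
  and xy: "x \<noteq> y" and s: "s > 0" and L: "L > 0"
 shows "emeasure \<nu> (hitting_classes (tube x y s)) \<le> ennreal (norm (y - x) + 2 * L + 2 * s) / line_green CARD('n) L s"
proof -
 define len where "len = norm (y - x)"
 define u where "u = (1 / len) *\<^sub>R (y - x)"
 have len: "len > 0" using xy by (simp add: len_def)
 have u: "norm u = 1" using len by (simp add: u_def len_def)
 define c where "c = 1 / line_green CARD('n) L s"
 note c = line_green_inverse[OF d L s, folded c_def]
 define m where "m = segment_measure x u (- L - s) (len + L + s) c"
 have "emeasure \<nu> (hitting_classes (tube x y s)) \<le> emeasure m (space m)"
 proof (rule sznitman_hits_le[OF d \<nu> open_tube bounded_tube])
  show "finite_measure m" unfolding m_def using L s len c(1) by (intro finite_segment_measure) auto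
  show "sets m = sets borel" by (simp add: m_def)
  fix z assume "z \<in> tube x y s"
  then obtain p where p: "p \<in> closed_segment x y" "norm (z - p) < s"
   by (auto simp: tube_def dist_norm norm_minus_commute)
  then obtain \<theta> where \<theta>: "\<theta> \<in> {0..1}" "p = x + \<theta> *\<^sub>R (y - x)"
   by (auto simp: closed_segment_def algebra_simps)
  define \<tau> where "\<tau> = \<theta> * len"
  have p\<tau>: "p = x + \<tau> *\<^sub>R u" using \<theta> len by (simp add: \<tau>_def u_def)
  have \<tau>: "0 \<le> \<tau>" "\<tau> \<le> len" using \<theta> len by (auto simp: \<tau>_def mult_left_le_one_le)
  define t0 where "t0 = (z - x) \<bullet> u"
  have uu: "u \<bullet> u = 1" using u by (simp add: dot_square_norm)
  have "t0 - \<tau> = (z - p) \<bullet> u" by (simp add: t0_def p\<tau> inner_diff_left inner_add_left uu)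
  then have "\<bar>t0 - \<tau>\<bar> \<le> norm (z - p)" using Cauchy_Schwarz_ineq2[of "z - p" u] u by simp
  then have t0: "\<bar>t0 - \<tau>\<bar> < s" using p by linarith
  have "(norm (z - (x + t0 *\<^sub>R u)))\<^sup>2 \<le> (norm (z - p))\<^sup>2"
   unfolding p\<tau> t0_def norm_sq_line[OF u, of z x \<tau>] by simp
  then have "norm (z - (x + t0 *\<^sub>R u)) \<le> s" using p(2) by (simp add: abs_le_square_iff[symmetric])
  then have "c * line_green CARD('n) L s \<le> potential m z"
   unfolding m_def by (intro potential_segment_measure_ge[OF d u s]) (use t0 \<tau> in \<open>auto simp: t0_def\<close>)
  then show "1 \<le> potential m z" by (simp add: c(2))
 qed
 also have "emeasure m (space m) = c * ennreal (len + L + s - (- L - s))"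
  unfolding m_def using L s len by (intro emeasure_segment_measure_space) auto
 also have "len + L + s - (- L - s) = norm (y - x) + 2 * L + 2 * s" by (simp add: len_def)
 finally show ?thesis by (simp add: c_def ennreal_divide_times)
qed

text \<open>The segment itself, with density the inverse of \<open>line_green\<close> at its full
  length, has potential at most 1 off the tube of radius \<open>s\<close>; the strictly larger
  radius \<open>s'\<close> provides the gap required by \<open>sznitman_hits_ge\<close>.\<close>

lemma sznitman_tube_ge:
 fixes \<nu> :: "(real \<Rightarrow> real^'n) set measure"
 assumes d: "CARD('n) \<ge> 3" and \<nu>: "sznitman_measure \<nu>"
  and xy: "x \<noteq> y" and s: "0 < s" "s < s'"
 shows "ennreal (norm (y - x)) / line_green CARD('n) (norm (y - x)) s \<le> emeasure \<nu> (hitting_classes (tube x y s'))"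
proof -
 define len where "len = norm (y - x)"
 define u where "u = (1 / len) *\<^sub>R (y - x)"
 have len: "len > 0" using xy by (simp add: len_def)
 have u: "norm u = 1" using len by (simp add: u_def len_def)
 define c where "c = 1 / line_green CARD('n) len s"
 note c = line_green_inverse[OF d len s(1), folded c_def]
 define m where "m = segment_measure x u 0 len c"
 define S where "S = closed_segment x y"
 have seg: "x + t *\<^sub>R u \<in> S" if "t \<in> {0..len}" for t
  unfolding S_def closed_segment_def mem_Collect_eq using len that by (intro exI[of _ "t / len"]) (auto simp: u_def algebra_simps)
 have "emeasure m (space m) \<le> emeasure \<nu> (hitting_classes (tube x y s'))"
 proof (rule sznitman_hits_ge[OF d \<nu> open_tube bounded_tube])
  show "finite_measure m" unfolding m_def using len c(1) by (intro finite_segment_measure) auto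
  show "sets m = sets borel" by (simp add: m_def)
  show S: "closed S" by (simp add: S_def)
  show "emeasure m (- S) = 0" unfolding m_def using S seg by (rule emeasure_segment_measure_outside)
  show "S \<subseteq> tube x y s" unfolding tube_def S_def using s by force
  show "tube x y s \<in> sets borel" by (intro borel_open open_tube)
  show "tube x y s \<subseteq> tube x y s'" unfolding tube_def using s by force
  show "s' - s > 0" using s by simp
  show "s' - s \<le> norm (z - v)" if z: "z \<notin> tube x y s'" and v: "v \<in> tube x y s" for z v
  proof -
   obtain p where p: "p \<in> closed_segment x y" "norm (p - v) < s" using v by (auto simp: tube_def dist_norm)
   then have "norm (p - z) \<ge> s'" using z by (auto simp: tube_def dist_norm)
   moreover have "norm (p - z) \<le> norm (p - v) + norm (z - v)"
    using norm_triangle_ineq4[of "p - v" "z - v"] by simp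
   ultimately show ?thesis using p(2) by linarith
  qed
  show "potential m z \<le> 1" if z: "z \<notin> tube x y s" for z
  proof -
   have "potential m z \<le> c * line_green CARD('n) (len - 0) s"
    unfolding m_def
   proof (rule potential_segment_measure_le[OF d u s(1)])
    fix t assume "t \<in> {0..len}"
    then have "x + t *\<^sub>R u \<in> closed_segment x y" using seg unfolding S_def by blast
    then show "s \<le> norm (z - (x + t *\<^sub>R u))" using z by (auto simp: tube_def dist_norm norm_minus_commute not_less)
   qed (use len in simp)
   then show ?thesis by (simp add: c(2))
  qed
 qed
 also have "emeasure m (space m) = c * ennreal (len - 0)"
  unfolding m_def using len by (intro emeasure_segment_measure_space) auto
 finally show ?thesis by (simp add: c_def ennreal_divide_times len_def)
qed

text \<open>Point masses at the two centres serve as comparison measures: mass \<open>1 / g\<close>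
  makes the potential at least 1 on the own ball and at most \<open>k / g\<close> on the other,
  where \<open>k\<close> is the Green function at the least possible distance.\<close>

lemma sznitman_pair_le:
 fixes \<nu> :: "(real \<Rightarrow> real^'n) set measure"
 assumes d: "CARD('n) \<ge> 3" and \<nu>: "sznitman_measure \<nu>"
  and R: "R > 0" and far: "norm (x1 - x2) \<ge> 2 * R"
  and U1: "open U1" "U1 \<subseteq> ball x1 R" and U2: "open U2" "U2 \<subseteq> ball x2 R"
 shows "emeasure \<nu> (hitting_classes U1 \<inter> hitting_classes U2)
   \<le> ennreal (2 * green_sq CARD('n) ((norm (x1 - x2) - R)\<^sup>2) / green_sq CARD('n) (R\<^sup>2) ^ 2)"
proof -
 define g where "g = green_sq CARD('n) (R\<^sup>2)"
 have g: "g > 0" unfolding g_def by (rule green_sq_pos[OF d]) (use R in auto)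
 define k where "k = green_sq CARD('n) ((norm (x1 - x2) - R)\<^sup>2)"
 have k: "k \<ge> 0" unfolding k_def by (rule green_sq_nonneg[OF d])
 define m where "m x = scale_measure (ennreal (1 / g)) (return borel x)" for x :: "real^'n"
 have sm [simp]: "sets (m x) = sets borel" and spm [simp]: "space (m x) = UNIV" for x
  by (auto simp: m_def space_scale_measure)
 have mass: "emeasure (m x) (space (m x)) = ennreal (1 / g)" for x
  by (simp add: m_def space_scale_measure)
 have fin: "finite_measure (m x)" for x by (rule finite_measureI) (simp only: mass, simp)
 have pot: "potential (m x) z = ennreal (1 / g) * green (z - x)" for x z
  unfolding potential_def m_def by (subst nn_integral_scale_measure) (auto simp: nn_integral_return)
 have near: "potential (m x) z \<ge> 1" if z: "z \<in> ball x R" for x z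
 proof (cases "z = x")
  case True
  then show ?thesis using g by (simp add: pot green_def ennreal_mult_top)
 next
  case False
  then have "z - x \<noteq> 0" by simp
  have "(norm (z - x))\<^sup>2 \<le> R\<^sup>2" using z by (intro power_mono) (auto simp: dist_norm norm_minus_commute)
  then have "g \<le> green_sq CARD('n) ((norm (z - x))\<^sup>2)"
   unfolding g_def using \<open>z - x \<noteq> 0\<close> by (intro green_sq_antimono d) auto
  then have "1 / g * g \<le> 1 / g * green_sq CARD('n) ((norm (z - x))\<^sup>2)" using g by (intro mult_left_mono) auto
  then have "1 \<le> 1 / g * green_sq CARD('n) ((norm (z - x))\<^sup>2)" using g by simp
  then show ?thesis unfolding pot green_eq_green_sq[OF \<open>z - x \<noteq> 0\<close>]
   using g by (subst ennreal_mult[symmetric]) (auto simp: green_sq_nonneg[OF d] simp flip: ennreal_1 intro!: ennreal_leI)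
 qed
 have away: "potential (m x) z \<le> ennreal (k / g)" if z: "z \<in> ball x' R" and xx: "norm (x - x') = norm (x1 - x2)" for x x' z
 proof -
  have zR: "norm (z - x') < R" using z by (simp add: dist_norm norm_minus_commute)
  have "norm (x - x') \<le> norm (z - x) + norm (z - x')"
   using norm_triangle_ineq4[of "z - x'" "z - x"] by simp
  then have n: "norm (x1 - x2) - R \<le> norm (z - x)" using zR xx by simp
  have pos: "norm (x1 - x2) - R > 0" using far R by simp
  then have "z - x \<noteq> 0" using n by auto
  have "(norm (x1 - x2) - R)\<^sup>2 \<le> (norm (z - x))\<^sup>2" using n pos by (intro power_mono) auto
  then have "green_sq CARD('n) ((norm (z - x))\<^sup>2) \<le> k" unfolding k_def using pos by (intro green_sq_antimono d) auto
  then have "1 / g * green_sq CARD('n) ((norm (z - x))\<^sup>2) \<le> k / g" using g by (simp add: divide_right_mono)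
  then show ?thesis unfolding pot green_eq_green_sq[OF \<open>z - x \<noteq> 0\<close>]
   using g by (subst ennreal_mult[symmetric]) (auto simp: green_sq_nonneg[OF d] intro!: ennreal_leI)
 qed
 have "emeasure \<nu> (hitting_classes U1 \<inter> hitting_classes U2) \<le>
   ennreal (k / g) * (emeasure (m x1) (space (m x1)) + emeasure (m x2) (space (m x2)))"
 proof (rule sznitman_hits_both_le[OF d \<nu> U1(1) _ U2(1) _ fin sm fin sm])
  show "bounded U1" "bounded U2" using U1 U2 bounded_ball bounded_subset by blast+
  show "1 \<le> potential (m x1) z" if "z \<in> U1" for z using that U1 by (intro near) auto
  show "1 \<le> potential (m x2) z" if "z \<in> U2" for z using that U2 by (intro near) auto
  show "potential (m x1) z \<le> ennreal (k / g)" if "z \<in> U2" for z using that U2 by (intro away[of z x2]) auto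
  show "potential (m x2) z \<le> ennreal (k / g)" if "z \<in> U1" for z using that U1 by (intro away[of z x1]) (auto simp: norm_minus_commute)
 qed
 also have "... = ennreal (k / g) * ennreal (2 * (1 / g))"
  unfolding mass using g by (simp flip: ennreal_plus)
 also have "... = ennreal (2 * k / g ^ 2)"
  using g k by (subst ennreal_mult[symmetric]) (auto simp: power2_eq_square)
 finally show ?thesis by (simp add: k_def g_def)
qed

section \<open>Size of the line potential\<close>

lemma powr_minus_half: "(x::real) \<ge> 0 \<Longrightarrow> x powr (- (1/2)) = 1 / sqrt x"
 by (simp add: powr_minus powr_half_sqrt inverse_eq_divide)

text \<open>The Green function is a time integral of Gaussians. Integrating along the line removes
  one Gaussian factor, and what remains is the Green function of dimension \<open>d - 1\<close> at
  distance \<open>s\<close>, finite because \<open>d - 1 \<ge> 3\<close>.\<close>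

lemma nn_integral_line_green:
 assumes d: "d \<ge> 4" and s: "s > 0"
 shows "(\<integral>\<^sup>+t. ennreal (green_sq d (t\<^sup>2 + s\<^sup>2)) \<partial>lborel)
   = ennreal (Gamma (real (d - 3) / 2) / (2 * pi powr (real (d - 1) / 2)) * s powr (3 - real d))"
proof -
 define b where "b = real d / 2"
 have b: "b \<ge> 2" using d by (simp add: b_def)
 have g: "ennreal (green_sq d (t\<^sup>2 + s\<^sup>2)) =
   (\<integral>\<^sup>+\<tau>. indicator {0<..} \<tau> * ennreal ((2 * pi * \<tau>) powr (- b) * exp (- ((t\<^sup>2 + s\<^sup>2) / 2) / \<tau>)) \<partial>lborel)" for t
 proof -
  have A: "t\<^sup>2 + s\<^sup>2 > 0" using s by (simp add: add_nonneg_pos)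
  then show ?thesis using nn_integral_gaussian_time[OF A, of b] b by (simp add: green_sq_def green_const_def b_def)
 qed
 have gauss: "(\<integral>\<^sup>+t. ennreal ((2 * pi * \<tau>) powr (- b) * exp (- ((t\<^sup>2 + s\<^sup>2) / 2) / \<tau>)) \<partial>lborel)
   = ennreal ((2 * pi * \<tau>) powr (- (b - 1/2)) * exp (- (s\<^sup>2 / 2) / \<tau>))" if \<tau>: "\<tau> > 0" for \<tau>
 proof -
  have pt: "(2 * pi * \<tau>) powr (- b) * exp (- ((t\<^sup>2 + s\<^sup>2) / 2) / \<tau>) =
    (2 * pi * \<tau>) powr (- (b - 1/2)) * exp (- (s\<^sup>2 / 2) / \<tau>) * normal_density 0 (sqrt \<tau>) t" for t
  proof -
   have "(2 * pi * \<tau>) powr (- b) = (2 * pi * \<tau>) powr (- (b - 1/2)) * (2 * pi * \<tau>) powr (- (1/2))"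
    by (simp flip: powr_add)
   also have "(2 * pi * \<tau>) powr (- (1/2)) = 1 / sqrt (2 * pi * \<tau>)"
    using \<tau> by (intro powr_minus_half) simp
   finally have 1: "(2 * pi * \<tau>) powr (- b) = (2 * pi * \<tau>) powr (- (b - 1/2)) * (1 / sqrt (2 * pi * \<tau>))" .
   have 2: "exp (- ((t\<^sup>2 + s\<^sup>2) / 2) / \<tau>) = exp (- (s\<^sup>2 / 2) / \<tau>) * exp (- t\<^sup>2 / (2 * \<tau>))"
    using \<tau> by (subst exp_add[symmetric]) (simp add: field_simps)
   show ?thesis unfolding 1 2 using \<tau> by (simp add: normal_density_def)
  qed
  show ?thesis unfolding pt using \<tau>
   by (simp add: ennreal_mult' nn_integral_cmult) (subst nn_integral_eq_integral; simp)
 qed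
 have "(\<integral>\<^sup>+t. ennreal (green_sq d (t\<^sup>2 + s\<^sup>2)) \<partial>lborel) =
  (\<integral>\<^sup>+t. \<integral>\<^sup>+\<tau>. indicator {0<..} \<tau> * ennreal ((2 * pi * \<tau>) powr (- b) * exp (- ((t\<^sup>2 + s\<^sup>2) / 2) / \<tau>)) \<partial>lborel \<partial>lborel)"
  by (simp only: g)
 also have "... = (\<integral>\<^sup>+\<tau>. \<integral>\<^sup>+t. indicator {0<..} \<tau> * ennreal ((2 * pi * \<tau>) powr (- b) * exp (- ((t\<^sup>2 + s\<^sup>2) / 2) / \<tau>)) \<partial>lborel \<partial>lborel)"
  by (rule lborel_pair.Fubini') measurable
 also have "... = (\<integral>\<^sup>+\<tau>. indicator {0<..} \<tau> * ennreal ((2 * pi * \<tau>) powr (- (b - 1/2)) * exp (- (s\<^sup>2 / 2) / \<tau>)) \<partial>lborel)"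
 proof (rule nn_integral_cong)
  fix \<tau> :: real
  show "(\<integral>\<^sup>+t. indicator {0<..} \<tau> * ennreal ((2 * pi * \<tau>) powr (- b) * exp (- ((t\<^sup>2 + s\<^sup>2) / 2) / \<tau>)) \<partial>lborel)
   = indicator {0<..} \<tau> * ennreal ((2 * pi * \<tau>) powr (- (b - 1/2)) * exp (- (s\<^sup>2 / 2) / \<tau>))"
  proof (cases "\<tau> > 0")
   case True
   then show ?thesis using gauss[OF True] by (simp add: indicator_def)
  qed (simp add: indicator_def)
 qed
 also have "... = ennreal (Gamma (b - 1/2 - 1) / (2 * pi powr (b - 1/2)) * s\<^sup>2 powr (1 - (b - 1/2)))"
  using s b by (intro nn_integral_gaussian_time) auto
 also have "... = ennreal (Gamma (real (d - 3) / 2) / (2 * pi powr (real (d - 1) / 2)) * s powr (3 - real d))"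
 proof -
  have e: "b - 1/2 - 1 = real (d - 3) / 2" "b - 1/2 = real (d - 1) / 2" "2 * (1 - real (d - 1) / 2) = 3 - real d"
   using d by (auto simp: b_def of_nat_diff field_simps)
  show ?thesis unfolding e(1) unfolding e(2) power2_powr[OF s] e(3) ..
 qed
 finally show ?thesis .
qed

lemma line_green_le:
 assumes d: "d \<ge> 4" and s: "s > 0"
 shows "line_green d L s \<le> ennreal (Gamma (real (d - 3) / 2) / (2 * pi powr (real (d - 1) / 2)) * s powr (3 - real d))"
 unfolding nn_integral_line_green[OF assms, symmetric] line_green_def
 by (intro nn_integral_mono) (auto simp: indicator_def)

lemma line_green_tendsto:
 assumes d: "d \<ge> 4" and s: "s > 0"
 shows "(\<lambda>n. line_green d (real n) s) \<longlonglongrightarrow> ennreal (Gamma (real (d - 3) / 2) / (2 * pi powr (real (d - 1) / 2)) * s powr (3 - real d))"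
 unfolding nn_integral_line_green[OF assms, symmetric] line_green_def
proof (rule nn_integral_LIMSEQ)
 show "incseq (\<lambda>n t. indicator {- real n..real n} t * ennreal (green_sq d (t\<^sup>2 + s\<^sup>2)))"
  by (auto simp: incseq_def le_fun_def indicator_def)
 show "(\<lambda>n. indicator {- real n..real n} t * ennreal (green_sq d (t\<^sup>2 + s\<^sup>2))) \<longlonglongrightarrow> ennreal (green_sq d (t\<^sup>2 + s\<^sup>2))" for t
 proof (rule tendsto_eventually)
  obtain N where "\<bar>t\<bar> \<le> real N" using real_arch_simple by blast
  then show "eventually (\<lambda>n. indicator {- real n..real n} t * ennreal (green_sq d (t\<^sup>2 + s\<^sup>2)) = ennreal (green_sq d (t\<^sup>2 + s\<^sup>2))) sequentially"
   by (intro eventually_sequentiallyI[of N]) (auto simp: indicator_def)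
 qed
qed auto

text \<open>In dimension 3 the integrand is a multiple of
  \<open>1 / sqrt (t\<^sup>2 + s\<^sup>2)\<close> and the potential grows like the logarithm of the
  length. For lengths close to \<open>ln r\<close> this produces the factor \<open>ln (ln r)\<close>
  of the scale.\<close>

lemma line_green_3:
 assumes s: "s > 0" and L: "L > 0"
 shows "line_green 3 L s = ennreal (arsinh (L / s) / pi)"
proof -
 have gc: "green_const 3 = 1 / (2 * pi)"
 proof -
  have "pi powr (3 / 2) = pi * sqrt pi"
   using powr_add[of pi 1 "1/2"] by (simp add: powr_half_sqrt)
  then show ?thesis by (simp add: green_const_def Gamma_one_half_real)
 qed
 have pw: "green_sq 3 (t\<^sup>2 + s\<^sup>2) = 1 / (2 * pi) * (1 / sqrt (t\<^sup>2 + s\<^sup>2))" for t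
 proof -
  have "(t\<^sup>2 + s\<^sup>2) powr (1 - real 3 / 2) = (t\<^sup>2 + s\<^sup>2) powr (- (1 / 2))" by simp
  then show ?thesis unfolding green_sq_def gc using powr_minus_half[of "t\<^sup>2 + s\<^sup>2"] by simp
 qed
 have "line_green 3 L s = (\<integral>\<^sup>+t. ennreal (1 / (2 * pi) * (1 / sqrt (t\<^sup>2 + s\<^sup>2))) * indicator {-L..L} t \<partial>lborel)"
  unfolding line_green_def pw by (intro nn_integral_cong) (simp add: mult.commute)
 also have "... = ennreal (1 / (2 * pi) * arsinh (L / s) - 1 / (2 * pi) * arsinh (- L / s))"
 proof (rule nn_integral_FTC_Icc)
  show "((\<lambda>t. 1 / (2 * pi) * arsinh (t / s)) has_real_derivative 1 / (2 * pi) * (1 / sqrt (t\<^sup>2 + s\<^sup>2))) (at t)" for t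
  proof -
   have "(t / s)\<^sup>2 + 1 = (t\<^sup>2 + s\<^sup>2) / s\<^sup>2" using s by (simp add: field_simps power2_eq_square)
   then have e: "sqrt ((t / s)\<^sup>2 + 1) = sqrt (t\<^sup>2 + s\<^sup>2) / s" using s by (simp add: real_sqrt_divide)
   have "((\<lambda>t. t / s) has_real_derivative 1 / s) (at t)" by (rule DERIV_cdivide[OF DERIV_ident])
   from DERIV_chain2[OF arsinh_real_has_field_derivative this]
   have "((\<lambda>t. arsinh (t / s)) has_real_derivative 1 / sqrt (t\<^sup>2 + s\<^sup>2)) (at t)"
    unfolding e using s by simp
   then show ?thesis by (rule DERIV_cmult)
  qed
 qed (use L in auto)
 also have "1 / (2 * pi) * arsinh (L / s) - 1 / (2 * pi) * arsinh (- L / s) = arsinh (L / s) / pi"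
  by (simp add: arsinh_minus_real field_simps)
 finally show ?thesis .
qed

lemma arsinh_bounds:
 assumes "(x::real) > 0" shows "ln x \<le> arsinh x" "arsinh x \<le> ln (2 * x + 1)"
proof -
 have e: "arsinh x = ln (x + sqrt (x\<^sup>2 + 1))"
  by (simp add: arsinh_real_def)
 show "ln x \<le> arsinh x" unfolding e using assms by (subst ln_le_cancel_iff) (auto intro: add_pos_nonneg)
 have "sqrt (x\<^sup>2 + 1) \<le> sqrt ((x + 1)\<^sup>2)" using assms by (intro real_sqrt_le_mono) (simp add: power2_eq_square algebra_simps)
 then have "sqrt (x\<^sup>2 + 1) \<le> x + 1" using assms by simp
 then show "arsinh x \<le> ln (2 * x + 1)" unfolding e using assms by (subst ln_le_cancel_iff) (auto intro: add_pos_nonneg)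
qed

section \<open>Visibility in a Poisson cover\<close>

lemma poisson_process_void:
 assumes pp: "poisson_process M \<Lambda> X" and A: "A \<in> sets \<Lambda>" "emeasure \<Lambda> A < \<infinity>"
 shows "{\<omega> \<in> space M. X \<omega> \<inter> A = {}} \<in> sets M"
  and "measure M {\<omega> \<in> space M. X \<omega> \<inter> A = {}} = exp (- measure \<Lambda> A)"
proof -
 have eq: "{\<omega> \<in> space M. X \<omega> \<inter> A = {}} = {\<omega> \<in> space M. num_points (X \<omega>) A = of_nat 0}"
  by (auto simp: num_points_def emeasure_count_space_eq_0)
 have "(\<lambda>\<omega>. num_points (X \<omega>) A) \<in> borel_measurable M"
  using pp A unfolding poisson_process_def by blast
 then show "{\<omega> \<in> space M. X \<omega> \<inter> A = {}} \<in> sets M" unfolding eq by measurable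
 have "\<forall>k::nat. measure M {\<omega> \<in> space M. num_points (X \<omega>) A = of_nat k} = exp (- measure \<Lambda> A) * measure \<Lambda> A ^ k / fact k"
  using pp A unfolding poisson_process_def by blast
 from spec[OF this, of 0] show "measure M {\<omega> \<in> space M. X \<omega> \<inter> A = {}} = exp (- measure \<Lambda> A)"
  unfolding eq by simp
qed

text \<open>Chebyshev's inequality for the sum \<open>Z\<close> of the void events weighted by their
  inverse probabilities. Its mean is the number of sets, it vanishes when all of them are hit, and
  inclusion-exclusion for the intensity gives the covariances
  \<open>exp (measure \<Lambda> (B i \<inter> B j)) - 1\<close>.\<close>

lemma poisson_all_hit_le:
 assumes pp: "poisson_process M \<Lambda> X" and I: "finite I" "I \<noteq> {}"
  and B: "\<And>i. i \<in> I \<Longrightarrow> B i \<in> sets \<Lambda>" "\<And>i. i \<in> I \<Longrightarrow> emeasure \<Lambda> (B i) < \<infinity>"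
 shows "measure M {\<omega> \<in> space M. \<forall>i\<in>I. X \<omega> \<inter> B i \<noteq> {}} \<le>
   (\<Sum>i\<in>I. \<Sum>j\<in>I. exp (measure \<Lambda> (B i \<inter> B j)) - 1) / (real (card I))\<^sup>2"
proof -
 interpret prob_space M using pp by (simp add: poisson_process_def)
 define b where "b i = measure \<Lambda> (B i)" for i
 define E where "E i = {\<omega> \<in> space M. X \<omega> \<inter> B i = {}}" for i
 have Em: "E i \<in> events" if "i \<in> I" for i
  unfolding E_def by (rule poisson_process_void(1)[OF pp B(1)[OF that] B(2)[OF that]])
 have EE: "prob (E i \<inter> E j) = exp (measure \<Lambda> (B i \<inter> B j)) / (exp (b i) * exp (b j))" if "i \<in> I" "j \<in> I" for i j
 proof -
  have fm: "B i \<in> fmeasurable \<Lambda>" "B j \<in> fmeasurable \<Lambda>" using B that by (auto simp: fmeasurable_def)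
  have U: "B i \<union> B j \<in> sets \<Lambda>" "emeasure \<Lambda> (B i \<union> B j) < \<infinity>"
   using fmeasurable.Un[OF fm] by (auto simp: fmeasurable_def)
  have "E i \<inter> E j = {\<omega> \<in> space M. X \<omega> \<inter> (B i \<union> B j) = {}}" by (auto simp: E_def)
  then have "prob (E i \<inter> E j) = exp (- measure \<Lambda> (B i \<union> B j))"
   using poisson_process_void(2)[OF pp U] by simp
  also have "measure \<Lambda> (B i \<union> B j) = b i + b j - measure \<Lambda> (B i \<inter> B j)"
   using measure_Un3[OF fm] by (simp add: b_def)
  finally show ?thesis by (simp add: exp_minus exp_add exp_diff field_simps)
 qed
 have E1: "prob (E i) = 1 / exp (b i)" if "i \<in> I" for i
  unfolding E_def b_def by (simp add: poisson_process_void(2)[OF pp B(1)[OF that] B(2)[OF that]] exp_minus inverse_eq_divide)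
 define n where "n = real (card I)"
 have n: "n > 0" using I by (simp add: n_def card_gt_0_iff)
 define Z where "Z \<omega> = (\<Sum>i\<in>I. indicator (E i) \<omega> * exp (b i))" for \<omega>
 have int1: "integrable M (\<lambda>\<omega>. indicator (E i) \<omega> * exp (b i))" if "i \<in> I" for i
  using Em[OF that] by (intro integrable_mult_left) (simp add: integrable_indicator_iff less_top[symmetric])
 have int2: "integrable M (\<lambda>\<omega>. indicator (E i \<inter> E j) \<omega> * (exp (b i) * exp (b j)))" if "i \<in> I" "j \<in> I" for i j
  using Em[OF that(1)] Em[OF that(2)] by (intro integrable_mult_left) (simp add: integrable_indicator_iff less_top[symmetric])
 have EZ: "expectation Z = n"
  unfolding Z_def n_def using Em E1 by (simp add: Bochner_Integration.integral_sum[OF int1])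
 have Z2: "(Z \<omega>)\<^sup>2 = (\<Sum>i\<in>I. \<Sum>j\<in>I. indicator (E i \<inter> E j) \<omega> * (exp (b i) * exp (b j)))" for \<omega>
  unfolding Z_def power2_eq_square sum_product by (intro sum.cong refl) (auto simp: indicator_def)
 have iZ: "integrable M Z" unfolding Z_def by (intro Bochner_Integration.integrable_sum int1)
 have iZ2: "integrable M (\<lambda>\<omega>. (Z \<omega>)\<^sup>2)" unfolding Z2 by (intro Bochner_Integration.integrable_sum int2)
 have Zm [measurable]: "Z \<in> borel_measurable M" using iZ by (rule borel_measurable_integrable)
 have "expectation (\<lambda>\<omega>. (Z \<omega>)\<^sup>2) = (\<Sum>i\<in>I. \<Sum>j\<in>I. expectation (\<lambda>\<omega>. indicator (E i \<inter> E j) \<omega> * (exp (b i) * exp (b j))))"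
  unfolding Z2 using int2 by (simp add: Bochner_Integration.integral_sum Bochner_Integration.integrable_sum)
 also have "... = (\<Sum>i\<in>I. \<Sum>j\<in>I. exp (measure \<Lambda> (B i \<inter> B j)))"
  by (intro sum.cong refl) (use Em in \<open>simp add: EE\<close>)
 finally have "variance Z = (\<Sum>i\<in>I. \<Sum>j\<in>I. exp (measure \<Lambda> (B i \<inter> B j))) - n\<^sup>2"
  using variance_eq[OF iZ iZ2] by (simp add: EZ)
 also have "... = (\<Sum>i\<in>I. \<Sum>j\<in>I. exp (measure \<Lambda> (B i \<inter> B j)) - 1)"
  by (simp add: sum_subtractf n_def power2_eq_square)
 finally have var: "variance Z = (\<Sum>i\<in>I. \<Sum>j\<in>I. exp (measure \<Lambda> (B i \<inter> B j)) - 1)" .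
 have "prob {\<omega> \<in> space M. \<forall>i\<in>I. X \<omega> \<inter> B i \<noteq> {}} \<le> prob {\<omega> \<in> space M. n \<le> \<bar>Z \<omega> - expectation Z\<bar>}"
 proof (rule finite_measure_mono)
  show "{\<omega> \<in> space M. \<forall>i\<in>I. X \<omega> \<inter> B i \<noteq> {}} \<subseteq> {\<omega> \<in> space M. n \<le> \<bar>Z \<omega> - expectation Z\<bar>}"
  proof safe
   fix \<omega> assume "\<forall>i\<in>I. X \<omega> \<inter> B i \<noteq> {}"
   then have "Z \<omega> = 0" unfolding Z_def by (intro sum.neutral) (auto simp: E_def)
   then show "n \<le> \<bar>Z \<omega> - expectation Z\<bar>" using n by (simp add: EZ)
  qed
 qed measurable
 also have "... \<le> variance Z / n\<^sup>2" using iZ2 n by (intro Chebyshev_inequality) auto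
 finally show ?thesis unfolding var n_def .
qed

lemma max_visibility_gtD:
 assumes "max_visibility C r > ereal l"
 obtains x y where "x \<in> cball 0 r" "y \<in> cball 0 r" "norm (x - y) > l" "closed_segment x y \<inter> C = {}"
 using assms unfolding max_visibility_def less_Sup_iff by auto

lemma max_visibility_ltD:
 assumes "max_visibility C r < ereal l" "x \<in> cball 0 r" "y \<in> cball 0 r" "norm (x - y) \<ge> l"
 shows "closed_segment x y \<inter> C \<noteq> {}"
proof
 assume "closed_segment x y \<inter> C = {}"
 then have "ereal (norm (x - y)) \<le> max_visibility C r"
  unfolding max_visibility_def using assms by (intro Sup_upper) blast
 then have "ereal l \<le> max_visibility C r" using assms(4) by (meson ereal_less_eq(3) order_trans)
 then show False using assms(1) by simp
qed

abbreviation (input) prob_visibility_gt :: "'w measure \<Rightarrow> ('w \<Rightarrow> (real^'n) set) \<Rightarrow> real \<Rightarrow> real \<Rightarrow> real" where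
 "prob_visibility_gt M C l r \<equiv> measure M {\<omega> \<in> space M. max_visibility (C \<omega>) r > ereal l}"

abbreviation (input) prob_visibility_lt :: "'w measure \<Rightarrow> ('w \<Rightarrow> (real^'n) set) \<Rightarrow> real \<Rightarrow> real \<Rightarrow> real" where
 "prob_visibility_lt M C l r \<equiv> measure M {\<omega> \<in> space M. max_visibility (C \<omega>) r < ereal l}"

section \<open>Lattices, nets and perturbed segments\<close>

definition lattice :: "nat \<Rightarrow> (int^'n) set" where
 "lattice N = {k. \<forall>i. \<bar>k $ i\<bar> \<le> int N}"

lemma lattice_box:
 fixes c :: "int^'n"
 shows "finite {k::int^'n. \<forall>i. \<bar>k $ i - c $ i\<bar> \<le> int N}" and "card {k::int^'n. \<forall>i. \<bar>k $ i - c $ i\<bar> \<le> int N} = (2 * N + 1) ^ CARD('n)"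
proof -
 let ?P = "PiE UNIV (\<lambda>i. {c $ i - int N..c $ i + int N})"
 have eq: "{k::int^'n. \<forall>i. \<bar>k $ i - c $ i\<bar> \<le> int N} = vec_lambda ` ?P"
 proof safe
  fix k :: "int^'n" assume *: "\<forall>i. \<bar>k $ i - c $ i\<bar> \<le> int N"
  have "k = vec_lambda (vec_nth k)" by simp
  moreover have "vec_nth k \<in> ?P" using * by (auto simp: PiE_iff abs_le_iff) (smt (verit))+
  ultimately show "k \<in> vec_lambda ` ?P" by blast
 next
  fix f i assume "f \<in> ?P"
  then have "f i \<in> {c $ i - int N..c $ i + int N}" by (rule PiE_mem) simp
  then show "\<bar>vec_lambda f $ i - c $ i\<bar> \<le> int N" by auto
 qed
 have fP: "finite ?P" by (intro finite_PiE) auto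
 show "finite {k::int^'n. \<forall>i. \<bar>k $ i - c $ i\<bar> \<le> int N}" unfolding eq using fP by simp
 have "inj_on vec_lambda ?P" by (auto simp: inj_on_def vec_lambda_inject)
 then have "card (vec_lambda ` ?P) = card ?P" by (rule card_image)
 also have "... = (2 * N + 1) ^ CARD('n)"
 proof -
  have "card {c $ i - int N..c $ i + int N} = 2 * N + 1" for i by simp
  then show ?thesis by (simp only: card_PiE[OF finite] prod_constant)
 qed
 finally show "card {k::int^'n. \<forall>i. \<bar>k $ i - c $ i\<bar> \<le> int N} = (2 * N + 1) ^ CARD('n)" unfolding eq .
qed

lemma finite_lattice: "finite (lattice N)" and card_lattice: "card (lattice N :: (int^'n) set) = (2 * N + 1) ^ CARD('n)"
 using lattice_box[of 0 N] by (simp_all add: lattice_def)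

definition lattice_point :: "real \<Rightarrow> int^'n \<Rightarrow> real^'n" where
 "lattice_point D k = (\<chi> i. D * of_int (k $ i))"

lemma norm_lattice_point_le:
 assumes "k \<in> lattice N" "D \<ge> 0"
 shows "norm (lattice_point D k :: real^'n) \<le> real CARD('n) * D * real N"
proof -
 have "norm (lattice_point D k) \<le> (\<Sum>i\<in>UNIV. \<bar>lattice_point D k $ i\<bar>)" by (rule norm_le_l1_cart)
 also have "... \<le> (\<Sum>i\<in>(UNIV::'n set). D * real N)"
 proof (rule sum_mono)
  fix i :: 'n
  have "\<bar>k $ i\<bar> \<le> int N" using assms(1) by (simp add: lattice_def)
  then have "\<bar>real_of_int (k $ i)\<bar> \<le> real N" by linarith
  then have "D * \<bar>real_of_int (k $ i)\<bar> \<le> D * real N" using assms(2) by (rule mult_left_mono)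
  then show "\<bar>lattice_point D k $ i\<bar> \<le> D * real N" using assms(2) by (simp add: lattice_point_def abs_mult)
 qed
 finally show ?thesis by simp
qed

lemma lattice_point_component_le:
 assumes "D \<ge> 0"
 shows "D * \<bar>real_of_int (j $ i - k $ i)\<bar> \<le> norm (lattice_point D j - lattice_point D k)"
proof -
 have "D * \<bar>real_of_int (j $ i - k $ i)\<bar> = \<bar>(lattice_point D j - lattice_point D k) $ i\<bar>"
  using assms by (simp add: lattice_point_def abs_mult right_diff_distrib[symmetric])
 then show ?thesis using component_le_norm_cart[of "lattice_point D j - lattice_point D k" i] by simp
qed

lemma lattice_point_separated:
 assumes "D \<ge> 0" "j \<noteq> k" shows "D \<le> norm (lattice_point D j - lattice_point D k)"
proof -
 obtain i where "j $ i \<noteq> k $ i" using assms(2) by (auto simp: vec_eq_iff)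
 then have "1 \<le> \<bar>real_of_int (j $ i - k $ i)\<bar>" by linarith
 then have "D * 1 \<le> D * \<bar>real_of_int (j $ i - k $ i)\<bar>" using assms(1) by (rule mult_left_mono)
 then show ?thesis using lattice_point_component_le[OF assms(1), of j i k] by linarith
qed

lemma exists_net:
 fixes \<delta> :: real
 assumes \<delta>: "\<delta> > 0"
 obtains K where "K \<ge> 0" "\<And>R. R \<ge> 1 \<Longrightarrow> \<exists>G::(real^'n) set. finite G \<and> real (card G) \<le> K * R ^ CARD('n) \<and> (\<forall>x\<in>cball 0 R. \<exists>g\<in>G. norm (x - g) \<le> \<delta>)"
proof
 \<comment> \<open>Rounding a coordinate down to the lattice costs at most \<open>\<eta>\<close>,
   and the norm is bounded by the sum over the coordinates.\<close>
 define \<eta> where "\<eta> = \<delta> / real CARD('n)"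
 have \<eta>: "\<eta> > 0" using \<delta> by (simp add: \<eta>_def)
 define K where "K = (2 / \<eta> + 5) ^ CARD('n)"
 show "K \<ge> 0" using \<eta> by (simp add: K_def)
 fix R :: real assume R: "R \<ge> 1"
 \<comment> \<open>The added 1 leaves room for the floor of a negative coordinate.\<close>
 define N where "N = nat \<lceil>R / \<eta> + 1\<rceil>"
 have N: "R / \<eta> + 1 \<le> real N" "real N \<le> R / \<eta> + 2"   proof -
  have "\<lceil>R / \<eta> + 1\<rceil> \<ge> 0" using R \<eta> by (smt (verit) divide_nonneg_pos le_of_int_ceiling of_int_0_le_iff)
  then have "real N = real_of_int \<lceil>R / \<eta> + 1\<rceil>" by (simp only: N_def of_nat_nat)
  then show "R / \<eta> + 1 \<le> real N" "real N \<le> R / \<eta> + 2" by linarith+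
 qed
 let ?G = "lattice_point \<eta> ` (lattice N :: (int^'n) set)"
 have "real (card ?G) \<le> real (card (lattice N :: (int^'n) set))" using card_image_le[OF finite_lattice] by simp
 also have "... = (2 * real N + 1) ^ CARD('n)" by (simp add: card_lattice add.commute)
 also have "... \<le> ((2 / \<eta> + 5) * R) ^ CARD('n)"
 proof (rule power_mono)
  have "2 * real N + 1 \<le> 2 / \<eta> * R + 5" using N by simp
  also have "... \<le> (2 / \<eta> + 5) * R" using R by (simp add: algebra_simps)
  finally show "2 * real N + 1 \<le> (2 / \<eta> + 5) * R" .
 qed simp
 also have "... = K * R ^ CARD('n)" by (simp add: K_def power_mult_distrib)
 finally have card: "real (card ?G) \<le> K * R ^ CARD('n)" .
 have "\<exists>g\<in>?G. norm (x - g) \<le> \<delta>" if x: "x \<in> cball 0 R" for x :: "real^'n"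
 proof -
  define k where "k = (\<chi> i. \<lfloor>x $ i / \<eta>\<rfloor>)"
  have "\<bar>k $ i\<bar> \<le> int N" for i
  proof -
   have "\<bar>x $ i\<bar> \<le> R" using component_le_norm_cart[of x i] x by simp
   then have "\<bar>x $ i / \<eta>\<bar> \<le> R / \<eta>" using \<eta> by (simp add: divide_right_mono)
   then have "\<bar>real_of_int \<lfloor>x $ i / \<eta>\<rfloor>\<bar> \<le> real N" using N(1) by linarith
   then show ?thesis by (simp add: k_def)
  qed
  then have "k \<in> lattice N" by (simp add: lattice_def)
  moreover have "norm (x - lattice_point \<eta> k) \<le> \<delta>"
  proof -
   have "norm (x - lattice_point \<eta> k) \<le> (\<Sum>i\<in>UNIV. \<bar>(x - lattice_point \<eta> k) $ i\<bar>)" by (rule norm_le_l1_cart)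
   also have "... \<le> (\<Sum>i\<in>(UNIV::'n set). \<eta>)"
   proof (rule sum_mono)
    fix i
    have f: "real_of_int \<lfloor>x $ i / \<eta>\<rfloor> \<le> x $ i / \<eta>" "x $ i / \<eta> < real_of_int \<lfloor>x $ i / \<eta>\<rfloor> + 1" by linarith+
    have "\<eta> * real_of_int \<lfloor>x $ i / \<eta>\<rfloor> \<le> x $ i" using mult_left_mono[OF f(1), of \<eta>] \<eta> by simp
    moreover have "x $ i \<le> \<eta> * real_of_int \<lfloor>x $ i / \<eta>\<rfloor> + \<eta>" using mult_strict_left_mono[OF f(2) \<eta>] \<eta> by (simp add: distrib_left)
    ultimately show "\<bar>(x - lattice_point \<eta> k) $ i\<bar> \<le> \<eta>" by (simp add: lattice_point_def k_def abs_le_iff)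
   qed
   also have "... = \<delta>" by (simp add: \<eta>_def)
   finally show ?thesis .
  qed
  ultimately show ?thesis by blast
 qed
 then show "\<exists>G::(real^'n) set. finite G \<and> real (card G) \<le> K * R ^ CARD('n) \<and> (\<forall>x\<in>cball 0 R. \<exists>g\<in>G. norm (x - g) \<le> \<delta>)"
  using card finite_lattice by (intro exI[of _ ?G]) auto
qed

lemma exp_minus_one_le:
 fixes h K :: real
 assumes "0 \<le> h" "h \<le> K" shows "exp h - 1 \<le> exp K * h"
proof -
 have "1 - h \<le> exp (- h)" using exp_ge_add_one_self[of "- h"] by simp
 then have "exp h * (1 - h) \<le> exp h * exp (- h)" by (intro mult_left_mono) auto
 then have "exp h - 1 \<le> exp h * h" by (simp add: exp_minus field_simps)
 also have "... \<le> exp K * h" using assms by (intro mult_right_mono) auto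
 finally show ?thesis .
qed

lemma closed_segment_perturb:
 fixes x y x' y' p :: "'a::real_normed_vector"
 assumes "norm (x' - x) \<le> \<delta>" "norm (y' - y) \<le> \<delta>" "p \<in> closed_segment x y"
 shows "\<exists>p'\<in>closed_segment x' y'. norm (p' - p) \<le> \<delta>"
proof -
 obtain s where s: "0 \<le> s" "s \<le> 1" "p = (1 - s) *\<^sub>R x + s *\<^sub>R y" using assms(3) by (auto simp: closed_segment_def)
 define p' where "p' = (1 - s) *\<^sub>R x' + s *\<^sub>R y'"
 have "p' - p = (1 - s) *\<^sub>R (x' - x) + s *\<^sub>R (y' - y)" by (simp add: s p'_def algebra_simps)
 then have "norm (p' - p) \<le> norm ((1 - s) *\<^sub>R (x' - x)) + norm (s *\<^sub>R (y' - y))" by (metis norm_triangle_ineq)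
 also have "... = (1 - s) * norm (x' - x) + s * norm (y' - y)" using s by simp
 also have "... \<le> (1 - s) * \<delta> + s * \<delta>" using s assms by (intro add_mono mult_left_mono) auto
 also have "... = \<delta>" by (simp add: algebra_simps)
 finally show ?thesis using s by (intro bexI[of _ p']) (auto simp: p'_def closed_segment_def)
qed

lemma closed_segment_perturb_dist:
 assumes "norm (x' - x) \<le> \<delta>" "norm (y' - y) \<le> \<delta>" "p \<in> closed_segment x y" "dist p z \<le> s - \<delta>"
 shows "\<exists>p'\<in>closed_segment x' y'. dist z p' \<le> s"
proof -
 obtain p' where p': "p' \<in> closed_segment x' y'" "norm (p' - p) \<le> \<delta>"
  using closed_segment_perturb[OF assms(1-3)] by blast
 have "dist z p' \<le> dist z p + dist p p'" by (rule dist_triangle)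
 then have "dist z p' \<le> s" using assms(4) p'(2) by (simp add: dist_commute dist_norm norm_minus_commute)
 then show ?thesis using p'(1) by blast
qed

lemma dist_closed_segment_le:
 fixes z :: "'a::euclidean_space"
 assumes "norm u = 1" "0 \<le> l" "p \<in> closed_segment z (z + l *\<^sub>R u)"
 shows "dist z w \<le> l + dist p w"
proof -
 have "dist z p \<le> dist z (z + l *\<^sub>R u)" using dist_in_closed_segment[OF assms(3)] by (simp add: dist_commute)
 also have "... = l" using assms by (simp add: dist_norm)
 finally show ?thesis using dist_triangle[of z w p] by simp
qed

lemma log_scale_bounds:
 assumes "\<gamma> > 0" shows "eventually (\<lambda>r::real. 1 \<le> \<gamma> * ln r \<and> \<gamma> * ln r \<le> (ln r)\<^sup>2) at_top"
proof (rule eventually_conj)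
 show "eventually (\<lambda>r. 1 \<le> \<gamma> * ln r) at_top" using assms by real_asymp
 show "eventually (\<lambda>r. \<gamma> * ln r \<le> (ln r)\<^sup>2) at_top" using assms by real_asymp
qed

text \<open>The common frame of the three models: a point of the process is a centre with a radius,
  a line, or a class of trajectories, and \<open>grain\<close> is the obstacle it stands for. The
  union describes \<open>C\<close> almost surely, so events are compared up to null sets.\<close>

locale poisson_cover =
 fixes M :: "'w measure" and \<mu> :: "'s measure" and \<alpha> :: real and X :: "'w \<Rightarrow> 's set"
  and grain :: "'s \<Rightarrow> (real^'n) set" and C :: "'w \<Rightarrow> (real^'n) set"
 assumes pp: "poisson_process M (scale_measure (ennreal \<alpha>) \<mu>) X"
  and C: "AE \<omega> in M. C \<omega> = (\<Union>g\<in>X \<omega>. grain g)" and \<alpha>: "\<alpha> > 0"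
begin

abbreviation "\<Lambda> \<equiv> scale_measure (ennreal \<alpha>) \<mu>"

sublocale prob_space M using pp by (simp add: poisson_process_def)

lemma intensity_le:
 assumes "ennreal \<alpha> * emeasure \<mu> A \<le> ennreal t" "0 \<le> t"
 shows "emeasure \<Lambda> A < \<infinity>" "measure \<Lambda> A \<le> t"
proof -
 have le: "emeasure \<Lambda> A \<le> ennreal t" using assms(1) by (simp add: emeasure_scale_measure)
 show "emeasure \<Lambda> A < \<infinity>" using le by (rule order.strict_trans1) simp
 show "measure \<Lambda> A \<le> t" using le assms(2) by (simp add: measure_def enn2real_leI)
qed

text \<open>A visible segment longer than \<open>ell r\<close> is cut to this length and compared
  with one from a finite family. \<open>H x y\<close> holds grains that block every segment with
  endpoints within \<open>\<delta>\<close> of \<open>x\<close> and \<open>y\<close>, so visibility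
  forces one of finitely many voids. Base points range over radius \<open>r\<close> but
  displacements only over radius \<open>ell r\<close>, which is why \<open>\<tau> > CARD('n)\<close>
  suffices.\<close>

lemma visibility_upper_tail:
 assumes \<delta>: "\<delta> > 0" and \<tau>: "\<tau> > real CARD('n)"
  and ell: "eventually (\<lambda>r. 1 \<le> ell r \<and> ell r \<le> (ln r)\<^sup>2) at_top"
  and H: "\<And>x y. H x y \<in> sets \<mu>"
  and blocks: "\<And>g x y x' y'. g \<in> H x y \<Longrightarrow> norm (x' - x) \<le> \<delta> \<Longrightarrow> norm (y' - y) \<le> \<delta> \<Longrightarrow> closed_segment x' y' \<inter> grain g \<noteq> {}"
  and mass: "eventually (\<lambda>r. \<forall>x y. ell r - 2 * \<delta> \<le> norm (x - y) \<and> norm (x - y) \<le> ell r + 2 * \<delta> \<longrightarrow>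
    emeasure \<mu> (H x y) < \<infinity> \<and> ennreal (\<tau> * ln r) \<le> ennreal \<alpha> * emeasure \<mu> (H x y)) at_top"
 shows "(\<lambda>r. prob_visibility_gt M C (ell r) r)
   \<in> O(\<lambda>r. r powr (- ((\<tau> - real CARD('n)) / 2)))"
proof -
 define d where "d = CARD('n)"
 \<comment> \<open>Base point and displacement each carry an error of at most
   \<open>\<delta> / 2\<close>, so both endpoints are off by at most
   \<open>\<delta>\<close>.\<close>
 obtain K where K: "K \<ge> 0" "\<And>R. R \<ge> 1 \<Longrightarrow> \<exists>G::(real^'n) set. finite G \<and> real (card G) \<le> K * R ^ d \<and> (\<forall>x\<in>cball 0 R. \<exists>g\<in>G. norm (x - g) \<le> \<delta> / 2)"
  unfolding d_def using exists_net[of "\<delta> / 2"] \<delta> by (metis half_gt_zero)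
 let ?V = "\<lambda>r. {\<omega> \<in> space M. max_visibility (C \<omega>) r > ereal (ell r)}"
 have bound: "eventually (\<lambda>r. prob (?V r) \<le> K\<^sup>2 * (r ^ d * ((ln r)\<^sup>2) ^ d * r powr - \<tau>)) at_top"
  using ell mass eventually_gt_at_top[of 1]
 proof eventually_elim
  case (elim r)
  then have r: "r > 1" and l: "1 \<le> ell r" "ell r \<le> (ln r)\<^sup>2" by auto
  obtain G1 where G1: "finite G1" "real (card G1) \<le> K * r ^ d" "\<And>x::real^'n. x \<in> cball 0 r \<Longrightarrow> \<exists>g\<in>G1. norm (x - g) \<le> \<delta> / 2"
   using K(2)[of r] r by auto
  obtain G2 where G2: "finite G2" "real (card G2) \<le> K * ell r ^ d" "\<And>x::real^'n. x \<in> cball 0 (ell r) \<Longrightarrow> \<exists>g\<in>G2. norm (x - g) \<le> \<delta> / 2"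
   using K(2)[of "ell r"] l by auto
  define I where "I = {(g, v) \<in> G1 \<times> G2. ell r - 2 * \<delta> \<le> norm v \<and> norm v \<le> ell r + 2 * \<delta>}"
  have I: "finite I" "I \<subseteq> G1 \<times> G2" using G1 G2 by (auto simp: I_def)
  define A where "A p = H (fst p) (fst p + snd p)" for p
  have A: "A p \<in> sets \<Lambda>" "emeasure \<Lambda> (A p) < \<infinity>" "\<tau> * ln r \<le> measure \<Lambda> (A p)" if "p \<in> I" for p
  proof -
   have "ell r - 2 * \<delta> \<le> norm (fst p - (fst p + snd p)) \<and> norm (fst p - (fst p + snd p)) \<le> ell r + 2 * \<delta>"
    using that by (auto simp: I_def)
   then have m: "emeasure \<mu> (A p) < \<infinity>" "ennreal (\<tau> * ln r) \<le> ennreal \<alpha> * emeasure \<mu> (A p)"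
    using elim unfolding A_def by blast+
   show "A p \<in> sets \<Lambda>" by (simp add: A_def H)
   show fin: "emeasure \<Lambda> (A p) < \<infinity>" using m(1) by (simp add: emeasure_scale_measure ennreal_mult_less_top)
   have "ennreal (\<tau> * ln r) \<le> emeasure \<Lambda> (A p)" using m(2) by (simp add: emeasure_scale_measure)
   then show "\<tau> * ln r \<le> measure \<Lambda> (A p)"
    using fin by (metis emeasure_eq_ennreal_measure ennreal_le_iff infinity_ennreal_def less_irrefl measure_nonneg)
  qed
  define E where "E p = {\<omega> \<in> space M. X \<omega> \<inter> A p = {}}" for p
  have Em: "E p \<in> events" if "p \<in> I" for p
   unfolding E_def by (rule poisson_process_void(1)[OF pp A(1,2)[OF that]])
  have EP: "prob (E p) \<le> r powr - \<tau>" if "p \<in> I" for p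
  proof -
   have "prob (E p) = exp (- measure \<Lambda> (A p))" unfolding E_def by (rule poisson_process_void(2)[OF pp A(1,2)[OF that]])
   also have "... \<le> exp (- \<tau> * ln r)" using A(3)[OF that] by simp
   also have "... = r powr - \<tau>" using r by (simp add: powr_def)
   finally show ?thesis .
  qed
  have "prob (?V r) \<le> prob (\<Union>p\<in>I. E p)"
  proof (rule finite_measure_mono_AE)
   show "AE \<omega> in M. \<omega> \<in> ?V r \<longrightarrow> \<omega> \<in> (\<Union>p\<in>I. E p)"
    using C
   proof (rule AE_mp, intro AE_I2 impI)
    fix \<omega> assume \<omega>: "\<omega> \<in> space M" "\<omega> \<in> ?V r" and Ceq: "C \<omega> = (\<Union>g\<in>X \<omega>. grain g)"
    then obtain x y where xy: "x \<in> cball 0 r" "y \<in> cball 0 r" "norm (x - y) > ell r" "closed_segment x y \<inter> C \<omega> = {}"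
     using max_visibility_gtD by blast
    \<comment> \<open>The fraction of the segment to keep for its length to be exactly
      \<open>ell r\<close>.\<close>
    define c where "c = ell r / norm (y - x)"
    define v where "v = c *\<^sub>R (y - x)"
    have nxy: "norm (y - x) > ell r" using xy by (simp add: norm_minus_commute)
    have c: "c \<in> {0..1}" using nxy l by (auto simp: c_def divide_simps)
    have "norm (y - x) > 0" using nxy l by linarith
    then have nv: "norm v = ell r" using l by (auto simp: v_def c_def)
    have "x + v \<in> closed_segment x y" using c by (auto simp: v_def closed_segment_def algebra_simps intro!: exI[of _ c])
    then have sub: "closed_segment x (x + v) \<subseteq> closed_segment x y" by (simp add: subset_closed_segment)
    obtain g where g: "g \<in> G1" "norm (x - g) \<le> \<delta> / 2" using G1(3)[OF xy(1)] by blast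
    obtain v0 where v0: "v0 \<in> G2" "norm (v - v0) \<le> \<delta> / 2" using G2(3)[of v] nv by auto
    have "\<bar>norm v - norm v0\<bar> \<le> \<delta> / 2" using v0(2) norm_triangle_ineq3[of v v0] by linarith
    then have "ell r - 2 * \<delta> \<le> norm v0" "norm v0 \<le> ell r + 2 * \<delta>" using nv \<delta> by linarith+
    then have p: "(g, v0) \<in> I" using g v0 by (auto simp: I_def)
    have "X \<omega> \<inter> A (g, v0) = {}"
    proof (rule ccontr)
     assume "X \<omega> \<inter> A (g, v0) \<noteq> {}"
     then obtain h where h: "h \<in> X \<omega>" "h \<in> H g (g + v0)" by (auto simp: A_def)
     have "x + v - (g + v0) = (x - g) + (v - v0)" by simp
     then have "norm (x + v - (g + v0)) \<le> norm (x - g) + norm (v - v0)" by (metis norm_triangle_ineq)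
     then have "closed_segment x (x + v) \<inter> grain h \<noteq> {}" using g v0 \<delta> by (intro blocks[OF h(2)]) auto
     then show False using sub xy(4) h(1) unfolding Ceq by blast
    qed
    then show "\<omega> \<in> (\<Union>p\<in>I. E p)" using p \<omega>(1) by (auto simp: E_def)
   qed
   show "(\<Union>p\<in>I. E p) \<in> events" using Em I(1) by (intro sets.finite_UN) auto
  qed
  also have "... \<le> (\<Sum>p\<in>I. prob (E p))" using Em I(1) by (intro finite_measure_subadditive_finite) auto
  also have "... \<le> (\<Sum>p\<in>I. r powr - \<tau>)" by (intro sum_mono EP)
  also have "... = real (card I) * r powr - \<tau>" by simp
  also have "... \<le> (K * r ^ d * (K * ((ln r)\<^sup>2) ^ d)) * r powr - \<tau>"
  proof (rule mult_right_mono)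
   have "real (card I) \<le> real (card (G1 \<times> G2))" using card_mono[OF finite_cartesian_product[OF G1(1) G2(1)] I(2)] by (simp only: of_nat_le_iff)
   also have "... = real (card G1) * real (card G2)" by (simp add: card_cartesian_product)
   also have "... \<le> (K * r ^ d) * (K * ell r ^ d)" using G1(2) G2(2) K(1) r by (intro mult_mono) auto
   also have "... \<le> (K * r ^ d) * (K * ((ln r)\<^sup>2) ^ d)" using K(1) r l by (intro mult_left_mono power_mono) auto
   finally show "real (card I) \<le> K * r ^ d * (K * ((ln r)\<^sup>2) ^ d)" .
  qed simp
  also have "... = K\<^sup>2 * (r ^ d * ((ln r)\<^sup>2) ^ d * r powr - \<tau>)" by (simp add: power2_eq_square mult_ac)
  finally show ?case .
 qed
 define e where "e = real d"
 have e0: "e > 0" "\<tau> > e" using \<tau> by (auto simp: e_def d_def)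
 \<comment> \<open>Half of the surplus of \<open>\<tau>\<close> over the dimension is kept as the
   exponent; the other half absorbs the power of \<open>ln r\<close>.\<close>
 define k where "k = (\<tau> - e) / 2"
 have k: "k > 0" using e0 by (simp add: k_def)
 have "(\<lambda>r. prob (?V r)) \<in> O(\<lambda>r. (ln r) powr (2 * e) * r powr (- 2 * k))"
 proof (rule bigoI[where c="K\<^sup>2"])
  show "eventually (\<lambda>r. norm (prob (?V r)) \<le> K\<^sup>2 * norm ((ln r) powr (2 * e) * r powr (- 2 * k))) at_top"
   using bound eventually_gt_at_top[of 1]
  proof eventually_elim
   case (elim r)
   have "((ln r)\<^sup>2) ^ d = ln r ^ (2 * d)" by (simp add: power_mult)
   also have "... = (ln r) powr (real (2 * d))" by (rule powr_realpow[symmetric]) (use elim in simp)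
   also have "real (2 * d) = 2 * e" by (simp add: e_def)
   finally have 1: "((ln r)\<^sup>2) ^ d = (ln r) powr (2 * e)" .
   have "r ^ d * r powr - \<tau> = r powr e * r powr - \<tau>" using elim by (simp add: e_def powr_realpow)
   also have "... = r powr (e - \<tau>)" by (simp flip: powr_add)
   also have "e - \<tau> = - 2 * k" by (simp add: k_def field_simps)
   finally have 2: "r ^ d * r powr - \<tau> = r powr (- 2 * k)" .
   have "r ^ d * ((ln r)\<^sup>2) ^ d * r powr - \<tau> = (ln r) powr (2 * e) * r powr (- 2 * k)"
    unfolding 1 2[symmetric] by (simp only: mult_ac)
   with elim(1) have "prob (?V r) \<le> K\<^sup>2 * ((ln r) powr (2 * e) * r powr (- 2 * k))" by (simp only:)
   then show ?case by (simp add: abs_mult)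
  qed
 qed
 also have "(\<lambda>r. (ln r) powr (2 * e) * r powr (- 2 * k)) \<in> O(\<lambda>r. r powr (- k))" using e0(1) k by real_asymp
 finally show ?thesis by (simp add: d_def e_def k_def)
qed

context
 fixes ell lev :: "real \<Rightarrow> real" and u :: "real^'n" and \<tau> \<eta> :: real and H :: "real^'n \<Rightarrow> real^'n \<Rightarrow> 's set"
 assumes u: "norm u = 1" and \<tau>: "0 \<le> \<tau>" "\<tau> < real CARD('n)" and \<eta>: "\<eta> = (1 - \<tau> / real CARD('n)) / 2"
  and ell: "eventually (\<lambda>r. 1 \<le> ell r \<and> ell r \<le> (ln r)\<^sup>2) at_top"
  and lev: "eventually (\<lambda>r. lev r \<le> ell r) at_top"
  and H: "\<And>x y. H x y \<in> sets \<mu>"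
  and covers: "\<And>g x y. g \<in> space \<mu> \<Longrightarrow> closed_segment x y \<inter> grain g \<noteq> {} \<Longrightarrow> g \<in> H x y"
  and mass: "eventually (\<lambda>r. \<forall>x y. norm (x - y) = ell r \<longrightarrow> ennreal \<alpha> * emeasure \<mu> (H x y) \<le> ennreal (\<tau> * ln r)) at_top"
begin

text \<open>Second moment method: if most of the segments based at the points of a lattice of mesh
 \<open>r\<close> to the power \<open>\<eta>\<close> are almost independent, then one of them is visible.\<close>

lemma visibility_lower_tail:
 fixes err :: "real \<Rightarrow> real" and q :: "real \<Rightarrow> real^'n \<Rightarrow> real^'n \<Rightarrow> real"
 assumes overlap: "eventually (\<lambda>r. \<forall>x y. r powr \<eta> \<le> norm (x - y) \<longrightarrow> 0 \<le> q r x y \<and> q r x y \<le> K \<and>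
    ennreal \<alpha> * emeasure \<mu> (H x (x + ell r *\<^sub>R u) \<inter> H y (y + ell r *\<^sub>R u)) \<le> ennreal (q r x y)) at_top"
  and sum_q: "eventually (\<lambda>r. \<forall>N. r powr (1 - \<eta>) / (2 * real CARD('n)) \<le> real N + 1 \<longrightarrow>
   (\<Sum>j\<in>(lattice N :: (int^'n) set). \<Sum>k\<in>lattice N - {j}. q r (lattice_point (r powr \<eta>) j) (lattice_point (r powr \<eta>) k))
    \<le> A * err r * (real (card (lattice N :: (int^'n) set)))\<^sup>2) at_top"
  and err: "eventually (\<lambda>r. err r \<ge> 0) at_top" and A: "A \<ge> 0"
 shows "(\<lambda>r. prob_visibility_lt M C (lev r) r)
   \<in> O(\<lambda>r. r powr (- ((real CARD('n) - \<tau>) / 2)) + err r)"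
proof -
 define d where "d = CARD('n)"
 have d: "d > 0" by (simp add: d_def)
 have \<eta>01: "0 < \<eta>" "\<eta> < 1" using \<tau> by (auto simp: \<eta> field_simps)
 define c where "c = (2 * real d) ^ d"
 have c: "c \<ge> 1" using d unfolding c_def by (intro one_le_power) simp
 have lnr: "eventually (\<lambda>r::real. (ln r)\<^sup>2 \<le> r / 2) at_top" by real_asymp
 let ?V = "\<lambda>r. {\<omega> \<in> space M. max_visibility (C \<omega>) r < ereal (lev r)}"
 let ?p = "\<lambda>r. r powr (- ((real d - \<tau>) / 2))"
 show ?thesis
 proof (rule bigoI[where c="c + exp K * A"])
  show "eventually (\<lambda>r. norm (prob (?V r)) \<le> (c + exp K * A) * norm (r powr (- ((real CARD('n) - \<tau>) / 2)) + err r)) at_top"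
   using ell mass overlap sum_q lnr eventually_gt_at_top[of 1] lev err
  proof eventually_elim
   case (elim r)
   then have r: "r > 1" and l: "1 \<le> ell r" "ell r \<le> r / 2" and levr: "ereal (lev r) \<le> ereal (ell r)"
    and ov: "\<And>x y. r powr \<eta> \<le> norm (x - y) \<Longrightarrow> 0 \<le> q r x y" "\<And>x y. r powr \<eta> \<le> norm (x - y) \<Longrightarrow> q r x y \<le> K"
     "\<And>x y. r powr \<eta> \<le> norm (x - y) \<Longrightarrow> ennreal \<alpha> * emeasure \<mu> (H x (x + ell r *\<^sub>R u) \<inter> H y (y + ell r *\<^sub>R u)) \<le> ennreal (q r x y)"
    by auto
   define D where "D = r powr \<eta>"
   have D: "D > 0" using r by (simp add: D_def)
   \<comment> \<open>With at most this many lattice steps in each coordinate the base points stay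
     within \<open>r / 2\<close>, which leaves room for the segments inside the ball of radius
     \<open>r\<close>.\<close>
   define t where "t = r powr (1 - \<eta>) / (2 * real d)"
   have t: "t > 0" using r d by (simp add: t_def)
   define N where "N = nat \<lfloor>t\<rfloor>"
   have N: "real N \<le> t" "t \<le> real N + 1" using t unfolding N_def by linarith+
   let ?I = "lattice N :: (int^'n) set"
   define n where "n = real (card ?I)"
   have ne: "(0 :: int^'n) \<in> ?I" by (simp add: lattice_def)
   have n_eq: "n = (2 * real N + 1) ^ d" by (simp add: n_def card_lattice d_def add.commute)
   have n: "n > 0" unfolding n_eq by simp
   define x where "x k = lattice_point D k" for k :: "int^'n"
   define B where "B k = H (x k) (x k + ell r *\<^sub>R u)" for k
   have nu: "norm (ell r *\<^sub>R u) = ell r" using u l by simp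
   have B: "B k \<in> sets \<Lambda>" "emeasure \<Lambda> (B k) < \<infinity>" "measure \<Lambda> (B k) \<le> \<tau> * ln r" for k
   proof -
    have "norm (x k - (x k + ell r *\<^sub>R u)) = ell r" using nu by simp
    then have "ennreal \<alpha> * emeasure \<mu> (B k) \<le> ennreal (\<tau> * ln r)" using elim unfolding B_def by blast
    from intensity_le[OF this] show "emeasure \<Lambda> (B k) < \<infinity>" "measure \<Lambda> (B k) \<le> \<tau> * ln r" using \<tau> r by auto
   qed (simp add: B_def H)
   let ?S = "{\<omega> \<in> space M. \<forall>k\<in>?I. X \<omega> \<inter> B k \<noteq> {}}"
   have "prob (?V r) \<le> prob ?S"
   proof (rule finite_measure_mono_AE)
    show "AE \<omega> in M. \<omega> \<in> ?V r \<longrightarrow> \<omega> \<in> ?S" using C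
    proof (rule AE_mp, intro AE_I2 impI CollectI conjI ballI notI)
     fix \<omega> k assume \<omega>: "\<omega> \<in> space M" "\<omega> \<in> ?V r" and k: "k \<in> ?I"
      and Ceq: "C \<omega> = (\<Union>g\<in>X \<omega>. grain g)" and em: "X \<omega> \<inter> B k = {}"
     have "norm (x k) \<le> real d * D * real N" unfolding x_def d_def using norm_lattice_point_le[OF k] D by simp
     also have "... \<le> real d * D * t" using N D by (intro mult_left_mono) auto
     also have "... = r / 2" using d r by (simp add: D_def t_def flip: powr_add)
     finally have xk: "norm (x k) \<le> r / 2" .
     have "norm (x k + ell r *\<^sub>R u) \<le> norm (x k) + norm (ell r *\<^sub>R u)" by (rule norm_triangle_ineq)
     then have "x k + ell r *\<^sub>R u \<in> cball 0 r" using xk nu l by simp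
     moreover have "x k \<in> cball 0 r" using xk r by simp
     moreover have "norm (x k - (x k + ell r *\<^sub>R u)) \<ge> ell r" using nu by simp
     ultimately have "closed_segment (x k) (x k + ell r *\<^sub>R u) \<inter> C \<omega> \<noteq> {}"
      using \<omega>(2) levr max_visibility_ltD[of "C \<omega>" r "ell r" "x k" "x k + ell r *\<^sub>R u"] order.strict_trans2 by blast
     then obtain g where g: "g \<in> X \<omega>" "closed_segment (x k) (x k + ell r *\<^sub>R u) \<inter> grain g \<noteq> {}" unfolding Ceq by blast
     have "X \<omega> \<subseteq> space \<mu>" using pp \<omega>(1) unfolding poisson_process_def space_scale_measure by blast
     then have "g \<in> B k" unfolding B_def using g by (intro covers) auto
     then show False using em g(1) by blast
    qed simp
    have "?S = space M - (\<Union>k\<in>?I. {\<omega> \<in> space M. X \<omega> \<inter> B k = {}})" by auto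
    also have "... \<in> events"
     using poisson_process_void(1)[OF pp B(1,2)] by (intro sets.Diff sets.finite_UN finite_lattice) auto
    finally show "?S \<in> events" .
   qed
   also have "... \<le> (\<Sum>i\<in>?I. \<Sum>j\<in>?I. exp (measure \<Lambda> (B i \<inter> B j)) - 1) / n\<^sup>2"
    unfolding n_def by (rule poisson_all_hit_le[OF pp finite_lattice]) (use ne B in auto)
   \<comment> \<open>The diagonal terms may be as large as \<open>r powr \<tau>\<close>, and only
     the number of base points beats them; the overlap bound applies off the diagonal.\<close>
   also have "(\<Sum>i\<in>?I. \<Sum>j\<in>?I. exp (measure \<Lambda> (B i \<inter> B j)) - 1) =
     (\<Sum>i\<in>?I. exp (measure \<Lambda> (B i)) - 1) + (\<Sum>i\<in>?I. \<Sum>j\<in>?I - {i}. exp (measure \<Lambda> (B i \<inter> B j)) - 1)"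
    unfolding sum.distrib[symmetric]
   proof (rule sum.cong[OF refl])
    fix i assume i: "i \<in> ?I"
    show "(\<Sum>j\<in>?I. exp (measure \<Lambda> (B i \<inter> B j)) - 1) = exp (measure \<Lambda> (B i)) - 1 + (\<Sum>j\<in>?I - {i}. exp (measure \<Lambda> (B i \<inter> B j)) - 1)"
     by (subst sum.remove[OF finite_lattice i]) simp
   qed
   also have "... / n\<^sup>2 \<le> (n * r powr \<tau> + exp K * A * err r * n\<^sup>2) / n\<^sup>2"
   proof (intro divide_right_mono add_mono)
    have "exp (measure \<Lambda> (B i)) - 1 \<le> r powr \<tau>" for i
    proof -
     have "exp (measure \<Lambda> (B i)) \<le> exp (\<tau> * ln r)" using B(3) by simp
     moreover have "r powr \<tau> = exp (\<tau> * ln r)" using r by (simp add: powr_def)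
     ultimately show ?thesis by linarith
    qed
    then show "(\<Sum>i\<in>?I. exp (measure \<Lambda> (B i)) - 1) \<le> n * r powr \<tau>"
     using sum_mono[of ?I "\<lambda>i. exp (measure \<Lambda> (B i)) - 1" "\<lambda>i. r powr \<tau>"] by (simp add: n_def)
    have "(\<Sum>i\<in>?I. \<Sum>j\<in>?I - {i}. exp (measure \<Lambda> (B i \<inter> B j)) - 1) \<le> (\<Sum>i\<in>?I. \<Sum>j\<in>?I - {i}. exp K * q r (x i) (x j))"
    proof (intro sum_mono)
     fix i j assume "j \<in> ?I - {i}"
     then have far: "r powr \<eta> \<le> norm (x i - x j)" unfolding x_def D_def using r by (intro lattice_point_separated) auto
     have "measure \<Lambda> (B i \<inter> B j) \<le> q r (x i) (x j)"
      unfolding B_def by (rule intensity_le(2)[OF ov(3)[OF far] ov(1)[OF far]])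
     then have "exp (measure \<Lambda> (B i \<inter> B j)) - 1 \<le> exp (q r (x i) (x j)) - 1" by simp
     also have "... \<le> exp K * q r (x i) (x j)" using ov(1,2)[OF far] by (rule exp_minus_one_le)
     finally show "exp (measure \<Lambda> (B i \<inter> B j)) - 1 \<le> exp K * q r (x i) (x j)" .
    qed
    also have "... = exp K * (\<Sum>i\<in>?I. \<Sum>j\<in>?I - {i}. q r (x i) (x j))" by (simp add: sum_distrib_left)
    also have "... \<le> exp K * (A * err r * n\<^sup>2)"
     using elim(4) N(2) unfolding x_def n_def D_def t_def d_def by (intro mult_left_mono) auto
    finally show "(\<Sum>i\<in>?I. \<Sum>j\<in>?I - {i}. exp (measure \<Lambda> (B i \<inter> B j)) - 1) \<le> exp K * A * err r * n\<^sup>2" by (simp only: mult.assoc)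
   qed simp
   also have "... = r powr \<tau> / n + exp K * A * err r" using n by (simp add: add_divide_distrib power2_eq_square)
   also have "r powr \<tau> / n \<le> c * ?p r"
   proof -
    \<comment> \<open>The choice of \<open>\<eta>\<close> puts \<open>real d * (1 - \<eta>)\<close>,
      the exponent of the number of base points, halfway between \<open>\<tau>\<close> and
      \<open>d\<close>.\<close>
    have e: "\<tau> - real d * (1 - \<eta>) = - ((real d - \<tau>) / 2)" using d by (simp add: \<eta> d_def field_simps)
    have "t ^ d \<le> n" unfolding n_eq using N t by (intro power_mono) auto
    moreover have "t ^ d = r powr (real d * (1 - \<eta>)) / c"
     using r by (simp add: t_def c_def power_divide powr_realpow[symmetric] powr_powr mult.commute)
    ultimately have "r powr (real d * (1 - \<eta>)) / c \<le> n" by simp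
    then have "r powr \<tau> / n \<le> r powr \<tau> / (r powr (real d * (1 - \<eta>)) / c)"
     using r c n by (intro divide_left_mono mult_pos_pos) auto
    also have "... = c * r powr (\<tau> - real d * (1 - \<eta>))" by (simp add: powr_diff)
    finally show ?thesis unfolding e .
   qed
   finally have "prob (?V r) \<le> c * ?p r + exp K * A * err r" by simp
   also have "... \<le> (c + exp K * A) * (?p r + err r)"
   proof -
    have "0 \<le> c * err r" "0 \<le> exp K * A * ?p r" using c elim A by auto
    then show ?thesis by (simp add: distrib_left distrib_right)
   qed
   finally show ?case using elim by (simp add: d_def)
  qed
 qed
qed

text \<open>The case of cylinders and interlacements, where the overlap of distant segments is
  uniformly small and the sum over pairs is estimated termwise.\<close>

lemma visibility_lower_tail_decorrelated:
 assumes \<epsilon>: "\<epsilon> > 0"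
  and overlap: "eventually (\<lambda>r. \<forall>x y. r powr \<eta> \<le> norm (x - y) \<longrightarrow>
    ennreal \<alpha> * emeasure \<mu> (H x (x + ell r *\<^sub>R u) \<inter> H y (y + ell r *\<^sub>R u)) \<le> ennreal (r powr (- \<epsilon>))) at_top"
 shows "(\<lambda>r. prob_visibility_lt M C (lev r) r)
   \<in> O(\<lambda>r. r powr (- min ((real CARD('n) - \<tau>) / 2) \<epsilon>))"
proof -
 have "(\<lambda>r. prob_visibility_lt M C (lev r) r)
   \<in> O(\<lambda>r. r powr (- ((real CARD('n) - \<tau>) / 2)) + r powr (- \<epsilon>))"
 proof (rule visibility_lower_tail[where q="\<lambda>r x y. r powr (- \<epsilon>)" and K=1 and A=1])
  show "eventually (\<lambda>r. \<forall>x y. r powr \<eta> \<le> norm (x - y) \<longrightarrow> 0 \<le> r powr (- \<epsilon>) \<and> r powr (- \<epsilon>) \<le> 1 \<and>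
    ennreal \<alpha> * emeasure \<mu> (H x (x + ell r *\<^sub>R u) \<inter> H y (y + ell r *\<^sub>R u)) \<le> ennreal (r powr (- \<epsilon>))) at_top"
   using overlap eventually_gt_at_top[of 1]
  proof eventually_elim
   case (elim r)
   have "r powr (- \<epsilon>) \<le> r powr 0" using elim(2) \<epsilon> by (intro powr_mono) auto
   then show ?case using elim by simp
  qed
  show "eventually (\<lambda>r. \<forall>N. r powr (1 - \<eta>) / (2 * real CARD('n)) \<le> real N + 1 \<longrightarrow>
   (\<Sum>j\<in>(lattice N :: (int^'n) set). \<Sum>k\<in>lattice N - {j}. r powr (- \<epsilon>)) \<le> 1 * r powr (- \<epsilon>) * (real (card (lattice N :: (int^'n) set)))\<^sup>2) at_top"
  proof (intro always_eventually allI impI)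
   fix r :: real and N :: nat
   let ?I = "lattice N :: (int^'n) set"
   have "(\<Sum>j\<in>?I. \<Sum>k\<in>?I - {j}. r powr (- \<epsilon>)) \<le> (\<Sum>j\<in>?I. \<Sum>k\<in>?I. r powr (- \<epsilon>))"
    by (intro sum_mono sum_mono2 finite_lattice) auto
   then show "(\<Sum>j\<in>?I. \<Sum>k\<in>?I - {j}. r powr (- \<epsilon>)) \<le> 1 * r powr (- \<epsilon>) * (real (card ?I))\<^sup>2" by (simp add: power2_eq_square mult_ac)
  qed
 qed auto
 also have "(\<lambda>r. r powr (- ((real CARD('n) - \<tau>) / 2)) + r powr (- \<epsilon>)) \<in> O(\<lambda>r. r powr (- min ((real CARD('n) - \<tau>) / 2) \<epsilon>))"
 proof (rule bigoI[where c=2])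
  show "eventually (\<lambda>r. norm (r powr (- ((real CARD('n) - \<tau>) / 2)) + r powr (- \<epsilon>)) \<le> 2 * norm (r powr (- min ((real CARD('n) - \<tau>) / 2) \<epsilon>))) at_top"
   using eventually_ge_at_top[of 1]
  proof eventually_elim
   case (elim r)
   have "r powr (- ((real CARD('n) - \<tau>) / 2)) \<le> r powr (- min ((real CARD('n) - \<tau>) / 2) \<epsilon>)" "r powr (- \<epsilon>) \<le> r powr (- min ((real CARD('n) - \<tau>) / 2) \<epsilon>)"
    by (rule powr_mono[OF _ elim], simp only: neg_le_iff_le min.cobounded1 min.cobounded2)+
   then show ?case by simp
  qed
 qed
 finally show ?thesis .
qed

end

text \<open>Half of the surplus of \<open>\<alpha> * a * \<gamma>\<close> over the dimension absorbs
  the length \<open>2 * \<delta>\<close> lost to the net; \<open>visibility_upper_tail\<close>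
  halves the rest, whence the quarter in the exponent.\<close>

lemma log_visibility_upper_tail:
 assumes \<delta>: "\<delta> > 0" and a: "a \<ge> 0" and \<gamma>: "real CARD('n) < \<alpha> * a * \<gamma>"
  and H: "\<And>x y. H x y \<in> sets \<mu>"
  and blocks: "\<And>g x y x' y'. g \<in> H x y \<Longrightarrow> norm (x' - x) \<le> \<delta> \<Longrightarrow> norm (y' - y) \<le> \<delta> \<Longrightarrow> closed_segment x' y' \<inter> grain g \<noteq> {}"
  and mass: "\<And>x y. emeasure \<mu> (H x y) < \<infinity>" "\<And>x y. ennreal (a * norm (x - y)) \<le> emeasure \<mu> (H x y)"
 shows "(\<lambda>r. prob_visibility_gt M C (\<gamma> * ln r) r) \<in> O(\<lambda>r. r powr (- ((\<alpha> * a * \<gamma> - real CARD('n)) / 4)))"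
proof -
 define k where "k = \<alpha> * a"
 define \<tau> where "\<tau> = (real CARD('n) + k * \<gamma>) / 2"
 have \<tau>: "real CARD('n) < \<tau>" "\<tau> < k * \<gamma>" using \<gamma> unfolding \<tau>_def k_def by argo+
 have k: "k \<ge> 0" using a \<alpha> by (simp add: k_def)
 have "k * \<gamma> > 0" using \<tau> by linarith
 then have \<gamma>0: "\<gamma> > 0" and k0: "k > 0" using k by (auto simp: zero_less_mult_iff)
 have ev: "eventually (\<lambda>r. \<tau> * ln r \<le> k * (\<gamma> * ln r - 2 * \<delta>)) at_top" using \<tau>(2) k0 by real_asymp
 have "(\<lambda>r. prob_visibility_gt M C (\<gamma> * ln r) r) \<in> O(\<lambda>r. r powr (- ((\<tau> - real CARD('n)) / 2)))"
 proof (rule visibility_upper_tail[OF \<delta> \<tau>(1) log_scale_bounds[OF \<gamma>0] H blocks])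
  show "eventually (\<lambda>r. \<forall>x y. \<gamma> * ln r - 2 * \<delta> \<le> norm (x - y) \<and> norm (x - y) \<le> \<gamma> * ln r + 2 * \<delta> \<longrightarrow>
    emeasure \<mu> (H x y) < \<infinity> \<and> ennreal (\<tau> * ln r) \<le> ennreal \<alpha> * emeasure \<mu> (H x y)) at_top"
   using ev
  proof eventually_elim
   case (elim r)
   show ?case
   proof (intro allI impI conjI mass(1))
    fix x y :: "real^'n" assume len: "\<gamma> * ln r - 2 * \<delta> \<le> norm (x - y) \<and> norm (x - y) \<le> \<gamma> * ln r + 2 * \<delta>"
    have "k * (\<gamma> * ln r - 2 * \<delta>) \<le> k * norm (x - y)" using len k by (intro mult_left_mono) auto
    then have "\<tau> * ln r \<le> \<alpha> * (a * norm (x - y))" using elim by (simp add: k_def)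
    then have "ennreal (\<tau> * ln r) \<le> ennreal \<alpha> * ennreal (a * norm (x - y))"
     using \<alpha> by (subst ennreal_mult'[symmetric]) (auto intro: ennreal_leI)
    also have "... \<le> ennreal \<alpha> * emeasure \<mu> (H x y)" by (intro mult_left_mono mass(2)) simp
    finally show "ennreal (\<tau> * ln r) \<le> ennreal \<alpha> * emeasure \<mu> (H x y)" .
   qed
  qed
 qed
 moreover have "(\<tau> - real CARD('n)) / 2 = (k * \<gamma> - real CARD('n)) / 4" by (simp add: \<tau>_def field_simps)
 ultimately show ?thesis by (simp only: k_def)
qed

text \<open>The bounded contribution \<open>b\<close> of the ends of a segment is absorbed by the
  gap between \<open>\<alpha> * a * \<gamma>\<close> and \<open>\<tau>\<close>.\<close>

lemma log_mass_le:
 assumes a: "a \<ge> 0" and b: "b \<ge> 0" and \<gamma>: "\<gamma> > 0" and \<tau>: "\<alpha> * a * \<gamma> < \<tau>"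
  and mass: "\<And>x y. emeasure \<mu> (H x y) \<le> ennreal (a * norm (x - y) + b)"
 shows "eventually (\<lambda>r. \<forall>x y. norm (x - y :: real^'n) = \<gamma> * ln r \<longrightarrow> ennreal \<alpha> * emeasure \<mu> (H x y) \<le> ennreal (\<tau> * ln r)) at_top"
proof -
 define k c where "k = \<alpha> * a * \<gamma>" "c = \<alpha> * b"
 have "k < \<tau>" using \<tau> by (simp add: k_c_def)
 then have "eventually (\<lambda>r. k * ln r + c \<le> \<tau> * ln r) at_top" by real_asymp
 then show ?thesis
 proof eventually_elim
  case (elim r)
  show ?case
  proof (intro allI impI)
   fix x y :: "real^'n" assume xy: "norm (x - y) = \<gamma> * ln r"
   have "ennreal \<alpha> * emeasure \<mu> (H x y) \<le> ennreal \<alpha> * ennreal (a * norm (x - y) + b)" by (intro mult_left_mono mass) simp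
   also have "... = ennreal (\<alpha> * (a * norm (x - y) + b))" using \<alpha> by (subst ennreal_mult'[symmetric]) auto
   also have "... \<le> ennreal (\<tau> * ln r)" using elim unfolding xy k_c_def by (intro ennreal_leI) (simp add: algebra_simps)
   finally show "ennreal \<alpha> * emeasure \<mu> (H x y) \<le> ennreal (\<tau> * ln r)" .
  qed
 qed
qed

lemma log_lev:
 assumes "\<gamma>' \<le> \<gamma>" shows "eventually (\<lambda>r::real. \<gamma>' * ln r \<le> \<gamma> * ln r) at_top"
 using eventually_ge_at_top[of 1] by eventually_elim (simp add: assms mult_right_mono)

end

section \<open>Brownian interlacements\<close>

text \<open>For \<open>d \<ge> 4\<close> the Newtonian capacity of a ball of radius \<open>s\<close>
  in dimension \<open>d - 1\<close>, which is the capacity per unit length of a long cylinder in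
  dimension \<open>d\<close> and the inverse of the limit of \<open>line_green\<close>.\<close>

definition cylinder_capacity :: "nat \<Rightarrow> real \<Rightarrow> real" where
 "cylinder_capacity d s = 2 * pi powr (real (d - 1) / 2) * s ^ (d - 3) / Gamma (real (d - 3) / 2)"

lemma cylinder_capacity_pos: "d \<ge> 4 \<Longrightarrow> s > 0 \<Longrightarrow> cylinder_capacity d s > 0"
 unfolding cylinder_capacity_def by (intro divide_pos_pos mult_pos_pos Gamma_real_pos) auto

lemma inverse_cylinder_capacity:
 assumes "d \<ge> 4" "s > 0"
 shows "Gamma (real (d - 3) / 2) / (2 * pi powr (real (d - 1) / 2)) * s powr (3 - real d) = 1 / cylinder_capacity d s"
proof -
 have "s powr (3 - real d) = 1 / s ^ (d - 3)"
  using assms by (simp add: powr_minus_divide[symmetric] powr_realpow[symmetric] of_nat_diff)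
 then show ?thesis by (simp add: cylinder_capacity_def)
qed

lemma eventually_at_right_obtain:
 fixes b :: real
 assumes "eventually P (at_right 0)" "b > 0" obtains \<delta> where "P \<delta>" "\<delta> < b" "0 < \<delta>"
proof -
 obtain c where c: "c > 0" "\<And>y. 0 < y \<Longrightarrow> y < c \<Longrightarrow> P y" using assms(1) unfolding eventually_at_right_field by blast
 obtain \<delta> where "0 < \<delta>" "\<delta> < min b c" using dense[of 0 "min b c"] assms(2) c(1) by auto
 then show ?thesis by (intro that[of \<delta>] c(2)) auto
qed

lemma ennreal_divide_left_mono: "b \<le> c \<Longrightarrow> a / c \<le> a / (b :: ennreal)"
 proof -
 assume "b \<le> c"
 then have "inverse c \<le> inverse b" by (simp add: less_eq_ennreal.rep_eq inverse_ennreal.rep_eq ereal_inverse_antimono)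
 then show ?thesis unfolding divide_ennreal_def by (rule mult_left_mono) simp
qed

lemma interlacement_const_pos:
 assumes "d \<ge> 3" "\<rho> > 0" shows "visibility_const Interlacements d \<rho> Q > 0"
proof (cases "d = 3")
 case False
 then have "cylinder_capacity d \<rho> > 0" using assms by (intro cylinder_capacity_pos) auto
 then show ?thesis using False by (simp add: cylinder_capacity_def)
qed simp

text \<open>\<open>w r\<close> is a lower bound for the inverse of \<open>line_green\<close>, that
  is, for the capacity per unit length, common to all lengths in the window.\<close>

lemma line_green_le_imp_tube_lower:
 assumes \<alpha>: "\<alpha> > 0" and lim: "((\<lambda>r. \<alpha> * ((q r - b) * w r) / ln r) \<longlongrightarrow> \<kappa>) at_top" "\<tau> < \<kappa>"
  and q: "eventually (\<lambda>r. q r > b) at_top"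
  and w: "\<And>r len. 0 < len \<Longrightarrow> len \<le> q r + b \<Longrightarrow> w r > 0 \<and> line_green d len s \<le> ennreal (1 / w r)"
 shows "eventually (\<lambda>r. \<forall>len. q r - b \<le> len \<and> len \<le> q r + b \<longrightarrow>
  0 < len \<and> ennreal (\<tau> * ln r) \<le> ennreal \<alpha> * (ennreal len / line_green d len s)) at_top"
 using order_tendstoD(1)[OF lim] q eventually_gt_at_top[of 1]
proof eventually_elim
 case (elim r)
 show ?case
 proof (intro allI impI, elim conjE)
  fix len assume len: "q r - b \<le> len" "len \<le> q r + b"
  have len0: "len > 0" using len elim by linarith
  note w = w[OF len0 len(2)]
  have "\<tau> * ln r \<le> \<alpha> * ((q r - b) * w r)" using elim by (intro less_imp_le) (metis ln_gt_zero pos_less_divide_eq)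
  also have "... \<le> \<alpha> * (len * w r)" using \<alpha> w len by (intro mult_left_mono mult_right_mono) auto
  finally have "ennreal (\<tau> * ln r) \<le> ennreal (\<alpha> * (len * w r))" by (rule ennreal_leI)
  also have "... = ennreal \<alpha> * (ennreal len / ennreal (1 / w r))"
   using \<alpha> len0 w by (simp add: divide_ennreal ennreal_mult[symmetric])
  also have "... \<le> ennreal \<alpha> * (ennreal len / line_green d len s)"
   using w by (intro mult_left_mono ennreal_divide_left_mono) auto
  finally show "0 < len \<and> ennreal (\<tau> * ln r) \<le> ennreal \<alpha> * (ennreal len / line_green d len s)" using len0 by simp
 qed
qed

text \<open>\<open>L r\<close> is the overhang of the comparison segment: long enough for
  \<open>line_green\<close> to be close to its final size, and short enough to change the leading
  constant by little.\<close>

lemma le_line_green_imp_tube_upper: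
 assumes \<alpha>: "\<alpha> > 0" and lim: "((\<lambda>r. \<alpha> * ((q r + 2 * L r + 2 * s) * w r) / ln r) \<longlongrightarrow> \<kappa>) at_top" "\<kappa> < \<tau>" and s: "s > 0"
  and w: "eventually (\<lambda>r. 0 \<le> q r \<and> 0 < L r \<and> 0 < w r \<and> ennreal (1 / w r) \<le> line_green d (L r) s) at_top"
 shows "eventually (\<lambda>r. \<exists>L>0. ennreal \<alpha> * (ennreal (q r + 2 * L + 2 * s) / line_green d L s) \<le> ennreal (\<tau> * ln r)) at_top"
 using order_tendstoD(2)[OF lim] w eventually_gt_at_top[of 1]
proof eventually_elim
 case (elim r)
 then have w: "0 \<le> q r" "0 < L r" "0 < w r" "ennreal (1 / w r) \<le> line_green d (L r) s" by auto
 have "ennreal \<alpha> * (ennreal (q r + 2 * L r + 2 * s) / line_green d (L r) s) \<le> ennreal \<alpha> * (ennreal (q r + 2 * L r + 2 * s) / ennreal (1 / w r))"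
  using w(4) by (intro mult_left_mono ennreal_divide_left_mono) auto
 also have "... = ennreal (\<alpha> * ((q r + 2 * L r + 2 * s) * w r))"
 proof -
  have "q r + 2 * L r + 2 * s \<ge> 0" using w s by linarith
  then show ?thesis using \<alpha> w(3) by (simp add: divide_ennreal ennreal_mult[symmetric])
 qed
 also have "... \<le> ennreal (\<tau> * ln r)"
  using elim by (intro ennreal_leI less_imp_le) (metis ln_gt_zero pos_divide_less_eq)
 finally show ?case using w(2) by blast
qed

lemma interlacement_tube_lower:
 assumes d: "d \<ge> 3" and \<alpha>: "\<alpha> > 0" and \<rho>: "\<rho> > 0"
  and \<gamma>: "real d < \<alpha> * visibility_const Interlacements d \<rho> Q * \<gamma>"
 shows "\<gamma> > 0" and "\<exists>\<delta> \<tau>. 0 < \<delta> \<and> 2 * \<delta> < \<rho> \<and> real d < \<tau> \<and>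
  eventually (\<lambda>r. \<forall>len. \<gamma> * visibility_scale Interlacements d r - 2 * \<delta> \<le> len \<and> len \<le> \<gamma> * visibility_scale Interlacements d r + 2 * \<delta> \<longrightarrow>
   0 < len \<and> ennreal (\<tau> * ln r) \<le> ennreal \<alpha> * (ennreal len / line_green d len (\<rho> - 2 * \<delta>))) at_top"
proof -
 have "0 < (\<alpha> * visibility_const Interlacements d \<rho> Q) * \<gamma>" using \<gamma> by linarith
 moreover have "0 < \<alpha> * visibility_const Interlacements d \<rho> Q"
  using \<alpha> interlacement_const_pos[OF d \<rho>, of Q] by (rule mult_pos_pos)
 ultimately show \<gamma>0: "\<gamma> > 0" by (rule zero_less_mult_pos)
 obtain \<tau> where \<tau>: "real d < \<tau>" "\<tau> < \<alpha> * visibility_const Interlacements d \<rho> Q * \<gamma>" using dense[OF \<gamma>] by blast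
 show "\<exists>\<delta> \<tau>. 0 < \<delta> \<and> 2 * \<delta> < \<rho> \<and> real d < \<tau> \<and>
  eventually (\<lambda>r. \<forall>len. \<gamma> * visibility_scale Interlacements d r - 2 * \<delta> \<le> len \<and> len \<le> \<gamma> * visibility_scale Interlacements d r + 2 * \<delta> \<longrightarrow>
   0 < len \<and> ennreal (\<tau> * ln r) \<le> ennreal \<alpha> * (ennreal len / line_green d len (\<rho> - 2 * \<delta>))) at_top"
 proof (cases "d = 3")
  case True
  \<comment> \<open>In dimension 3 the radius enters only inside a logarithm, so a fixed fraction of
    it can be given up.\<close>
  define \<delta> s where "\<delta> = \<rho> / 4" and "s = \<rho> - 2 * \<delta>"
  have s: "s > 0" "\<delta> > 0" "2 * \<delta> < \<rho>" using \<rho> by (auto simp: s_def \<delta>_def)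
  let ?q = "\<lambda>r. \<gamma> * (ln r * ln (ln r))"
  define w where "w r = pi / ln (2 * ((?q r + 2 * \<delta>) / s) + 1)" for r
  have "eventually (\<lambda>r. \<forall>len. ?q r - 2 * \<delta> \<le> len \<and> len \<le> ?q r + 2 * \<delta> \<longrightarrow>
    0 < len \<and> ennreal (\<tau> * ln r) \<le> ennreal \<alpha> * (ennreal len / line_green 3 len s)) at_top"
  proof (rule line_green_le_imp_tube_lower[OF \<alpha>])
   show "((\<lambda>r. \<alpha> * ((?q r - 2 * \<delta>) * w r) / ln r) \<longlongrightarrow> \<alpha> * pi * \<gamma>) at_top"
    unfolding w_def using \<gamma>0 s \<alpha> by real_asymp
   show "\<tau> < \<alpha> * pi * \<gamma>" using \<tau> True by simp
   show "eventually (\<lambda>r. ?q r > 2 * \<delta>) at_top" using \<gamma>0 by real_asymp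
   fix r len assume len: "0 < len" "len \<le> ?q r + 2 * \<delta>"
   have "arsinh (len / s) \<le> ln (2 * (len / s) + 1)" using len s by (intro arsinh_bounds) auto
   also have "... \<le> ln (2 * ((?q r + 2 * \<delta>) / s) + 1)"
    using len s by (subst ln_le_cancel_iff) (auto intro!: divide_right_mono add_pos_pos add_nonneg_pos)
   finally have "line_green 3 len s \<le> ennreal (1 / w r)"
    unfolding line_green_3[OF s(1) len(1)] w_def by (intro ennreal_leI) (simp add: divide_right_mono)
   moreover have "1 < 2 * ((?q r + 2 * \<delta>) / s) + 1" using len s by simp
   ultimately show "w r > 0 \<and> line_green 3 len s \<le> ennreal (1 / w r)" by (simp add: w_def)
  qed
  then show ?thesis using s \<tau> True
   by (intro exI[of _ \<delta>] exI[of _ \<tau>]) (simp add: visibility_scale_def s_def)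
 next
  case False
  then have d4: "d \<ge> 4" and \<tau>': "\<tau> < \<alpha> * cylinder_capacity d \<rho> * \<gamma>" using d \<tau> by (simp_all add: cylinder_capacity_def)
  \<comment> \<open>From dimension 4 on the limiting constant involves the radius; its continuity
    provides a \<open>\<delta>\<close> that keeps the strict inequality.\<close>
  have "((\<lambda>\<delta>. \<alpha> * cylinder_capacity d (\<rho> - 2 * \<delta>) * \<gamma>) \<longlongrightarrow> \<alpha> * cylinder_capacity d (\<rho> - 2 * 0) * \<gamma>) (at_right 0)"
   unfolding cylinder_capacity_def by (intro tendsto_intros less_imp_neq[OF Gamma_real_pos, symmetric]) (use d4 in auto)
  from order_tendstoD(1)[OF this, of \<tau>] \<tau>'
  have "eventually (\<lambda>\<delta>. \<tau> < \<alpha> * cylinder_capacity d (\<rho> - 2 * \<delta>) * \<gamma>) (at_right 0)" by simp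
  then obtain \<delta> where "\<tau> < \<alpha> * cylinder_capacity d (\<rho> - 2 * \<delta>) * \<gamma>" "\<delta> < \<rho> / 2" "0 < \<delta>"
   using half_gt_zero[OF \<rho>] by (rule eventually_at_right_obtain)
  then have \<delta>: "\<tau> < \<alpha> * cylinder_capacity d (\<rho> - 2 * \<delta>) * \<gamma>" "2 * \<delta> < \<rho>" "0 < \<delta>" by simp_all
  define s c where "s = \<rho> - 2 * \<delta>" and "c = cylinder_capacity d s"
  have s: "s > 0" using \<delta> by (simp add: s_def)
  have c: "c > 0" unfolding c_def using d4 s by (rule cylinder_capacity_pos)
  have "eventually (\<lambda>r. \<forall>len. \<gamma> * ln r - 2 * \<delta> \<le> len \<and> len \<le> \<gamma> * ln r + 2 * \<delta> \<longrightarrow>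
    0 < len \<and> ennreal (\<tau> * ln r) \<le> ennreal \<alpha> * (ennreal len / line_green d len s)) at_top"
  proof (rule line_green_le_imp_tube_lower[OF \<alpha>])
   show "((\<lambda>r. \<alpha> * ((\<gamma> * ln r - 2 * \<delta>) * c) / ln r) \<longlongrightarrow> \<alpha> * c * \<gamma>) at_top" using \<gamma>0 c \<alpha> by real_asymp
   show "\<tau> < \<alpha> * c * \<gamma>" using \<delta> by (simp add: c_def s_def)
   show "eventually (\<lambda>r. \<gamma> * ln r > 2 * \<delta>) at_top" using \<gamma>0 by real_asymp
   show "c > 0 \<and> line_green d len s \<le> ennreal (1 / c)" for len
    using c line_green_le[OF d4 s, of len] unfolding inverse_cylinder_capacity[OF d4 s] c_def by simp
  qed
  then show ?thesis using \<delta> \<tau> False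
   by (intro exI[of _ \<delta>] exI[of _ \<tau>]) (simp add: visibility_scale_def s_def)
 qed
qed

lemma interlacement_tube_upper:
 assumes d: "d \<ge> 3" and \<alpha>: "\<alpha> > 0" and \<rho>: "\<rho> > 0" and \<gamma>0: "\<gamma> > 0"
  and \<gamma>: "\<alpha> * visibility_const Interlacements d \<rho> Q * \<gamma> < real d"
 shows "\<exists>\<rho>' \<tau>. \<rho> < \<rho>' \<and> 0 \<le> \<tau> \<and> \<tau> < real d \<and>
  eventually (\<lambda>r. \<exists>L>0. ennreal \<alpha> * (ennreal (\<gamma> * visibility_scale Interlacements d r + 2 * L + 2 * \<rho>') / line_green d L \<rho>') \<le> ennreal (\<tau> * ln r)) at_top"
proof -
 define p where "p = \<alpha> * visibility_const Interlacements d \<rho> Q * \<gamma>"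
 have p: "p > 0" unfolding p_def by (intro mult_pos_pos \<alpha> \<gamma>0 interlacement_const_pos d \<rho>)
 obtain \<tau> where \<tau>: "\<tau> < real d" "p < \<tau>" using dense[OF \<gamma>] by (auto simp: p_def)
 have \<tau>0: "\<tau> > 0" using p \<tau> by linarith
 show ?thesis
 proof (cases "d = 3")
  case True
  define s where "s = 2 * \<rho>"
  have s: "s > 0" "\<rho> < s" using \<rho> by (auto simp: s_def)
  have p3: "p = \<alpha> * pi * \<gamma>" using True by (simp add: p_def)
  have "1 < \<tau> / p" using \<tau> p by simp
  then obtain t where t: "1 < t" "t < \<tau> / p" using dense by blast
  \<comment> \<open>An overhang of \<open>e\<close> times the length at both ends multiplies the
    length by \<open>1 + 2 * e = t\<close>, the factor that can be afforded. It may be proportional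
    to the length because a constant factor is negligible inside the logarithm.\<close>
  define e where "e = (t - 1) / 2"
  have e: "e > 0" using t by (simp add: e_def)
  let ?q = "\<lambda>r. \<gamma> * (ln r * ln (ln r))"
  have "eventually (\<lambda>r. \<exists>L>0. ennreal \<alpha> * (ennreal (?q r + 2 * L + 2 * s) / line_green 3 L s) \<le> ennreal (\<tau> * ln r)) at_top"
  proof (rule le_line_green_imp_tube_upper[OF \<alpha> _ _ s(1), where L="\<lambda>r. e * ?q r" and w="\<lambda>r. pi / ln (e * ?q r / s)"])
   show "((\<lambda>r. \<alpha> * ((?q r + 2 * (e * ?q r) + 2 * s) * (pi / ln (e * ?q r / s))) / ln r) \<longlongrightarrow> \<alpha> * (\<gamma> + 2 * (e * \<gamma>)) * pi) at_top"
    using \<gamma>0 s(1) e \<alpha> by real_asymp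
   have "\<alpha> * (\<gamma> + 2 * (e * \<gamma>)) * pi = p * t" by (simp add: p3 e_def field_simps)
   then show "\<alpha> * (\<gamma> + 2 * (e * \<gamma>)) * pi < \<tau>" using t(2) p by (simp add: field_simps)
   have "eventually (\<lambda>r. ?q r > 0) at_top" using \<gamma>0 by real_asymp
   moreover have "eventually (\<lambda>r. e * ?q r / s > 1) at_top" using \<gamma>0 e s(1) by real_asymp
   ultimately show "eventually (\<lambda>r. 0 \<le> ?q r \<and> 0 < e * ?q r \<and> 0 < pi / ln (e * ?q r / s) \<and>
     ennreal (1 / (pi / ln (e * ?q r / s))) \<le> line_green 3 (e * ?q r) s) at_top"
   proof eventually_elim
    case (elim r)
    have L: "e * ?q r > 0" using elim e by simp
    have "ln (e * ?q r / s) \<le> arsinh (e * ?q r / s)" using L s by (intro arsinh_bounds) auto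
    then have "ennreal (1 / (pi / ln (e * ?q r / s))) \<le> line_green 3 (e * ?q r) s"
     unfolding line_green_3[OF s(1) L] by (intro ennreal_leI) (simp add: divide_right_mono)
    then show ?case using elim L by simp
   qed
  qed
  then show ?thesis using s \<tau> \<tau>0 True
   by (intro exI[of _ s] exI[of _ \<tau>]) (simp add: visibility_scale_def)
 next
  case False
  then have d4: "d \<ge> 4" and p4: "p = \<alpha> * cylinder_capacity d \<rho> * \<gamma>" using d by (simp_all add: cylinder_capacity_def p_def)
  have "((\<lambda>\<delta>. \<alpha> * cylinder_capacity d (\<rho> + \<delta>) * \<gamma>) \<longlongrightarrow> \<alpha> * cylinder_capacity d (\<rho> + 0) * \<gamma>) (at_right 0)"
   unfolding cylinder_capacity_def by (intro tendsto_intros less_imp_neq[OF Gamma_real_pos, symmetric]) (use d4 in auto)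
  from order_tendstoD(2)[OF this, of \<tau>] \<tau>
  have "eventually (\<lambda>\<delta>. \<alpha> * cylinder_capacity d (\<rho> + \<delta>) * \<gamma> < \<tau>) (at_right 0)" by (simp add: p4)
  then obtain \<delta> where \<delta>: "\<alpha> * cylinder_capacity d (\<rho> + \<delta>) * \<gamma> < \<tau>" "0 < \<delta>"
   using zero_less_one by (rule eventually_at_right_obtain)
  define s c where "s = \<rho> + \<delta>" and "c = cylinder_capacity d s"
  have s: "s > 0" "\<rho> < s" using \<delta> \<rho> by (auto simp: s_def)
  have c: "c > 0" unfolding c_def using d4 s(1) by (rule cylinder_capacity_pos)
  \<comment> \<open>There is room for a value \<open>g\<close> below the limit \<open>1 / c\<close>
    of \<open>line_green\<close>. It is exceeded at a fixed overhang \<open>n\<close>, and a fixed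
    overhang is negligible beside \<open>ln r\<close>.\<close>
  have "\<alpha> * \<gamma> / \<tau> < 1 / c" using \<delta>(1) c \<tau>0 by (simp add: c_def s_def field_simps)
  then obtain g where g: "\<alpha> * \<gamma> / \<tau> < g" "g < 1 / c" using dense by blast
  have "0 < \<alpha> * \<gamma> / \<tau>" using \<alpha> \<gamma>0 \<tau>0 by simp
  then have g0: "g > 0" using g(1) by linarith
  have "(\<lambda>n. line_green d (real n) s) \<longlonglongrightarrow> ennreal (1 / c)"
   using line_green_tendsto[OF d4 s(1)] unfolding inverse_cylinder_capacity[OF d4 s(1)] c_def .
  then have "eventually (\<lambda>n. ennreal g < line_green d (real n) s) sequentially"
   using g g0 by (intro order_tendstoD(1)) (auto simp: ennreal_less_iff)
  then have "eventually (\<lambda>n. ennreal g < line_green d (real n) s \<and> n > 0) sequentially"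
   using eventually_gt_at_top[of 0] by (rule eventually_conj)
  then obtain n where n: "ennreal g < line_green d (real n) s" "n > 0"
   by (auto simp: eventually_sequentially)
  have "eventually (\<lambda>r. \<exists>L>0. ennreal \<alpha> * (ennreal (\<gamma> * ln r + 2 * L + 2 * s) / line_green d L s) \<le> ennreal (\<tau> * ln r)) at_top"
  proof (rule le_line_green_imp_tube_upper[OF \<alpha> _ _ s(1), where L="\<lambda>_. real n" and w="\<lambda>_. 1 / g"])
   show "((\<lambda>r. \<alpha> * ((\<gamma> * ln r + 2 * real n + 2 * s) * (1 / g)) / ln r) \<longlongrightarrow> \<alpha> * \<gamma> / g) at_top"
    using \<gamma>0 g0 \<alpha> by real_asymp
   show "\<alpha> * \<gamma> / g < \<tau>" using g(1) g0 \<tau>0 by (simp add: field_simps)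
   show "eventually (\<lambda>r. 0 \<le> \<gamma> * ln r \<and> 0 < real n \<and> 0 < 1 / g \<and> ennreal (1 / (1 / g)) \<le> line_green d (real n) s) at_top"
    using eventually_ge_at_top[of 1] by eventually_elim (use \<gamma>0 g0 n in auto)
  qed
  then show ?thesis using s \<tau> \<tau>0 False
   by (intro exI[of _ s] exI[of _ \<tau>]) (simp add: visibility_scale_def)
 qed
qed

lemma interlacement_scale_bounds:
 assumes "\<gamma> > 0"
 shows "eventually (\<lambda>r. 1 \<le> \<gamma> * visibility_scale Interlacements d r \<and> \<gamma> * visibility_scale Interlacements d r \<le> (ln r)\<^sup>2) at_top"
proof (cases "d = 3")
 case True
 have "eventually (\<lambda>r. 1 \<le> \<gamma> * (ln r * ln (ln r))) at_top" using assms by real_asymp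
 moreover have "eventually (\<lambda>r. \<gamma> * (ln r * ln (ln r)) \<le> (ln r)\<^sup>2) at_top" using assms by real_asymp
 ultimately show ?thesis using True by (auto simp: visibility_scale_def intro: eventually_conj)
next
 case False
 have "eventually (\<lambda>r. 1 \<le> \<gamma> * ln r) at_top" using assms by real_asymp
 moreover have "eventually (\<lambda>r. \<gamma> * ln r \<le> (ln r)\<^sup>2) at_top" using assms by real_asymp
 ultimately show ?thesis using False by (auto simp: visibility_scale_def intro: eventually_conj)
qed

section \<open>Tail estimates for the interlacements\<close>

lemma sets_hitting_classes_tube:
 fixes \<nu> :: "(real \<Rightarrow> real^'n) set measure"
 assumes "sznitman_measure \<nu>" shows "hitting_classes (tube x y s) \<in> sets \<nu>"
 using assms sets_hitting_classes[OF sets_trajectory_hits_open[OF open_tube]]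
 by (simp add: sznitman_measure_def)

lemma hitting_classes_blocks:
 assumes "c \<in> hitting_classes (tube x y (\<rho> - \<delta>))" and "norm (x' - x) \<le> \<delta>" "norm (y' - y) \<le> \<delta>"
 shows "closed_segment x' y' \<inter> (\<Union>w\<in>c. nbhd (range w) \<rho>) \<noteq> {}"
proof -
 obtain w t p where c: "w \<in> c" "p \<in> closed_segment x y" "dist p (w t) < \<rho> - \<delta>"
  using assms(1) by (auto simp: hitting_classes_def tube_def)
 from closed_segment_perturb_dist[OF assms(2,3) c(2) less_imp_le[OF c(3)]] show ?thesis using c(1) by (fastforce simp: nbhd_def)
qed

lemma interlacements_cover:
 assumes "brownian_interlacements \<alpha> \<rho> M C" "\<alpha> > 0"
 obtains \<nu> X where "sznitman_measure \<nu>" "poisson_cover M \<nu> \<alpha> X (\<lambda>c. \<Union>w\<in>c. nbhd (range w) \<rho>) C"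
 using assms unfolding brownian_interlacements_def poisson_cover_def by blast

text \<open>All constants are fixed before the probability space is introduced, so the exponent is
  the same for every realisation of the model. The radius is reduced twice: to
  \<open>\<rho> - \<delta>\<close> for the perturbation of the segment, and to
  \<open>\<rho> - 2 * \<delta>\<close> for the gap in \<open>sznitman_tube_ge\<close>.\<close>

lemma interlacements_upper_tail:
 fixes \<alpha> \<rho> \<gamma> :: real
 assumes d: "CARD('n) \<ge> 3" and \<alpha>: "\<alpha> > 0" and \<rho>: "\<rho> > 0"
  and \<gamma>: "real CARD('n) < \<alpha> * visibility_const Interlacements CARD('n) \<rho> Q * \<gamma>"
 shows "\<exists>\<epsilon>>0. \<forall>(M :: 'w measure) (C :: 'w \<Rightarrow> (real^'n) set). brownian_interlacements \<alpha> \<rho> M C \<longrightarrow>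
  (\<lambda>r. prob_visibility_gt M C (\<gamma> * visibility_scale Interlacements CARD('n) r) r)
   \<in> O(\<lambda>r. r powr (- \<epsilon>))"
proof -
 define d where "d = CARD('n)"
 obtain \<delta> \<tau> where \<delta>: "0 < \<delta>" "2 * \<delta> < \<rho>" and \<tau>: "real d < \<tau>" and
  len: "eventually (\<lambda>r. \<forall>len. \<gamma> * visibility_scale Interlacements d r - 2 * \<delta> \<le> len \<and> len \<le> \<gamma> * visibility_scale Interlacements d r + 2 * \<delta> \<longrightarrow>
   0 < len \<and> ennreal (\<tau> * ln r) \<le> ennreal \<alpha> * (ennreal len / line_green d len (\<rho> - 2 * \<delta>))) at_top"
  using interlacement_tube_lower(2)[OF d \<alpha> \<rho> \<gamma>, folded d_def] by (elim exE conjE)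
 note ell = interlacement_scale_bounds[OF interlacement_tube_lower(1)[OF d \<alpha> \<rho> \<gamma>], of d]
 show ?thesis unfolding d_def[symmetric]
 proof (intro exI[of _ "(\<tau> - real d) / 2"] conjI allI impI)
  show "(\<tau> - real d) / 2 > 0" using \<tau> by simp
  fix M :: "'w measure" and C :: "'w \<Rightarrow> (real^'n) set"
  assume "brownian_interlacements \<alpha> \<rho> M C"
  then obtain \<nu> X where \<nu>: "sznitman_measure \<nu>" and pc: "poisson_cover M \<nu> \<alpha> X (\<lambda>c. \<Union>w\<in>c. nbhd (range w) \<rho>) C"
   using interlacements_cover[OF _ \<alpha>] by blast
  show "(\<lambda>r. prob_visibility_gt M C (\<gamma> * visibility_scale Interlacements d r) r) \<in> O(\<lambda>r. r powr (- ((\<tau> - real d) / 2)))"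
   unfolding d_def
  proof (rule poisson_cover.visibility_upper_tail[OF pc \<delta>(1) \<tau>[unfolded d_def] ell[unfolded d_def] sets_hitting_classes_tube[OF \<nu>] hitting_classes_blocks])
   show "eventually (\<lambda>r. \<forall>x y :: real^'n. \<gamma> * visibility_scale Interlacements CARD('n) r - 2 * \<delta> \<le> norm (x - y) \<and> norm (x - y) \<le> \<gamma> * visibility_scale Interlacements CARD('n) r + 2 * \<delta> \<longrightarrow>
    emeasure \<nu> (hitting_classes (tube x y (\<rho> - \<delta>))) < \<infinity> \<and> ennreal (\<tau> * ln r) \<le> ennreal \<alpha> * emeasure \<nu> (hitting_classes (tube x y (\<rho> - \<delta>)))) at_top"
    using len
   proof eventually_elim
    case (elim r)
    show ?case
    proof (intro allI impI)
     fix x y :: "real^'n"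
     assume "\<gamma> * visibility_scale Interlacements CARD('n) r - 2 * \<delta> \<le> norm (x - y) \<and> norm (x - y) \<le> \<gamma> * visibility_scale Interlacements CARD('n) r + 2 * \<delta>"
     then have xy: "0 < norm (x - y)" and le: "ennreal (\<tau> * ln r) \<le> ennreal \<alpha> * (ennreal (norm (x - y)) / line_green d (norm (x - y)) (\<rho> - 2 * \<delta>))"
      using elim unfolding d_def by blast+
     have ne: "x \<noteq> y" using xy by auto
     let ?A = "hitting_classes (tube x y (\<rho> - \<delta>))"
     \<comment> \<open>Only finiteness is wanted here, so the overhang is set to 1.\<close>
     have "emeasure \<nu> ?A \<le> ennreal (norm (y - x) + 2 * 1 + 2 * (\<rho> - \<delta>)) / line_green CARD('n) 1 (\<rho> - \<delta>)"
      using \<delta> by (intro sznitman_tube_le d \<nu> ne) auto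
     also have "... < \<infinity>"
      using line_green_pos_finite(1)[OF d, of 1 "\<rho> - \<delta>"] \<delta> by (simp add: ennreal_divide_eq_top_iff less_top[symmetric])
     finally have fin: "emeasure \<nu> ?A < \<infinity>" .
     have "ennreal (norm (x - y)) / line_green d (norm (x - y)) (\<rho> - 2 * \<delta>) \<le> emeasure \<nu> ?A"
      using \<delta> sznitman_tube_ge[OF d \<nu> ne, of "\<rho> - 2 * \<delta>" "\<rho> - \<delta>"] by (simp add: d_def norm_minus_commute)
     then have "ennreal \<alpha> * (ennreal (norm (x - y)) / line_green d (norm (x - y)) (\<rho> - 2 * \<delta>)) \<le> ennreal \<alpha> * emeasure \<nu> ?A"
      by (rule mult_left_mono) simp
     then show "emeasure \<nu> ?A < \<infinity> \<and> ennreal (\<tau> * ln r) \<le> ennreal \<alpha> * emeasure \<nu> ?A" using le fin by (intro conjI) auto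
    qed
   qed
  qed
 qed
qed

text \<open>Two tubes inside balls of logarithmic size at distance \<open>r powr \<eta>\<close> or
  more are both hit with intensity of order \<open>r powr (- (2 * \<eta> * k))\<close> up to
  logarithms, where \<open>2 * k = d - 2\<close> is the decay exponent of the Green function. Half
  of the exponent pays for the logarithms.\<close>

lemma interlacements_lower_tail:
 fixes \<alpha> \<rho> \<gamma> :: real
 assumes d: "CARD('n) \<ge> 3" and \<alpha>: "\<alpha> > 0" and \<rho>: "\<rho> > 0" and \<gamma>0: "\<gamma> > 0" and \<gamma>': "\<gamma>' \<le> \<gamma>"
  and \<gamma>: "\<alpha> * visibility_const Interlacements CARD('n) \<rho> Q * \<gamma> < real CARD('n)"
 shows "\<exists>\<epsilon>>0. \<forall>(M :: 'w measure) (C :: 'w \<Rightarrow> (real^'n) set). brownian_interlacements \<alpha> \<rho> M C \<longrightarrow>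
  (\<lambda>r. prob_visibility_lt M C (\<gamma>' * visibility_scale Interlacements CARD('n) r) r)
   \<in> O(\<lambda>r. r powr (- \<epsilon>))"
proof -
 define d where "d = CARD('n)"
 have d3: "d \<ge> 3" using d by (simp add: d_def)
 define ell where "ell r = \<gamma> * visibility_scale Interlacements d r" for r
 obtain s \<tau> where s: "\<rho> < s" and \<tau>: "0 \<le> \<tau>" "\<tau> < real d" and
  up: "eventually (\<lambda>r. \<exists>L>0. ennreal \<alpha> * (ennreal (ell r + 2 * L + 2 * s) / line_green d L s) \<le> ennreal (\<tau> * ln r)) at_top"
  using interlacement_tube_upper[OF d \<alpha> \<rho> \<gamma>0 \<gamma>, folded d_def, folded ell_def] by (elim exE conjE)
 have s0: "s > 0" using s \<rho> by simp
 define \<eta> where "\<eta> = (1 - \<tau> / real d) / 2"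
 have \<eta>: "0 < \<eta>" using \<tau> d3 by (auto simp: \<eta>_def field_simps)
 define k where "k = real d / 2 - 1"
 have k: "k > 0" using d3 by (simp add: k_def)
 have \<epsilon>: "\<eta> * k > 0" using \<eta> k by simp
 have ell: "eventually (\<lambda>r. 1 \<le> ell r \<and> ell r \<le> (ln r)\<^sup>2) at_top"
  unfolding ell_def by (rule interlacement_scale_bounds[OF \<gamma>0])
 have lev: "eventually (\<lambda>r. \<gamma>' * visibility_scale Interlacements d r \<le> ell r) at_top"
  using interlacement_scale_bounds[of 1 d]
  by (simp, elim eventually_mono) (auto simp: ell_def intro!: mult_right_mono \<gamma>')
 define c where "c = green_const d"
 have c: "c > 0" unfolding c_def by (rule green_const_pos[OF d3])
 \<comment> \<open>A ball of this radius around the base point contains the tube of radius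
   \<open>s\<close> around its segment, as \<open>ell r \<le> (ln r)\<^sup>2\<close>.\<close>
 define R where "R r = (ln r)\<^sup>2 + s" for r
 have dec: "eventually (\<lambda>r. \<alpha> * (2 * (c * ((r powr \<eta> / 2)\<^sup>2) powr (- k)) / (c * ((R r)\<^sup>2) powr (- k))\<^sup>2) \<le> r powr (- (\<eta> * k))) at_top"
  unfolding R_def using \<eta> k c \<alpha> s0 by real_asymp
 have big: "eventually (\<lambda>r. 2 * R r \<le> r powr \<eta>) at_top" unfolding R_def using \<eta> s0 by real_asymp
 define u :: "real^'n" where "u = axis (SOME i. True) 1"
 have u: "norm u = 1" by (simp add: u_def)
 define H where "H x y = hitting_classes (tube x y s)" for x y :: "real^'n"
 let ?B = "\<lambda>r x y. H x (x + ell r *\<^sub>R u) \<inter> H y (y + ell r *\<^sub>R u)"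
 show ?thesis
 proof (intro exI[of _ "min ((real d - \<tau>) / 2) (\<eta> * k)"] conjI allI impI)
  show "min ((real d - \<tau>) / 2) (\<eta> * k) > 0" using \<tau> \<epsilon> by simp
  fix M :: "'w measure" and C :: "'w \<Rightarrow> (real^'n) set"
  assume "brownian_interlacements \<alpha> \<rho> M C"
  then obtain \<nu> X where \<nu>: "sznitman_measure \<nu>" and pc: "poisson_cover M \<nu> \<alpha> X (\<lambda>c. \<Union>w\<in>c. nbhd (range w) \<rho>) C"
   using interlacements_cover[OF _ \<alpha>] by blast
  show "(\<lambda>r. prob_visibility_lt M C (\<gamma>' * visibility_scale Interlacements CARD('n) r) r)
   \<in> O(\<lambda>r. r powr (- min ((real d - \<tau>) / 2) (\<eta> * k)))"
   unfolding d_def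
  proof (rule poisson_cover.visibility_lower_tail_decorrelated[OF pc u \<tau>[unfolded d_def] \<eta>_def[unfolded d_def] ell lev[unfolded d_def] _ _ _ \<epsilon>, where H=H])
   show "H x y \<in> sets \<nu>" for x y unfolding H_def by (rule sets_hitting_classes_tube[OF \<nu>])
   fix g and x y :: "real^'n" assume g: "g \<in> space \<nu>" "closed_segment x y \<inter> (\<Union>w\<in>g. nbhd (range w) \<rho>) \<noteq> {}"
   have "space \<nu> = trajectories // time_shift"
    using sets_eq_imp_space_eq[of \<nu> trajectory_quotient] \<nu> unfolding sznitman_measure_def space_trajectory_quotient by blast
   moreover obtain p w t where p: "p \<in> closed_segment x y" "w \<in> g" "dist (w t) p \<le> \<rho>"
    using g(2) by (auto simp: nbhd_def)
   moreover have "w t \<in> tube x y s" unfolding tube_def using p s by (intro UN_I[OF p(1)]) (simp add: dist_commute)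
   ultimately show "g \<in> H x y" using g(1) by (auto simp: H_def hitting_classes_def)
  next
   show "eventually (\<lambda>r. \<forall>x y :: real^'n. norm (x - y) = ell r \<longrightarrow> ennreal \<alpha> * emeasure \<nu> (H x y) \<le> ennreal (\<tau> * ln r)) at_top"
    using up ell
   proof eventually_elim
    case (elim r)
    then obtain L where L: "L > 0" "ennreal \<alpha> * (ennreal (ell r + 2 * L + 2 * s) / line_green d L s) \<le> ennreal (\<tau> * ln r)" by blast
    show ?case
    proof (intro allI impI)
     fix x y :: "real^'n" assume xy: "norm (x - y) = ell r"
     then have "x \<noteq> y" using elim by auto
     then have "emeasure \<nu> (H x y) \<le> ennreal (norm (y - x) + 2 * L + 2 * s) / line_green CARD('n) L s"
      unfolding H_def by (rule sznitman_tube_le[OF d \<nu> _ s0 L(1)])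
     then have "ennreal \<alpha> * emeasure \<nu> (H x y) \<le> ennreal \<alpha> * (ennreal (ell r + 2 * L + 2 * s) / line_green d L s)"
      unfolding norm_minus_commute[of y] xy d_def by (rule mult_left_mono) simp
     then show "ennreal \<alpha> * emeasure \<nu> (H x y) \<le> ennreal (\<tau> * ln r)" using L(2) by simp
    qed
   qed
  next
   show "eventually (\<lambda>r. \<forall>x y. r powr \<eta> \<le> norm (x - y) \<longrightarrow>
    ennreal \<alpha> * emeasure \<nu> (?B r x y) \<le> ennreal (r powr (- (\<eta> * k)))) at_top"
    using dec big ell eventually_gt_at_top[of 1]
   proof eventually_elim
    case (elim r)
    have R0: "R r > 0" unfolding R_def using s0 by (intro add_nonneg_pos) auto
    show ?case
    proof (intro allI impI)
     fix x y :: "real^'n" assume far: "r powr \<eta> \<le> norm (x - y)"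
     have sub: "tube z (z + ell r *\<^sub>R u) s \<subseteq> ball z (R r)" for z
     proof
      fix w assume "w \<in> tube z (z + ell r *\<^sub>R u) s"
      then obtain p where p: "p \<in> closed_segment z (z + ell r *\<^sub>R u)" "dist p w < s" by (auto simp: tube_def)
      then show "w \<in> ball z (R r)" using dist_closed_segment_le[OF u _ p(1), of w] elim by (simp add: R_def)
     qed
     have far2: "2 * R r \<le> norm (x - y)" using far elim by linarith
     define g where "g = green_sq d ((R r)\<^sup>2)"
     have "emeasure \<nu> (?B r x y) \<le> ennreal (2 * green_sq d ((norm (x - y) - R r)\<^sup>2) / g ^ 2)"
      unfolding H_def g_def d_def by (rule sznitman_pair_le[OF d \<nu> R0 far2 open_tube sub open_tube sub])
     also have "... \<le> ennreal (2 * green_sq d ((r powr \<eta> / 2)\<^sup>2) / g\<^sup>2)"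
     proof (intro ennreal_leI divide_right_mono mult_left_mono green_sq_antimono d3)
      show "(r powr \<eta> / 2)\<^sup>2 \<le> (norm (x - y) - R r)\<^sup>2" using far elim by (intro power_mono) auto
     qed (use elim in auto)
     finally have "ennreal \<alpha> * emeasure \<nu> (?B r x y) \<le> ennreal \<alpha> * ennreal (2 * green_sq d ((r powr \<eta> / 2)\<^sup>2) / g\<^sup>2)"
      by (rule mult_left_mono) simp
     also have "... = ennreal (\<alpha> * (2 * green_sq d ((r powr \<eta> / 2)\<^sup>2) / g\<^sup>2))"
      using \<alpha> by (subst ennreal_mult'[symmetric]) auto
     also have "... \<le> ennreal (r powr (- (\<eta> * k)))"
     proof (rule ennreal_leI)
      have "- k = 1 - real d / 2" by (simp add: k_def)
      then show "\<alpha> * (2 * green_sq d ((r powr \<eta> / 2)\<^sup>2) / g\<^sup>2) \<le> r powr (- (\<eta> * k))"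
       using elim(1) unfolding green_sq_def g_def c_def[symmetric] by simp
     qed
     finally show "ennreal \<alpha> * emeasure \<nu> (?B r x y) \<le> ennreal (r powr (- (\<eta> * k)))" .
    qed
   qed
  qed
 qed
qed

section \<open>Boolean models\<close>

lemma infdist_le_iff_nbhd:
 fixes S :: "'a::heine_borel set"
 assumes "closed S" "S \<noteq> {}" shows "infdist z S \<le> s \<longleftrightarrow> z \<in> nbhd S s"
proof
 assume le: "infdist z S \<le> s"
 obtain p where "p \<in> S" "infdist z S = dist z p" using infdist_attains_inf[OF assms] by blast
 then show "z \<in> nbhd S s" using le by (auto simp: nbhd_def dist_commute)
next
 assume "z \<in> nbhd S s"
 then obtain p where "p \<in> S" "dist z p \<le> s" by (auto simp: nbhd_def dist_commute)
 then show "infdist z S \<le> s" using infdist_le2 by blast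
qed

lemma emeasure_closed_segment:
 fixes a b :: "real^'n"
 assumes "CARD('n) \<ge> 2" shows "emeasure lborel (closed_segment a b) = 0"
proof -
 have "negligible (closed_segment a b)"
  using assms by (simp add: negligible_convex_interior interior_closed_segment_ge2)
 then show ?thesis by (simp add: negligible_iff_null_sets null_sets_completion_iff null_setsD1)
qed

lemma integrable_of_nonneg_law:
 fixes Q :: "real measure" and f g :: "real \<Rightarrow> real"
 assumes "sets Q = sets borel" "AE x in Q. x \<ge> 0" "integrable Q g"
  and "f \<in> borel_measurable borel" "\<And>x. 0 \<le> x \<Longrightarrow> \<bar>f x\<bar> \<le> g x"
 shows "integrable Q f"
proof (rule Bochner_Integration.integrable_bound[OF assms(3)])
 show "f \<in> borel_measurable Q" using assms(4) measurable_cong_sets[OF assms(1) refl] by blast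
 show "AE x in Q. norm (f x) \<le> norm (g x)" using assms(2) by eventually_elim (use assms(5) in force)
qed

text \<open>The case \<open>F = {}\<close> of \<open>emeasure_thick_tube\<close>, extended to radius
  0, where the segment is a null set since the dimension is at least 2.\<close>

lemma emeasure_nbhd_segment:
 fixes a b :: "real^'n"
 assumes d: "CARD('n) \<ge> 2"
 defines "\<kappa> \<equiv> unit_ball_vol (real (CARD('n) - 1))"
 shows "s > 0 \<Longrightarrow> ennreal (norm (a - b) * (\<kappa> * s ^ (CARD('n) - 1))) \<le> emeasure lborel (nbhd (closed_segment a b) s)"
  and "s \<ge> 0 \<Longrightarrow> emeasure lborel (nbhd (closed_segment a b) s) \<le> ennreal ((norm (a - b) + 2 * s) * (\<kappa> * s ^ (CARD('n) - 1)))"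
proof -
 have pos: "ennreal (norm (a - b) * (\<kappa> * s ^ (CARD('n) - 1))) \<le> emeasure lborel (nbhd (closed_segment a b) s) \<and>
   emeasure lborel (nbhd (closed_segment a b) s) \<le> ennreal ((norm (a - b) + 2 * s) * (\<kappa> * s ^ (CARD('n) - 1)))" if s: "s > 0" for s
  using emeasure_thick_tube(2,3)[of s undefined "{}" a b] s by (simp add: \<kappa>_def)
 show "s > 0 \<Longrightarrow> ennreal (norm (a - b) * (\<kappa> * s ^ (CARD('n) - 1))) \<le> emeasure lborel (nbhd (closed_segment a b) s)"
  using pos by blast
 assume "s \<ge> 0"
 then consider "s > 0" | "s = 0" by linarith
 then show "emeasure lborel (nbhd (closed_segment a b) s) \<le> ennreal ((norm (a - b) + 2 * s) * (\<kappa> * s ^ (CARD('n) - 1)))"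
 proof cases
  case 2
  then have "nbhd (closed_segment a b) s = closed_segment a b" by (auto simp: nbhd_def)
  then show ?thesis using emeasure_closed_segment[OF d, of a b] by simp
 qed (use pos in blast)
qed

text \<open>The balls that still meet the segment after their radius is reduced by
  \<open>\<delta>\<close>. A neighbourhood of negative radius is empty, so radii below
  \<open>\<delta>\<close> drop out by themselves.\<close>

definition segment_balls :: "real^'n \<Rightarrow> real^'n \<Rightarrow> real \<Rightarrow> ((real^'n) \<times> real) set" where
 "segment_balls x y \<delta> = {(z, s). z \<in> nbhd (closed_segment x y) (s - \<delta>)}"

lemma sets_segment_balls:
 assumes "sets Q = sets borel"
 shows "segment_balls x y \<delta> \<in> sets ((lborel :: (real^'n) measure) \<Otimes>\<^sub>M Q)"
proof -
 have eq: "segment_balls x y \<delta> = {p. infdist (fst p) (closed_segment x y) \<le> snd p - \<delta>}"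
  by (auto simp: segment_balls_def infdist_le_iff_nbhd)
 have "closed (segment_balls x y \<delta>)" unfolding eq
  by (intro closed_Collect_le continuous_intros)
 then have "segment_balls x y \<delta> \<in> sets (borel \<Otimes>\<^sub>M borel)" unfolding borel_prod by (rule borel_closed)
 moreover have "sets ((lborel :: (real^'n) measure) \<Otimes>\<^sub>M Q) = sets (borel \<Otimes>\<^sub>M borel)"
  by (intro sets_pair_measure_cong assms) simp
 ultimately show ?thesis by simp
qed

lemma emeasure_boolean_intensity:
 assumes "prob_space Q" "A \<in> sets ((lborel :: (real^'n) measure) \<Otimes>\<^sub>M Q)"
 shows "emeasure ((lborel :: (real^'n) measure) \<Otimes>\<^sub>M Q) A = (\<integral>\<^sup>+s. emeasure lborel {z. (z, s) \<in> A} \<partial>Q)"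
proof -
 interpret Q: prob_space Q by fact
 interpret pair_sigma_finite "lborel :: (real^'n) measure" Q ..
 show ?thesis using emeasure_pair_measure_alt2[OF assms(2)] by (simp add: vimage_def)
qed

lemma integrable_power_le:
 fixes Q :: "real measure"
 assumes "prob_space Q" "sets Q = sets borel" "AE x in Q. x \<ge> 0" "integrable Q (\<lambda>x. x ^ d)" "k \<le> d"
 shows "integrable Q (\<lambda>x. x ^ k)"
proof (rule integrable_of_nonneg_law[OF assms(2,3)])
 interpret prob_space Q by fact
 show "integrable Q (\<lambda>x. 1 + x ^ d)" using assms by (intro Bochner_Integration.integrable_add) auto
 fix x :: real assume x: "0 \<le> x"
 have "x ^ k \<le> 1 + x ^ d"
 proof (cases "x \<le> 1")
  case True
  then have "x ^ k \<le> 1" using x by (rule power_le_one[rotated])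
  then show ?thesis using x by (smt (verit) zero_le_power)
 next
  case False
  then have "x ^ k \<le> x ^ d" using assms(5) by (intro power_increasing) auto
  then show ?thesis by simp
 qed
 then show "\<bar>x ^ k\<bar> \<le> 1 + x ^ d" using x by simp
qed measurable

text \<open>The allowance \<open>2 * s\<close> for the two ends of the tube produces the moment of
  order \<open>d\<close>, a bounded contribution by the moment assumption.\<close>

lemma segment_balls_intensity_le:
 fixes x y :: "real^'n" and Q :: "real measure"
 assumes d: "CARD('n) \<ge> 2" and Q: "prob_space Q" "sets Q = sets borel" "AE x in Q. x \<ge> 0" "integrable Q (\<lambda>x. x ^ CARD('n))"
 shows "emeasure (lborel \<Otimes>\<^sub>M Q) (segment_balls x y 0) \<le>
  ennreal (unit_ball_vol (real (CARD('n) - 1)) * (norm (x - y) * (\<integral>s. s ^ (CARD('n) - 1) \<partial>Q) + 2 * (\<integral>s. s ^ CARD('n) \<partial>Q)))"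
proof -
 let ?\<kappa> = "unit_ball_vol (real (CARD('n) - 1))"
 have i1: "integrable Q (\<lambda>s. s ^ (CARD('n) - 1))" by (rule integrable_power_le[OF Q]) simp
 have "emeasure (lborel \<Otimes>\<^sub>M Q) (segment_balls x y 0) = (\<integral>\<^sup>+s. emeasure lborel (nbhd (closed_segment x y) s) \<partial>Q)"
  by (subst emeasure_boolean_intensity[OF Q(1) sets_segment_balls[OF Q(2)]]) (simp add: segment_balls_def)
 also have "... \<le> (\<integral>\<^sup>+s. ennreal (?\<kappa> * (norm (x - y) * s ^ (CARD('n) - 1) + 2 * s ^ CARD('n))) \<partial>Q)"
 proof (rule nn_integral_mono_AE, rule AE_mp[OF Q(3)], intro AE_I2 impI)
  fix s :: real assume s: "0 \<le> s"
  have "s ^ CARD('n) = s * s ^ (CARD('n) - 1)" using d by (cases "CARD('n)") auto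
  then have eq: "(norm (x - y) + 2 * s) * (?\<kappa> * s ^ (CARD('n) - 1)) = ?\<kappa> * (norm (x - y) * s ^ (CARD('n) - 1) + 2 * s ^ CARD('n))"
   by (simp add: algebra_simps)
  show "emeasure lborel (nbhd (closed_segment x y) s) \<le> ennreal (?\<kappa> * (norm (x - y) * s ^ (CARD('n) - 1) + 2 * s ^ CARD('n)))"
   using emeasure_nbhd_segment(2)[OF d s, of x y] unfolding eq .
 qed
 also have "... = ennreal (\<integral>s. ?\<kappa> * (norm (x - y) * s ^ (CARD('n) - 1) + 2 * s ^ CARD('n)) \<partial>Q)"
 proof (rule nn_integral_eq_integral)
  show "integrable Q (\<lambda>s. ?\<kappa> * (norm (x - y) * s ^ (CARD('n) - 1) + 2 * s ^ CARD('n)))"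
   by (intro integrable_mult_right Bochner_Integration.integrable_add i1 Q(4))
  show "AE s in Q. 0 \<le> ?\<kappa> * (norm (x - y) * s ^ (CARD('n) - 1) + 2 * s ^ CARD('n))"
   using Q(3) by (rule AE_mp) (intro AE_I2 impI mult_nonneg_nonneg add_nonneg_nonneg zero_le_power unit_ball_vol_nonneg norm_ge_zero, auto)
 qed
 also have "(\<integral>s. ?\<kappa> * (norm (x - y) * s ^ (CARD('n) - 1) + 2 * s ^ CARD('n)) \<partial>Q) =
   ?\<kappa> * (norm (x - y) * (\<integral>s. s ^ (CARD('n) - 1) \<partial>Q) + 2 * (\<integral>s. s ^ CARD('n) \<partial>Q))"
  using i1 Q(4) by simp
 finally show ?thesis .
qed

lemma segment_balls_intensity_ge:
 fixes x y :: "real^'n" and Q :: "real measure"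
 assumes d: "CARD('n) \<ge> 2" and Q: "prob_space Q" "sets Q = sets borel" and \<delta>: "\<delta> > 0"
  and i: "integrable Q (\<lambda>s. max (s - \<delta>) 0 ^ (CARD('n) - 1))"
 shows "ennreal (unit_ball_vol (real (CARD('n) - 1)) * norm (x - y) * (\<integral>s. max (s - \<delta>) 0 ^ (CARD('n) - 1) \<partial>Q)) \<le>
  emeasure (lborel \<Otimes>\<^sub>M Q) (segment_balls x y \<delta>)"
proof -
 let ?\<kappa> = "unit_ball_vol (real (CARD('n) - 1))"
 have "ennreal (?\<kappa> * norm (x - y) * (\<integral>s. max (s - \<delta>) 0 ^ (CARD('n) - 1) \<partial>Q)) =
   (\<integral>\<^sup>+s. ennreal (?\<kappa> * norm (x - y) * max (s - \<delta>) 0 ^ (CARD('n) - 1)) \<partial>Q)"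
  using i by (subst nn_integral_eq_integral) auto
 also have "... \<le> (\<integral>\<^sup>+s. emeasure lborel (nbhd (closed_segment x y) (s - \<delta>)) \<partial>Q)"
 proof (rule nn_integral_mono)
  fix s :: real
  show "ennreal (?\<kappa> * norm (x - y) * max (s - \<delta>) 0 ^ (CARD('n) - 1)) \<le> emeasure lborel (nbhd (closed_segment x y) (s - \<delta>))"
  proof (cases "s > \<delta>")
   case True
   then show ?thesis using emeasure_nbhd_segment(1)[OF d, of "s - \<delta>" x y] by (simp add: mult_ac)
  next
   case False
   then show ?thesis using d by (simp add: max_absorb2 power_0_left)
  qed
 qed
 also have "... = emeasure (lborel \<Otimes>\<^sub>M Q) (segment_balls x y \<delta>)"
  by (subst emeasure_boolean_intensity[OF Q(1) sets_segment_balls[OF Q(2)]]) (simp add: segment_balls_def)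
 finally show ?thesis .
qed

lemma segment_balls_blocks:
 assumes "g \<in> segment_balls x y \<delta>" and "norm (x' - x) \<le> \<delta>" "norm (y' - y) \<le> \<delta>"
 shows "closed_segment x' y' \<inter> (case g of (z, s) \<Rightarrow> cball z s) \<noteq> {}"
proof -
 obtain z s p where c: "g = (z, s)" "p \<in> closed_segment x y" "dist p z \<le> s - \<delta>"
  using assms(1) by (auto simp: segment_balls_def nbhd_def)
 then show ?thesis using closed_segment_perturb_dist[OF assms(2,3)] by fastforce
qed

text \<open>Reducing all radii by \<open>1 / Suc n\<close> lowers the moment by an amount that
  vanishes by dominated convergence, so the perturbation of segments costs nothing in the critical
  constant.\<close>

lemma truncated_moment_tendsto:
 fixes Q :: "real measure"
 assumes Q: "prob_space Q" "sets Q = sets borel" "AE x in Q. x \<ge> 0" "integrable Q (\<lambda>x. x ^ k)"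
 shows "integrable Q (\<lambda>s. max (s - 1 / Suc n) 0 ^ k)"
  and "(\<lambda>n. \<integral>s. max (s - 1 / Suc n) 0 ^ k \<partial>Q) \<longlonglongrightarrow> (\<integral>s. s ^ k \<partial>Q)"
proof -
 have meas: "(\<lambda>s. max (s - c) 0 ^ k) \<in> borel_measurable Q" "(\<lambda>s. s ^ k) \<in> borel_measurable Q" for c :: real
  unfolding measurable_cong_sets[OF Q(2) refl] by measurable
 have le: "AE s in Q. norm (max (s - 1 / Suc n) 0 ^ k) \<le> s ^ k" for n
  using Q(3) by (rule AE_mp, intro AE_I2 impI) (auto intro!: power_mono)
 have lim: "AE s in Q. (\<lambda>n. max (s - 1 / Suc n) 0 ^ k) \<longlonglongrightarrow> s ^ k"
  using Q(3)
 proof (rule AE_mp, intro AE_I2 impI)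
  fix s :: real assume s: "0 \<le> s"
  have "(\<lambda>n. max (s - 1 / Suc n) 0 ^ k) \<longlonglongrightarrow> max (s - 0) 0 ^ k"
   by (intro tendsto_intros LIMSEQ_Suc[OF lim_1_over_n])
  then show "(\<lambda>n. max (s - 1 / Suc n) 0 ^ k) \<longlonglongrightarrow> s ^ k" using s by simp
 qed
 show "(\<lambda>n. \<integral>s. max (s - 1 / Suc n) 0 ^ k \<partial>Q) \<longlonglongrightarrow> (\<integral>s. s ^ k \<partial>Q)"
  by (rule integral_dominated_convergence[where w="\<lambda>s. s ^ k"]) (rule meas Q(4) lim le)+
 show "integrable Q (\<lambda>s. max (s - 1 / Suc n) 0 ^ k)"
  by (rule integrable_of_nonneg_law[OF Q(2-4)]) (auto intro: power_mono)
qed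

section \<open>Tail estimates for the Boolean model\<close>

lemma boolean_cover:
 assumes "boolean_model \<alpha> Q M C" "\<alpha> > 0"
 obtains X where "poisson_cover M (lborel \<Otimes>\<^sub>M Q) \<alpha> X (\<lambda>(z, s). cball z s) C"
 using assms unfolding boolean_model_def poisson_cover_def by blast

lemma boolean_upper_tail:
 fixes \<alpha> \<gamma> :: real
 assumes d: "CARD('n) \<ge> 2" and \<alpha>: "\<alpha> > 0"
  and Q: "prob_space Q" "sets Q = sets borel" "AE x in Q. x \<ge> 0" "integrable Q (\<lambda>x. x ^ CARD('n))"
  and \<gamma>: "real CARD('n) < \<alpha> * visibility_const Boolean CARD('n) \<rho> Q * \<gamma>"
 shows "\<exists>\<epsilon>>0. \<forall>(M :: 'w measure) (C :: 'w \<Rightarrow> (real^'n) set). boolean_model \<alpha> Q M C \<longrightarrow>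
  (\<lambda>r. prob_visibility_gt M C (\<gamma> * ln r) r) \<in> O(\<lambda>r. r powr (- \<epsilon>))"
proof -
 define d \<kappa> where "d = CARD('n)" "\<kappa> = unit_ball_vol (real (CARD('n) - 1))"
 have \<kappa>: "\<kappa> > 0" by (simp add: d_\<kappa>_def)
 define m where "m \<delta> = (\<integral>s. max (s - \<delta>) 0 ^ (d - 1) \<partial>Q)" for \<delta>
 have i1: "integrable Q (\<lambda>s. s ^ (d - 1))" unfolding d_\<kappa>_def by (rule integrable_power_le[OF Q]) simp
 have \<gamma>m: "real d < \<alpha> * (\<kappa> * (\<integral>s. s ^ (d - 1) \<partial>Q)) * \<gamma>" using \<gamma> by (simp add: d_\<kappa>_def)
 \<comment> \<open>The strict inequality for \<open>\<gamma>\<close> leaves room to shrink all radii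
   by some \<open>1 / Suc n\<close>.\<close>
 have "(\<lambda>n. \<alpha> * (\<kappa> * m (1 / Suc n)) * \<gamma>) \<longlonglongrightarrow> \<alpha> * (\<kappa> * (\<integral>s. s ^ (d - 1) \<partial>Q)) * \<gamma>"
  unfolding m_def by (intro tendsto_intros truncated_moment_tendsto Q(1,2,3) i1)
 then have "eventually (\<lambda>n. real d < \<alpha> * (\<kappa> * m (1 / Suc n)) * \<gamma>) sequentially"
  by (rule order_tendstoD(1)) (rule \<gamma>m)
 then obtain n where n: "real d < \<alpha> * (\<kappa> * m (1 / Suc n)) * \<gamma>"
  using eventually_happens'[OF sequentially_bot] by blast
 define \<delta> where "\<delta> = 1 / real (Suc n)"
 have \<delta>: "\<delta> > 0" by (simp add: \<delta>_def)
 have im: "integrable Q (\<lambda>s. max (s - \<delta>) 0 ^ (d - 1))" unfolding \<delta>_def by (intro truncated_moment_tendsto Q(1,2,3) i1)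
 have a0: "\<kappa> * m \<delta> \<ge> 0" using \<kappa> unfolding m_def by (intro mult_nonneg_nonneg integral_nonneg_AE) auto
 show ?thesis
 proof (intro exI[of _ "(\<alpha> * (\<kappa> * m \<delta>) * \<gamma> - real CARD('n)) / 4"] conjI allI impI)
  show "(\<alpha> * (\<kappa> * m \<delta>) * \<gamma> - real CARD('n)) / 4 > 0" using n by (simp add: \<delta>_def d_\<kappa>_def)
  fix M :: "'w measure" and C :: "'w \<Rightarrow> (real^'n) set"
  assume "boolean_model \<alpha> Q M C"
  then obtain X where pc: "poisson_cover M (lborel \<Otimes>\<^sub>M Q) \<alpha> X (\<lambda>(z, s). cball z s) C"
   using boolean_cover[OF _ \<alpha>] by blast
  show "(\<lambda>r. prob_visibility_gt M C (\<gamma> * ln r) r)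
   \<in> O(\<lambda>r. r powr (- ((\<alpha> * (\<kappa> * m \<delta>) * \<gamma> - real CARD('n)) / 4)))"
  proof (rule poisson_cover.log_visibility_upper_tail[OF pc \<delta> a0 _ sets_segment_balls[OF Q(2)] segment_balls_blocks])
   show "real CARD('n) < \<alpha> * (\<kappa> * m \<delta>) * \<gamma>" using n by (simp add: \<delta>_def d_\<kappa>_def)
   fix x y :: "real^'n"
   have "segment_balls x y \<delta> \<subseteq> segment_balls x y 0" unfolding segment_balls_def nbhd_def using \<delta> by force
   then have "emeasure (lborel \<Otimes>\<^sub>M Q) (segment_balls x y \<delta>) \<le> emeasure (lborel \<Otimes>\<^sub>M Q) (segment_balls x y 0)"
    by (rule emeasure_mono) (rule sets_segment_balls[OF Q(2)])
   also have "... < \<infinity>" using segment_balls_intensity_le[OF d Q] by (rule order.strict_trans1) simp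
   finally show "emeasure (lborel \<Otimes>\<^sub>M Q) (segment_balls x y \<delta>) < \<infinity>" .
   show "ennreal (\<kappa> * m \<delta> * norm (x - y)) \<le> emeasure (lborel \<Otimes>\<^sub>M Q) (segment_balls x y \<delta>)"
    using segment_balls_intensity_ge[OF d Q(1,2) \<delta>, of x y] im by (simp add: d_\<kappa>_def m_def mult_ac)
  qed
 qed
qed

text \<open>Below the spacing \<open>D\<close> there is no other lattice point, and above it a box
  count applies. Leaving out \<open>j\<close> avoids an additive constant, so the bound tends to 0
  with \<open>t\<close>, as needed for radii small compared with \<open>r\<close>.\<close>

lemma card_lattice_near_le:
 fixes j :: "int^'n"
 assumes D: "D > 0" and t: "t \<ge> 0"
 shows "real (card {k \<in> lattice N - {j}. norm (lattice_point D j - lattice_point D k :: real^'n) \<le> t}) \<le> (3 * t / D) ^ CARD('n)"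
  (is "real (card ?S) \<le> _")
proof (cases "t < D")
 case True
 have "\<not> norm (lattice_point D j - lattice_point D k :: real^'n) \<le> t" if "k \<noteq> j" for k
  using lattice_point_separated[of D j k] that True D by auto
 then have "?S = {}" by auto
 then show ?thesis using D t by (simp only: card.empty of_nat_0) simp
next
 case False
 define N' where "N' = nat \<lfloor>t / D\<rfloor>"
 have tD: "1 \<le> t / D" using False D by simp
 have "?S \<subseteq> {k. \<forall>i. \<bar>k $ i - j $ i\<bar> \<le> int N'}"
 proof (intro subsetI CollectI allI)
  fix k i assume "k \<in> ?S"
  then have "D * \<bar>real_of_int (j $ i - k $ i)\<bar> \<le> t"
   using lattice_point_component_le[of D j i k] D by auto
  then have "\<bar>real_of_int (j $ i - k $ i)\<bar> \<le> t / D" using D by (simp add: pos_le_divide_eq mult.commute)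
  then have "real_of_int \<bar>k $ i - j $ i\<bar> \<le> t / D" by linarith
  then show "\<bar>k $ i - j $ i\<bar> \<le> int N'" using tD unfolding N'_def by linarith
 qed
 then have "card ?S \<le> (2 * N' + 1) ^ CARD('n)"
  unfolding lattice_box(2)[of j N', symmetric] by (rule card_mono[OF lattice_box(1)])
 then have "real (card ?S) \<le> real ((2 * N' + 1) ^ CARD('n))"
  by (simp only: of_nat_le_iff)
 also have "... = (2 * real N' + 1) ^ CARD('n)" by (simp add: add.commute)
 also have "... \<le> (3 * t / D) ^ CARD('n)"
 proof (rule power_mono)
  have "real N' \<le> t / D" using tD unfolding N'_def by linarith
  then show "2 * real N' + 1 \<le> 3 * t / D" using tD by simp
 qed simp
 finally show ?thesis .
qed

text \<open>The fraction of pairs of base points within \<open>4 * s\<close> of each other is of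
  order \<open>min (s / r) 1 ^ d\<close>, the weight in the radius error. The factor
  \<open>24 * d\<close> is \<open>3 * 4\<close> from the count times \<open>2 * d\<close> from the
  size of the lattice.\<close>

lemma sum_lattice_near_le:
 fixes N :: nat
 defines "I \<equiv> lattice N :: (int^'n) set"
 assumes r: "r > 0" and D: "D > 0" and s: "s \<ge> 0" and N: "r / (2 * real CARD('n) * D) \<le> real N + 1"
 shows "(\<Sum>j\<in>I. \<Sum>k\<in>I - {j}. indicator {norm (lattice_point D j - lattice_point D k :: real^'n)..} (4 * s))
  \<le> (real (card I))\<^sup>2 * (24 * real CARD('n)) ^ CARD('n) * min (s / r) 1 ^ CARD('n)"
proof -
 have fin: "finite I" unfolding I_def by (rule finite_lattice)
 let ?d = "real CARD('n)"
 have d: "?d \<ge> 1" by simp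
 have n: "real (card I) = (2 * real N + 1) ^ CARD('n)" unfolding I_def by (simp add: card_lattice add.commute)
 have one: "(\<Sum>k\<in>I - {j}. indicator {norm (lattice_point D j - lattice_point D k :: real^'n)..} (4 * s))
   \<le> real (card I) * ((24 * ?d) ^ CARD('n) * min (s / r) 1 ^ CARD('n))" if "j \<in> I" for j
 proof -
  let ?S = "{k \<in> lattice N - {j}. norm (lattice_point D j - lattice_point D k :: real^'n) \<le> 4 * s}"
  have "(\<Sum>k\<in>I - {j}. indicator {norm (lattice_point D j - lattice_point D k :: real^'n)..} (4 * s)) = (\<Sum>k\<in>I - {j}. if k \<in> ?S then 1 else (0::real))"
   by (intro sum.cong) (auto simp: indicator_def I_def)
  also have "... = (\<Sum>k\<in>?S. 1)"
   using fin by (intro sum.mono_neutral_cong_right) (auto simp: I_def)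
  also have "... = real (card ?S)" by simp
  also have "... \<le> real (card I) * ((24 * ?d) ^ CARD('n) * min (s / r) 1 ^ CARD('n))"
  proof (cases "s < r")
   case False
   have "card ?S \<le> card I" using fin by (intro card_mono) (auto simp: I_def)
   then have "real (card ?S) \<le> real (card I) * 1" by simp
   also have "... \<le> real (card I) * ((24 * ?d) ^ CARD('n) * min (s / r) 1 ^ CARD('n))"
   proof (rule mult_left_mono)
    have "min (s / r) 1 = 1" using False r by simp
    moreover have "1 \<le> (24 * ?d) ^ CARD('n)" using d by (intro one_le_power) linarith
    ultimately show "1 \<le> (24 * ?d) ^ CARD('n) * min (s / r) 1 ^ CARD('n)" by simp
   qed simp
   finally show ?thesis .
  next
   case True
   have "real (card ?S) \<le> (3 * (4 * s) / D) ^ CARD('n)" using s by (intro card_lattice_near_le D) simp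
   also have "... \<le> ((2 * real N + 1) * (24 * ?d) * (s / r)) ^ CARD('n)"
   proof (rule power_mono)
    have "3 * (4 * s) / D = (r / (2 * ?d * D)) * (24 * ?d * (s / r))" using r D d by (simp add: field_simps)
    also have "... \<le> (2 * real N + 1) * (24 * ?d * (s / r))" using N s r by (intro mult_right_mono) auto
    finally show "3 * (4 * s) / D \<le> (2 * real N + 1) * (24 * ?d) * (s / r)" by (simp only: mult.assoc)
    show "0 \<le> 3 * (4 * s) / D" using s D by simp
   qed
   also have "... = real (card I) * ((24 * ?d) ^ CARD('n) * min (s / r) 1 ^ CARD('n))"
   proof -
    have "min (s / r) 1 = s / r" using True r by (simp add: min_absorb1)
    then show ?thesis unfolding n by (simp only: power_mult_distrib mult.assoc)
   qed
   finally show ?thesis .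
  qed
  finally show ?thesis .
 qed
 have "(\<Sum>j\<in>I. \<Sum>k\<in>I - {j}. indicator {norm (lattice_point D j - lattice_point D k :: real^'n)..} (4 * s)) \<le>
   (\<Sum>j\<in>I. real (card I) * ((24 * ?d) ^ CARD('n) * min (s / r) 1 ^ CARD('n)))"
  by (rule sum_mono) (rule one)
 also have "... = (real (card I))\<^sup>2 * (24 * ?d) ^ CARD('n) * min (s / r) 1 ^ CARD('n)" by (simp add: power2_eq_square)
 finally show ?thesis .
qed

text \<open>A ball of radius \<open>s\<close> meeting both segments forces
  \<open>norm (x - y) \<le> 2 * s + 2 * l\<close>, hence \<open>norm (x - y) \<le> 4 * s\<close>
  because \<open>4 * l \<le> norm (x - y)\<close>. Then also \<open>l \<le> s\<close>, and the tube
  around one segment has volume at most \<open>3 * s\<close> times its cross-section.\<close>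

lemma segment_balls_pair_le:
 fixes x y :: "real^'n" and Q :: "real measure"
 assumes d: "CARD('n) \<ge> 2" and Q: "prob_space Q" "sets Q = sets borel" "AE x in Q. x \<ge> 0" "integrable Q (\<lambda>x. x ^ CARD('n))"
  and u: "norm u = 1" and l: "0 \<le> l" "4 * l \<le> norm (x - y)"
 shows "emeasure (lborel \<Otimes>\<^sub>M Q) (segment_balls x (x + l *\<^sub>R u) 0 \<inter> segment_balls y (y + l *\<^sub>R u) 0) \<le>
  ennreal (3 * unit_ball_vol (real (CARD('n) - 1)) * (\<integral>s. s ^ CARD('n) * indicator {norm (x - y)..} (4 * s) \<partial>Q))"
proof -
 let ?\<kappa> = "unit_ball_vol (real (CARD('n) - 1))"
 let ?x = "x + l *\<^sub>R u" and ?y = "y + l *\<^sub>R u"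
 have near: "norm (z - w) \<le> s + l" if "z \<in> nbhd (closed_segment w (w + l *\<^sub>R u)) s" for z w s
 proof -
  obtain p where p: "p \<in> closed_segment w (w + l *\<^sub>R u)" "dist p z \<le> s" using \<open>z \<in> _\<close> by (auto simp: nbhd_def)
  then show ?thesis using dist_closed_segment_le[OF u l(1) p(1), of z] by (simp add: dist_norm norm_minus_commute)
 qed
 have "emeasure (lborel \<Otimes>\<^sub>M Q) (segment_balls x ?x 0 \<inter> segment_balls y ?y 0)
  = (\<integral>\<^sup>+s. emeasure lborel (nbhd (closed_segment x ?x) s \<inter> nbhd (closed_segment y ?y) s) \<partial>Q)"
  by (subst emeasure_boolean_intensity[OF Q(1) sets.Int[OF sets_segment_balls[OF Q(2)] sets_segment_balls[OF Q(2)]]])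
    (simp add: segment_balls_def Int_def)
 also have "... \<le> (\<integral>\<^sup>+s. ennreal (3 * ?\<kappa> * (s ^ CARD('n) * indicator {norm (x - y)..} (4 * s))) \<partial>Q)"
 proof (rule nn_integral_mono_AE, rule AE_mp[OF Q(3)], intro AE_I2 impI)
  fix s :: real assume s: "0 \<le> s"
  show "emeasure lborel (nbhd (closed_segment x ?x) s \<inter> nbhd (closed_segment y ?y) s) \<le> ennreal (3 * ?\<kappa> * (s ^ CARD('n) * indicator {norm (x - y)..} (4 * s)))"
  proof (cases "norm (x - y) \<le> 4 * s")
   case True
   have nx: "norm (x - ?x) = l" using u l by simp
   have "emeasure lborel (nbhd (closed_segment x ?x) s \<inter> nbhd (closed_segment y ?y) s) \<le> emeasure lborel (nbhd (closed_segment x ?x) s)"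
    using compact_nbhd[of "closed_segment x ?x" s] by (intro emeasure_mono) (auto simp: borel_compact)
   also have "... \<le> ennreal ((l + 2 * s) * (?\<kappa> * s ^ (CARD('n) - 1)))" using emeasure_nbhd_segment(2)[OF d s, of x ?x] unfolding nx .
   also have "... \<le> ennreal ((3 * s) * (?\<kappa> * s ^ (CARD('n) - 1)))"
    using True l s by (intro ennreal_leI mult_right_mono) auto
   also have "(3 * s) * (?\<kappa> * s ^ (CARD('n) - 1)) = 3 * ?\<kappa> * s ^ CARD('n)"
   proof -
    have "s ^ CARD('n) = s * s ^ (CARD('n) - 1)" using d by (cases "CARD('n)") auto
    then show ?thesis by (simp only: mult_ac)
   qed
   finally show ?thesis using True by simp
  next
   case False
   have "nbhd (closed_segment x ?x) s \<inter> nbhd (closed_segment y ?y) s = {}"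
   proof (rule ccontr)
    assume "nbhd (closed_segment x ?x) s \<inter> nbhd (closed_segment y ?y) s \<noteq> {}"
    then obtain z where "norm (z - x) \<le> s + l" "norm (z - y) \<le> s + l" using near by blast
    then have "norm (x - y) \<le> 2 * s + 2 * l" using norm_triangle_ineq4[of "z - y" "z - x"] by simp
    then show False using False l by linarith
   qed
   then show ?thesis by simp
  qed
 qed
 also have "... = ennreal (\<integral>s. 3 * ?\<kappa> * (s ^ CARD('n) * indicator {norm (x - y)..} (4 * s)) \<partial>Q)"
 proof (rule nn_integral_eq_integral)
  show "integrable Q (\<lambda>s. 3 * ?\<kappa> * (s ^ CARD('n) * indicator {norm (x - y)..} (4 * s)))"
   by (intro integrable_mult_right integrable_of_nonneg_law[OF Q(2-4)]) (auto simp: indicator_def)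
  show "AE s in Q. 0 \<le> 3 * ?\<kappa> * (s ^ CARD('n) * indicator {norm (x - y)..} (4 * s))"
   using Q(3) by (rule AE_mp) (auto intro!: AE_I2 mult_nonneg_nonneg)
 qed
 finally show ?thesis by simp
qed

lemma radius_error_nonneg:
 assumes "AE x in Q. x \<ge> 0" "r > 0" shows "radius_error d Q r \<ge> 0"
 unfolding radius_error_def
 by (rule integral_nonneg_AE, rule AE_mp[OF assms(1)]) (use assms(2) in \<open>auto intro!: AE_I2 mult_nonneg_nonneg zero_le_power\<close>)

lemma integrable_radius_error:
 fixes Q :: "real measure"
 assumes Q: "sets Q = sets borel" "AE x in Q. x \<ge> 0" "integrable Q (\<lambda>x. x ^ d)" and r: "r > 0"
 shows "integrable Q (\<lambda>x. x ^ d * min (x / r) 1 ^ d)"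
proof (rule integrable_of_nonneg_law[OF Q])
 fix x :: real assume x: "0 \<le> x"
 have "0 \<le> min (x / r) 1 ^ d" "min (x / r) 1 ^ d \<le> 1" using x r by (auto intro!: power_le_one)
 then show "\<bar>x ^ d * min (x / r) 1 ^ d\<bar> \<le> x ^ d" using x by (simp add: abs_mult mult_left_le)
qed measurable

text \<open>A single large ball can block many segments, so distant segments need not decorrelate at
  a polynomial rate. The overlaps are summed over the lattice under the expectation, where counting
  the pairs within \<open>4 * s\<close> turns the moment of order \<open>d\<close> into the radius
  error.\<close>

lemma boolean_lower_tail:
 fixes \<alpha> \<gamma> :: real
 assumes d: "CARD('n) \<ge> 2" and \<alpha>: "\<alpha> > 0" and \<gamma>0: "\<gamma> > 0" and \<gamma>': "\<gamma>' \<le> \<gamma>"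
  and Q: "prob_space Q" "sets Q = sets borel" "AE x in Q. x \<ge> 0" "integrable Q (\<lambda>x. x ^ CARD('n))"
  and \<gamma>: "\<alpha> * visibility_const Boolean CARD('n) \<rho> Q * \<gamma> < real CARD('n)"
 shows "\<exists>\<epsilon>>0. \<forall>(M :: 'w measure) (C :: 'w \<Rightarrow> (real^'n) set). boolean_model \<alpha> Q M C \<longrightarrow>
  (\<lambda>r. prob_visibility_lt M C (\<gamma>' * ln r) r)
   \<in> O(\<lambda>r. r powr (- \<epsilon>) + radius_error CARD('n) Q r)"
proof -
 define d \<kappa> where "d = CARD('n)" "\<kappa> = unit_ball_vol (real (CARD('n) - 1))"
 have \<kappa>: "\<kappa> > 0" by (simp add: d_\<kappa>_def)
 define m m2 where "m = (\<integral>s. s ^ (CARD('n) - 1) \<partial>Q)" "m2 = (\<integral>s. s ^ CARD('n) \<partial>Q)"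
 have m0: "m \<ge> 0" "m2 \<ge> 0" unfolding m_m2_def by (rule integral_nonneg_AE, rule AE_mp[OF Q(3)], intro AE_I2 impI, simp)+
 define a where "a = \<kappa> * m"
 have a: "a \<ge> 0" using \<kappa> m0 by (simp add: a_def)
 have \<gamma>a: "\<alpha> * a * \<gamma> < real CARD('n)" using \<gamma> by (simp add: a_def d_\<kappa>_def m_m2_def)
 define \<tau> where "\<tau> = (real CARD('n) + \<alpha> * a * \<gamma>) / 2"
 have \<tau>: "0 \<le> \<tau>" "\<tau> < real CARD('n)" "\<alpha> * a * \<gamma> < \<tau>" using \<gamma>a mult_nonneg_nonneg[OF mult_nonneg_nonneg[OF less_imp_le[OF \<alpha>] a] less_imp_le[OF \<gamma>0]] unfolding \<tau>_def by argo+
 define \<eta> where "\<eta> = (1 - \<tau> / real CARD('n)) / 2"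
 have \<eta>: "0 < \<eta>" using \<tau> by (simp add: \<eta>_def)
 have far: "eventually (\<lambda>r. 4 * (\<gamma> * ln r) \<le> r powr \<eta>) at_top" using \<eta> \<gamma>0 by real_asymp
 define u :: "real^'n" where "u = axis (SOME i. True) 1"
 have u: "norm u = 1" by (simp add: u_def)
 define J where "J x y s = s ^ CARD('n) * indicator {norm (x - y)..} (4 * s)" for x y :: "real^'n" and s :: real
 have iJ: "integrable Q (J x y)" for x y
  unfolding J_def by (rule integrable_of_nonneg_law[OF Q(2-4)]) (auto simp: indicator_def)
 have J0: "(\<integral>s. J x y s \<partial>Q) \<ge> 0" for x y
  by (rule integral_nonneg_AE, rule AE_mp[OF Q(3)]) (auto simp: J_def indicator_def)
 have J2: "(\<integral>s. J x y s \<partial>Q) \<le> m2" for x y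
  unfolding m_m2_def by (rule integral_mono_AE[OF iJ Q(4)], rule AE_mp[OF Q(3)]) (auto simp: J_def indicator_def)
 \<comment> \<open>A moment restricted to radii comparable with the distance; it never exceeds a
   multiple of the full moment, which supplies the bound \<open>K\<close> for the
   exponentials.\<close>
 define q where "q r x y = \<alpha> * (3 * \<kappa> * (\<integral>s. J x y s \<partial>Q))" for r :: real and x y
 define A where "A = \<alpha> * (3 * \<kappa>) * (24 * real CARD('n)) ^ CARD('n)"
 have A: "A \<ge> 0" using \<alpha> \<kappa> by (simp add: A_def)
 let ?B = "\<lambda>r x y. segment_balls x (x + (\<gamma> * ln r) *\<^sub>R u) 0 \<inter> segment_balls y (y + (\<gamma> * ln r) *\<^sub>R u) 0"
 show ?thesis
 proof (intro exI[of _ "(real CARD('n) - \<tau>) / 2"] conjI allI impI)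
  show "(real CARD('n) - \<tau>) / 2 > 0" using \<tau> by simp
  fix M :: "'w measure" and C :: "'w \<Rightarrow> (real^'n) set"
  assume "boolean_model \<alpha> Q M C"
  then obtain X where pc: "poisson_cover M (lborel \<Otimes>\<^sub>M Q) \<alpha> X (\<lambda>(z, s). cball z s) C"
   using boolean_cover[OF _ \<alpha>] by blast
  show "(\<lambda>r. prob_visibility_lt M C (\<gamma>' * ln r) r)
   \<in> O(\<lambda>r. r powr (- ((real CARD('n) - \<tau>) / 2)) + radius_error CARD('n) Q r)"
  proof (rule poisson_cover.visibility_lower_tail[OF pc u \<tau>(1,2) \<eta>_def log_scale_bounds[OF \<gamma>0] poisson_cover.log_lev[OF pc \<gamma>'],
     where H="\<lambda>x y. segment_balls x y 0" and q=q and K="\<alpha> * (3 * \<kappa> * m2)" and A=A])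
   show "segment_balls x y 0 \<in> sets (lborel \<Otimes>\<^sub>M Q)" for x y :: "real^'n" by (rule sets_segment_balls[OF Q(2)])
   show "g \<in> segment_balls x y 0" if "closed_segment x y \<inter> (case g of (z, s) \<Rightarrow> cball z s) \<noteq> {}" for g and x y :: "real^'n"
    using that by (auto simp: segment_balls_def nbhd_def dist_commute split: prod.splits)
   have le: "emeasure (lborel \<Otimes>\<^sub>M Q) (segment_balls x y 0) \<le> ennreal (a * norm (x - y) + 2 * \<kappa> * m2)" for x y :: "real^'n"
    using segment_balls_intensity_le[OF d Q, of x y] by (simp add: a_def d_\<kappa>_def m_m2_def algebra_simps)
   show "eventually (\<lambda>r. \<forall>x y :: real^'n. norm (x - y) = \<gamma> * ln r \<longrightarrow> ennreal \<alpha> * emeasure (lborel \<Otimes>\<^sub>M Q) (segment_balls x y 0) \<le> ennreal (\<tau> * ln r)) at_top"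
    using \<kappa> m0 by (intro poisson_cover.log_mass_le[OF pc a _ \<gamma>0 \<tau>(3) le]) simp
   show "eventually (\<lambda>r. \<forall>x y. r powr \<eta> \<le> norm (x - y) \<longrightarrow> 0 \<le> q r x y \<and> q r x y \<le> \<alpha> * (3 * \<kappa> * m2) \<and>
    ennreal \<alpha> * emeasure (lborel \<Otimes>\<^sub>M Q) (?B r x y) \<le> ennreal (q r x y)) at_top"
    using far eventually_gt_at_top[of 1]
   proof eventually_elim
    case (elim r)
    have l0: "0 \<le> \<gamma> * ln r" using \<gamma>0 elim by simp
    show ?case
    proof (intro allI impI conjI)
     fix x y :: "real^'n" assume "r powr \<eta> \<le> norm (x - y)"
     then have fr: "4 * (\<gamma> * ln r) \<le> norm (x - y)" using elim by simp
     show "0 \<le> q r x y" "q r x y \<le> \<alpha> * (3 * \<kappa> * m2)"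
      unfolding q_def using \<alpha> \<kappa> J0 J2 by (auto intro!: mult_left_mono)
     have "ennreal \<alpha> * emeasure (lborel \<Otimes>\<^sub>M Q) (?B r x y)
      \<le> ennreal \<alpha> * ennreal (3 * \<kappa> * (\<integral>s. J x y s \<partial>Q))"
      using segment_balls_pair_le[OF d Q u l0 fr] unfolding d_\<kappa>_def J_def by (intro mult_left_mono) auto
     also have "... = ennreal (q r x y)" unfolding q_def using \<alpha> by (subst ennreal_mult'[symmetric]) auto
     finally show "ennreal \<alpha> * emeasure (lborel \<Otimes>\<^sub>M Q) (?B r x y) \<le> ennreal (q r x y)" .
    qed
   qed
   show "eventually (\<lambda>r. \<forall>N. r powr (1 - \<eta>) / (2 * real CARD('n)) \<le> real N + 1 \<longrightarrow>
    (\<Sum>j\<in>(lattice N :: (int^'n) set). \<Sum>k\<in>lattice N - {j}. q r (lattice_point (r powr \<eta>) j) (lattice_point (r powr \<eta>) k))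
    \<le> A * radius_error CARD('n) Q r * (real (card (lattice N :: (int^'n) set)))\<^sup>2) at_top"
    using eventually_gt_at_top[of 1]
   proof eventually_elim
    case (elim r)
    show ?case
    proof (intro allI impI)
     fix N assume N: "r powr (1 - \<eta>) / (2 * real CARD('n)) \<le> real N + 1"
     let ?I = "lattice N :: (int^'n) set"
     define D where "D = r powr \<eta>"
     have D: "D > 0" using elim by (simp add: D_def)
     have "r powr (1 - \<eta>) = r / D" using elim by (simp add: D_def powr_diff)
     then have N': "r / (2 * real CARD('n) * D) \<le> real N + 1" using N by (simp add: mult_ac)
     let ?p = "lattice_point D :: int^'n \<Rightarrow> real^'n"
     let ?c = "(real (card ?I))\<^sup>2 * (24 * real CARD('n)) ^ CARD('n)"
     have "(\<Sum>j\<in>?I. \<Sum>k\<in>?I - {j}. q r (?p j) (?p k)) = \<alpha> * (3 * \<kappa>) * (\<integral>s. (\<Sum>j\<in>?I. \<Sum>k\<in>?I - {j}. J (?p j) (?p k) s) \<partial>Q)"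
      using iJ by (simp add: q_def sum_distrib_left mult.assoc)
     also have "... \<le> \<alpha> * (3 * \<kappa>) * (\<integral>s. ?c * (s ^ CARD('n) * min (s / r) 1 ^ CARD('n)) \<partial>Q)"
     proof (intro mult_left_mono integral_mono_AE)
      show "integrable Q (\<lambda>s. \<Sum>j\<in>?I. \<Sum>k\<in>?I - {j}. J (?p j) (?p k) s)" by (intro Bochner_Integration.integrable_sum iJ)
      show "integrable Q (\<lambda>s. ?c * (s ^ CARD('n) * min (s / r) 1 ^ CARD('n)))"
       using integrable_radius_error[OF Q(2,3,4), of r] elim by simp
      show "AE s in Q. (\<Sum>j\<in>?I. \<Sum>k\<in>?I - {j}. J (?p j) (?p k) s) \<le> ?c * (s ^ CARD('n) * min (s / r) 1 ^ CARD('n))"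
       using Q(3)
      proof (rule AE_mp, intro AE_I2 impI)
       fix s :: real assume s: "0 \<le> s"
       have "(\<Sum>j\<in>?I. \<Sum>k\<in>?I - {j}. J (?p j) (?p k) s) = s ^ CARD('n) * (\<Sum>j\<in>?I. \<Sum>k\<in>?I - {j}. indicator {norm (?p j - ?p k)..} (4 * s))"
        by (simp add: J_def sum_distrib_left)
       also have "... \<le> s ^ CARD('n) * (?c * min (s / r) 1 ^ CARD('n))"
        using s elim D N' by (intro mult_left_mono sum_lattice_near_le) auto
       finally show "(\<Sum>j\<in>?I. \<Sum>k\<in>?I - {j}. J (?p j) (?p k) s) \<le> ?c * (s ^ CARD('n) * min (s / r) 1 ^ CARD('n))"
        by (simp only: mult_ac)
      qed
     qed (use \<alpha> \<kappa> in simp)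
     also have "... = A * radius_error CARD('n) Q r * (real (card ?I))\<^sup>2"
      unfolding integral_mult_right_zero A_def radius_error_def by (simp only: mult_ac)
     finally show "(\<Sum>j\<in>?I. \<Sum>k\<in>?I - {j}. q r (lattice_point (r powr \<eta>) j) (lattice_point (r powr \<eta>) k))
      \<le> A * radius_error CARD('n) Q r * (real (card ?I))\<^sup>2" unfolding D_def .
    qed
   qed
   show "eventually (\<lambda>r. radius_error CARD('n) Q r \<ge> 0) at_top"
    using eventually_gt_at_top[of 0] by eventually_elim (rule radius_error_nonneg[OF Q(3)])
  qed (rule A)
 qed
qed

section \<open>Poisson cylinders\<close>

type_synonym 'n rvec = "(real, 'n) vec"

definition drop_first :: "('n::{finite,linorder}) rvec \<Rightarrow> 'n rvec" where
 "drop_first x = (\<chi> i. if i = Min UNIV then 0 else x $ i)"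

lemma linear_drop_first: "linear (drop_first :: ('n::{finite,linorder}) rvec \<Rightarrow> 'n rvec)"
 by (rule linearI) (auto simp: drop_first_def vec_eq_iff)

lemma continuous_on_drop_first [continuous_intros]:
 "continuous_on S f \<Longrightarrow> continuous_on S (\<lambda>x. drop_first (f x :: ('n::{finite,linorder}) rvec))"
 by (rule continuous_on_compose2[OF linear_continuous_on[OF linear_drop_first[unfolded linear_conv_bounded_linear], of UNIV]]) auto

lemma measurable_drop_first [measurable]: "(drop_first :: ('n::{finite,linorder}) rvec \<Rightarrow> _) \<in> borel \<rightarrow>\<^sub>M borel"
 by (intro borel_measurable_continuous_onI continuous_intros)

lemma norm_drop_first_sq:
 fixes x :: "('n::{finite,linorder}) rvec"
 shows "(norm x)\<^sup>2 = (x $ Min UNIV)\<^sup>2 + (norm (drop_first x))\<^sup>2"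
  and "norm (drop_first x) = sqrt (\<Sum>i\<in>-{Min UNIV}. (x $ i)\<^sup>2)"
proof -
 have "(\<Sum>i\<in>UNIV. (drop_first x $ i)\<^sup>2) = (\<Sum>i\<in>-{Min UNIV}. (drop_first x $ i)\<^sup>2)"
  by (rule sum.mono_neutral_right) (auto simp: drop_first_def)
 also have "... = (\<Sum>i\<in>-{Min UNIV}. (x $ i)\<^sup>2)" by (rule sum.cong) (auto simp: drop_first_def)
 finally show n: "norm (drop_first x) = sqrt (\<Sum>i\<in>-{Min UNIV}. (x $ i)\<^sup>2)" by (simp add: norm_vec_def L2_set_def)
 have "(norm x)\<^sup>2 = (\<Sum>i\<in>UNIV. (x $ i)\<^sup>2)" by (simp add: norm_vec_def L2_set_def sum_nonneg)
 also have "... = (x $ Min UNIV)\<^sup>2 + (\<Sum>i\<in>UNIV - {Min UNIV}. (x $ i)\<^sup>2)" by (rule sum.remove) auto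
 finally show "(norm x)\<^sup>2 = (x $ Min UNIV)\<^sup>2 + (norm (drop_first x))\<^sup>2"
  unfolding n by (simp add: Compl_eq_Diff_UNIV sum_nonneg)
qed

lemma norm_drop_first_le: "norm (drop_first x) \<le> norm (x :: ('n::{finite,linorder}) rvec)"
 by (rule power2_le_imp_le) (auto simp: norm_drop_first_sq(1)[of x])

lemma sets_hyperplane_measure [simp, measurable_cong]: "sets hyperplane_measure = sets borel"
 by (simp add: hyperplane_measure_def)

lemma space_hyperplane_measure [simp]: "space hyperplane_measure = UNIV"
 by (simp add: hyperplane_measure_def)

text \<open>Fubini with the first coordinate split off. \<open>drop_first\<close> is the identity on
  the hyperplane that carries the measure; writing it makes later identities for the integrand hold
  at every \<open>z\<close>.\<close>

lemma nn_integral_lborel_hyperplane: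
 fixes f :: "('n::{finite,linorder}) rvec \<Rightarrow> ennreal"
 assumes f [measurable]: "f \<in> borel_measurable borel"
 shows "(\<integral>\<^sup>+x. f x \<partial>lborel) = (\<integral>\<^sup>+t. \<integral>\<^sup>+z. f (t *\<^sub>R first_axis + drop_first z) \<partial>hyperplane_measure \<partial>lborel)"
proof -
 interpret product_sigma_finite "\<lambda>_::'n. lborel :: real measure" by standard
 let ?i = "Min UNIV :: 'n"
 let ?I = "UNIV - {?i}"
 have ins: "insert ?i ?I = UNIV" by auto
 have m: "(\<lambda>g. f (vec_lambda g)) \<in> borel_measurable (Pi\<^sub>M (insert ?i ?I) (\<lambda>_. lborel))"
  unfolding ins by measurable
 have m2: "(\<lambda>g. \<chi> i. if i = ?i then 0 else g i) \<in> (\<Pi>\<^sub>M i\<in>?I. lborel) \<rightarrow>\<^sub>M (borel :: 'n rvec measure)"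
 proof (rule borel_measurable_euclidean_space[THEN iffD2], rule ballI)
  fix b :: "'n rvec" assume "b \<in> Basis"
  then obtain i where b: "b = axis i 1" by (auto simp: Basis_vec_def)
  have "(\<lambda>g. (\<chi> i. if i = ?i then 0 else g i) \<bullet> b) = (\<lambda>g. if i = ?i then 0 else g i)" by (auto simp: b inner_axis)
  then show "(\<lambda>g. (\<chi> i. if i = ?i then 0 else g i) \<bullet> b) \<in> borel_measurable (\<Pi>\<^sub>M i\<in>?I. lborel)" by (cases "i = ?i") simp_all
 qed
 have "(\<integral>\<^sup>+x. f x \<partial>lborel) = (\<integral>\<^sup>+g. f (vec_lambda g) \<partial>(\<Pi>\<^sub>M i\<in>insert ?i ?I. lborel))"
  unfolding ins by (rule nn_integral_lborel_vec[OF f])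
 also have "... = (\<integral>\<^sup>+t. \<integral>\<^sup>+g. f (vec_lambda (g(?i := t))) \<partial>(\<Pi>\<^sub>M i\<in>?I. lborel) \<partial>lborel)"
  by (rule product_nn_integral_insert_rev[OF _ _ m]) auto
 also have "... = (\<integral>\<^sup>+t. \<integral>\<^sup>+z. f (t *\<^sub>R first_axis + drop_first z) \<partial>hyperplane_measure \<partial>lborel)"
 proof (rule nn_integral_cong)
  fix t :: real
  have "vec_lambda (g(?i := t)) = t *\<^sub>R first_axis + drop_first (\<chi> i. if i = ?i then 0 else g i)" for g :: "'n \<Rightarrow> real"
   by (auto simp: vec_eq_iff first_axis_def drop_first_def axis_def)
  then show "(\<integral>\<^sup>+g. f (vec_lambda (g(?i := t))) \<partial>(\<Pi>\<^sub>M i\<in>?I. lborel)) = (\<integral>\<^sup>+z. f (t *\<^sub>R first_axis + drop_first z) \<partial>hyperplane_measure)"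
   unfolding hyperplane_measure_def by (subst nn_integral_distr[OF m2]) auto
 qed
 finally show ?thesis .
qed

lemma first_axis_component: "(t *\<^sub>R first_axis + drop_first z) $ Min UNIV = t"
 and drop_first_decomp: "drop_first (t *\<^sub>R first_axis + drop_first z) = drop_first z"
 by (auto simp: first_axis_def drop_first_def axis_def vec_eq_iff)

text \<open>Multiplying by the unit interval in the missing direction turns the hyperplane measure
  into Lebesgue measure, for which the volumes of tubes and cylinders are known.\<close>

lemma emeasure_hyperplane_slab:
 fixes S :: "(('n::{finite,linorder}) rvec) set"
 assumes S [measurable]: "S \<in> sets borel"
 shows "emeasure hyperplane_measure {z. drop_first z \<in> S} = emeasure lborel {w. 0 \<le> w $ Min UNIV \<and> w $ Min UNIV \<le> 1 \<and> drop_first w \<in> S}"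
proof -
 let ?f = "\<lambda>w::'n rvec. indicator {0..1} (w $ Min UNIV) * (indicator S (drop_first w) :: ennreal)"
 have "emeasure lborel {w. 0 \<le> w $ Min UNIV \<and> w $ Min UNIV \<le> 1 \<and> drop_first w \<in> S} = (\<integral>\<^sup>+w. indicator {w. 0 \<le> w $ Min UNIV \<and> w $ Min UNIV \<le> 1 \<and> drop_first w \<in> S} w \<partial>lborel)"
  by (rule nn_integral_indicator[symmetric]) measurable
 also have "... = (\<integral>\<^sup>+w. ?f w \<partial>lborel)" by (intro nn_integral_cong) (auto simp: indicator_def)
 also have "... = (\<integral>\<^sup>+t. \<integral>\<^sup>+z. indicator {0..1::real} t * indicator S (drop_first z) \<partial>hyperplane_measure \<partial>lborel)"
  by (subst nn_integral_lborel_hyperplane) (simp_all only: first_axis_component drop_first_decomp, measurable)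
 also have "... = (\<integral>\<^sup>+t. indicator {0..1::real} t * emeasure hyperplane_measure {z. drop_first z \<in> S} \<partial>lborel)"
 proof (rule nn_integral_cong)
  fix t :: real
  have "(\<integral>\<^sup>+z. indicator S (drop_first z) \<partial>hyperplane_measure) = (\<integral>\<^sup>+z. indicator {z. drop_first z \<in> S} z \<partial>hyperplane_measure)"
   by (intro nn_integral_cong) (auto simp: indicator_def)
  also have "... = emeasure hyperplane_measure {z. drop_first z \<in> S}"
   by (rule nn_integral_indicator) measurable
  finally show "(\<integral>\<^sup>+z. indicator {0..1::real} t * indicator S (drop_first z) \<partial>hyperplane_measure) = indicator {0..1::real} t * emeasure hyperplane_measure {z. drop_first z \<in> S}"
   by (subst nn_integral_cmult) auto
 qed
 also have "... = emeasure hyperplane_measure {z. drop_first z \<in> S}" by (subst nn_integral_multc) auto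
 finally show ?thesis ..
qed

abbreviation (input) shadow_measure :: "('n::{finite,linorder}) rvec \<Rightarrow> 'n rvec \<Rightarrow> real \<Rightarrow> ennreal" where
 "shadow_measure a b s \<equiv> emeasure hyperplane_measure {z. drop_first z \<in> nbhd (closed_segment a b) s}"

text \<open>The case of one fixed coordinate in \<open>emeasure_thick_tube\<close>. The
  cross-section has dimension \<open>d - 2\<close>, the origin of the ball volume and the power of
  the radius in the constant for the cylinders.\<close>

lemma emeasure_hyperplane_segment:
 fixes a b :: "('n::{finite,linorder}) rvec"
 assumes d: "CARD('n) \<ge> 2" and s: "s > 0" and ab: "drop_first a = a" "drop_first b = b"
 defines "c \<equiv> unit_ball_vol (real (CARD('n) - 2)) * s ^ (CARD('n) - 2)"
 shows "ennreal (norm (a - b) * c) \<le> shadow_measure a b s"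
  and "shadow_measure a b s \<le> ennreal ((norm (a - b) + 2 * s) * c)"
proof -
 let ?F = "{Min UNIV :: 'n}"
 have "\<exists>j. j \<notin> ?F"
 proof (rule ccontr)
  assume "\<not> (\<exists>j. j \<notin> ?F)"
  then have "UNIV = ?F" by blast
  then have "CARD('n) = card ?F" by (rule arg_cong)
  then show False using d by simp
 qed
 then obtain j where j: "j \<notin> ?F" by blast
 have "a $ Min UNIV = drop_first a $ Min UNIV" "b $ Min UNIV = drop_first b $ Min UNIV" using ab by simp_all
 then have z: "i \<in> ?F \<Longrightarrow> a $ i = 0 \<and> b $ i = 0" for i by (simp add: drop_first_def)
 have card: "card (- ?F) - 1 = CARD('n) - 2" by (simp add: Compl_eq_Diff_UNIV card_Diff_subset)
 have eq: "shadow_measure a b s = emeasure lborel {w. (\<forall>i\<in>?F. 0 \<le> w $ i \<and> w $ i \<le> 1) \<and>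
   (\<chi> i. if i \<in> ?F then 0 else w $ i) \<in> nbhd (closed_segment a b) s}"
  using compact_nbhd[of "closed_segment a b" s]
  by (subst emeasure_hyperplane_slab) (simp_all add: borel_compact drop_first_def conj_assoc)
 show "ennreal (norm (a - b) * c) \<le> shadow_measure a b s"
  "shadow_measure a b s \<le> ennreal ((norm (a - b) + 2 * s) * c)"
  using emeasure_thick_tube(2,3)[OF s j z] unfolding eq card c_def by blast+
qed

lemma sigma_finite_hyperplane_measure:
 assumes d: "CARD('n::{finite,linorder}) \<ge> 2"
 shows "sigma_finite_measure (hyperplane_measure :: 'n rvec measure)"
proof
 let ?A = "\<lambda>n. {z::'n rvec. drop_first z \<in> nbhd (closed_segment 0 0) (real (Suc n))}"
 have z: "drop_first (0 :: 'n rvec) = 0" by (simp add: drop_first_def vec_eq_iff)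
 show "\<exists>A. countable A \<and> A \<subseteq> sets (hyperplane_measure :: 'n rvec measure) \<and> \<Union> A = space (hyperplane_measure :: 'n rvec measure) \<and> (\<forall>a\<in>A. emeasure hyperplane_measure a \<noteq> \<infinity>)"
 proof (intro exI[of _ "range ?A"] conjI ballI)
  show "range ?A \<subseteq> sets (hyperplane_measure :: 'n rvec measure)"
  proof safe
   fix n
   have "nbhd (closed_segment 0 0) (real (Suc n)) \<in> sets (borel :: 'n rvec measure)"
    using compact_nbhd[of "closed_segment 0 (0::'n rvec)"] by (intro borel_compact) simp
   then have "drop_first -` nbhd (closed_segment 0 0) (real (Suc n)) \<inter> space borel \<in> sets (borel :: 'n rvec measure)"
    by (rule measurable_sets[OF measurable_drop_first])
   then show "?A n \<in> sets (hyperplane_measure :: 'n rvec measure)" by (simp add: vimage_def)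
  qed
  show "\<Union> (range ?A) = space (hyperplane_measure :: 'n rvec measure)"
  proof -
   have "\<exists>n. z \<in> ?A n" for z :: "'n rvec"
   proof -
    obtain n where "norm (drop_first z) \<le> real n" using real_arch_simple by blast
    then show ?thesis by (intro exI[of _ n]) (simp add: nbhd_def)
   qed
   then show ?thesis by auto
  qed
  fix a assume "a \<in> range ?A"
  then obtain n where a: "a = ?A n" by blast
  show "emeasure hyperplane_measure a \<noteq> \<infinity>"
   using emeasure_hyperplane_segment(2)[OF d _ z z, of "real (Suc n)"] unfolding a
   by (metis ennreal_less_top infinity_ennreal_def leD of_nat_0_less_iff zero_less_Suc)
 qed simp
qed

section \<open>Gaussian moments of norms\<close>

lemma nn_integral_radial:
 fixes N :: "'a \<Rightarrow> real"
 assumes N [measurable]: "N \<in> borel_measurable M" and N0: "\<And>x. x \<in> space M \<Longrightarrow> N x \<ge> 0" and k: "k \<ge> 1" and c: "c > 0"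
  and ball: "\<And>s. s > 0 \<Longrightarrow> emeasure M {x \<in> space M. N x \<le> s} = ennreal (c * s ^ k)"
  and f [measurable]: "f \<in> borel_measurable borel"
 shows "(\<integral>\<^sup>+x. f (N x) \<partial>M) = (\<integral>\<^sup>+r. f r * ennreal (c * real k * r ^ (k - 1)) * indicator {0..} r \<partial>lborel)"
proof -
 let ?D = "density lborel (\<lambda>r. ennreal (c * real k * r ^ (k - 1)) * indicator {0..} r)"
 \<comment> \<open>The law of \<open>N\<close> is determined by its distribution function, which is
   the volume of balls, and the density is its derivative.\<close>
 have eq: "distr M borel N = ?D"
 proof (rule measure_eqI_generator_eq[where E="range (\<lambda>a. {..a})" and \<Omega>=UNIV and A="\<lambda>i. {..real i + 1}"])
  show "Int_stable (range (\<lambda>a::real. {..a}))" by (auto simp: Int_stable_def)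
  show "sets (distr M borel N) = sigma_sets UNIV (range (\<lambda>a::real. {..a}))" "sets ?D = sigma_sets UNIV (range (\<lambda>a::real. {..a}))"
   by (simp_all add: borel_eq_atMost)
  show "(\<Union>i. {..real i + 1}) = UNIV"
  proof -
   have "\<exists>i. x \<le> real i + 1" for x using real_arch_simple[of x] by (meson le_add_same_cancel1 order_trans zero_le_one)
   then show ?thesis by auto
  qed
  have e: "emeasure (distr M borel N) {..a} = emeasure M {x \<in> space M. N x \<le> a}" for a
   by (subst emeasure_distr) (auto simp: vimage_def Int_def conj_commute)
  show "emeasure (distr M borel N) {..real i + 1} \<noteq> \<infinity>" for i unfolding e by (subst ball) auto
  fix X :: "real set" assume "X \<in> range (\<lambda>a. {..a})"
  then obtain a where X: "X = {..a}" by blast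
  have D: "emeasure ?D {..a} = (\<integral>\<^sup>+r. ennreal (c * real k * r ^ (k - 1)) * indicator {0..a} r \<partial>lborel)"
   by (subst emeasure_density) (auto intro!: nn_integral_cong simp: indicator_def)
  consider "a > 0" | "a = 0" | "a < 0" by linarith
  then have "emeasure M {x \<in> space M. N x \<le> a} = emeasure ?D {..a}"
  proof cases
   case 1
   have "(\<integral>\<^sup>+r. ennreal (c * real k * r ^ (k - 1)) * indicator {0..a} r \<partial>lborel) = ennreal (c * a ^ k - c * 0 ^ k)"
    using c 1 by (intro nn_integral_FTC_Icc) (auto intro!: derivative_eq_intros mult_nonneg_nonneg)
   then show ?thesis unfolding D ball[OF 1] using k by (simp add: power_0_left)
  next
   case 2
   \<comment> \<open>The volume of balls is given for positive radii; at radius 0 it is obtained by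
     letting \<open>s\<close> decrease to 0.\<close>
   have lim: "((\<lambda>s. ennreal (c * s ^ k)) \<longlongrightarrow> ennreal (c * 0 ^ k)) (at_right 0)"
    by (intro tendsto_ennrealI tendsto_intros)
   have "eventually (\<lambda>s. emeasure M {x \<in> space M. N x \<le> 0} \<le> ennreal (c * s ^ k)) (at_right 0)"
    using eventually_at_right_less[of 0]
   proof eventually_elim
    case (elim s)
    then show ?case unfolding ball[OF elim, symmetric] by (intro emeasure_mono) auto
   qed
   then have "emeasure M {x \<in> space M. N x \<le> 0} \<le> ennreal (c * 0 ^ k)"
    by (rule tendsto_lowerbound[OF lim]) (rule trivial_limit_at_right_real)
   then have "emeasure M {x \<in> space M. N x \<le> 0} = 0" using k by (simp add: power_0_left)
   moreover have "emeasure ?D {..0} = 0"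
   proof -
    have "emeasure ?D {..0} = (\<integral>\<^sup>+r. ennreal (c * real k * r ^ (k - 1)) * indicator {0} r \<partial>lborel)" using D 2 by simp
    also have "... = (\<integral>\<^sup>+r. 0 \<partial>(lborel :: real measure))"
     using AE_lborel_singleton[of "0::real"] by (intro nn_integral_cong_AE) (auto elim: eventually_mono)
    finally show ?thesis by simp
   qed
   ultimately show ?thesis using 2 by simp
  next
   case 3
   then have e: "{x \<in> space M. N x \<le> a} = {}" using N0 by force
   show ?thesis unfolding D e using 3 by simp
  qed
  then show "emeasure (distr M borel N) X = emeasure ?D X" unfolding X e .
 qed auto
 have "(\<integral>\<^sup>+x. f (N x) \<partial>M) = (\<integral>\<^sup>+r. f r \<partial>distr M borel N)" by (subst nn_integral_distr) auto
 also have "... = (\<integral>\<^sup>+r. f r * ennreal (c * real k * r ^ (k - 1)) * indicator {0..} r \<partial>lborel)"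
  unfolding eq by (subst nn_integral_density) (auto simp: mult_ac)
 finally show ?thesis .
qed

text \<open>For even \<open>k\<close> the Gamma function at a half-integer is matched with the
  factorial quotient of the Gaussian moments; for odd \<open>k\<close> it is a factorial.\<close>

lemma nn_integral_gaussian_power:
 "(\<integral>\<^sup>+r. ennreal (r ^ k * exp (- r\<^sup>2)) * indicator {0..} r \<partial>lborel) = ennreal (Gamma (real (k + 1) / 2) / 2)"
proof -
 have "has_bochner_integral lborel (\<lambda>x::real. indicator {0..} x *\<^sub>R (exp (- x\<^sup>2) * x ^ k)) (Gamma (real (k + 1) / 2) / 2)"
 proof (cases "even k")
  case True
  then obtain j where j: "k = 2 * j" by blast
  have G: "Gamma (real j + 1 / 2) = sqrt pi * (fact (2 * j) / (2 ^ (2 * j) * fact j))"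
  proof (induction j)
   case 0
   then show ?case by (simp add: Gamma_one_half_real)
  next
   case (Suc j)
   have "Gamma (real j + 1 / 2 + 1) = (real j + 1 / 2) * Gamma (real j + 1 / 2)"
    by (rule Gamma_plus1) (auto elim!: nonpos_Ints_cases')
   also have "... = sqrt pi * (fact (2 * Suc j) / (2 ^ (2 * Suc j) * fact (Suc j)))"
    unfolding Suc.IH by (simp add: field_simps del: of_nat_Suc) (simp add: algebra_simps)
   finally show ?case by (simp add: algebra_simps)
  qed
  have e: "real (k + 1) / 2 = real j + 1 / 2" by (simp add: j add_divide_distrib)
  have v: "Gamma (real (k + 1) / 2) / 2 = sqrt pi / 2 * (fact (2 * j) / (2 ^ (2 * j) * fact j))" unfolding e G by simp
  show ?thesis unfolding v unfolding j by (rule gaussian_moment_even_pos)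
 next
  case False
  then obtain j where j: "k = 2 * j + 1" by (blast elim: oddE)
  have "real (k + 1) / 2 = 1 + real j" by (simp add: j add_divide_distrib)
  then have v: "Gamma (real (k + 1) / 2) = fact j" by (simp only: Gamma_fact)
  show ?thesis unfolding v unfolding j by (rule gaussian_moment_odd_pos)
 qed
 then have "(\<integral>\<^sup>+x. ennreal (indicator {0..} x *\<^sub>R (exp (- x\<^sup>2) * x ^ k)) \<partial>lborel) = ennreal (Gamma (real (k + 1) / 2) / 2)"
  by (subst nn_integral_eq_integral) (auto simp: has_bochner_integral_iff indicator_def)
 moreover have "ennreal (indicator {0..} x *\<^sub>R (exp (- x\<^sup>2) * x ^ k)) = ennreal (x ^ k * exp (- x\<^sup>2)) * indicator {0..} x" for x :: real
  by (simp add: indicator_def mult.commute)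
 ultimately show ?thesis by simp
qed

text \<open>The integral of \<open>norm x * exp (- (norm x)\<^sup>2)\<close> over Euclidean space of
  dimension \<open>k\<close>.\<close>

definition gaussian_norm_moment :: "nat \<Rightarrow> real" where
 "gaussian_norm_moment k = pi powr (real k / 2) * Gamma (real (k + 1) / 2) / Gamma (real k / 2)"

lemma gaussian_norm_moment_pos: "k \<ge> 1 \<Longrightarrow> gaussian_norm_moment k > 0"
 unfolding gaussian_norm_moment_def by (intro divide_pos_pos mult_pos_pos Gamma_real_pos) auto

text \<open>The function \<open>N\<close> need only have balls of Euclidean volume, so the lemma
  serves both the norm on the whole space and the norm of the projection under the hyperplane
  measure.\<close>

lemma nn_integral_gaussian_norm:
 fixes N :: "'a \<Rightarrow> real"
 assumes N [measurable]: "N \<in> borel_measurable M" and N0: "\<And>x. x \<in> space M \<Longrightarrow> N x \<ge> 0" and k: "k \<ge> 1"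
  and ball: "\<And>s. s > 0 \<Longrightarrow> emeasure M {x \<in> space M. N x \<le> s} = ennreal (unit_ball_vol (real k) * s ^ k)"
 shows "(\<integral>\<^sup>+x. ennreal (N x * exp (- (N x)\<^sup>2)) \<partial>M) = ennreal (gaussian_norm_moment k)"
proof -
 define c where "c = unit_ball_vol (real k)"
 have c: "c > 0" by (simp add: c_def)
 have "(\<integral>\<^sup>+x. ennreal (N x * exp (- (N x)\<^sup>2)) \<partial>M) = (\<integral>\<^sup>+r. ennreal (r * exp (- r\<^sup>2)) * ennreal (c * real k * r ^ (k - 1)) * indicator {0..} r \<partial>lborel)"
  by (rule nn_integral_radial[OF N N0 k c ball[folded c_def]]) auto
 also have "... = (\<integral>\<^sup>+r. ennreal (c * real k) * (ennreal (r ^ k * exp (- r\<^sup>2)) * indicator {0..} r) \<partial>lborel)"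
 proof (rule nn_integral_cong)
  fix r :: real
  have "r ^ k = r * r ^ (k - 1)" using k by (cases k) auto
  then have "r \<ge> 0 \<Longrightarrow> ennreal (r * exp (- r\<^sup>2)) * ennreal (c * real k * r ^ (k - 1)) = ennreal (c * real k) * ennreal (r ^ k * exp (- r\<^sup>2))"
   using c by (simp add: ennreal_mult'[symmetric] mult_ac)
  then show "ennreal (r * exp (- r\<^sup>2)) * ennreal (c * real k * r ^ (k - 1)) * indicator {0..} r = ennreal (c * real k) * (ennreal (r ^ k * exp (- r\<^sup>2)) * indicator {0..} r)"
   by (auto simp: indicator_def)
 qed
 also have "... = ennreal (c * real k) * ennreal (Gamma (real (k + 1) / 2) / 2)"
  by (subst nn_integral_cmult) (simp_all only: nn_integral_gaussian_power, measurable)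
 also have "... = ennreal (c * real k * (Gamma (real (k + 1) / 2) / 2))"
  using c by (subst ennreal_mult'[symmetric]) auto
 also have "c * real k * (Gamma (real (k + 1) / 2) / 2) = gaussian_norm_moment k"
 proof -
  have g: "Gamma (real k / 2 + 1) = real k / 2 * Gamma (real k / 2)"
   using k by (intro Gamma_plus1) (auto elim!: nonpos_Ints_cases')
  have "Gamma (real k / 2) > 0" using k by (intro Gamma_real_pos) auto
  then show ?thesis using k unfolding c_def unit_ball_vol_def g gaussian_norm_moment_def by (simp add: field_simps)
 qed
 finally show ?thesis .
qed

lemma nn_integral_gaussian_norm_lborel:
 "(\<integral>\<^sup>+x. ennreal (norm x * exp (- (norm x)\<^sup>2)) \<partial>(lborel :: (real^'n) measure)) = ennreal (gaussian_norm_moment CARD('n))"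
proof (rule nn_integral_gaussian_norm)
 fix s :: real assume s: "s > 0"
 have "{x \<in> space (lborel :: (real^'n) measure). norm x \<le> s} = cball 0 s" by auto
 then show "emeasure lborel {x \<in> space (lborel :: (real^'n) measure). norm x \<le> s} = ennreal (unit_ball_vol (real CARD('n)) * s ^ CARD('n))"
  using s by (simp add: emeasure_cball)
qed (auto simp: Suc_le_eq)

text \<open>The Gaussian weight factorises over the first coordinate and the hyperplane; the former
  contributes \<open>sqrt pi\<close>.\<close>

lemma nn_integral_gaussian_drop_first:
 assumes d: "CARD('n::{finite,linorder}) \<ge> 2"
 shows "(\<integral>\<^sup>+x. ennreal (norm (drop_first x) * exp (- (norm x)\<^sup>2)) \<partial>(lborel :: 'n rvec measure)) =
  ennreal (sqrt pi * gaussian_norm_moment (CARD('n) - 1))"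
proof -
 let ?J = "ennreal (gaussian_norm_moment (CARD('n) - 1))"
 have J: "(\<integral>\<^sup>+z. ennreal (norm (drop_first z) * exp (- (norm (drop_first z))\<^sup>2)) \<partial>(hyperplane_measure :: 'n rvec measure)) = ?J"
 proof (rule nn_integral_gaussian_norm[where N="\<lambda>z. norm (drop_first z)"])
  fix s :: real assume s: "s > 0"
  let ?F = "{Min UNIV :: 'n}"
  have "{z \<in> space (hyperplane_measure :: 'n rvec measure). norm (drop_first z) \<le> s} = {z. drop_first z \<in> cball 0 s}" by auto
  then have "emeasure hyperplane_measure {z \<in> space (hyperplane_measure :: 'n rvec measure). norm (drop_first z) \<le> s} =
   emeasure lborel {w::'n rvec. 0 \<le> w $ Min UNIV \<and> w $ Min UNIV \<le> 1 \<and> drop_first w \<in> cball 0 s}"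
   by (simp only:) (rule emeasure_hyperplane_slab, simp)
  also have "{w::'n rvec. 0 \<le> w $ Min UNIV \<and> w $ Min UNIV \<le> 1 \<and> drop_first w \<in> cball 0 s} =
   {x. (\<forall>i\<in>?F. 0 \<le> x $ i \<and> x $ i \<le> 1) \<and> sqrt (\<Sum>i\<in>-?F. (x $ i)\<^sup>2) \<le> s}"
   by (auto simp: norm_drop_first_sq(2))
  also have "emeasure lborel \<dots> = ennreal ((\<Prod>i\<in>?F. 1) * (unit_ball_vol (real (card (-?F))) * s ^ card (-?F)))"
   by (rule emeasure_coordinate_cylinder[OF s]) simp
  also have "card (-?F) = CARD('n) - 1" by (simp add: Compl_eq_Diff_UNIV card_Diff_subset)
  finally show "emeasure hyperplane_measure {z \<in> space (hyperplane_measure :: 'n rvec measure). norm (drop_first z) \<le> s}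
   = ennreal (unit_ball_vol (real (CARD('n) - 1)) * s ^ (CARD('n) - 1))" by simp
 qed (use d in auto)
 have "(\<integral>\<^sup>+x. ennreal (norm (drop_first x) * exp (- (norm x)\<^sup>2)) \<partial>(lborel :: 'n rvec measure)) =
  (\<integral>\<^sup>+t. \<integral>\<^sup>+z. ennreal (norm (drop_first z) * exp (- (t\<^sup>2 + (norm (drop_first z))\<^sup>2))) \<partial>(hyperplane_measure :: 'n rvec measure) \<partial>lborel)"
 proof -
  have "(norm (t *\<^sub>R first_axis + drop_first z :: 'n rvec))\<^sup>2 = t\<^sup>2 + (norm (drop_first z))\<^sup>2" for t z
   by (subst norm_drop_first_sq(1)) (simp only: first_axis_component drop_first_decomp)
  then show ?thesis by (subst nn_integral_lborel_hyperplane) (simp_all only: drop_first_decomp, measurable)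
 qed
 also have "... = (\<integral>\<^sup>+t. ennreal (exp (- t\<^sup>2)) * ?J \<partial>lborel)"
 proof (rule nn_integral_cong)
  fix t :: real
  have "(\<integral>\<^sup>+z. ennreal (norm (drop_first z) * exp (- (t\<^sup>2 + (norm (drop_first z))\<^sup>2))) \<partial>(hyperplane_measure :: 'n rvec measure)) =
   (\<integral>\<^sup>+z. ennreal (exp (- t\<^sup>2)) * ennreal (norm (drop_first z) * exp (- (norm (drop_first z))\<^sup>2)) \<partial>(hyperplane_measure :: 'n rvec measure))"
   by (intro nn_integral_cong) (simp add: ennreal_mult'[symmetric] exp_add[symmetric] mult_ac)
  also have "... = ennreal (exp (- t\<^sup>2)) * ?J" by (subst nn_integral_cmult) (simp_all only: J, measurable)
  finally show "(\<integral>\<^sup>+z. ennreal (norm (drop_first z) * exp (- (t\<^sup>2 + (norm (drop_first z))\<^sup>2))) \<partial>(hyperplane_measure :: 'n rvec measure)) = ennreal (exp (- t\<^sup>2)) * ?J" .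
 qed
 also have "... = (\<integral>\<^sup>+t. ennreal (exp (- t\<^sup>2)) \<partial>lborel) * ?J" by (rule nn_integral_multc) measurable
 also have "(\<integral>\<^sup>+t. ennreal (exp (- t\<^sup>2)) \<partial>lborel) = ennreal (sqrt pi)"
 proof -
  have "has_bochner_integral lborel (\<lambda>x::real. exp (- x\<^sup>2)) (sqrt pi)"
   using has_bochner_integral_even_function[OF gaussian_moment_0] by simp
  then show ?thesis by (subst nn_integral_eq_integral) (auto simp: has_bochner_integral_iff)
 qed
 also have "ennreal (sqrt pi) * ?J = ennreal (sqrt pi * gaussian_norm_moment (CARD('n) - 1))"
  by (subst ennreal_mult'[symmetric]) auto
 finally show ?thesis .
qed

text \<open>The mean length of the projection of a uniformly rotated unit vector to a hyperplane,
  see \<open>haar_SO_mean_projection\<close>.\<close>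

definition beta_ratio :: "nat \<Rightarrow> real" where
 "beta_ratio d = Beta (1 / 2) (real d / 2) / Beta (1 / 2) (real (d - 1) / 2)"

lemma beta_ratio_pos: "d \<ge> 2 \<Longrightarrow> beta_ratio d > 0"
 unfolding beta_ratio_def Beta_def by (intro divide_pos_pos mult_pos_pos Gamma_real_pos) (auto intro!: add_pos_nonneg)

lemma beta_ratio_eq:
 assumes d: "d \<ge> 2"
 shows "beta_ratio d * gaussian_norm_moment d = sqrt pi * gaussian_norm_moment (d - 1)"
proof -
 have sp: "sqrt pi = pi powr (1 / 2)" by (simp add: powr_half_sqrt)
 have p: "pi powr (1 / 2) * pi powr (real (d - 1) / 2) = pi powr (real d / 2)"
  using d by (simp flip: powr_add) (simp add: field_simps)
 have e: "1 / 2 + real d / 2 = real (d + 1) / 2" "1 / 2 + real (d - 1) / 2 = real d / 2" "real (d - 1 + 1) / 2 = real d / 2"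
  using d by (simp_all add: field_simps)
 define g0 g1 g2 g3 where g: "g0 = Gamma (1 / 2 :: real)" "g1 = Gamma (real d / 2)" "g2 = Gamma (real (d - 1) / 2)" "g3 = Gamma (real (d + 1) / 2)"
 have G: "g0 > 0" "g1 > 0" "g2 > 0" "g3 > 0" unfolding g using d by (auto intro!: Gamma_real_pos)
 show ?thesis
  unfolding beta_ratio_def gaussian_norm_moment_def Beta_def e
  unfolding sp mult.assoc[symmetric] times_divide_eq_right p g[symmetric] using G by (simp add: field_simps)
qed

declare transpose_matrix_vector [simp del]

section \<open>Averages over the Haar measure\<close>

lemma haar_SO_space:
 assumes "haar_SO \<theta>" shows "space \<theta> = {A. rotation_matrix A}" "sets \<theta> = sets (restrict_space borel {A. rotation_matrix A})"
 using assms sets_eq_imp_space_eq[of \<theta> "restrict_space borel {A. rotation_matrix A}"]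
 by (auto simp: haar_SO_def space_restrict_space)

lemma continuous_on_matrix_vector_mult:
 fixes f :: "'a::topological_space \<Rightarrow> real^'n^'m"
 assumes "continuous_on S f" "continuous_on S g" shows "continuous_on S (\<lambda>x. f x *v g x)"
 unfolding matrix_vector_mult_def using assms by (intro continuous_intros)

lemma continuous_on_transpose:
 fixes f :: "'a::topological_space \<Rightarrow> real^'n^'m"
 assumes "continuous_on S f" shows "continuous_on S (\<lambda>x. transpose (f x))"
 unfolding transpose_def using assms by (intro continuous_intros)

lemma measurable_rotation_action:
 fixes \<theta> :: "(real^'n^'n) measure"
 assumes "haar_SO \<theta>" and N: "sets N = sets borel" and c: "continuous_on UNIV (\<lambda>p. f (fst p) (snd p) :: 'b::topological_space)"
 shows "(\<lambda>(A, z). f A (z :: real^'n)) \<in> \<theta> \<Otimes>\<^sub>M N \<rightarrow>\<^sub>M borel"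
proof -
 have "(\<lambda>p. f (fst p) (snd p)) \<in> (borel :: ((real^'n^'n) \<times> (real^'n)) measure) \<rightarrow>\<^sub>M borel"
  using c by (rule borel_measurable_continuous_onI)
 then have f: "(\<lambda>(A, z). f A z) \<in> borel \<Otimes>\<^sub>M borel \<rightarrow>\<^sub>M borel" unfolding borel_prod[symmetric] by (simp add: split_def)
 have "(\<lambda>p. (fst p, snd p)) \<in> \<theta> \<Otimes>\<^sub>M N \<rightarrow>\<^sub>M (borel :: (real^'n^'n) measure) \<Otimes>\<^sub>M (borel :: (real^'n) measure)"
 proof (rule measurable_Pair)
  have "(\<lambda>A. A) \<in> \<theta> \<rightarrow>\<^sub>M borel"
   unfolding measurable_cong_sets[OF haar_SO_space(2)[OF assms(1)] refl] by (rule measurable_restrict_space1) simp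
  then show "fst \<in> \<theta> \<Otimes>\<^sub>M N \<rightarrow>\<^sub>M (borel :: (real^'n^'n) measure)" by (rule measurable_compose[OF measurable_fst])
  have "(\<lambda>z. z) \<in> N \<rightarrow>\<^sub>M borel" unfolding measurable_cong_sets[OF N refl] by simp
  then show "snd \<in> \<theta> \<Otimes>\<^sub>M N \<rightarrow>\<^sub>M (borel :: (real^'n) measure)" by (rule measurable_compose[OF measurable_snd])
 qed
 from measurable_compose[OF this f] show ?thesis by (simp add: split_def)
qed

lemma measurable_haar_action:
 fixes \<theta> :: "(real^'n^'n) measure"
 assumes "haar_SO \<theta>" and g: "g \<in> borel_measurable (borel :: (real^'n) measure)"
 shows "(\<lambda>(A, u). g (transpose A *v u)) \<in> borel_measurable (\<theta> \<Otimes>\<^sub>M (lborel :: (real^'n) measure))"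
  and "(\<lambda>A. g (transpose A *v u)) \<in> borel_measurable \<theta>"
proof -
 have "(\<lambda>(A, u). transpose A *v u) \<in> \<theta> \<Otimes>\<^sub>M (lborel :: (real^'n) measure) \<rightarrow>\<^sub>M borel"
  by (intro measurable_rotation_action[OF assms(1) sets_lborel] continuous_on_matrix_vector_mult continuous_on_transpose continuous_intros)
 from measurable_compose[OF this g] show 1: "(\<lambda>(A, u). g (transpose A *v u)) \<in> borel_measurable (\<theta> \<Otimes>\<^sub>M (lborel :: (real^'n) measure))"
  by (simp add: split_def)
 show "(\<lambda>A. g (transpose A *v u)) \<in> borel_measurable \<theta>"
  using measurable_compose[OF measurable_Pair2'[of u "lborel :: (real^'n) measure" \<theta>] 1] by simp
qed

lemma orthogonal_transpose_rotation:
 fixes A :: "real^'n^'n"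
 assumes "rotation_matrix A" shows "orthogonal_transformation ((*v) (transpose A))" "orthogonal_transformation ((*v) A)"
 using assms by (auto simp: rotation_matrix_def orthogonal_transformation_matrix)

text \<open>A rotation \<open>R\<close> takes \<open>v\<close> to \<open>u\<close>, and left
  invariance replaces \<open>A\<close> by \<open>R ** A\<close>; since
  \<open>transpose R *v u = v\<close>, the transpose absorbs \<open>R\<close>. Transposes appear
  because a rotated line is studied by rotating the segment back.\<close>

lemma haar_SO_rotation_invariant:
 fixes \<theta> :: "(real^'n^'n) measure" and g :: "real^'n \<Rightarrow> ennreal"
 assumes d: "CARD('n) \<ge> 2" and \<theta>: "haar_SO \<theta>" and g: "g \<in> borel_measurable borel" and uv: "norm u = norm v"
 shows "(\<integral>\<^sup>+A. g (transpose A *v u) \<partial>\<theta>) = (\<integral>\<^sup>+A. g (transpose A *v v) \<partial>\<theta>)"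
proof -
 obtain f where f: "orthogonal_transformation f" "det (matrix f) = 1" "f v = u"
  using rotation_exists[OF d uv[symmetric]] by blast
 define R where "R = matrix f"
 have R: "rotation_matrix R" using f by (simp add: R_def rotation_matrix_def orthogonal_transformation_matrix)
 have Rv: "R *v v = u" using f(1,3) by (simp add: R_def matrix_works orthogonal_transformation_linear)
 have RtR: "transpose R ** R = mat 1" using R by (simp add: rotation_matrix_def orthogonal_matrix)
 have Rt: "transpose R *v u = v" unfolding Rv[symmetric] matrix_vector_mul_assoc RtR by simp
 have m: "(\<lambda>A. R ** A) \<in> \<theta> \<rightarrow>\<^sub>M \<theta>"
  unfolding measurable_cong_sets[OF haar_SO_space(2)[OF \<theta>] haar_SO_space(2)[OF \<theta>]]
 proof (rule measurable_restrict_space3)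
  show "(\<lambda>A. R ** A) \<in> borel \<rightarrow>\<^sub>M borel"
   unfolding matrix_matrix_mult_def by (intro borel_measurable_continuous_onI continuous_intros)
  show "(\<lambda>A. R ** A) \<in> {A. rotation_matrix A} \<rightarrow> {A. rotation_matrix A}"
   using R by (auto simp: rotation_matrix_def orthogonal_matrix_mul det_mul)
 qed
 have "(\<integral>\<^sup>+A. g (transpose A *v u) \<partial>\<theta>) = (\<integral>\<^sup>+A. g (transpose A *v u) \<partial>distr \<theta> \<theta> (\<lambda>A. R ** A))"
  using \<theta> R unfolding haar_SO_def by metis
 also have "... = (\<integral>\<^sup>+A. g (transpose (R ** A) *v u) \<partial>\<theta>)"
  by (subst nn_integral_distr[OF m]) (simp_all add: measurable_haar_action(2)[OF \<theta> g])
 also have "... = (\<integral>\<^sup>+A. g (transpose A *v v) \<partial>\<theta>)"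
  by (simp only: matrix_transpose_mul matrix_vector_mul_assoc[symmetric] Rt)
 finally show ?thesis .
qed

text \<open>Averaging over a radial weight replaces the Haar measure by Lebesgue measure.\<close>

lemma haar_SO_average:
 fixes \<theta> :: "(real^'n^'n) measure" and g :: "real^'n \<Rightarrow> ennreal"
 assumes \<theta>: "haar_SO \<theta>" and g [measurable]: "g \<in> borel_measurable borel"
 shows "(\<integral>\<^sup>+u. \<integral>\<^sup>+A. g (transpose A *v u) \<partial>\<theta> \<partial>lborel) = (\<integral>\<^sup>+u. g u \<partial>lborel)"
proof -
 interpret \<theta>: prob_space \<theta> using \<theta> by (simp add: haar_SO_def)
 interpret pair_sigma_finite \<theta> "lborel :: (real^'n) measure" ..
 have "(\<integral>\<^sup>+u. \<integral>\<^sup>+A. g (transpose A *v u) \<partial>\<theta> \<partial>lborel) = (\<integral>\<^sup>+A. \<integral>\<^sup>+u. g (transpose A *v u) \<partial>lborel \<partial>\<theta>)"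
  using measurable_haar_action(1)[OF \<theta> g] by (rule Fubini')
 also have "... = (\<integral>\<^sup>+A. \<integral>\<^sup>+u. g u \<partial>lborel \<partial>\<theta>)"
  by (intro nn_integral_cong nn_integral_orthogonal orthogonal_transpose_rotation g) (simp add: haar_SO_space(1)[OF \<theta>])
 also have "... = (\<integral>\<^sup>+u. g u \<partial>lborel)" by (simp add: \<theta>.emeasure_space_1)
 finally show ?thesis .
qed

lemma norm_transpose_rotation: "rotation_matrix A \<Longrightarrow> norm (transpose A *v u :: real^'n) = norm u"
 using orthogonal_transformation_norm[OF orthogonal_transpose_rotation(1)] .

lemma drop_first_scaleR: "drop_first (c *\<^sub>R x) = c *\<^sub>R drop_first (x :: ('n::{finite,linorder}) rvec)"
 using linear_scale[OF linear_drop_first] .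

text \<open>By invariance and homogeneity the mean is a multiple of \<open>norm v\<close>.
  Integrating \<open>norm (drop_first x)\<close> against a Gaussian weight in two ways identifies
  the multiple as a quotient of Gaussian moments, so no surface measure on the sphere
  enters.\<close>

lemma haar_SO_mean_projection:
 fixes \<theta> :: "(('n::{finite,linorder}) rvec, 'n) vec measure" and v :: "'n rvec"
 assumes d: "CARD('n) \<ge> 2" and \<theta>: "haar_SO \<theta>"
 shows "(\<integral>\<^sup>+A. ennreal (norm (drop_first (transpose A *v v))) \<partial>\<theta>) = ennreal (beta_ratio CARD('n) * norm v)"
proof -
 let ?g = "\<lambda>x::'n rvec. ennreal (norm (drop_first x))"
 have g [measurable]: "?g \<in> borel_measurable borel" by measurable
 define F where "F u = (\<integral>\<^sup>+A. ?g (transpose A *v u) \<partial>\<theta>)" for u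
 define e :: "'n rvec" where "e = first_axis"
 have e: "norm e = 1" by (simp add: e_def first_axis_def)
 have F: "F u = ennreal (norm u) * F e" for u
 proof -
  have "F u = F (norm u *\<^sub>R e)" unfolding F_def using e by (intro haar_SO_rotation_invariant[OF d \<theta> g]) simp
  also have "... = (\<integral>\<^sup>+A. ennreal (norm u) * ?g (transpose A *v e) \<partial>\<theta>)"
   unfolding F_def by (intro nn_integral_cong) (simp add: matrix_vector_mult_scaleR drop_first_scaleR ennreal_mult')
  also have "... = ennreal (norm u) * F e"
   unfolding F_def by (rule nn_integral_cmult[OF measurable_haar_action(2)[OF \<theta> g]])
  finally show ?thesis .
 qed
 let ?h = "\<lambda>x::'n rvec. ennreal (norm (drop_first x) * exp (- (norm x)\<^sup>2))"
 have h: "?h \<in> borel_measurable borel" by measurable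
 have "ennreal (sqrt pi * gaussian_norm_moment (CARD('n) - 1)) = (\<integral>\<^sup>+u. ?h u \<partial>lborel)"
  by (rule nn_integral_gaussian_drop_first[OF d, symmetric])
 also have "... = (\<integral>\<^sup>+u. \<integral>\<^sup>+A. ?h (transpose A *v u) \<partial>\<theta> \<partial>lborel)" by (rule haar_SO_average[OF \<theta> h, symmetric])
 also have "... = (\<integral>\<^sup>+u. ennreal (norm u * exp (- (norm u)\<^sup>2)) * F e \<partial>(lborel :: 'n rvec measure))"
 proof (rule nn_integral_cong)
  fix u :: "'n rvec"
  have "(\<integral>\<^sup>+A. ?h (transpose A *v u) \<partial>\<theta>) = (\<integral>\<^sup>+A. ennreal (exp (- (norm u)\<^sup>2)) * ?g (transpose A *v u) \<partial>\<theta>)"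
   by (rule nn_integral_cong) (simp add: haar_SO_space(1)[OF \<theta>] norm_transpose_rotation ennreal_mult' mult.commute)
  also have "... = ennreal (exp (- (norm u)\<^sup>2)) * F u"
   unfolding F_def by (rule nn_integral_cmult[OF measurable_haar_action(2)[OF \<theta> g]])
  also have "... = ennreal (norm u * exp (- (norm u)\<^sup>2)) * F e"
   by (subst F) (simp add: ennreal_mult' mult_ac)
  finally show "(\<integral>\<^sup>+A. ?h (transpose A *v u) \<partial>\<theta>) = ennreal (norm u * exp (- (norm u)\<^sup>2)) * F e" .
 qed
 also have "... = (\<integral>\<^sup>+u. ennreal (norm u * exp (- (norm u)\<^sup>2)) \<partial>(lborel :: 'n rvec measure)) * F e"
  by (rule nn_integral_multc) measurable
 also have "... = ennreal (gaussian_norm_moment CARD('n)) * F e" by (simp only: nn_integral_gaussian_norm_lborel)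
 finally have eq: "ennreal (beta_ratio CARD('n) * gaussian_norm_moment CARD('n)) = ennreal (gaussian_norm_moment CARD('n)) * F e"
  using beta_ratio_eq[OF d] by simp
 have G: "gaussian_norm_moment CARD('n) > 0" using d by (intro gaussian_norm_moment_pos) simp
 have "F e = ennreal (beta_ratio CARD('n))"
 proof -
  have "ennreal (gaussian_norm_moment CARD('n)) * F e = ennreal (gaussian_norm_moment CARD('n)) * ennreal (beta_ratio CARD('n))"
   using eq G beta_ratio_pos[OF d] by (simp add: ennreal_mult' mult.commute)
  then show ?thesis using G by (simp add: ennreal_mult_cancel_left)
 qed
 then have "F v = ennreal (norm v) * ennreal (beta_ratio CARD('n))" using F[of v] by simp
 also have "... = ennreal (beta_ratio CARD('n) * norm v)" by (simp add: ennreal_mult' mult.commute)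
 finally show ?thesis by (simp add: F_def)
qed

text \<open>The same averaging with the unit ball as weight. Vectors of the ball with
  \<open>norm (drop_first x) \<le> s * norm x\<close> lie in a cylinder of radius \<open>s\<close>
  and length 2 around the first axis, whose volume is of order \<open>s ^ (d - 1)\<close>.\<close>

lemma haar_SO_small_projection:
 fixes \<theta> :: "(('n::{finite,linorder}) rvec, 'n) vec measure" and v :: "'n rvec"
 assumes d: "CARD('n) \<ge> 2" and \<theta>: "haar_SO \<theta>" and t: "t > 0" and v: "v \<noteq> 0"
 shows "emeasure \<theta> {A \<in> space \<theta>. norm (drop_first (transpose A *v v)) \<le> t} \<le>
  ennreal (2 * unit_ball_vol (real (CARD('n) - 1)) / unit_ball_vol (real CARD('n)) * (t / norm v) ^ (CARD('n) - 1))"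
proof -
 define s where "s = t / norm v"
 have s: "s > 0" using t v by (simp add: s_def)
 define k where "k = CARD('n) - 1"
 let ?g = "\<lambda>x::'n rvec. indicator {x. norm (drop_first x) \<le> s * norm x} x :: ennreal"
 have g [measurable]: "?g \<in> borel_measurable borel" by measurable
 define F where "F u = (\<integral>\<^sup>+A. ?g (transpose A *v u) \<partial>\<theta>)" for u
 have F: "F u = F v" if "u \<noteq> 0" for u
 proof -
  have "F u = (\<integral>\<^sup>+A. ?g (transpose A *v ((norm u / norm v) *\<^sub>R v)) \<partial>\<theta>)"
   unfolding F_def using v by (intro haar_SO_rotation_invariant[OF d \<theta> g]) simp
  also have "... = F v" unfolding F_def
  proof (rule nn_integral_cong)
   fix A :: "('n rvec, 'n) vec"
   define c where "c = norm u / norm v"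
   have c: "c > 0" using that v by (simp add: c_def)
   have "norm (drop_first (transpose A *v (c *\<^sub>R v))) \<le> s * norm (transpose A *v (c *\<^sub>R v)) \<longleftrightarrow>
    c * norm (drop_first (transpose A *v v)) \<le> c * (s * norm (transpose A *v v))"
    using c by (simp add: matrix_vector_mult_scaleR drop_first_scaleR mult_ac)
   then show "?g (transpose A *v ((norm u / norm v) *\<^sub>R v)) = ?g (transpose A *v v)"
    using c unfolding c_def[symmetric] by (simp add: indicator_def)
  qed
  finally show ?thesis .
 qed
 let ?h = "\<lambda>x::'n rvec. indicator (cball 0 1) x * ?g x"
 have c: "(indicator (cball 0 1) :: 'n rvec \<Rightarrow> ennreal) \<in> borel_measurable borel" by (rule borel_measurable_indicator) simp
 have h: "?h \<in> borel_measurable borel" by (rule borel_measurable_times_ennreal[OF c g])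
 let ?F = "{Min UNIV :: 'n}"
 let ?l = "\<lambda>i::'n. 1 :: real"
 let ?S = "{x::'n rvec. (\<forall>i\<in>?F. 0 \<le> x $ i \<and> x $ i \<le> 1) \<and> sqrt (\<Sum>i\<in>-?F. (x $ i)\<^sup>2) \<le> s}"
 have S [measurable]: "?S \<in> sets borel" by measurable
 have "card (-?F) = k" by (simp add: k_def Compl_eq_Diff_UNIV card_Diff_subset)
 then have eS: "emeasure lborel ?S = ennreal (unit_ball_vol (real k) * s ^ k)"
  using emeasure_coordinate_cylinder[OF s, of ?F ?l] by simp
 have "emeasure lborel (cball (0::'n rvec) 1) * F v = (\<integral>\<^sup>+u. indicator (cball 0 1) u * F v \<partial>(lborel :: 'n rvec measure))"
  using c by (subst nn_integral_multc) auto
 also have "... = (\<integral>\<^sup>+u. \<integral>\<^sup>+A. ?h (transpose A *v u) \<partial>\<theta> \<partial>(lborel :: 'n rvec measure))"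
 proof (rule nn_integral_cong_AE, rule AE_mp[OF AE_lborel_singleton[of 0]], intro AE_I2 impI)
  fix u :: "'n rvec" assume u: "u \<noteq> 0"
  have "(\<integral>\<^sup>+A. ?h (transpose A *v u) \<partial>\<theta>) = (\<integral>\<^sup>+A. indicator (cball 0 1) u * ?g (transpose A *v u) \<partial>\<theta>)"
   by (rule nn_integral_cong) (simp add: haar_SO_space(1)[OF \<theta>] norm_transpose_rotation indicator_def)
  also have "... = indicator (cball 0 1) u * F u"
   unfolding F_def by (rule nn_integral_cmult[OF measurable_haar_action(2)[OF \<theta> g]])
  finally show "indicator (cball 0 1) u * F v = (\<integral>\<^sup>+A. ?h (transpose A *v u) \<partial>\<theta>)" using F[OF u] by simp
 qed
 also have "... = (\<integral>\<^sup>+u. ?h u \<partial>lborel)" by (rule haar_SO_average[OF \<theta> h])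
 \<comment> \<open>The cylinder is the union of its half with non-negative first coordinate and the
   reflection of that half, each of the shape measured by
   \<open>emeasure_coordinate_cylinder\<close>.\<close>
 also have "... \<le> (\<integral>\<^sup>+u. indicator ?S u + indicator ?S (- u) \<partial>lborel)"
 proof (rule nn_integral_mono)
  fix u :: "'n rvec"
  show "?h u \<le> indicator ?S u + indicator ?S (- u)"
  proof (cases "norm u \<le> 1 \<and> norm (drop_first u) \<le> s * norm u")
   case True
   have "s * norm u \<le> s * 1" using True s by (intro mult_left_mono) auto
   then have "norm (drop_first u) \<le> s" using True by linarith
   then have n: "sqrt (\<Sum>i\<in>-?F. (u $ i)\<^sup>2) \<le> s" by (simp only: norm_drop_first_sq(2))
   have "\<bar>u $ Min UNIV\<bar> \<le> 1" using component_le_norm_cart[of u "Min UNIV"] True by linarith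
   then have "u \<in> ?S \<or> - u \<in> ?S" using n by (cases "0 \<le> u $ Min UNIV") auto
   then show ?thesis by (auto simp: indicator_def)
  qed (auto simp: indicator_def)
 qed
 also have "... = (\<integral>\<^sup>+u. indicator ?S u \<partial>lborel) + (\<integral>\<^sup>+u. indicator ?S (- u) \<partial>lborel)"
  by (rule nn_integral_add) measurable
 also have "(\<integral>\<^sup>+u. indicator ?S (- u) \<partial>lborel) = (\<integral>\<^sup>+u. indicator ?S u \<partial>lborel)"
  by (rule nn_integral_uminus) measurable
 also have "(\<integral>\<^sup>+u. indicator ?S u \<partial>lborel) = ennreal (unit_ball_vol (real k) * s ^ k)" using eS by simp
 finally have le: "ennreal (unit_ball_vol (real CARD('n))) * F v \<le> ennreal (2 * (unit_ball_vol (real k) * s ^ k))"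
  using s by (simp add: emeasure_cball ennreal_plus[symmetric] del: ennreal_plus)
 have Fle: "F v \<le> ennreal (2 * unit_ball_vol (real k) / unit_ball_vol (real CARD('n)) * s ^ k)"
 proof -
  define w where "w = unit_ball_vol (real CARD('n))"
  have w: "w > 0" by (simp add: w_def)
  have "F v = ennreal (1 / w) * (ennreal w * F v)" using w by (simp add: mult.assoc[symmetric] ennreal_mult'[symmetric])
  also have "... \<le> ennreal (1 / w) * ennreal (2 * (unit_ball_vol (real k) * s ^ k))" using le by (intro mult_left_mono) (auto simp: w_def)
  also have "... = ennreal (2 * unit_ball_vol (real k) / w * s ^ k)" using w by (simp add: ennreal_mult'[symmetric] mult_ac)
  finally show ?thesis by (simp add: w_def)
 qed
 have "emeasure \<theta> {A \<in> space \<theta>. norm (drop_first (transpose A *v v)) \<le> t} = F v"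
 proof -
  have m: "{A \<in> space \<theta>. norm (drop_first (transpose A *v v)) \<le> t} \<in> sets \<theta>"
  proof -
   have [measurable]: "(\<lambda>A. norm (drop_first (transpose A *v v))) \<in> borel_measurable \<theta>"
    by (rule measurable_haar_action(2)[OF \<theta>]) measurable
   show ?thesis by measurable
  qed
  have "F v = (\<integral>\<^sup>+A. indicator {A \<in> space \<theta>. norm (drop_first (transpose A *v v)) \<le> t} A \<partial>\<theta>)"
   unfolding F_def
  proof (rule nn_integral_cong)
   fix A assume A: "A \<in> space \<theta>"
   then have "s * norm (transpose A *v v) = t" using v by (simp add: haar_SO_space(1)[OF \<theta>] norm_transpose_rotation s_def)
   then show "?g (transpose A *v v) = indicator {A \<in> space \<theta>. norm (drop_first (transpose A *v v)) \<le> t} A"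
    using A by (simp add: indicator_def)
  qed
  then show ?thesis using nn_integral_indicator[OF m] by simp
 qed
 then show ?thesis using Fle by (simp add: k_def s_def)
qed

section \<open>The measure of the lines hitting a set\<close>

definition lines_hitting :: "('n::finite) rvec set \<Rightarrow> 'n rvec set set" where
 "lines_hitting K = {L \<in> affine_lines. L \<inter> K \<noteq> {}}"

definition line_map :: "(('n::{finite,linorder}) rvec,'n) vec \<times> 'n rvec \<Rightarrow> 'n rvec set" where
 "line_map = (\<lambda>(A, z). (\<lambda>x. A *v x) ` range (\<lambda>s::real. s *\<^sub>R first_axis + z))"

lemma line_map_hits: "line_map p \<inter> K \<noteq> {} \<longleftrightarrow> (\<exists>t. fst p *v (t *\<^sub>R first_axis + snd p) \<in> K)"
 by (cases p) (auto simp: line_map_def)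

lemma sets_rotation_hits:
 fixes K :: "('n::{finite,linorder}) rvec set"
 assumes \<theta>: "haar_SO \<theta>" and K: "compact K"
 shows "{p \<in> space (\<theta> \<Otimes>\<^sub>M hyperplane_measure). \<exists>t. fst p *v (t *\<^sub>R first_axis + snd p) \<in> K} \<in> sets (\<theta> \<Otimes>\<^sub>M (hyperplane_measure :: 'n rvec measure))"
proof -
 have "{p \<in> space (\<theta> \<Otimes>\<^sub>M (hyperplane_measure :: 'n rvec measure)). \<exists>t\<in>UNIV. fst p *v (t *\<^sub>R first_axis + snd p) \<in> K} \<in> sets (\<theta> \<Otimes>\<^sub>M hyperplane_measure)"
 proof (rule sets_Collect_hits_closed[where F="\<lambda>p t. fst p *v (t *\<^sub>R first_axis + snd p)" and S="\<lambda>n. {- real n..real n}"])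
  fix t :: real
  have "(\<lambda>(A, z). A *v (t *\<^sub>R first_axis + z)) \<in> \<theta> \<Otimes>\<^sub>M (hyperplane_measure :: 'n rvec measure) \<rightarrow>\<^sub>M borel"
   by (intro measurable_rotation_action[OF \<theta> sets_hyperplane_measure] continuous_on_matrix_vector_mult continuous_intros)
  then show "(\<lambda>p. fst p *v (t *\<^sub>R first_axis + snd p)) \<in> \<theta> \<Otimes>\<^sub>M (hyperplane_measure :: 'n rvec measure) \<rightarrow>\<^sub>M borel"
   by (simp add: split_def)
  show "UNIV = (\<Union>n. {- real n..real n})" by (rule UNIV_eq_UN_Icc)
 qed (auto intro!: continuous_on_matrix_vector_mult continuous_intros compact_imp_closed K)
 then show ?thesis by simp
qed

lemma measurable_line_map:
 assumes \<theta>: "haar_SO (\<theta> :: (('n::{finite,linorder}) rvec,'n) vec measure)"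
 shows "line_map \<in> \<theta> \<Otimes>\<^sub>M hyperplane_measure \<rightarrow>\<^sub>M line_space"
 unfolding line_space_def
proof (rule measurable_measure_of)
 show "{{L \<in> affine_lines. L \<inter> K \<noteq> {}} |K::'n rvec set. compact K} \<subseteq> Pow affine_lines" by auto
 show "line_map \<in> space (\<theta> \<Otimes>\<^sub>M hyperplane_measure) \<rightarrow> affine_lines"
 proof
  fix p :: "('n rvec,'n) vec \<times> 'n rvec" assume "p \<in> space (\<theta> \<Otimes>\<^sub>M hyperplane_measure)"
  then obtain A z where p: "p = (A, z)" "rotation_matrix A" by (cases p) (auto simp: space_pair_measure haar_SO_space(1)[OF \<theta>])
  have "norm (A *v (first_axis :: 'n rvec)) = 1"
   using orthogonal_transformation_norm[OF orthogonal_transpose_rotation(2)[OF p(2)]] by (simp add: first_axis_def)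
  then have ne: "A *v (first_axis :: 'n rvec) \<noteq> 0" by auto
  have "line_map p = range (\<lambda>s::real. A *v z + s *\<^sub>R (A *v first_axis))"
   unfolding p line_map_def prod.case image_image
   by (simp add: matrix_vector_right_distrib matrix_vector_mult_scaleR add.commute)
  then show "line_map p \<in> affine_lines" unfolding affine_lines_def using ne by blast
 qed
 fix Y assume "Y \<in> {{L \<in> affine_lines. L \<inter> K \<noteq> {}} |K::'n rvec set. compact K}"
 then obtain K :: "'n rvec set" where K: "compact K" "Y = {L \<in> affine_lines. L \<inter> K \<noteq> {}}" by blast
 have "line_map -` Y \<inter> space (\<theta> \<Otimes>\<^sub>M hyperplane_measure) = {p \<in> space (\<theta> \<Otimes>\<^sub>M hyperplane_measure). \<exists>t. fst p *v (t *\<^sub>R first_axis + snd p) \<in> K}"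
  using Pi_mem[OF \<open>line_map \<in> space (\<theta> \<Otimes>\<^sub>M hyperplane_measure) \<rightarrow> affine_lines\<close>]
  by (intro set_eqI) (simp only: Int_iff vimage_eq mem_Collect_eq K(2) line_map_hits, blast)
 then show "line_map -` Y \<inter> space (\<theta> \<Otimes>\<^sub>M hyperplane_measure) \<in> sets (\<theta> \<Otimes>\<^sub>M hyperplane_measure)"
  using sets_rotation_hits[OF \<theta> K(1)] by simp
qed

lemma space_line_space: "space line_space = affine_lines"
 unfolding line_space_def by (rule space_measure_of) auto

lemma sets_lines_hitting:
 assumes "compact (K :: ('n::finite) rvec set)" shows "lines_hitting K \<in> sets line_space"
proof -
 have "sets line_space = sigma_sets affine_lines {{L \<in> affine_lines. L \<inter> K \<noteq> {}} |K::'n rvec set. compact K}"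
  unfolding line_space_def by (rule sets_measure_of) auto
 then show ?thesis unfolding lines_hitting_def using assms by (auto intro: sigma_sets.Basic)
qed

lemma line_measure_eq: "line_measure \<theta> = distr (\<theta> \<Otimes>\<^sub>M hyperplane_measure) line_space line_map"
 by (simp add: line_measure_def line_map_def)

lemma sets_line_measure [simp]: "sets (line_measure \<theta>) = sets line_space"
 and space_line_measure [simp]: "space (line_measure \<theta>) = affine_lines"
 by (simp_all add: line_measure_eq space_line_space)

lemma emeasure_lines_hitting_both:
 fixes K1 K2 :: "('n::{finite,linorder}) rvec set"
 assumes d: "CARD('n) \<ge> 2" and \<theta>: "haar_SO \<theta>" and K: "compact K1" "compact K2"
 shows "emeasure (line_measure \<theta>) (lines_hitting K1 \<inter> lines_hitting K2) =
  (\<integral>\<^sup>+A. emeasure hyperplane_measure {z. (\<exists>t. A *v (t *\<^sub>R first_axis + z) \<in> K1) \<and> (\<exists>t. A *v (t *\<^sub>R first_axis + z) \<in> K2)} \<partial>\<theta>)"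
proof -
 interpret H: sigma_finite_measure "hyperplane_measure :: 'n rvec measure" by (rule sigma_finite_hyperplane_measure[OF d])
 let ?N = "\<theta> \<Otimes>\<^sub>M (hyperplane_measure :: 'n rvec measure)"
 let ?S = "\<lambda>K. {p \<in> space ?N. \<exists>t. fst p *v (t *\<^sub>R first_axis + snd p) \<in> K}"
 have sp: "line_map p \<in> affine_lines" if "p \<in> space ?N" for p
  using measurable_space[OF measurable_line_map[OF \<theta>] that] by (simp add: space_line_space)
 have "emeasure (line_measure \<theta>) (lines_hitting K1 \<inter> lines_hitting K2) = emeasure ?N (line_map -` (lines_hitting K1 \<inter> lines_hitting K2) \<inter> space ?N)"
  unfolding line_measure_eq by (intro emeasure_distr measurable_line_map[OF \<theta>] sets.Int sets_lines_hitting K)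
 also have "line_map -` (lines_hitting K1 \<inter> lines_hitting K2) \<inter> space ?N = ?S K1 \<inter> ?S K2"
  using sp by (intro set_eqI) (simp only: Int_iff vimage_eq mem_Collect_eq lines_hitting_def line_map_hits, blast)
 also have "emeasure ?N \<dots> = (\<integral>\<^sup>+A. \<integral>\<^sup>+z. indicator (?S K1 \<inter> ?S K2) (A, z) \<partial>hyperplane_measure \<partial>\<theta>)"
  by (intro H.emeasure_pair_measure sets.Int sets_rotation_hits[OF \<theta>] K)
 also have "... = (\<integral>\<^sup>+A. emeasure hyperplane_measure {z. (\<exists>t. A *v (t *\<^sub>R first_axis + z) \<in> K1) \<and> (\<exists>t. A *v (t *\<^sub>R first_axis + z) \<in> K2)} \<partial>\<theta>)"
 proof (rule nn_integral_cong)
  fix A assume A: "A \<in> space \<theta>"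
  let ?T = "{z. (\<exists>t. A *v (t *\<^sub>R first_axis + z) \<in> K1) \<and> (\<exists>t. A *v (t *\<^sub>R first_axis + z) \<in> K2)}"
  have "Pair A -` (?S K1 \<inter> ?S K2) \<in> sets hyperplane_measure"
   by (intro sets_Pair1[of "?S K1 \<inter> ?S K2" \<theta>] sets.Int sets_rotation_hits[OF \<theta>] K)
  also have "Pair A -` (?S K1 \<inter> ?S K2) = ?T" using A by (auto simp: space_pair_measure)
  finally have T: "?T \<in> sets hyperplane_measure" .
  have "(\<integral>\<^sup>+z. indicator (?S K1 \<inter> ?S K2) (A, z) \<partial>hyperplane_measure) = (\<integral>\<^sup>+z. indicator ?T z \<partial>hyperplane_measure)"
   using A by (intro nn_integral_cong) (auto simp: indicator_def space_pair_measure)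
  then show "(\<integral>\<^sup>+z. indicator (?S K1 \<inter> ?S K2) (A, z) \<partial>hyperplane_measure) = emeasure hyperplane_measure ?T"
   using nn_integral_indicator[OF T] by simp
 qed
 finally show ?thesis .
qed

lemma emeasure_lines_hitting:
 fixes K :: "('n::{finite,linorder}) rvec set"
 assumes d: "CARD('n) \<ge> 2" and \<theta>: "haar_SO \<theta>" and K: "compact K"
 shows "emeasure (line_measure \<theta>) (lines_hitting K) = (\<integral>\<^sup>+A. emeasure hyperplane_measure {z. \<exists>t. A *v (t *\<^sub>R first_axis + z) \<in> K} \<partial>\<theta>)"
 using emeasure_lines_hitting_both[OF d \<theta> K K] by simp

text \<open>Rotating back by \<open>transpose A\<close> makes the line parallel to the first axis,
  and such a line comes within \<open>s\<close> of a point iff the two projections do.\<close>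

lemma rotated_line_hits_nbhd:
 fixes x y z :: "('n::{finite,linorder}) rvec"
 assumes A: "rotation_matrix A"
 shows "(\<exists>t. A *v (t *\<^sub>R first_axis + z) \<in> nbhd (closed_segment x y) s) \<longleftrightarrow>
  drop_first z \<in> nbhd (closed_segment (drop_first (transpose A *v x)) (drop_first (transpose A *v y))) s"
proof -
 have AtA: "transpose A ** A = mat 1" using A by (simp add: rotation_matrix_def orthogonal_matrix)
 let ?q = "\<lambda>\<tau>. transpose A *v (x + \<tau> *\<^sub>R (y - x))"
 have n: "norm (A *v w - p) = norm (w - transpose A *v p)" for w p :: "'n rvec"
 proof -
  have "norm (A *v w - p) = norm (transpose A *v (A *v w - p))" by (simp add: norm_transpose_rotation[OF A])
  also have "transpose A *v (A *v w - p) = w - transpose A *v p"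
   by (simp add: matrix_vector_mult_diff_distrib matrix_vector_mul_assoc AtA)
  finally show ?thesis .
 qed
 have line: "(\<exists>t. norm (t *\<^sub>R first_axis + w) \<le> s) \<longleftrightarrow> norm (drop_first w) \<le> s" for w :: "'n rvec"
 proof
  assume "\<exists>t. norm (t *\<^sub>R first_axis + w) \<le> s"
  then obtain t where t: "norm (t *\<^sub>R first_axis + w) \<le> s" by blast
  have "drop_first (t *\<^sub>R first_axis + w) = drop_first w" by (auto simp: drop_first_def first_axis_def axis_def vec_eq_iff)
  then show "norm (drop_first w) \<le> s" using norm_drop_first_le[of "t *\<^sub>R first_axis + w"] t by simp
 next
  assume "norm (drop_first w) \<le> s"
  moreover have "(- (w $ Min UNIV)) *\<^sub>R first_axis + w = drop_first w" by (auto simp: drop_first_def first_axis_def axis_def vec_eq_iff)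
  ultimately show "\<exists>t. norm (t *\<^sub>R first_axis + w) \<le> s" by metis
 qed
 have "(\<exists>t. A *v (t *\<^sub>R first_axis + z) \<in> nbhd (closed_segment x y) s) \<longleftrightarrow>
   (\<exists>\<tau>\<in>{0..1}. \<exists>t. norm (t *\<^sub>R first_axis + (z - ?q \<tau>)) \<le> s)"
  unfolding mem_nbhd_segment n by (auto simp: algebra_simps)
 also have "... \<longleftrightarrow> (\<exists>\<tau>\<in>{0..1}. norm (drop_first (z - ?q \<tau>)) \<le> s)" unfolding line ..
 also have "... \<longleftrightarrow> drop_first z \<in> nbhd (closed_segment (drop_first (transpose A *v x)) (drop_first (transpose A *v y))) s"
  unfolding mem_nbhd_segment
  by (simp add: linear_diff[OF linear_drop_first] linear_add[OF linear_drop_first] drop_first_scaleR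
    matrix_vector_right_distrib matrix_vector_mult_diff_distrib matrix_vector_mult_scaleR)
 finally show ?thesis .
qed

lemma drop_first_idem: "drop_first (drop_first x) = drop_first (x :: ('n::{finite,linorder}) rvec)"
 by (auto simp: drop_first_def vec_eq_iff)

lemma drop_first_transpose_diff:
 "norm (drop_first (transpose A *v x) - drop_first (transpose A *v y)) = norm (drop_first (transpose A *v (x - y :: ('n::{finite,linorder}) rvec)))"
 by (simp add: linear_diff[OF linear_drop_first] matrix_vector_mult_diff_distrib)

text \<open>For a fixed rotation, the lines hitting the tube are parametrised by a neighbourhood of
  the projected segment; averaging its length over the rotations gives the factor
  \<open>beta_ratio\<close>.\<close>

lemma emeasure_lines_hitting_segment:
 fixes x y :: "('n::{finite,linorder}) rvec"
 assumes d: "CARD('n) \<ge> 2" and \<theta>: "haar_SO \<theta>" and s: "s > 0"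
 defines "c \<equiv> unit_ball_vol (real (CARD('n) - 2)) * s ^ (CARD('n) - 2)"
 shows "ennreal (c * beta_ratio CARD('n) * norm (x - y)) \<le> emeasure (line_measure \<theta>) (lines_hitting (nbhd (closed_segment x y) s))" (is "_ \<le> ?E")
  and "emeasure (line_measure \<theta>) (lines_hitting (nbhd (closed_segment x y) s)) \<le> ennreal (c * (beta_ratio CARD('n) * norm (x - y) + 2 * s))"
proof -
 interpret \<theta>: prob_space \<theta> using \<theta> by (simp add: haar_SO_def)
 let ?N = "\<lambda>A. norm (drop_first (transpose A *v (x - y)))"
 have c: "c > 0" using s by (simp add: c_def)
 have N: "(\<lambda>A. ennreal (?N A)) \<in> borel_measurable \<theta>" by (rule measurable_haar_action(2)[OF \<theta>]) measurable
 have eq: "?E =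
  (\<integral>\<^sup>+A. shadow_measure (drop_first (transpose A *v x)) (drop_first (transpose A *v y)) s \<partial>\<theta>)"
  unfolding emeasure_lines_hitting[OF d \<theta> compact_nbhd[OF compact_segment]]
  by (intro nn_integral_cong) (simp add: haar_SO_space(1)[OF \<theta>] rotated_line_hits_nbhd)
 note b = emeasure_hyperplane_segment[OF d s drop_first_idem drop_first_idem, folded c_def]
 have b1: "ennreal c * ennreal (?N A) \<le> shadow_measure (drop_first (transpose A *v x)) (drop_first (transpose A *v y)) s" for A :: "('n rvec,'n) vec"
  using b(1)[of "transpose A *v x" "transpose A *v y"] c unfolding drop_first_transpose_diff by (simp add: ennreal_mult'[symmetric] mult.commute)
 have b2: "shadow_measure (drop_first (transpose A *v x)) (drop_first (transpose A *v y)) s \<le> ennreal c * (ennreal (?N A) + ennreal (2 * s))" for A :: "('n rvec,'n) vec"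
  using b(2)[of "transpose A *v x" "transpose A *v y"] c s unfolding drop_first_transpose_diff
  by (simp add: ennreal_mult'[symmetric] ennreal_plus[symmetric] mult.commute del: ennreal_plus)
 have "ennreal (c * beta_ratio CARD('n) * norm (x - y)) = ennreal c * (\<integral>\<^sup>+A. ennreal (?N A) \<partial>\<theta>)"
  unfolding haar_SO_mean_projection[OF d \<theta>] using c by (simp add: ennreal_mult' mult.assoc)
 also have "... = (\<integral>\<^sup>+A. ennreal c * ennreal (?N A) \<partial>\<theta>)" by (rule nn_integral_cmult[OF N, symmetric])
 also have "... \<le> ?E"
  unfolding eq by (intro nn_integral_mono b1)
 finally show "ennreal (c * beta_ratio CARD('n) * norm (x - y)) \<le> ?E" .
 have "?E \<le> (\<integral>\<^sup>+A. ennreal c * (ennreal (?N A) + ennreal (2 * s)) \<partial>\<theta>)"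
  unfolding eq by (intro nn_integral_mono b2)
 also have "... = ennreal c * ((\<integral>\<^sup>+A. ennreal (?N A) \<partial>\<theta>) + ennreal (2 * s))"
  using N by (simp add: nn_integral_cmult nn_integral_add \<theta>.emeasure_space_1)
 also have "... = ennreal (c * (beta_ratio CARD('n) * norm (x - y) + 2 * s))"
  unfolding haar_SO_mean_projection[OF d \<theta>] using c s beta_ratio_pos[OF d]
  by (simp add: ennreal_mult'[symmetric] ennreal_plus[symmetric] del: ennreal_plus)
 finally show "?E \<le> ennreal (c * (beta_ratio CARD('n) * norm (x - y) + 2 * s))" .
qed

text \<open>Seen along a line that meets both balls, the projections of \<open>x\<close> and
  \<open>y\<close> are at distance at most \<open>2 * R\<close>, so the direction is nearly that of
  \<open>x - y\<close>. The probability of such directions is multiplied by the shadow of one ball,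
  estimated as that of a degenerate segment.\<close>

lemma emeasure_lines_hitting_balls:
 fixes x y :: "('n::{finite,linorder}) rvec"
 assumes d: "CARD('n) \<ge> 2" and \<theta>: "haar_SO \<theta>" and R: "R > 0" and xy: "x \<noteq> y"
 shows "emeasure (line_measure \<theta>) (lines_hitting (cball x R) \<inter> lines_hitting (cball y R)) \<le>
  ennreal (2 * unit_ball_vol (real (CARD('n) - 2)) * (2 * unit_ball_vol (real (CARD('n) - 1)) / unit_ball_vol (real CARD('n))) * (2 * R\<^sup>2 / norm (x - y)) ^ (CARD('n) - 1))"
proof -
 define c where "c = unit_ball_vol (real (CARD('n) - 2)) * R ^ (CARD('n) - 2)"
 have c: "c > 0" using R by (simp add: c_def)
 let ?E = "{A \<in> space \<theta>. norm (drop_first (transpose A *v (x - y))) \<le> 2 * R}"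
 have E: "?E \<in> sets \<theta>"
 proof -
  have [measurable]: "(\<lambda>A. norm (drop_first (transpose A *v (x - y)))) \<in> borel_measurable \<theta>"
   by (rule measurable_haar_action(2)[OF \<theta>]) measurable
  show ?thesis by measurable
 qed
 have nb: "cball w R = nbhd (closed_segment w w) R" for w :: "'n rvec" by (simp add: nbhd_def)
 have "emeasure (line_measure \<theta>) (lines_hitting (cball x R) \<inter> lines_hitting (cball y R)) \<le> (\<integral>\<^sup>+A. ennreal (2 * R * c) * indicator ?E A \<partial>\<theta>)"
  unfolding emeasure_lines_hitting_both[OF d \<theta> compact_cball compact_cball]
 proof (rule nn_integral_mono)
  fix A assume A: "A \<in> space \<theta>"
  then have rot: "rotation_matrix A" by (simp add: haar_SO_space(1)[OF \<theta>])
  let ?a = "drop_first (transpose A *v x)" and ?b = "drop_first (transpose A *v y)"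
  let ?T = "{z. (\<exists>t. A *v (t *\<^sub>R first_axis + z) \<in> cball x R) \<and> (\<exists>t. A *v (t *\<^sub>R first_axis + z) \<in> cball y R)}"
  have T: "?T = {z. drop_first z \<in> nbhd (closed_segment ?a ?a) R \<and> drop_first z \<in> nbhd (closed_segment ?b ?b) R}"
   unfolding nb rotated_line_hits_nbhd[OF rot] ..
  show "emeasure hyperplane_measure ?T \<le> ennreal (2 * R * c) * indicator ?E A"
  proof (cases "A \<in> ?E")
   case True
   have "nbhd (closed_segment ?a ?a) R \<in> sets borel" by (intro borel_compact compact_nbhd compact_segment)
   from measurable_sets[OF measurable_drop_first this]
   have "{z. drop_first z \<in> nbhd (closed_segment ?a ?a) R} \<in> sets hyperplane_measure" by (simp add: vimage_def)
   then have "emeasure hyperplane_measure ?T \<le> shadow_measure ?a ?a R"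
    unfolding T by (intro emeasure_mono) auto
   also have "... \<le> ennreal (2 * R * c)"
    using emeasure_hyperplane_segment(2)[OF d R drop_first_idem drop_first_idem, of "transpose A *v x" "transpose A *v x"] by (simp add: c_def)
   finally show ?thesis using True by simp
  next
   case False
   have em: "?T = {}"
   proof (rule ccontr)
    assume "?T \<noteq> {}"
    then obtain z where "drop_first z \<in> nbhd (closed_segment ?a ?a) R" "drop_first z \<in> nbhd (closed_segment ?b ?b) R" unfolding T by blast
    then have "dist ?a (drop_first z) \<le> R" "dist ?b (drop_first z) \<le> R" by (auto simp: nbhd_def)
    then have "dist ?a ?b \<le> 2 * R" using dist_triangle2[of ?a ?b "drop_first z"] by linarith
    then have "norm (drop_first (transpose A *v (x - y))) \<le> 2 * R" unfolding dist_norm drop_first_transpose_diff .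
    then show False using False A by blast
   qed
   show ?thesis unfolding em by simp
  qed
 qed
 also have "... = ennreal (2 * R * c) * emeasure \<theta> ?E" using E by (rule nn_integral_cmult_indicator)
 also have "... \<le> ennreal (2 * R * c) * ennreal (2 * unit_ball_vol (real (CARD('n) - 1)) / unit_ball_vol (real CARD('n)) * (2 * R / norm (x - y)) ^ (CARD('n) - 1))"
  using R xy by (intro mult_left_mono haar_SO_small_projection[OF d \<theta>]) auto
 also have "... = ennreal (2 * R * c * (2 * unit_ball_vol (real (CARD('n) - 1)) / unit_ball_vol (real CARD('n)) * (2 * R / norm (x - y)) ^ (CARD('n) - 1)))"
  using R c by (subst ennreal_mult'[symmetric]) auto
 also have "2 * R * c * (2 * unit_ball_vol (real (CARD('n) - 1)) / unit_ball_vol (real CARD('n)) * (2 * R / norm (x - y)) ^ (CARD('n) - 1))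
  = 2 * unit_ball_vol (real (CARD('n) - 2)) * (2 * unit_ball_vol (real (CARD('n) - 1)) / unit_ball_vol (real CARD('n))) * (2 * R\<^sup>2 / norm (x - y)) ^ (CARD('n) - 1)"
 proof -
  have "R * R ^ (CARD('n) - 2) = R ^ (CARD('n) - 1)" using d by (metis Suc_diff_Suc Suc_1 Suc_le_eq power_Suc)
  moreover have "(2 * R\<^sup>2 / norm (x - y)) ^ (CARD('n) - 1) = R ^ (CARD('n) - 1) * (2 * R / norm (x - y)) ^ (CARD('n) - 1)"
   by (simp add: power_mult_distrib[symmetric] power2_eq_square mult_ac)
  ultimately show ?thesis by (simp add: c_def mult_ac)
 qed
 finally show ?thesis .
qed

section \<open>Tail estimates for the cylinders\<close>

lemma lines_hitting_blocks:
 assumes "L \<in> lines_hitting (nbhd (closed_segment x y) (\<rho> - \<delta>))" and "norm (x' - x) \<le> \<delta>" "norm (y' - y) \<le> \<delta>"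
 shows "closed_segment x' y' \<inter> nbhd L \<rho> \<noteq> {}"
proof -
 obtain q p where c: "q \<in> L" "p \<in> closed_segment x y" "dist p q \<le> \<rho> - \<delta>"
  using assms(1) by (auto simp: lines_hitting_def nbhd_def)
 from closed_segment_perturb_dist[OF assms(2,3) c(2,3)] show ?thesis using c(1) by (fastforce simp: nbhd_def)
qed

lemma cylinders_cover:
 fixes C :: "'w \<Rightarrow> ('n::{finite,linorder}) rvec set"
 assumes "poisson_cylinders \<alpha> \<rho> M C" "\<alpha> > 0"
 obtains \<theta> X where "haar_SO (\<theta> :: ('n rvec,'n) vec measure)" "poisson_cover M (line_measure \<theta>) \<alpha> X (\<lambda>L. nbhd L \<rho>) C"
 using assms unfolding poisson_cylinders_def poisson_cover_def by blast

lemma visibility_const_cylinders: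
 "visibility_const Cylinders d \<rho> Q = unit_ball_vol (real (d - 2)) * \<rho> ^ (d - 2) * beta_ratio d"
 by (simp add: beta_ratio_def)

lemma cylinders_upper_tail:
 fixes \<alpha> \<rho> \<gamma> :: real
 assumes d: "CARD('n::{finite,linorder}) \<ge> 2" and \<alpha>: "\<alpha> > 0" and \<rho>: "\<rho> > 0"
  and \<gamma>: "real CARD('n) < \<alpha> * visibility_const Cylinders CARD('n) \<rho> Q * \<gamma>"
 shows "\<exists>\<epsilon>>0. \<forall>(M :: 'w measure) (C :: 'w \<Rightarrow> 'n rvec set). poisson_cylinders \<alpha> \<rho> M C \<longrightarrow>
  (\<lambda>r. prob_visibility_gt M C (\<gamma> * ln r) r) \<in> O(\<lambda>r. r powr (- \<epsilon>))"
proof -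
 define c where "c s = unit_ball_vol (real (CARD('n) - 2)) * s ^ (CARD('n) - 2) * beta_ratio CARD('n)" for s
 have \<gamma>c: "real CARD('n) < \<alpha> * c (\<rho> - 0) * \<gamma>" using \<gamma> unfolding visibility_const_cylinders by (simp add: c_def)
 \<comment> \<open>The constant is continuous in the radius, so a small part \<open>\<delta>\<close>
   of it can be spent on the perturbation of segments.\<close>
 have "((\<lambda>\<delta>. \<alpha> * c (\<rho> - \<delta>) * \<gamma>) \<longlongrightarrow> \<alpha> * c (\<rho> - 0) * \<gamma>) (at_right 0)"
  unfolding c_def by (intro tendsto_intros)
 from order_tendstoD(1)[OF this \<gamma>c]
 have "eventually (\<lambda>\<delta>. real CARD('n) < \<alpha> * c (\<rho> - \<delta>) * \<gamma>) (at_right 0)" .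
 from eventually_at_right_obtain[OF this \<rho>]
 obtain \<delta> where \<delta>: "real CARD('n) < \<alpha> * c (\<rho> - \<delta>) * \<gamma>" "\<delta> < \<rho>" "0 < \<delta>" .
 define s where "s = \<rho> - \<delta>"
 have s: "s > 0" using \<delta> by (simp add: s_def)
 have c: "c s \<ge> 0" using s beta_ratio_pos[OF d] by (simp add: c_def)
 show ?thesis
 proof (intro exI[of _ "(\<alpha> * c s * \<gamma> - real CARD('n)) / 4"] conjI allI impI)
  show "(\<alpha> * c s * \<gamma> - real CARD('n)) / 4 > 0" using \<delta> by (simp add: s_def)
  fix M :: "'w measure" and C :: "'w \<Rightarrow> 'n rvec set"
  assume "poisson_cylinders \<alpha> \<rho> M C"
  then obtain \<theta> X where \<theta>: "haar_SO (\<theta> :: ('n rvec,'n) vec measure)" and pc: "poisson_cover M (line_measure \<theta>) \<alpha> X (\<lambda>L. nbhd L \<rho>) C"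
   using cylinders_cover[OF _ \<alpha>] by blast
  show "(\<lambda>r. prob_visibility_gt M C (\<gamma> * ln r) r) \<in> O(\<lambda>r. r powr (- ((\<alpha> * c s * \<gamma> - real CARD('n)) / 4)))"
  proof (rule poisson_cover.log_visibility_upper_tail[OF pc \<delta>(3) c \<delta>(1)[folded s_def] _ lines_hitting_blocks[of _ _ _ \<rho> \<delta>, folded s_def]])
   fix x y :: "'n rvec"
   show "lines_hitting (nbhd (closed_segment x y) s) \<in> sets (line_measure \<theta>)" by (simp add: sets_lines_hitting compact_nbhd)
   note b = emeasure_lines_hitting_segment[OF d \<theta> s, of x y, folded c_def]
   show "emeasure (line_measure \<theta>) (lines_hitting (nbhd (closed_segment x y) s)) < \<infinity>" using b(2) by (rule order.strict_trans1) simp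
   show "ennreal (c s * norm (x - y)) \<le> emeasure (line_measure \<theta>) (lines_hitting (nbhd (closed_segment x y) s))" by (rule b(1))
  qed
 qed
qed

lemma cylinders_lower_tail:
 fixes \<alpha> \<rho> \<gamma> :: real
 assumes d: "CARD('n::{finite,linorder}) \<ge> 2" and \<alpha>: "\<alpha> > 0" and \<rho>: "\<rho> > 0" and \<gamma>0: "\<gamma> > 0" and \<gamma>': "\<gamma>' \<le> \<gamma>"
  and \<gamma>: "\<alpha> * visibility_const Cylinders CARD('n) \<rho> Q * \<gamma> < real CARD('n)"
 shows "\<exists>\<epsilon>>0. \<forall>(M :: 'w measure) (C :: 'w \<Rightarrow> 'n rvec set). poisson_cylinders \<alpha> \<rho> M C \<longrightarrow>
  (\<lambda>r. prob_visibility_lt M C (\<gamma>' * ln r) r) \<in> O(\<lambda>r. r powr (- \<epsilon>))"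
proof -
 define d where "d = CARD('n)"
 define c where "c = unit_ball_vol (real (CARD('n) - 2)) * \<rho> ^ (CARD('n) - 2)"
 define a where "a = c * beta_ratio CARD('n)"
 have c: "c > 0" using \<rho> by (simp add: c_def)
 have a: "a \<ge> 0" using c beta_ratio_pos[OF d] by (simp add: a_def)
 have \<gamma>a: "\<alpha> * a * \<gamma> < real CARD('n)" using \<gamma> unfolding visibility_const_cylinders by (simp add: a_def c_def)
 define \<tau> where "\<tau> = (real CARD('n) + \<alpha> * a * \<gamma>) / 2"
 have \<tau>: "0 \<le> \<tau>" "\<tau> < real CARD('n)" "\<alpha> * a * \<gamma> < \<tau>" using \<gamma>a mult_nonneg_nonneg[OF mult_nonneg_nonneg[OF less_imp_le[OF \<alpha>] a] less_imp_le[OF \<gamma>0]] unfolding \<tau>_def by argo+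
 define \<eta> where "\<eta> = (1 - \<tau> / real CARD('n)) / 2"
 have \<eta>: "0 < \<eta>" using \<tau> by (simp add: \<eta>_def)
 have \<epsilon>: "\<eta> / 2 > 0" using \<eta> by simp
 define K where "K = 2 * unit_ball_vol (real (d - 2)) * (2 * unit_ball_vol (real (d - 1)) / unit_ball_vol (real d))"
 have K: "K > 0" by (simp add: K_def)
 define R where "R r = \<gamma> * ln r + \<rho>" for r
 \<comment> \<open>Half of the exponent \<open>\<eta>\<close> pays for the logarithms in
   \<open>R r\<close> and for the constants.\<close>
 have dec: "eventually (\<lambda>r. \<alpha> * (K * (2 * (R r)\<^sup>2 / r powr \<eta>)) \<le> r powr (- (\<eta> / 2))) at_top"
  unfolding R_def using \<eta> K \<alpha> \<gamma>0 \<rho> by real_asymp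
 have small: "eventually (\<lambda>r. 2 * (R r)\<^sup>2 \<le> r powr \<eta>) at_top" unfolding R_def using \<eta> \<gamma>0 \<rho> by real_asymp
 define u :: "'n rvec" where "u = axis (SOME i. True) 1"
 have u: "norm u = 1" by (simp add: u_def)
 define H where "H x y = lines_hitting (nbhd (closed_segment x y) \<rho>)" for x y :: "'n rvec"
 show ?thesis
 proof (intro exI[of _ "min ((real CARD('n) - \<tau>) / 2) (\<eta> / 2)"] conjI allI impI)
  show "min ((real CARD('n) - \<tau>) / 2) (\<eta> / 2) > 0" using \<tau> \<epsilon> by simp
  fix M :: "'w measure" and C :: "'w \<Rightarrow> 'n rvec set"
  assume "poisson_cylinders \<alpha> \<rho> M C"
  then obtain \<theta> X where \<theta>: "haar_SO (\<theta> :: ('n rvec,'n) vec measure)" and pc: "poisson_cover M (line_measure \<theta>) \<alpha> X (\<lambda>L. nbhd L \<rho>) C"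
   using cylinders_cover[OF _ \<alpha>] by blast
  show "(\<lambda>r. prob_visibility_lt M C (\<gamma>' * ln r) r)
   \<in> O(\<lambda>r. r powr (- min ((real CARD('n) - \<tau>) / 2) (\<eta> / 2)))"
  proof (rule poisson_cover.visibility_lower_tail_decorrelated[OF pc u \<tau>(1,2) \<eta>_def log_scale_bounds[OF \<gamma>0] poisson_cover.log_lev[OF pc \<gamma>'] _ _ _ \<epsilon>, where H=H])
   show "H x y \<in> sets (line_measure \<theta>)" for x y unfolding H_def by (simp add: sets_lines_hitting compact_nbhd)
   show "L \<in> H x y" if "L \<in> space (line_measure \<theta>)" "closed_segment x y \<inter> nbhd L \<rho> \<noteq> {}" for L x y
    using that by (fastforce simp: H_def lines_hitting_def nbhd_def dist_commute)
   have le: "emeasure (line_measure \<theta>) (H x y) \<le> ennreal (a * norm (x - y) + c * (2 * \<rho>))" for x y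
    using emeasure_lines_hitting_segment(2)[OF d \<theta> \<rho>, of x y] by (simp add: H_def a_def c_def algebra_simps)
   show "eventually (\<lambda>r. \<forall>x y :: 'n rvec. norm (x - y) = \<gamma> * ln r \<longrightarrow> ennreal \<alpha> * emeasure (line_measure \<theta>) (H x y) \<le> ennreal (\<tau> * ln r)) at_top"
    using c \<rho> by (intro poisson_cover.log_mass_le[OF pc a _ \<gamma>0 \<tau>(3) le]) simp
   show "eventually (\<lambda>r. \<forall>x y. r powr \<eta> \<le> norm (x - y) \<longrightarrow>
    ennreal \<alpha> * emeasure (line_measure \<theta>) (H x (x + (\<gamma> * ln r) *\<^sub>R u) \<inter> H y (y + (\<gamma> * ln r) *\<^sub>R u)) \<le> ennreal (r powr - (\<eta> / 2))) at_top"
    using dec small eventually_gt_at_top[of 1]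
   proof eventually_elim
    case (elim r)
    have l0: "\<gamma> * ln r > 0" using \<gamma>0 elim by simp
    have R0: "R r > 0" unfolding R_def using l0 \<rho> by linarith
    show ?case
    proof (intro allI impI)
     fix x y :: "'n rvec" assume far: "r powr \<eta> \<le> norm (x - y)"
     have D: "r powr \<eta> > 0" using elim by simp
     have sub: "nbhd (closed_segment z (z + (\<gamma> * ln r) *\<^sub>R u)) \<rho> \<subseteq> cball z (R r)" for z
     proof
      fix w assume "w \<in> nbhd (closed_segment z (z + (\<gamma> * ln r) *\<^sub>R u)) \<rho>"
      then obtain p where p: "p \<in> closed_segment z (z + (\<gamma> * ln r) *\<^sub>R u)" "dist p w \<le> \<rho>" by (auto simp: nbhd_def)
      then show "w \<in> cball z (R r)" using dist_closed_segment_le[OF u less_imp_le[OF l0] p(1), of w] by (simp add: R_def)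
     qed
     define q where "q = 2 * (R r)\<^sup>2 / norm (x - y)"
     have q: "0 \<le> q" "q \<le> 2 * (R r)\<^sup>2 / r powr \<eta>"
      unfolding q_def using far D by (auto intro!: divide_left_mono mult_pos_pos)
     have "2 * (R r)\<^sup>2 / r powr \<eta> \<le> 1" using elim D by simp
     then have q1: "q \<le> 1" using q(2) by linarith
     \<comment> \<open>As \<open>q \<le> 1\<close>, keeping one of the \<open>d - 1 \<ge> 1\<close>
       factors is enough for a polynomial bound.\<close>
     have "q ^ (d - 1) \<le> q ^ 1" using q(1) q1 d by (intro power_decreasing) (auto simp: d_def)
     then have qd: "q ^ (d - 1) \<le> 2 * (R r)\<^sup>2 / r powr \<eta>" using q(2) by simp
     have ne: "x \<noteq> y" using far D by auto
     let ?B = "H x (x + (\<gamma> * ln r) *\<^sub>R u) \<inter> H y (y + (\<gamma> * ln r) *\<^sub>R u)"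
     have "?B \<subseteq> lines_hitting (cball x (R r)) \<inter> lines_hitting (cball y (R r))"
      unfolding H_def lines_hitting_def using sub by blast
     then have "emeasure (line_measure \<theta>) ?B \<le> emeasure (line_measure \<theta>) (lines_hitting (cball x (R r)) \<inter> lines_hitting (cball y (R r)))"
      by (rule emeasure_mono) (simp add: sets.Int sets_lines_hitting)
     also have "... \<le> ennreal (K * q ^ (d - 1))"
      using emeasure_lines_hitting_balls[OF d \<theta> R0 ne] unfolding K_def q_def d_def .
     finally have "ennreal \<alpha> * emeasure (line_measure \<theta>) ?B \<le> ennreal \<alpha> * ennreal (K * q ^ (d - 1))"
      by (rule mult_left_mono) simp
     also have "... = ennreal (\<alpha> * (K * q ^ (d - 1)))" using \<alpha> by (subst ennreal_mult'[symmetric]) auto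
     also have "... \<le> ennreal (r powr - (\<eta> / 2))"
     proof (rule ennreal_leI)
      have "\<alpha> * (K * q ^ (d - 1)) \<le> \<alpha> * (K * (2 * (R r)\<^sup>2 / r powr \<eta>))"
       using \<alpha> K by (intro mult_left_mono qd) auto
      then show "\<alpha> * (K * q ^ (d - 1)) \<le> r powr - (\<eta> / 2)" using elim(1) by linarith
     qed
     finally show "ennreal \<alpha> * emeasure (line_measure \<theta>) ?B \<le> ennreal (r powr - (\<eta> / 2))" .
    qed
   qed
  qed
 qed
qed

section \<open>The visibility window\<close>

text \<open>The first bound compares the powers \<open>d\<close> and \<open>s \<le> d\<close> of a
  ratio \<open>x / r\<close> below 1; the second drops the truncation.\<close>

lemma radius_error_le:
 fixes Q :: "real measure"
 assumes Q: "prob_space Q" "sets Q = sets borel" "AE x in Q. x \<ge> 0" "integrable Q (\<lambda>x. x ^ d)"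
  and d: "d > 0" and s: "0 < s" "s \<le> real d" and i: "integrable Q (\<lambda>x. x powr (real d + s))" and r: "r > 0"
 shows "radius_error d Q r \<le> (\<integral>x. x ^ d * min (x powr s / r powr s) 1 \<partial>Q)"
  and "(\<integral>x. x ^ d * min (x powr s / r powr s) 1 \<partial>Q) \<le> (\<integral>x. x powr (real d + s) \<partial>Q) / r powr s"
proof -
 have i2: "integrable Q (\<lambda>x. x ^ d * min (x powr s / r powr s) 1)"
  by (rule integrable_of_nonneg_law[OF Q(2-4)]) (auto simp: abs_mult mult_left_le)
 note i1 = integrable_radius_error[OF Q(2-4) r]
 show "radius_error d Q r \<le> (\<integral>x. x ^ d * min (x powr s / r powr s) 1 \<partial>Q)"
  unfolding radius_error_def
 proof (rule integral_mono_AE[OF i1 i2], rule AE_mp[OF Q(3)], intro AE_I2 impI)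
  fix x :: real assume x: "0 \<le> x"
  have "min (x / r) 1 ^ d \<le> min (x powr s / r powr s) 1"
  proof (cases "x < r \<and> x > 0")
   case True
   define t where "t = x / r"
   have t: "0 < t" "t < 1" using True r by (auto simp: t_def)
   have "t ^ d = t powr real d" using t by (simp add: powr_realpow)
   also have "... \<le> t powr s" using t s by (intro powr_mono') auto
   finally have "t ^ d \<le> t powr s" .
   moreover have "t powr s \<le> 1" using t s powr_mono'[of 0 s t] by simp
   moreover have "t powr s = x powr s / r powr s" using True r by (simp add: t_def powr_divide)
   ultimately show ?thesis using t by (simp add: t_def min_absorb1)
  next
   case False
   then consider "x = 0" | "x \<ge> r" using x by linarith
   then show ?thesis
   proof cases
    case 1
    then show ?thesis using d by (simp add: power_0_left)
   next
    case 2
    have "r powr s \<le> x powr s" using 2 r s by (intro powr_mono2) auto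
    then have "min (x powr s / r powr s) 1 = 1" using r by simp
    moreover have "min (x / r) 1 = 1" using 2 r by simp
    ultimately show ?thesis by simp
   qed
  qed
  then show "x ^ d * min (x / r) 1 ^ d \<le> x ^ d * min (x powr s / r powr s) 1" using x by (intro mult_left_mono) auto
 qed
 have "(\<integral>x. x ^ d * min (x powr s / r powr s) 1 \<partial>Q) \<le> (\<integral>x. x powr (real d + s) / r powr s \<partial>Q)"
 proof (rule integral_mono_AE[OF i2], rule integrable_divide[OF i], rule AE_mp[OF Q(3)], intro AE_I2 impI)
  fix x :: real assume x: "0 \<le> x"
  have "x ^ d * x powr s = x powr (real d + s)"
   using x d by (cases "x = 0") (simp_all add: powr_add powr_realpow)
  then have eq: "x powr (real d + s) / r powr s = x ^ d * (x powr s / r powr s)" by simp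
  show "x ^ d * min (x powr s / r powr s) 1 \<le> x powr (real d + s) / r powr s"
   unfolding eq using x by (intro mult_left_mono) auto
 qed
 then show "(\<integral>x. x ^ d * min (x powr s / r powr s) 1 \<partial>Q) \<le> (\<integral>x. x powr (real d + s) \<partial>Q) / r powr s" by simp
qed

lemma divide_powr_bigo: "(\<lambda>r. c / r powr s) \<in> O(\<lambda>r. r powr (- s))" for c s :: real
 by (rule bigoI[where c="\<bar>c\<bar>"]) (auto simp: powr_minus_divide)

text \<open>A large \<open>s\<close> is reduced to \<open>t = min s d\<close>. The power
  \<open>d + t\<close> is dominated by the power \<open>d\<close> below 1 and by the power
  \<open>d + s\<close> above 1, so its moment is finite.\<close>

lemma radius_error_polynomial_decay:
 fixes Q :: "real measure"
 assumes Q: "prob_space Q" "sets Q = sets borel" "AE x in Q. x \<ge> 0" "integrable Q (\<lambda>x. x ^ d)"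
  and d: "d > 0" and s: "s > 0" and i: "integrable Q (\<lambda>x. x powr (real d + s))"
 shows "\<exists>\<epsilon>>0. radius_error d Q \<in> O(\<lambda>r. r powr (- \<epsilon>))"
proof -
 define t where "t = min s (real d)"
 have t: "0 < t" "t \<le> real d" "t \<le> s" using s d by (auto simp: t_def)
 have it: "integrable Q (\<lambda>x. x powr (real d + t))"
 proof (rule integrable_of_nonneg_law[OF Q(2,3) Bochner_Integration.integrable_add[OF Q(4) i]])
  fix x :: real assume x: "0 \<le> x"
  show "\<bar>x powr (real d + t)\<bar> \<le> x ^ d + x powr (real d + s)"
  proof (cases "0 < x \<and> x \<le> 1")
   case True
   then have "x powr (real d + t) \<le> x powr real d" using t by (intro powr_mono') auto
   then show ?thesis using True by (simp add: powr_realpow add_increasing2)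
  next
   case False
   then consider "x = 0" | "x > 1" using x by linarith
   then show ?thesis
   proof cases
    case 2
    then have "x powr (real d + t) \<le> x powr (real d + s)" using t by (intro powr_mono) auto
    then show ?thesis using x by (simp add: add_increasing)
   qed (use d in simp)
  qed
 qed measurable
 define K where "K = (\<integral>x. x powr (real d + t) \<partial>Q)"
 have "radius_error d Q \<in> O(\<lambda>r. K / r powr t)"
 proof (rule bigoI[where c=1])
  show "eventually (\<lambda>r. norm (radius_error d Q r) \<le> 1 * norm (K / r powr t)) at_top"
   using eventually_gt_at_top[of 0]
  proof eventually_elim
   case (elim r)
   have "radius_error d Q r \<le> K / r powr t"
    using radius_error_le[OF Q d t(1,2) it elim] unfolding K_def by linarith
   also have "... \<le> \<bar>K\<bar> / r powr t" by (intro divide_right_mono) auto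
   finally show ?case using radius_error_nonneg[OF Q(3) elim, of d] by simp
  qed
 qed
 also have "(\<lambda>r. K / r powr t) \<in> O(\<lambda>r. r powr (- t))" by (rule divide_powr_bigo)
 finally show ?thesis using t(1) by blast
qed

text \<open>A vanishing constant makes the critical value infinite and contradicts the hypothesis,
  so the division is by a positive number.\<close>

lemma critical_value_lessD:
 assumes "ereal (real d) / ereal k < ereal \<gamma>" "k \<ge> 0" "d > 0" shows "real d < k * \<gamma>"
proof (cases "k = 0")
 case True
 then have "ereal (real d) / ereal k = \<infinity>" using assms(3) by (simp add: divide_ereal_def)
 then show ?thesis using assms(1) by simp
next
 case False
 then have "real d / k < \<gamma>" using assms by simp
 then show ?thesis using False assms(2) by (simp add: pos_divide_less_eq mult.commute)
qed

text \<open>The lower tail estimates are made at positive levels. A non-positive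
  \<open>\<gamma>\<close> is replaced by a larger positive level still below the critical value,
  which only enlarges the event at large \<open>r\<close>.\<close>

lemma critical_value_greaterD:
 assumes "ereal \<gamma> < ereal (real d) / ereal k" "k \<ge> 0" "d > 0"
 obtains \<gamma>' where "\<gamma>' > 0" "\<gamma> \<le> \<gamma>'" "k * \<gamma>' < real d"
proof (cases "\<gamma> > 0")
 case True
 have "k * \<gamma> < real d"
 proof (cases "k = 0")
  case False
  then have "\<gamma> < real d / k" using assms by simp
  then show ?thesis using False assms(2) by (simp add: pos_less_divide_eq mult.commute)
 qed (use assms in simp)
 then show ?thesis using True that by blast
next
 case False
 \<comment> \<open>The denominator \<open>2 * k + 1\<close> is positive also for
   \<open>k = 0\<close>, so \<open>d / (2 * k + 1)\<close> is an admissible positive level in every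
   case.\<close>
 have "k / (2 * k + 1) < 1" using assms(2) by simp
 then have "real d * (k / (2 * k + 1)) < real d * 1" using assms(3) by (intro mult_strict_left_mono) auto
 then have "k * (real d / (2 * k + 1)) < real d" by (simp add: mult.commute)
 moreover have "real d / (2 * k + 1) > 0" using assms by simp
 ultimately show ?thesis using False that[of "real d / (2 * k + 1)"] by simp
qed

lemma visibility_const_nonneg:
 assumes "d \<ge> min_dim m" "\<rho> > 0" "AE x in Q. x \<ge> 0"
 shows "visibility_const m d \<rho> Q \<ge> 0"
proof (cases m)
 case Boolean
 have "(\<integral>x. x ^ (d - 1) \<partial>Q) \<ge> 0"
  by (rule integral_nonneg_AE, rule AE_mp[OF assms(3)]) (intro AE_I2 impI, simp)
 then show ?thesis using Boolean by simp
next
 case Cylinders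
 then have "beta_ratio d > 0" using assms(1) by (simp add: beta_ratio_pos)
 then show ?thesis unfolding Cylinders visibility_const_cylinders using assms(2) by (intro mult_nonneg_nonneg) auto
next
 case Interlacements
 then show ?thesis using interlacement_const_pos[of d \<rho> Q] assms by simp
qed

text \<open>The exponent is quantified after the kind of model, its parameters and
  \<open>\<gamma>\<close>, but before the probability space and \<open>C\<close>: this renders its
  dependence on the dimension, the law of \<open>C\<close> and \<open>\<gamma>\<close>
  alone.\<close>

theorem mainTheorem2:
  fixes \<alpha> \<rho> :: real and Q :: "real measure" and d :: nat
  assumes "\<alpha> > 0" and "\<rho> > 0"
    and "d = CARD('n::{finite,linorder})" and "d \<ge> 2"
    and "prob_space Q" and "sets Q = sets borel" and "AE x in Q. x \<ge> 0"
    and "integrable Q (\<lambda>x. x ^ d)"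
  shows
    "(\<forall>m \<gamma>. d \<ge> min_dim m \<and> ereal \<gamma> > critical_value m d \<alpha> \<rho> Q \<longrightarrow>
        (\<exists>\<epsilon>>0. \<forall>(M :: 'w measure) (C :: 'w \<Rightarrow> (real^('n::{finite,linorder})) set). is_model m \<alpha> \<rho> Q M C \<longrightarrow>
           (\<lambda>r. measure M {\<omega> \<in> space M.
              max_visibility (C \<omega>) r > ereal (\<gamma> * visibility_scale m d r)})
           \<in> O(\<lambda>r. r powr (- \<epsilon>)))) \<and>
     (\<forall>m \<gamma>. d \<ge> min_dim m \<and> ereal \<gamma> < critical_value m d \<alpha> \<rho> Q \<longrightarrow>
        (\<exists>\<epsilon>>0. \<forall>(M :: 'w measure) (C :: 'w \<Rightarrow> (real^('n::{finite,linorder})) set). is_model m \<alpha> \<rho> Q M C \<longrightarrow>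
           (\<lambda>r. measure M {\<omega> \<in> space M.
              max_visibility (C \<omega>) r < ereal (\<gamma> * visibility_scale m d r)})
           \<in> O(\<lambda>r. r powr (- \<epsilon>) + (if m = Boolean then radius_error d Q r else 0)))) \<and>
     (\<forall>s. 0 < s \<and> s \<le> real d \<and> integrable Q (\<lambda>x. x powr (real d + s)) \<longrightarrow>
        (\<forall>r>0. radius_error d Q r \<le> (\<integral>x. x ^ d * min (x powr s / r powr s) 1 \<partial>Q) \<and>
               (\<integral>x. x ^ d * min (x powr s / r powr s) 1 \<partial>Q)
                 \<le> (\<integral>x. x powr (real d + s) \<partial>Q) / r powr s) \<and>
        (\<lambda>r. (\<integral>x. x powr (real d + s) \<partial>Q) / r powr s) \<in> O(\<lambda>r. r powr (- s))) \<and>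
     ((\<forall>\<epsilon>>0. radius_error d Q \<notin> O(\<lambda>r. r powr (- \<epsilon>))) \<longrightarrow>
        (\<forall>s>0. \<not> integrable Q (\<lambda>x. x powr (real d + s))))"
proof (intro conjI allI impI)
 note \<alpha> = assms(1) and \<rho> = assms(2) and d = assms(3) and d2 = assms(4) and Q = assms(5-8)
 have d0: "d > 0" using d2 by simp
 fix m \<gamma>
 assume a: "d \<ge> min_dim m \<and> ereal \<gamma> > critical_value m d \<alpha> \<rho> Q"
 have "\<alpha> * visibility_const m d \<rho> Q \<ge> 0"
  using a \<alpha> \<rho> Q(3) by (intro mult_nonneg_nonneg visibility_const_nonneg) auto
 then have \<gamma>: "real d < \<alpha> * visibility_const m d \<rho> Q * \<gamma>"
  using a d0 unfolding critical_value_def by (intro critical_value_lessD) auto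
 show "\<exists>\<epsilon>>0. \<forall>(M :: 'w measure) (C :: 'w \<Rightarrow> (real^('n::{finite,linorder})) set). is_model m \<alpha> \<rho> Q M C \<longrightarrow>
   (\<lambda>r. measure M {\<omega> \<in> space M. max_visibility (C \<omega>) r > ereal (\<gamma> * visibility_scale m d r)}) \<in> O(\<lambda>r. r powr (- \<epsilon>))"
 proof (cases m)
  case Boolean
  show ?thesis
   using boolean_upper_tail[OF d2[unfolded d] \<alpha> Q(1-3) Q(4)[unfolded d] \<gamma>[unfolded Boolean d]]
   unfolding Boolean is_model.simps d visibility_scale_def by simp
 next
  case Cylinders
  show ?thesis
   using cylinders_upper_tail[OF d2[unfolded d] \<alpha> \<rho> \<gamma>[unfolded Cylinders d]]
   unfolding Cylinders is_model.simps d visibility_scale_def by simp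
 next
  case Interlacements
  then have "CARD('n) \<ge> 3" using a d by simp
  then show ?thesis
   using interlacements_upper_tail[OF _ \<alpha> \<rho> \<gamma>[unfolded Interlacements d]]
   unfolding Interlacements is_model.simps d by blast
 qed
next
 note \<alpha> = assms(1) and \<rho> = assms(2) and d = assms(3) and d2 = assms(4) and Q = assms(5-8)
 have d0: "d > 0" using d2 by simp
 fix m \<gamma>
 assume a: "d \<ge> min_dim m \<and> ereal \<gamma> < critical_value m d \<alpha> \<rho> Q"
 have k: "\<alpha> * visibility_const m d \<rho> Q \<ge> 0"
  using a \<alpha> \<rho> Q(3) by (intro mult_nonneg_nonneg visibility_const_nonneg) auto
 obtain \<gamma>' where \<gamma>': "\<gamma>' > 0" "\<gamma> \<le> \<gamma>'" "\<alpha> * visibility_const m d \<rho> Q * \<gamma>' < real d"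
  using critical_value_greaterD[OF a[THEN conjunct2, unfolded critical_value_def] k d0] by blast
 show "\<exists>\<epsilon>>0. \<forall>(M :: 'w measure) (C :: 'w \<Rightarrow> (real^('n::{finite,linorder})) set). is_model m \<alpha> \<rho> Q M C \<longrightarrow>
   (\<lambda>r. measure M {\<omega> \<in> space M. max_visibility (C \<omega>) r < ereal (\<gamma> * visibility_scale m d r)})
    \<in> O(\<lambda>r. r powr (- \<epsilon>) + (if m = Boolean then radius_error d Q r else 0))"
 proof (cases m)
  case Boolean
  show ?thesis
   using boolean_lower_tail[OF d2[unfolded d] \<alpha> \<gamma>'(1,2) Q(1-3) Q(4)[unfolded d] \<gamma>'(3)[unfolded Boolean d]]
   unfolding Boolean is_model.simps d visibility_scale_def by simp
 next
  case Cylinders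
  show ?thesis
   using cylinders_lower_tail[OF d2[unfolded d] \<alpha> \<rho> \<gamma>'(1,2) \<gamma>'(3)[unfolded Cylinders d]]
   unfolding Cylinders is_model.simps d visibility_scale_def by simp
 next
  case Interlacements
  then have "CARD('n) \<ge> 3" using a d by simp
  from interlacements_lower_tail[OF this \<alpha> \<rho> \<gamma>'(1,2) \<gamma>'(3)[unfolded Interlacements d]]
  show ?thesis unfolding Interlacements is_model.simps d by simp
 qed
next
 fix s r :: real
 assume "0 < s \<and> s \<le> real d \<and> integrable Q (\<lambda>x. x powr (real d + s))" "r > 0"
 then show "radius_error d Q r \<le> (\<integral>x. x ^ d * min (x powr s / r powr s) 1 \<partial>Q)"
  "(\<integral>x. x ^ d * min (x powr s / r powr s) 1 \<partial>Q) \<le> (\<integral>x. x powr (real d + s) \<partial>Q) / r powr s"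
  using radius_error_le[OF assms(5-8), of s r] assms(4) by auto
next
 fix s
 show "(\<lambda>r. (\<integral>x. x powr (real d + s) \<partial>Q) / r powr s) \<in> O(\<lambda>r. r powr (- s))" by (rule divide_powr_bigo)
next
 fix s :: real
 assume "\<forall>\<epsilon>>0. radius_error d Q \<notin> O(\<lambda>r. r powr (- \<epsilon>))" "s > 0"
 then show "\<not> integrable Q (\<lambda>x. x powr (real d + s))"
  using radius_error_polynomial_decay[OF assms(5-8), of s] assms(4) by auto
qed

end
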